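(* Let $T=T_{a,\varphi}$ be the Fourier integral operator on $\mathbf{R}^n$ with amplitude $a\in L^\infty S^m_\varrho$ (where $m\in\mathbf{R}$, $0\le\varrho\le1$) and phase function $\varphi\in L^\infty\Phi^2$. Suppose that the phase satisfies the rough corank condition (with $V_{x,\xi}\in\mathrm{Gr}(n,n-k)$, as defined in the context). Then $T$ can be extended as a bounded operator from $L^2_{\rm comp}$ to $L^2_{\rm loc}$ provided $$m<-\frac{n+k-1}{4}+\frac{(n-k)(\varrho-1)}{2}.$$
   Context: Notation: $\langle\xi\rangle=(1+|\xi|^2)^{1/2}$; $\widehat u(\xi)=\int e^{-i\langle x,\xi\rangle}u(x)\,dx$. Operator: $T_{a,\varphi}u(x)=(2\pi)^{-n}\int_{\mathbf{R}^n}e^{i\varphi(x,\xi)}a(x,\xi)\widehat u(\xi)\,d\xi$. Class $L^\infty S^m_\varrho$: functions $a(x,\xi)$ on $\mathbf{R}^n\times\mathbf{R}^n$, smooth in $\xi$ and bounded measurable in $x$, such that for every multi-index $\alpha$, $\sup_{\xi}\langle\xi\rangle^{-m+\varrho|\alpha|}\|\partial_\xi^\alpha a(\cdot,\xi)\|_{L^\infty(\mathbf{R}^n)}<\infty$. Class $L^\infty\Phi^2$: real-valued $\varphi(x,\xi)$, positively homogeneous of degree $1$ and smooth on $\mathbf{R}^n\setminus0$ in $\xi$, measurable in $x$, with $\sup_{\xi\ne0}|\xi|^{-1+|\alpha|}\|\partial_\xi^\alpha\varphi(\cdot,\xi)\|_{L^\infty(\mathbf{R}^n)}<\infty$ for all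 $|\alpha|\ge2$. Rough corank condition: let $\pi_1(x,\xi)=x$. For each $x\in\pi_1(\operatorname{supp}a)$ and all $\xi\in\mathbf{S}^{n-1}$ there exists a linear subspace $V_{x,\xi}$ belonging to the Grassmannian $\mathrm{Gr}(n,n-k)$ of $(n-k)$-dimensional subspaces of $\mathbf{R}^n$, varying continuously with $(x,\xi)$, and constants $c_1,c_2>0$ such that, if $\pi_{V_{x,\xi}}$ denotes the projection onto $V_{x,\xi}$, then $$|\partial_\xi\varphi(x,\xi)-\partial_\xi\varphi(y,\xi)|+c_1|x-y|^2\ge c_2|\pi_{V_{x,\xi}}(x-y)|$$ for all $x,y\in\pi_1(\operatorname{supp}a)$. Bounded from $L^2_{\rm comp}$ to $L^2_{\rm loc}$ means: for all compactly supported smooth $\chi_1,\chi_2$, the operator $\chi_1T\chi_2$ is bounded on $L^2(\mathbf{R}^n)$.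
   Formalization: The formal theorem assumes k < n; for k = n the space V is {0}, the rough corank condition is void, and the claim fails (zero phase, amplitude ⟨ξ⟩^m with -n/2 ≤ m < -(2n-1)/4). *)

theory Defs
  imports "HOL-Analysis.Analysis" "HOL-Probability.Essential_Supremum"
begin

section \<open>Iterated partial derivatives and smoothness\<close>

text \<open>
  A multi-index of order \<open>r\<close> is given by a list of \<open>r\<close> coordinate directions. For smooth functions
  the order of differentiation is irrelevant, so ranging over all lists amounts to ranging over all
  multi-indices, with \<open>length\<close> as the order.
\<close>

fun iter_partial ::
    "'n list \<Rightarrow> (real^'n \<Rightarrow> 'b::real_normed_vector) \<Rightarrow> real^'n \<Rightarrow> 'b" where
  "iter_partial [] f = f"
| "iter_partial (i # \<alpha>) f = (\<lambda>x. frechet_derivative (iter_partial \<alpha> f) (at x) (axis i 1))"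

text \<open>
  Only used for open \<open>S\<close>. Total differentiability of all iterated partial derivatives makes each of
  them continuous, hence this is \<open>C\<close>-infinity on \<open>S\<close>.
\<close>

definition smooth_on :: "(real^'n) set \<Rightarrow> (real^'n \<Rightarrow> 'b::real_normed_vector) \<Rightarrow> bool" where
  "smooth_on S f \<longleftrightarrow> (\<forall>\<alpha>. \<forall>x\<in>S. iter_partial \<alpha> f differentiable (at x))"

definition grad :: "(real^'n \<Rightarrow> real) \<Rightarrow> real^'n \<Rightarrow> real^'n" where
  "grad f x = (\<chi> i. iter_partial [i] f x)"

definition test_functions :: "(real^'n \<Rightarrow> complex) set" where
  "test_functions = {f. smooth_on UNIV f \<and> compact (closure {x. f x \<noteq> 0})}"

section \<open>Amplitudes and phases\<close>

definition japanese :: "real^'n \<Rightarrow> real" where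
  "japanese \<xi> = sqrt (1 + (norm \<xi>)\<^sup>2)"

definition Linf_norm :: "(real^'n \<Rightarrow> 'b::real_normed_vector) \<Rightarrow> ereal" where
  "Linf_norm f = esssup lebesgue (\<lambda>x. ereal (norm (f x)))"

text \<open>
  Amplitudes and phases are functions with values everywhere, the first argument being the space
  variable and the second the frequency variable; measurability is Lebesgue measurability.
\<close>

definition Linf_S :: "real \<Rightarrow> real \<Rightarrow> (real^'n \<Rightarrow> real^'n \<Rightarrow> complex) set" where
  "Linf_S m \<rho> = {a.
     (\<forall>x. smooth_on UNIV (a x)) \<and>
     (\<forall>\<xi>. (\<lambda>x. a x \<xi>) \<in> borel_measurable lebesgue) \<and>
     (\<forall>\<alpha>. (SUP \<xi>. ereal (japanese \<xi> powr (- m + \<rho> * real (length \<alpha>)))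
              * Linf_norm (\<lambda>x. iter_partial \<alpha> (a x) \<xi>)) < \<infinity>)}"

text \<open>The value of a phase at zero frequency is arbitrary.\<close>

definition Linf_Phi :: "nat \<Rightarrow> (real^'n \<Rightarrow> real^'n \<Rightarrow> real) set" where
  "Linf_Phi l = {\<phi>.
     (\<forall>x \<xi> t. \<xi> \<noteq> 0 \<longrightarrow> t > 0 \<longrightarrow> \<phi> x (t *\<^sub>R \<xi>) = t * \<phi> x \<xi>) \<and>
     (\<forall>x. smooth_on (- {0}) (\<phi> x)) \<and>
     (\<forall>\<xi>. \<xi> \<noteq> 0 \<longrightarrow> (\<lambda>x. \<phi> x \<xi>) \<in> borel_measurable lebesgue) \<and>
     (\<forall>\<alpha>. length \<alpha> \<ge> l \<longrightarrow>
        (SUP \<xi>\<in>- {0}. ereal (norm \<xi> powr (- 1 + real (length \<alpha>)))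
              * Linf_norm (\<lambda>x. iter_partial \<alpha> (\<phi> x) \<xi>)) < \<infinity>)}"

section \<open>The rough corank condition\<close>

definition grassmannian :: "nat \<Rightarrow> (real^'n) set set" where
  "grassmannian d = {V. subspace V \<and> dim V = d}"

text \<open>For a linear subspace the nearest-point map is the orthogonal projection.\<close>

abbreviation subspace_proj :: "(real^'n) set \<Rightarrow> real^'n \<Rightarrow> real^'n" where
  "subspace_proj V \<equiv> closest_point V"

definition space_support :: "(real^'n \<Rightarrow> real^'n \<Rightarrow> complex) \<Rightarrow> (real^'n) set" where
  "space_support a = fst ` closure {(x, \<xi>). a x \<xi> \<noteq> 0}"

text \<open>
  The Grassmannian carries its usual topology, in which a subspace is identified with the matrix of
  the orthogonal projection onto it. The constants are uniform in \<open>x\<close>, \<open>y\<close> and \<open>\<xi>\<close>.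
\<close>

definition rough_corank ::
    "nat \<Rightarrow> (real^'n \<Rightarrow> real^'n \<Rightarrow> complex) \<Rightarrow> (real^'n \<Rightarrow> real^'n \<Rightarrow> real) \<Rightarrow> bool" where
  "rough_corank k a \<phi> \<longleftrightarrow>
     (\<exists>V c\<^sub>1 c\<^sub>2.
        (\<forall>x\<in>space_support a. \<forall>\<xi>\<in>sphere 0 1. V x \<xi> \<in> grassmannian (CARD('n) - k)) \<and>
        continuous_on (space_support a \<times> sphere 0 1) (\<lambda>(x, \<xi>). matrix (subspace_proj (V x \<xi>))) \<and>
        c\<^sub>1 > 0 \<and> c\<^sub>2 > 0 \<and>
        (\<forall>x\<in>space_support a. \<forall>y\<in>space_support a. \<forall>\<xi>\<in>sphere 0 1.
           norm (grad (\<phi> x) \<xi> - grad (\<phi> y) \<xi>) + c\<^sub>1 * (norm (x - y))\<^sup>2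
             \<ge> c\<^sub>2 * norm (subspace_proj (V x \<xi>) (x - y))))"

section \<open>Fourier integral operators\<close>

definition fourier :: "(real^'n \<Rightarrow> complex) \<Rightarrow> real^'n \<Rightarrow> complex" where
  "fourier u \<xi> = (LINT x|lebesgue. exp (- \<i> * complex_of_real (x \<bullet> \<xi>)) * u x)"

definition FIO ::
    "(real^'n \<Rightarrow> real^'n \<Rightarrow> complex) \<Rightarrow> (real^'n \<Rightarrow> real^'n \<Rightarrow> real)
       \<Rightarrow> (real^'n \<Rightarrow> complex) \<Rightarrow> real^'n \<Rightarrow> complex" where
  "FIO a \<phi> u x = complex_of_real (1 / (2 * pi) ^ CARD('n))
     * (LINT \<xi>|lebesgue. exp (\<i> * complex_of_real (\<phi> x \<xi>)) * a x \<xi> * fourier u \<xi>)"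

section \<open>Boundedness from \<open>L\<^sup>2\<close>-comp to \<open>L\<^sup>2\<close>-loc\<close>

text \<open>Elements of these spaces are representatives; identities between them hold almost everywhere.\<close>

definition L2 :: "(real^'n \<Rightarrow> complex) set" where
  "L2 = {u \<in> borel_measurable lebesgue. integrable lebesgue (\<lambda>x. (norm (u x))\<^sup>2)}"

definition L2_norm :: "(real^'n \<Rightarrow> complex) \<Rightarrow> real" where
  "L2_norm u = sqrt (LINT x|lebesgue. (norm (u x))\<^sup>2)"

definition L2_comp :: "(real^'n \<Rightarrow> complex) set" where
  "L2_comp = {u \<in> L2. \<exists>K. compact K \<and> (AE x in lebesgue. x \<notin> K \<longrightarrow> u x = 0)}"

definition L2_loc :: "(real^'n \<Rightarrow> complex) set" where
  "L2_loc = {u \<in> borel_measurable lebesgue. \<forall>\<psi>\<in>test_functions. (\<lambda>x. \<psi> x * u x) \<in> L2}"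

definition bounded_L2_comp_loc ::
    "((real^'n \<Rightarrow> complex) \<Rightarrow> real^'n \<Rightarrow> complex) \<Rightarrow> bool" where
  "bounded_L2_comp_loc S \<longleftrightarrow>
     (\<forall>u\<in>L2_comp. S u \<in> L2_loc) \<and>
     (\<forall>u\<in>L2_comp. \<forall>v\<in>L2_comp. \<forall>c d.
        AE x in lebesgue. S (\<lambda>z. c * u z + d * v z) x = c * S u x + d * S v x) \<and>
     (\<forall>\<psi>\<^sub>1\<in>test_functions. \<forall>\<psi>\<^sub>2\<in>test_functions. \<exists>C. \<forall>u\<in>L2.
        (\<lambda>x. \<psi>\<^sub>1 x * S (\<lambda>z. \<psi>\<^sub>2 z * u z) x) \<in> L2 \<and>
        L2_norm (\<lambda>x. \<psi>\<^sub>1 x * S (\<lambda>z. \<psi>\<^sub>2 z * u z) x) \<le> C * L2_norm u)"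

text \<open>
  The integral defining an operator with amplitude in \<^term>\<open>Linf_S m \<rho>\<close> converges on test functions,
  which are dense in \<open>L\<^sup>2\<close>-comp; this is the domain from which it is extended.
\<close>

definition extends_to_bounded_L2_comp_loc ::
    "((real^'n \<Rightarrow> complex) \<Rightarrow> real^'n \<Rightarrow> complex) \<Rightarrow> bool" where
  "extends_to_bounded_L2_comp_loc T \<longleftrightarrow>
     (\<exists>S. bounded_L2_comp_loc S \<and>
          (\<forall>u\<in>test_functions. AE x in lebesgue. S u x = T u x))"

end

theory Submission
 imports Defs "HOL-Probability.Probability"
begin

text \<open>
 Cut the frequency side into the dyadic shells \<open>|\<xi>| ~ \<lambda> = 2\<^sup>j\<close>; it suffices that each piece has norm \<open>O(q\<^sup>j)\<close>, \<open>q < 1\<close>,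
 from \<open>L\<^sup>2\<close> to \<open>L\<^sup>2\<close> of a bounded set. Freeze the variables outside a set \<open>I\<close> of \<open>d = n - k\<close> coordinates on which the projection
 onto \<open>V\<close> is bounded below, and lift the shell to pairs of a centre \<open>\<zeta>\<close> and a point \<open>s\<eta>\<close>, with \<open>\<eta>\<close> in the cube of side
 \<open>\<lambda>\<^sup>1\<^sup>/\<^sup>2\<close> about \<open>\<zeta>\<close> and \<open>1 < s < 2\<close>. The kernel of \<open>T T\<^sup>*\<close> on a slice is then an oscillatory integral with phase
 \<open>s (\<phi>(x,\<eta>) - \<phi>(y,\<eta>))\<close>, whose gradient is at least a multiple of \<open>|x - y|\<close> by the corank condition. Integrating in \<open>s\<close>
 and a sublevel estimate in \<open>\<eta>\<close> gain \<open>min(1, \<lambda>\<^sup>-\<^sup>\<rho>/|x - y|)\<close>; for \<open>\<rho> >= 1/2\<close> integrating in \<open>\<eta>\<close> makes the kernel negligible once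
 \<open>|x - y|\<close> exceeds \<open>\<lambda>\<^sup>-\<^sup>1\<^sup>/\<^sup>2\<close> up to small powers. Schur's test over the \<open>d\<close> free variables gives exactly the stated range of \<open>m\<close>.
 Only measurability of \<open>V\<close> is used, through the sets of \<open>(x,\<omega>)\<close> for which a given \<open>I\<close> is admissible.
\<close>

text \<open>The lift is forced by a rough cut-off. Which coordinate set \<open>I\<close> is
  admissible depends on \<open>x\<close> and on the direction of the frequency, and only measurably,
  so it cannot be part of an amplitude that is integrated by parts. After the lift it is a function
  of the centre \<open>zeta\<close>, while oscillation is exploited in \<open>eta\<close> and
  \<open>s\<close>, where the amplitude is smooth. The size \<open>sqrt lam\<close> of the cubes
  fits the phase: its second derivatives are O(1/lam), so the gradient of a phase difference moves
  by O(1 / sqrt lam) over a cube, and nondegeneracy at the centre passes to every point once |x - y|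
  exceeds that by a suitable factor. For smaller |x - y| the radial integral gains only where the
  phase difference itself is large. By Euler's relation the difference may vanish where its gradient
  is orthogonal to the frequency; the sublevel estimate says how rarely this happens. Nothing is
  smooth in \<open>x\<close>, hence the passage to the composition with the adjoint, where
  \<open>x\<close> and \<open>y\<close> are mere parameters. The parameter \<open>t\<close>, a small
  power of \<open>lam\<close>, absorbs the losses, so that finitely many derivatives
  suffice.\<close>

notation scaleR (infixr ".*" 75)

abbreviation wave :: "'a::real_inner => 'a => complex"
 where "wave x xi \<equiv> exp (- \<i> * of_real (x \<bullet> xi))"

abbreviation bmeas :: "('a::topological_space => 'b::topological_space) set"
 where "bmeas \<equiv> borel_measurable borel"

abbreviation nn_lborel :: "('a::euclidean_space => ennreal) => ennreal" (binder "NN " 10)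
 where "nn_lborel f \<equiv> nn_integral lborel f"

abbreviation int_lborel :: "('a::euclidean_space => 'b::{banach, second_countable_topology}) => 'b" (binder "LL " 10)
 where "int_lborel f \<equiv> lebesgue_integral lborel f"

abbreviation sqn :: "complex => ennreal"
 where "sqn z \<equiv> ennreal ((norm z)\<^sup>2)"

section \<open>Derivative bounds in one variable\<close>

text \<open>Unfolding the recursion, derivatives of order j <= \<open>N\<close> are bounded by
  \<open>C * L ^ j\<close> on \<open>U\<close>, so 1/\<open>L\<close> is the length on which the
  function varies. The derivatives are existential witnesses, which lets the bounds pass through
  sums, products and inverses without naming an iterated derivative.\<close>

fun dbd :: "nat => real => real => real set => (real => 'a::real_normed_field) => bool" where
 "dbd 0 C L U g \<longleftrightarrow> (\<forall>t\<in>U. norm (g t) <= C)"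
| "dbd (Suc N) C L U g \<longleftrightarrow> (\<forall>t\<in>U. norm (g t) <= C) \<and>
   (\<exists>g'. (\<forall>t\<in>U. (g has_vector_derivative g' t) (at t)) \<and> dbd N (C * L) L U g')"

lemma dbd_bound: "dbd N C L U g ==> t \<in> U ==> norm (g t) <= C"
 by (cases N) auto

lemma dbd_SucD: "dbd (Suc N) C L U g ==> dbd N C L U g"
proof (induction N arbitrary: C g)
 case (Suc N)
 from Suc.prems obtain g' where "\<forall>t\<in>U. norm (g t) <= C"
  "\<forall>t\<in>U. (g has_vector_derivative g' t) (at t)" "dbd (Suc N) (C * L) L U g'"
  unfolding dbd.simps(2)[of "Suc N"] by blast
 with Suc.IH[of "C * L" g'] show ?case by (auto simp only: dbd.simps(2)[of N])
qed auto

lemma dbd_mono: "dbd N C L U g ==> C <= C' ==> 0 <= L ==> dbd N C' L U g"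
proof (induction N arbitrary: C C' g)
 case (Suc N)
 from Suc.prems obtain g' where g': "\<forall>t\<in>U. norm (g t) <= C"
  "\<forall>t\<in>U. (g has_vector_derivative g' t) (at t)" "dbd N (C * L) L U g'" by auto
 have "dbd N (C' * L) L U g'"
  using Suc.IH[OF g'(3)] Suc.prems by (auto intro: mult_right_mono)
 with g' Suc.prems show ?case by fastforce
qed auto

lemma dbd_mono_scale: "dbd N C L U g ==> 0 <= C ==> 0 <= L ==> L <= L' ==> dbd N C L' U g"
proof (induction N arbitrary: C g)
 case (Suc N)
 from Suc.prems obtain g' where g': "\<forall>t\<in>U. norm (g t) <= C"
  "\<forall>t\<in>U. (g has_vector_derivative g' t) (at t)" "dbd N (C * L) L U g'" by auto
 have "dbd N (C * L) L' U g'"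
  using Suc.IH[OF g'(3)] Suc.prems by auto
 then have "dbd N (C * L') L' U g'"
  by (rule dbd_mono) (use Suc.prems in \<open>auto intro: mult_left_mono\<close>)
 with g' Suc.prems show ?case by fastforce
qed auto

lemma dbd_const: "norm c <= C ==> 0 <= C ==> 0 <= L ==> dbd N C L U (\<lambda>t. c)"
proof (induction N arbitrary: c C)
 case (Suc N)
 have "dbd N (C * L) L U (\<lambda>t. 0::'a)" using Suc by auto
 then show ?case using Suc.prems
  by (auto intro!: exI[of _ "\<lambda>t. 0"] derivative_eq_intros)
qed auto

lemma dbd_add: "dbd N C L U f ==> dbd N D L U g ==> dbd N (C + D) L U (\<lambda>t. f t + g t)"
proof (induction N arbitrary: C D f g)
 case 0
 then show ?case by (auto intro: norm_triangle_mono)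
next
 case (Suc N)
 from Suc.prems obtain f' g' where *: "\<forall>t\<in>U. norm (f t) <= C" "\<forall>t\<in>U. norm (g t) <= D"
  "\<forall>t\<in>U. (f has_vector_derivative f' t) (at t)" "dbd N (C * L) L U f'"
  "\<forall>t\<in>U. (g has_vector_derivative g' t) (at t)" "dbd N (D * L) L U g'" by auto
 have "dbd N ((C + D) * L) L U (\<lambda>t. f' t + g' t)"
  using Suc.IH[OF *(4,6)] by (simp add: distrib_right)
 with * show ?case
  by (auto intro!: exI[of _ "\<lambda>t. f' t + g' t"] derivative_eq_intros norm_triangle_mono)
qed

lemma dbd_sum:
 assumes "finite I" "\<And>i. i \<in> I ==> dbd N (C i) L U (f i)" "0 <= L"
 shows "dbd N (\<Sum>i\<in>I. C i) L U (\<lambda>t. \<Sum>i\<in>I. f i t)"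
 using assms(1,2)
proof (induction I)
 case empty
 then show ?case using assms(3) by (auto intro: dbd_const)
next
 case (insert i I)
 then show ?case using dbd_add[of N "C i" L U "f i" "\<Sum>i\<in>I. C i"] by auto
qed

text \<open>Leibniz: each differentiation splits the product into two terms of the same kind, and
  \<open>N\<close> of them cost the factor \<open>2 ^ N\<close>.\<close>

lemma dbd_mult:
 "dbd N C L U f ==> dbd N D L U g ==> 0 <= C ==> 0 <= D ==> 0 <= L
  ==> dbd N (2 ^ N * C * D) L U (\<lambda>t. f t * g t)"
proof (induction N arbitrary: C D f g)
 case 0
 then show ?case by (auto simp: norm_mult intro: mult_mono)
next
 case (Suc N)
 from Suc.prems obtain f' g' where *: "\<forall>t\<in>U. norm (f t) <= C" "\<forall>t\<in>U. norm (g t) <= D"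
  "\<forall>t\<in>U. (f has_vector_derivative f' t) (at t)" "dbd N (C * L) L U f'"
  "\<forall>t\<in>U. (g has_vector_derivative g' t) (at t)" "dbd N (D * L) L U g'" by auto
 have "dbd N (2 ^ N * C * (D * L)) L U (\<lambda>t. f t * g' t)"
  by (rule Suc.IH[OF dbd_SucD[OF Suc.prems(1)] *(6)]) (use Suc.prems in auto)
 moreover have "dbd N (2 ^ N * (C * L) * D) L U (\<lambda>t. f' t * g t)"
  by (rule Suc.IH[OF *(4) dbd_SucD[OF Suc.prems(2)]]) (use Suc.prems in auto)
 ultimately have d: "dbd N (2 ^ Suc N * C * D * L) L U (\<lambda>t. f t * g' t + f' t * g t)"
  using dbd_add by (fastforce simp: algebra_simps)
 have b: "norm (f t * g t) <= 2 ^ Suc N * C * D" if "t \<in> U" for t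
 proof -
  have "norm (f t * g t) <= 1 * (C * D)" using * that by (auto simp: norm_mult intro!: mult_mono Suc.prems)
  also have "\<dots> <= 2 ^ Suc N * (C * D)" using Suc.prems
   by (intro mult_right_mono) (auto simp: one_le_power simp del: power_Suc)
  finally show ?thesis by (simp add: mult.assoc)
 qed
 show ?case unfolding dbd.simps(2)
  using b d * by (fastforce intro!: exI[of _ "\<lambda>t. f t * g' t + f' t * g t"] has_vector_derivative_mult)
qed

lemma dbd_scaleR: "dbd N C L U f ==> dbd N (\<bar>c\<bar> * C) L U (\<lambda>t. c .* f t)"
proof (induction N arbitrary: C f)
 case 0
 then show ?case by (auto intro: mult_left_mono)
next
 case (Suc N)
 from Suc.prems obtain f' where *: "\<forall>t\<in>U. norm (f t) <= C"
  "\<forall>t\<in>U. (f has_vector_derivative f' t) (at t)" "dbd N (C * L) L U f'" by auto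
 have "dbd N (\<bar>c\<bar> * C * L) L U (\<lambda>t. c .* f' t)" using Suc.IH[OF *(3)] by (simp add: mult.assoc)
 with * show ?case
  by (fastforce intro!: exI[of _ "\<lambda>t. c .* f' t"] derivative_eq_intros mult_left_mono)
qed

lemma dbd_of_real: "dbd N C L U f ==> dbd N C L U (\<lambda>t. complex_of_real (f t))"
proof (induction N arbitrary: C f)
 case (Suc N)
 from Suc.prems obtain f' where *: "\<forall>t\<in>U. norm (f t) <= C"
  "\<forall>t\<in>U. (f has_vector_derivative f' t) (at t)" "dbd N (C * L) L U f'" by auto
 then show ?case using Suc.IH[OF *(3)]
  by (auto intro!: exI[of _ "\<lambda>t. complex_of_real (f' t)"] has_vector_derivative_of_real
    simp: has_real_derivative_iff_has_vector_derivative)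
qed auto

lemma dbd_cnj: "dbd N C L U f ==> dbd N C L U (\<lambda>t. cnj (f t))"
proof (induction N arbitrary: C f)
 case (Suc N)
 from Suc.prems obtain f' where *: "\<forall>t\<in>U. norm (f t) <= C"
  "\<forall>t\<in>U. (f has_vector_derivative f' t) (at t)" "dbd N (C * L) L U f'" by auto
 then show ?case using Suc.IH[OF *(3)]
  by (auto intro!: exI[of _ "\<lambda>t. cnj (f' t)"] has_vector_derivative_cnj)
qed auto

text \<open>By (1/p)' = -p'/p^2, a derivative of 1/p costs L^2/D, which is at most \<open>L\<close>
  because \<open>L <= D\<close>. The constant depends on \<open>N\<close> and \<open>C\<close> only;
  from this uniformity over all phases come kernel bounds that are uniform in \<open>x\<close> and
  \<open>y\<close>.\<close>

lemma dbd_inverse: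
 assumes "0 <= C"
 shows "\<exists>K\<ge>1. \<forall>(p::real=>real) p' D L U. 0 < L --> L <= D --> (\<forall>t\<in>U. D <= \<bar>p t\<bar>) -->
   (\<forall>t\<in>U. (p has_vector_derivative p' t) (at t)) --> dbd N (C * L^2) L U p' -->
   dbd N (K / D) L U (\<lambda>t. 1 / p t)"
proof (induction N)
 case 0
 show ?case
 proof (intro exI[of _ 1] conjI allI impI)
  fix p p' :: "real => real" and D L :: real and U
  assume "0 < L" "L <= D" "\<forall>t\<in>U. D <= \<bar>p t\<bar>"
  moreover have "norm (1 / p t) <= 1 / D" if "t \<in> U" for t
   using calculation that by (auto intro!: frac_le)
  ultimately show "dbd 0 (1 / D) L U (\<lambda>t. 1 / p t)"
   by simp
 qed simp
next
 case (Suc N)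
 then obtain K where K: "K >= 1" and IH: "\<And>(p::real=>real) p' D L U. 0 < L ==> L <= D ==> (\<forall>t\<in>U. D <= \<bar>p t\<bar>) ==>
   (\<forall>t\<in>U. (p has_vector_derivative p' t) (at t)) ==> dbd N (C * L^2) L U p' ==>
   dbd N (K / D) L U (\<lambda>t. 1 / p t)" by metis
 \<comment> \<open>The maximum meets two demands: the size of 1/p itself, and the two applications
   of the product rule to p' * (1/p)^2.\<close>
 define K' where "K' = max K (2^N * (2^N * K * K) * C)"
 have K'1: "K' >= 1" using K unfolding K'_def by auto
 show ?case
 proof (intro exI[of _ K'] conjI allI impI)
  fix p p' :: "real => real" and D L :: real and U
  assume L: "0 < L" "L <= D" and pD: "\<forall>t\<in>U. D <= \<bar>p t\<bar>"
   and p': "\<forall>t\<in>U. (p has_vector_derivative p' t) (at t)" "dbd (Suc N) (C * L^2) L U p'"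
  have D: "D > 0" using L by auto
  have p'N: "dbd N (C * L^2) L U p'" using dbd_SucD p' by blast
  have q: "dbd N (K / D) L U (\<lambda>t. 1 / p t)" using IH[OF L pD p'(1) p'N] .
  have qq: "dbd N (2^N * (K/D) * (K/D)) L U (\<lambda>t. 1 / p t * (1 / p t))"
   by (rule dbd_mult[OF q q]) (use K D L in auto)
  have "dbd N (2^N * (2^N * (K/D) * (K/D)) * (C * L^2)) L U (\<lambda>t. 1 / p t * (1 / p t) * p' t)"
   by (rule dbd_mult[OF qq p'N]) (use K D L assms in auto)
  then have "dbd N (\<bar>-1\<bar> * (2^N * (2^N * (K/D) * (K/D)) * (C * L^2))) L U (\<lambda>t. (-1) .* (1 / p t * (1 / p t) * p' t))"
   by (rule dbd_scaleR)
  then have d: "dbd N (K' / D * L) L U (\<lambda>t. (-1) .* (1 / p t * (1 / p t) * p' t))"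
  proof (rule dbd_mono)
   have "\<bar>-1\<bar> * (2^N * (2^N * (K/D) * (K/D)) * (C * L^2)) = (2^N * (2^N * K * K) * C) * ((L/D) * (L/D))"
    by (simp add: field_simps power2_eq_square)
   also have "\<dots> <= K' * ((L/D) * 1)"
    using K assms L D K'1 by (intro mult_mono) (auto simp: K'_def)
   finally show "\<bar>-1\<bar> * (2^N * (2^N * (K/D) * (K/D)) * (C * L^2)) <= K' / D * L" by simp
  qed (use L in auto)
  have b: "norm (1 / p t) <= K' / D" if "t \<in> U" for t
  proof -
   have "norm (1 / p t) = 1 / \<bar>p t\<bar>" by simp
   also have "\<dots> <= K' / D" using pD that D K'1 by (intro frac_le) auto
   finally show ?thesis .
  qed
  have dv: "((\<lambda>t. 1 / p t) has_vector_derivative (-1) .* (1 / p t * (1 / p t) * p' t)) (at t)" if "t \<in> U" for t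
  proof -
   have "D <= \<bar>p t\<bar>" using pD that by blast
   then have "p t ~= 0" using D by auto
   moreover have "(p has_real_derivative p' t) (at t)"
    unfolding has_real_derivative_iff_has_vector_derivative using p'(1) that by (simp only:)
   ultimately have "((\<lambda>t. 1 / p t) has_real_derivative (0 * p t - 1 * p' t) / (p t * p t)) (at t)"
    by (intro DERIV_divide DERIV_const)
   moreover have "(0 * p t - 1 * p' t) / (p t * p t) = (-1) .* (1 / p t * (1 / p t) * p' t)"
    by simp
   ultimately show ?thesis
    unfolding has_real_derivative_iff_has_vector_derivative by (simp only:)
  qed
  show "dbd (Suc N) (K' / D) L U (\<lambda>t. 1 / p t)"
   unfolding dbd.simps
   by (intro conjI ballI exI[of _ "\<lambda>t. (-1) .* (1 / p t * (1 / p t) * p' t)"] b dv d)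
 qed (rule K'1)
qed

text \<open>This matters at the end points of the support, where the amplitude must vanish again
  after an integration by parts. Near \<open>t\<close> the function vanishes on the half-line
  pointing away from the interval, and a one-sided derivative already determines
  \<open>h'\<close>.\<close>

lemma vector_derivative_zero_outside:
 fixes h :: "real => 'a::real_normed_vector"
 assumes "open U" "t \<in> U" "t \<notin> {a<..<b}" "\<And>s. s \<in> U ==> s \<notin> {a<..<b} ==> h s = 0"
  and "(h has_vector_derivative h') (at t)"
 shows "h' = 0"
proof -
 obtain e where e: "e > 0" "ball t e \<subseteq> U" using assms(1,2) openE by blast
 have *: "h' = 0" if S: "S = {..t} \<and> t <= a \<or> S = {t..} \<and> b <= t" for S
 proof -
  have "(h has_vector_derivative h') (at t within S)"
   using assms(5) has_vector_derivative_at_within by blast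
  then have "((\<lambda>_. 0) has_vector_derivative h') (at t within S)"
   unfolding has_vector_derivative_def
  proof (rule has_derivative_transform_within[where d=e])
   show "h x' = 0" if "x' \<in> S" "dist x' t < e" for x'
    using assms(4)[of x'] e that S by (auto simp: dist_commute subset_eq)
  qed (use assms e S in auto)
  moreover have "at t within S ~= bot"
  proof -
   have "at t within {..<t} <= at t within {..t}" "at t within {t<..} <= at t within {t..}"
    by (auto intro!: at_le)
   moreover have "at t within {..<t} ~= bot" "at t within {t<..} ~= bot" by auto
   ultimately show ?thesis using S bot_unique by metis
  qed
  ultimately show ?thesis
   by (metis has_vector_derivative_const vector_derivative_unique_within)
 qed
 show ?thesis using *[of "{..t}"] *[of "{t..}"] assms(3) by (auto simp: not_less)
qed

section \<open>Non-stationary phase in one variable\<close>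

text \<open>\<open>p\<close> and \<open>p'\<close> are the first two derivatives of the phase
  \<open>f\<close>, \<open>D\<close> bounds |f'| from below, and \<open>L\<close> is a common
  inverse length scale of phase and amplitude. The open set \<open>U\<close> around the closed
  interval makes all derivatives two-sided at the end points.\<close>

definition phase_data ::
 "nat => real => (real=>real) => (real=>real) => (real=>real) => (real=>complex)
   => real => real => real => real => real => real set => bool" where
 "phase_data N C f p p' g G D L a b U \<longleftrightarrow>
   open U \<and> {a..b} \<subseteq> U \<and> a <= b \<and> 0 < L \<and> L <= D \<and> 0 <= G \<and>
   (\<forall>t\<in>U. (f has_vector_derivative p t) (at t)) \<and>
   (\<forall>t\<in>U. (p has_vector_derivative p' t) (at t)) \<and> (\<forall>t\<in>U. D <= \<bar>p t\<bar>) \<and>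
   dbd N (C * L^2) L U p' \<and> dbd N G L U g \<and> (\<forall>t\<in>U. t \<notin> {a<..<b} --> g t = 0)"

text \<open>An integration by parts replaces the amplitude g by i (g/p)'. This is again of the same
  type and vanishes outside the interval, with \<open>G\<close> multiplied by a constant times L/D;
  induction repeats it \<open>N\<close> times.\<close>

lemma nonstationary_phase:
 assumes "0 <= C"
 shows "\<exists>K\<ge>0. \<forall>f p p' g G D L a b U. phase_data N C f p p' g G D L a b U -->
   norm (integral {a..b} (\<lambda>t. exp (\<i> * of_real (f t)) * g t)) <= K * G * (b - a) * (L / D) ^ N"
proof (induction N)
 case 0
 show ?case
 proof (intro exI[of _ 1] conjI allI impI)
  fix f p p' :: "real => real" and g :: "real => complex" and G D L a b :: real and U
  assume "phase_data 0 C f p p' g G D L a b U"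
  then have U: "{a..b} \<subseteq> U" "a <= b" "0 <= G" and g: "dbd 0 G L U g" by (auto simp: phase_data_def)
  let ?F = "\<lambda>t. exp (\<i> * of_real (f t)) * g t"
  have "norm (integral {a..b} ?F) <= G * (b - a)"
  proof (cases "?F integrable_on {a..b}")
   case True
   have "norm (?F t) <= G" if "t \<in> cbox a b" for t
    using g U that by (auto simp: norm_mult subset_eq)
   then show ?thesis
    using has_integral_bound[of G ?F "integral {a..b} ?F" a b] True U by auto
  qed (use U in \<open>auto simp: not_integrable_integral\<close>)
  then show "norm (integral {a..b} ?F) <= 1 * G * (b - a) * (L / D) ^ 0" by simp
 qed simp
next
 case (Suc N)
 then obtain K where K: "K >= 0" and IH: "\<And>f p p' g G D L a b U. phase_data N C f p p' g G D L a b U ==>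
   norm (integral {a..b} (\<lambda>t. exp (\<i> * of_real (f t)) * g t)) <= K * G * (b - a) * (L / D) ^ N"
  by blast
 obtain Q where Q: "Q >= 1" and inv: "\<And>(p::real=>real) p' D L U. 0 < L ==> L <= D ==> (\<forall>t\<in>U. D <= \<bar>p t\<bar>) ==>
   (\<forall>t\<in>U. (p has_vector_derivative p' t) (at t)) ==> dbd (Suc N) (C * L^2) L U p' ==>
   dbd (Suc N) (Q / D) L U (\<lambda>t. 1 / p t)"
  using dbd_inverse[OF assms, of "Suc N"] by metis
 show ?case
 proof (intro exI[of _ "K * 2 ^ Suc N * Q"] conjI allI impI)
  fix f p p' :: "real => real" and g :: "real => complex" and G D L a b :: real and U
  assume "phase_data (Suc N) C f p p' g G D L a b U"
  then have U: "open U" "{a..b} \<subseteq> U" "a <= b" and L: "0 < L" "L <= D" and G: "0 <= G"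
   and f: "\<forall>t\<in>U. (f has_vector_derivative p t) (at t)"
   and p: "\<forall>t\<in>U. (p has_vector_derivative p' t) (at t)" and pD: "\<forall>t\<in>U. D <= \<bar>p t\<bar>"
   and p': "dbd (Suc N) (C * L^2) L U p'" and g: "dbd (Suc N) G L U g"
   and g0: "\<forall>t\<in>U. t \<notin> {a<..<b} --> g t = 0" unfolding phase_data_def by blast+
  have D: "D > 0" using L by auto
  have p0: "p t ~= 0" if "t \<in> U" for t
  proof -
   have "D <= \<bar>p t\<bar>" using pD that by blast
   then show ?thesis using D by auto
  qed
  let ?E = "\<lambda>t. exp (\<i> * of_real (f t)) :: complex"
  let ?q = "\<lambda>t. complex_of_real (1 / p t)"
  let ?h = "\<lambda>t. g t * ?q t"
  have "dbd (Suc N) (2 ^ Suc N * G * (Q / D)) L U ?h"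
   by (rule dbd_mult[OF g dbd_of_real[OF inv[OF L pD p p']]]) (use G Q D L in auto)
  then obtain h' where h': "\<And>t. t \<in> U ==> (?h has_vector_derivative h' t) (at t)"
   and dh': "dbd N (2 ^ Suc N * G * (Q / D) * L) L U h'" by auto
  have h0: "\<forall>t\<in>U. t \<notin> {a<..<b} --> h' t = 0"
  proof (intro ballI impI)
   fix t assume t: "t \<in> U" "t \<notin> {a<..<b}"
   show "h' t = 0"
    by (rule vector_derivative_zero_outside[OF U(1) t _ h'[OF t(1)]]) (use g0 in auto)
  qed
  have dE: "(?E has_vector_derivative \<i> * of_real (p t) * ?E t) (at t)" if "t \<in> U" for t
  proof -
   have "((\<lambda>t. \<i> * complex_of_real (f t)) has_vector_derivative \<i> * of_real (p t)) (at t)"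
    using f that by (auto intro!: has_vector_derivative_mult_right has_vector_derivative_of_real
     simp: has_real_derivative_iff_has_vector_derivative)
   then have "(exp \<circ> (\<lambda>t. \<i> * complex_of_real (f t)) has_vector_derivative (\<i> * of_real (p t)) * ?E t) (at t)"
    by (intro field_vector_diff_chain_at) (auto intro: DERIV_exp)
   then show ?thesis by (simp add: o_def)
  qed
  have der: "((\<lambda>t. ?E t * ?h t) has_vector_derivative ?E t * h' t + \<i> * (?E t * g t)) (at t)"
   if t: "t \<in> U" for t
  proof -
   have "((\<lambda>t. ?E t * ?h t) has_vector_derivative ?E t * h' t + \<i> * of_real (p t) * ?E t * ?h t) (at t)"
    by (rule has_vector_derivative_mult[OF dE[OF t] h'[OF t]])
   moreover have "\<i> * of_real (p t) * ?E t * ?h t = \<i> * (?E t * g t)"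
    using p0[OF t] by simp
   ultimately show ?thesis by (simp only:)
  qed
  have "((\<lambda>t. ?E t * h' t + \<i> * (?E t * g t)) has_integral (?E b * ?h b - ?E a * ?h a)) {a..b}"
   by (intro fundamental_theorem_of_calculus U(3) has_vector_derivative_at_within[OF der])
    (use U(2) in blast)
  moreover have gab: "g a = 0" "g b = 0" using U g0 by auto
  ultimately have I: "((\<lambda>t. ?E t * h' t + \<i> * (?E t * g t)) has_integral 0) {a..b}" 
   by (simp only: gab mult_zero_left mult_zero_right diff_zero)
  obtain g' where gd: "\<forall>t\<in>U. (g has_vector_derivative g' t) (at t)" using g by auto
  have c1: "isCont ?E t" if "t \<in> {a..b}" for t
   by (rule has_vector_derivative_continuous[OF dE]) (use U(2) that in blast)
  have c2: "isCont g t" if "t \<in> {a..b}" for t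
   by (rule has_vector_derivative_continuous[OF gd[rule_format]]) (use U(2) that in blast)
  from c1 c2 have "continuous_on {a..b} (\<lambda>t. ?E t * g t)"
   by (intro continuous_on_mult continuous_at_imp_continuous_on ballI)
  then have iE: "(\<lambda>t. ?E t * g t) integrable_on {a..b}" by (rule integrable_continuous_real)
  have "((\<lambda>t. (?E t * h' t + \<i> * (?E t * g t)) - \<i> * (?E t * g t)) has_integral
       (0 - \<i> * integral {a..b} (\<lambda>t. ?E t * g t))) {a..b}"
   by (intro has_integral_diff[OF I] has_integral_mult_right integrable_integral iE)
  then have "((\<lambda>t. ?E t * h' t) has_integral (- \<i> * integral {a..b} (\<lambda>t. ?E t * g t))) {a..b}"
   by simp
  then have "integral {a..b} (\<lambda>t. ?E t * h' t) = - \<i> * integral {a..b} (\<lambda>t. ?E t * g t)"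
   by (rule integral_unique)
  then have "norm (integral {a..b} (\<lambda>t. ?E t * g t)) = norm (integral {a..b} (\<lambda>t. ?E t * h' t))"
   by (simp add: norm_mult)
  also have "\<dots> <= K * (2 ^ Suc N * G * (Q / D) * L) * (b - a) * (L / D) ^ N"
  proof (rule IH)
   have "0 <= 2 ^ Suc N * G * (Q / D) * L" using G Q D L by simp
   then show "phase_data N C f p p' h' (2 ^ Suc N * G * (Q / D) * L) D L a b U"
    unfolding phase_data_def using U L f p pD dbd_SucD[OF p'] dh' h0 by blast
  qed
  also have "\<dots> = K * 2 ^ Suc N * Q * G * (b - a) * (L / D) ^ Suc N"
   by (simp only: power_Suc divide_inverse mult_ac)
  finally show "norm (integral {a..b} (\<lambda>t. ?E t * g t)) <= K * 2 ^ Suc N * Q * G * (b - a) * (L / D) ^ Suc N" .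
 next
  show "0 <= K * 2 ^ Suc N * Q" using K Q by simp
 qed
qed

section \<open>A bump function\<close>

text \<open>This is (1 - t^2)^M on [-1,1], continued by zero. Finite smoothness is enough, as fewer
  than \<open>M\<close> derivatives are ever taken, and derivative bounds can be written down
  explicitly.\<close>

definition bump :: "nat => real => real" where
 "bump M t = (max 0 (1 - t)) ^ M * (max 0 (1 + t)) ^ M"

lemma bump_nonneg: "0 <= bump M t"
 by (simp add: bump_def)

lemma bump_eq_0: "M > 0 ==> \<bar>t\<bar> >= 1 ==> bump M t = 0"
 by (cases "t >= 0") (auto simp: bump_def)

lemma bump_le_1: assumes "M > 0" shows "bump M t <= 1"
proof (cases "\<bar>t\<bar> >= 1")
 case True
 then show ?thesis using bump_eq_0[OF assms] by simp
next
 case False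
 then have "bump M t = ((1 - t) * (1 + t)) ^ M"
  by (simp add: bump_def power_mult_distrib)
 also have "\<dots> <= 1"
 proof (rule power_le_one)
  show "0 <= (1 - t) * (1 + t)" using False by (intro mult_nonneg_nonneg) auto
  have "(1 - t) * (1 + t) = 1 - t^2" by (simp add: power2_eq_square algebra_simps)
  then show "(1 - t) * (1 + t) <= 1" by simp
 qed
 finally show ?thesis .
qed

lemma bump_ge: assumes "\<bar>t\<bar> <= 1/2" shows "(1/4) ^ M <= bump M t"
proof -
 have "(1/2) ^ M <= (max 0 (1 - t)) ^ M" "(1/2) ^ M <= (max 0 (1 + t)) ^ M"
  using assms by (intro power_mono; auto)+
 then have "(1/2) ^ M * (1/2) ^ M <= bump M t"
  unfolding bump_def by (intro mult_mono) auto
 then show ?thesis by (simp add: power_mult_distrib[symmetric])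
qed

lemma continuous_on_bump [continuous_intros]: "continuous_on S f ==> continuous_on S (\<lambda>x. bump M (f x))"
 unfolding bump_def by (intro continuous_intros)

lemma borel_measurable_bump [measurable]: "bump M \<in> bmeas"
 by (intro borel_measurable_continuous_onI continuous_on_bump continuous_on_id)

lemma has_vector_derivative_max_power:
 assumes "M >= 2"
 shows "((\<lambda>t. (max 0 (b * t + c)) ^ M) has_vector_derivative (real M * b) .* (max 0 (b * t + c)) ^ (M - 1)) (at t)"
proof -
 let ?h = "\<lambda>s::real. (max 0 s) ^ M"
 have h: "(?h has_real_derivative real M * (max 0 s) ^ (M - 1)) (at s)" for s
 proof (cases "s = 0")
  case False
  show ?thesis
  proof (cases "s > 0")
   case True
   have "((\<lambda>s. s ^ M) has_real_derivative real M * s ^ (M - 1)) (at s)"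
    by (auto intro!: derivative_eq_intros)
   then have "(?h has_real_derivative real M * s ^ (M - 1)) (at s)"
    by (rule has_field_derivative_transform_within_open[where S="{0<..}"]) (use True in auto)
   then show ?thesis using True by simp
  next
   case False
   with \<open>s ~= 0\<close> have "s < 0" by simp
   have "((\<lambda>s. 0) has_real_derivative 0) (at s)" by simp
   then have "(?h has_real_derivative 0) (at s)"
    by (rule has_field_derivative_transform_within_open[where S="{..<0}"]) (use \<open>s < 0\<close> assms in auto)
   moreover have "(0::real) ^ (M - 1) = 0" using assms by (simp add: power_0_left)
   ultimately show ?thesis using \<open>s < 0\<close> by (simp only: max_absorb1 less_imp_le mult_zero_right)
  qed
 next
  \<comment> \<open>At the kink the difference quotient is at most |h|^(M - 1), which tends to 0
    because M >= 2.\<close>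
  case True
  have "((\<lambda>h. (?h (0 + h) - ?h 0) / h) \<longlongrightarrow> 0) (at 0)"
  proof (rule Lim_null_comparison)
   have "norm ((?h (0 + h) - ?h 0) / h) <= \<bar>h\<bar> ^ (M - 1)" for h
   proof -
    have "norm ((?h (0 + h) - ?h 0) / h) = (max 0 h) ^ M / \<bar>h\<bar>"
     using assms by (simp add: power_0_left abs_divide)
    also have "\<dots> <= \<bar>h\<bar> ^ M / \<bar>h\<bar>"
     by (intro divide_right_mono power_mono) auto
    also have "\<bar>h\<bar> ^ M / \<bar>h\<bar> <= \<bar>h\<bar> ^ (M - 1)"
     using assms by (cases "h = 0") (auto simp: power_eq_if)
    finally show ?thesis .
   qed
   then show "\<forall>\<^sub>F h in at 0. norm ((?h (0 + h) - ?h 0) / h) <= \<bar>h\<bar> ^ (M - 1)" by simp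
   have "((\<lambda>h::real. \<bar>h\<bar> ^ (M - 1)) \<longlongrightarrow> \<bar>0\<bar> ^ (M - 1)) (at 0)" by (intro tendsto_intros)
   then show "((\<lambda>h::real. \<bar>h\<bar> ^ (M - 1)) \<longlongrightarrow> 0) (at 0)" using assms by (simp add: power_0_left)
  qed
  then have "(?h has_real_derivative 0) (at 0)" unfolding DERIV_def .
  then show ?thesis using True assms by (simp add: power_0_left)
 qed
 have "((\<lambda>t. ?h (b * t + c)) has_real_derivative (real M * (max 0 (b * t + c)) ^ (M - 1)) * b) (at t)"
  by (rule DERIV_chain2[OF h]) (auto intro!: derivative_eq_intros)
 then show ?thesis
  unfolding has_real_derivative_iff_has_vector_derivative by (simp add: mult_ac)
qed

text \<open>Differentiation lowers the power \<open>M\<close>, whereas the scale \<open>L\<close>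
  has to stay the same along the induction; therefore \<open>L\<close> is tied to a fixed upper
  bound \<open>M0\<close> of all powers.\<close>

lemma dbd_max_power:
 assumes "\<And>t. t \<in> U ==> b * t + c <= B" "1 <= B" "real M0 * \<bar>b\<bar> <= L"
 shows "N < M ==> M <= M0 ==> dbd N (B ^ M) L U (\<lambda>t. (max 0 (b * t + c)) ^ M)"
proof (induction N arbitrary: M)
 case 0
 then show ?case using assms by (auto intro!: power_mono)
next
 case (Suc N)
 have L: "L >= 0" using assms(3) by (smt (verit) mult_nonneg_nonneg of_nat_0_le_iff)
 have "dbd N (B ^ (M - 1)) L U (\<lambda>t. (max 0 (b * t + c)) ^ (M - 1))"
  by (rule Suc.IH) (use Suc.prems in auto)
 then have "dbd N (\<bar>real M * b\<bar> * B ^ (M - 1)) L U (\<lambda>t. (real M * b) .* (max 0 (b * t + c)) ^ (M - 1))"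
  by (rule dbd_scaleR)
 then have d: "dbd N (B ^ M * L) L U (\<lambda>t. (real M * b) .* (max 0 (b * t + c)) ^ (M - 1))"
 proof (rule dbd_mono[OF _ _ L])
  have "\<bar>real M * b\<bar> <= real M0 * \<bar>b\<bar>" using Suc.prems by (auto simp: abs_mult intro: mult_right_mono)
  also have "\<dots> <= L" by (rule assms)
  finally have 1: "\<bar>real M * b\<bar> <= L" .
  have "B ^ (M - 1) <= B ^ M" by (rule power_increasing) (use assms in auto)
  then show "\<bar>real M * b\<bar> * B ^ (M - 1) <= B ^ M * L"
   using 1 L assms(2) by (subst mult.commute) (intro mult_mono, auto)
 qed
 have b: "norm ((max 0 (b * t + c)) ^ M) <= B ^ M" if "t \<in> U" for t
  using assms that by (auto intro!: power_mono)
 show ?case unfolding dbd.simps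
  by (intro conjI ballI exI[of _ "\<lambda>t. (real M * b) .* (max 0 (b * t + c)) ^ (M - 1)"] b d
    has_vector_derivative_max_power) (use Suc.prems in auto)
qed

text \<open>The interval is twice as wide as the support, to serve as an open neighbourhood of it.
  There both factors 1 + (t - c)/r and 1 - (t - c)/r are at most 3, the base of the
  constant.\<close>

lemma dbd_bump:
 assumes "N < M" "0 < r"
 shows "dbd N (2 ^ N * 3 ^ M * 3 ^ M) (real M / r) {c - 2 * r<..<c + 2 * r} (\<lambda>t. bump M ((t - c) / r))"
proof -
 let ?U = "{c - 2 * r<..<c + 2 * r}" and ?L = "real M / r"
 have bd: "s * t + e <= 3" if t: "t \<in> ?U" and s: "s = 1 / r \<and> e = 1 - c / r \<or> s = - 1 / r \<and> e = 1 + c / r" for s e t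
 proof -
  have "(t - c) / r <= 2" "- ((t - c) / r) <= 2" using t assms(2) by (auto simp: field_simps)
  moreover have "s * t + e = 1 + (t - c) / r \<or> s * t + e = 1 - (t - c) / r"
   using s by (auto simp: diff_divide_distrib)
  ultimately show ?thesis by auto
 qed
 have 1: "dbd N (3 ^ M) ?L ?U (\<lambda>t. (max 0 (- 1 / r * t + (1 + c / r))) ^ M)"
  by (rule dbd_max_power[of _ _ _ _ M]) (rule bd, use assms in auto)
 have 2: "dbd N (3 ^ M) ?L ?U (\<lambda>t. (max 0 (1 / r * t + (1 - c / r))) ^ M)"
  by (rule dbd_max_power[of _ _ _ _ M]) (rule bd, use assms in auto)
 have "dbd N (2 ^ N * 3 ^ M * 3 ^ M) ?L ?U (\<lambda>t. (max 0 (- 1 / r * t + (1 + c / r))) ^ M * (max 0 (1 / r * t + (1 - c / r))) ^ M)"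
  by (rule dbd_mult[OF 1 2]) (use assms in auto)
 moreover have "(\<lambda>t. (max 0 (- 1 / r * t + (1 + c / r))) ^ M * (max 0 (1 / r * t + (1 - c / r))) ^ M)
   = (\<lambda>t. bump M ((t - c) / r))"
 proof
  fix t
  have "- 1 / r * t + (1 + c / r) = 1 - (t - c) / r" "1 / r * t + (1 - c / r) = 1 + (t - c) / r"
   by (simp_all add: diff_divide_distrib)
  then show "(max 0 (- 1 / r * t + (1 + c / r))) ^ M * (max 0 (1 / r * t + (1 - c / r))) ^ M = bump M ((t - c) / r)"
   unfolding bump_def by (simp only:)
 qed
 ultimately show ?thesis by (simp only:)
qed

section \<open>A sublevel estimate in one variable\<close>

text \<open>Rolle: between \<open>M\<close> ordered zeros of G there are M - 1 zeros of its
  derivative, which is therefore small by induction. As G itself has a zero, integrating the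
  derivative gains the factor L (b - a) once more.\<close>

lemma dbd_zeros_bound:
 fixes G :: "real => real" and z :: "nat => real"
 assumes "{a..b} \<subseteq> U" "0 <= L" "a <= b"
 shows "dbd M B L U G ==> 0 <= B ==> (\<And>i. i < M ==> z i \<in> {a..b} \<and> G (z i) = 0)
  ==> (\<And>i. Suc i < M ==> z i < z (Suc i)) ==> t \<in> {a..b} ==> \<bar>G t\<bar> <= B * (L * (b - a)) ^ M"
proof (induction M arbitrary: B G z t)
 case 0
 then show ?case using assms by (auto simp: subset_eq)
next
 case (Suc M)
 obtain G' where G': "\<forall>t\<in>U. (G has_vector_derivative G' t) (at t)" "dbd M (B * L) L U G'"
  using Suc.prems(1) by auto
 have der: "(G has_real_derivative G' t) (at t)" if "t \<in> {a..b}" for t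
  unfolding has_real_derivative_iff_has_vector_derivative using G'(1) assms(1) that by auto
 have "\<exists>w. z i < w \<and> w < z (Suc i) \<and> G' w = 0" if i: "i < M" for i
 proof -
  have z: "z i < z (Suc i)" "z i \<in> {a..b}" "z (Suc i) \<in> {a..b}" "G (z i) = 0" "G (z (Suc i)) = 0"
   using Suc.prems(3)[of i] Suc.prems(3)[of "Suc i"] Suc.prems(4)[of i] i by auto
  have "\<exists>w. z i < w \<and> w < z (Suc i) \<and> G (z (Suc i)) - G (z i) = (z (Suc i) - z i) * G' w"
   using z by (intro MVT2 der) auto
  then show ?thesis using z by auto
 qed
 then obtain w where w: "\<And>i. i < M ==> z i < w i \<and> w i < z (Suc i) \<and> G' (w i) = 0" by metis
 have bd: "\<bar>G' s\<bar> <= B * L * (L * (b - a)) ^ M" if s: "s \<in> {a..b}" for s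
 proof (rule Suc.IH[OF G'(2)])
  show "0 <= B * L" using assms Suc.prems by simp
  show "w i \<in> {a..b} \<and> G' (w i) = 0" if "i < M" for i
   using w[OF that] Suc.prems(3)[of i] Suc.prems(3)[of "Suc i"] that by auto
  show "w i < w (Suc i)" if "Suc i < M" for i
   using w[of i] w[of "Suc i"] that by auto
 qed (rule s)
 have z0: "z 0 \<in> {a..b}" "G (z 0) = 0" using Suc.prems(3)[of 0] by auto
 have "norm (G t - G (z 0)) <= (B * L * (L * (b - a)) ^ M) * norm (t - z 0)"
 proof (rule field_differentiable_bound[of "{a..b}" G G'])
  show "(G has_field_derivative G' x) (at x within {a..b})" if "x \<in> {a..b}" for x
   using der[OF that] has_field_derivative_at_within by blast
  show "norm (G' x) <= B * L * (L * (b - a)) ^ M" if "x \<in> {a..b}" for x using bd[OF that] by simp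
 qed (use Suc.prems z0 in auto)
 also have "\<dots> <= (B * L * (L * (b - a)) ^ M) * (b - a)"
 proof (rule mult_left_mono)
  show "norm (t - z 0) <= b - a" using Suc.prems(5) z0 by (auto simp: abs_if)
  show "0 <= B * L * (L * (b - a)) ^ M" using Suc.prems(2) assms by simp
 qed
 finally show ?case using z0 by (simp add: mult_ac)
qed

text \<open>A maximal \<open>s\<close>-separated subset of \<open>E\<close> has at most
  \<open>M\<close> points by \<open>no\<close>, and maximality says that its
  \<open>s\<close>-neighbourhoods cover \<open>E\<close>.\<close>

lemma separated_cover:
 fixes E :: "real set"
 assumes s: "s > 0" and no: "\<And>t. (\<forall>i\<le>M. t i \<in> E) ==> (\<forall>i<M. t i + s <= t (Suc i)) ==> False"
 shows "\<exists>F. finite F \<and> card F <= M \<and> E \<subseteq> (\<Union>x\<in>F. {x - s..x + s})"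
proof -
 define P where "P F \<longleftrightarrow> finite F \<and> F \<subseteq> E \<and> (\<forall>x\<in>F. \<forall>y\<in>F. x ~= y --> s <= \<bar>x - y\<bar>)" for F
 have card: "card F <= M" if "P F" for F
 proof (rule ccontr)
  assume "\<not> card F <= M"
  then have c: "Suc M <= card F" by simp
  let ?l = "sorted_list_of_set F"
  have fin: "finite F" using that P_def by auto
  have len: "length ?l = card F" by simp
  show False
  proof (rule no[of "\<lambda>i. ?l ! i"])
   show "\<forall>i\<le>M. ?l ! i \<in> E"
   proof (intro allI impI)
    fix i assume "i <= M"
    then have "?l ! i \<in> set ?l" using c len by (intro nth_mem) simp
    then show "?l ! i \<in> E" using fin that P_def by auto
   qed
   show "\<forall>i<M. ?l ! i + s <= ?l ! (Suc i)"
   proof (intro allI impI)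
    fix i assume i: "i < M"
    have lt: "?l ! i < ?l ! (Suc i)"
     using strict_sorted_list_of_set[of F] i c len by (simp add: sorted_wrt_nth_less)
    have "?l ! i \<in> set ?l" "?l ! (Suc i) \<in> set ?l" using i c len by (auto intro!: nth_mem)
    then have "?l ! i \<in> F" "?l ! (Suc i) \<in> F" using fin by auto
    then have "s <= \<bar>?l ! i - ?l ! (Suc i)\<bar>" using that lt unfolding P_def by fastforce
    then show "?l ! i + s <= ?l ! (Suc i)" using lt by auto
   qed
  qed
 qed
 have "\<exists>F. P F \<and> (\<forall>F'. P F' --> card F' <= card F)"
 proof -
  have "P {}" by (simp add: P_def)
  then show ?thesis using ex_has_greatest_nat[of P "{}" card "Suc M"] card by (metis le_imp_less_Suc)
 qed
 then obtain F where F: "P F" "\<And>F'. P F' ==> card F' <= card F" by blast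
 have "x \<in> (\<Union>x\<in>F. {x - s..x + s})" if x: "x \<in> E" for x
 proof (rule ccontr)
  assume "x \<notin> (\<Union>x\<in>F. {x - s..x + s})"
  then have far: "s <= \<bar>x - y\<bar>" if "y \<in> F" for y using that by force
  have xF: "x \<notin> F" using far s by force
  have "P (insert x F)" using F(1) x far unfolding P_def
   by (auto simp: abs_minus_commute)
  from F(2)[OF this] show False using xF F(1) by (auto simp: P_def)
 qed
 then show ?thesis using F card[OF F(1)] P_def by blast
qed

text \<open>Suppose \<open>M + 1\<close> points of \<open>E\<close> were 4H/D apart. As |f| <= H at
  all of them, the slope falls to D/2 inside every gap, although it is at least D at the points.
  Hence p^2 has an interior minimum in every gap and its derivative has \<open>M\<close> zeros. By
  \<open>dbd_zeros_bound\<close> that derivative is then too small for p^2 to fall from D^2 to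
  D^2/4, a drop of 3/4 D^2 as in \<open>small\<close>. Squaring removes the sign of p.\<close>

lemma sublevel_estimate:
 fixes f p p' :: "real => real"
 assumes U: "{a..b} \<subseteq> U" "a <= b" "\<And>u v. u \<in> U ==> v \<in> U ==> L * \<bar>u - v\<bar> <= 1" "convex U"
  and L: "0 < L" and C: "0 <= C"
  and f: "\<And>t. t \<in> U ==> (f has_vector_derivative p t) (at t)"
  and p: "\<And>t. t \<in> U ==> (p has_vector_derivative p' t) (at t)"
  and p': "dbd M (C * L) L U p'"
  and D: "0 < D" "D <= 1" "0 < H"
  and M: "0 < M" and small: "2 ^ Suc M * (1 + C) * (1 + C) * (L * (b - a)) ^ Suc M < 3/4 * D^2"
  and E: "E = {t\<in>{a..b}. \<bar>f t\<bar> <= H \<and> D <= \<bar>p t\<bar>}"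
 shows "\<exists>F. finite F \<and> card F <= M \<and> E \<subseteq> (\<Union>x\<in>F. {x - 4 * H / D..x + 4 * H / D})"
proof (rule separated_cover)
 show "0 < 4 * H / D" using D by simp
 fix t assume tE: "\<forall>i\<le>M. t i \<in> E" and sep: "\<forall>i<M. t i + 4 * H / D <= t (Suc i)"
 have fr: "(f has_real_derivative p s) (at s)" if "s \<in> {a..b}" for s
  unfolding has_real_derivative_iff_has_vector_derivative using f that U by auto
 have pr: "(p has_real_derivative p' s) (at s)" if "s \<in> U" for s
  unfolding has_real_derivative_iff_has_vector_derivative using p that by auto
 have lt: "t i < t (Suc i)" if "i < M" for i
 proof -
  have "0 < 4 * H / D" using D by simp
  then show ?thesis using sep that by fastforce
 qed
 have tab: "t i \<in> {a..b}" "\<bar>f (t i)\<bar> <= H" "D <= \<bar>p (t i)\<bar>" if "i <= M" for i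
  using tE that E by auto
 have ex_s: "\<exists>s. t i < s \<and> s < t (Suc i) \<and> \<bar>p s\<bar> <= D / 2" if i: "i < M" for i
 proof -
  have "\<exists>s. t i < s \<and> s < t (Suc i) \<and> f (t (Suc i)) - f (t i) = (t (Suc i) - t i) * p s"
   using lt[OF i] tab(1)[of i] tab(1)[of "Suc i"] i by (intro MVT2 fr) auto
  then obtain s where s: "t i < s" "s < t (Suc i)" "f (t (Suc i)) - f (t i) = (t (Suc i) - t i) * p s" by auto
  have "\<bar>f (t (Suc i)) - f (t i)\<bar> <= 2 * H" using tab(2)[of i] tab(2)[of "Suc i"] i by auto
  then have 1: "(t (Suc i) - t i) * \<bar>p s\<bar> <= 2 * H" using s lt[OF i] by (simp add: abs_mult)
  have "4 * H / D * \<bar>p s\<bar> <= (t (Suc i) - t i) * \<bar>p s\<bar>"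
   using sep i by (intro mult_right_mono) (auto simp: algebra_simps)
  with 1 have "4 * H / D * \<bar>p s\<bar> <= 2 * H" by simp
  then have "\<bar>p s\<bar> <= D / 2" using D by (simp add: field_simps)
  then show ?thesis using s by auto
 qed
 then obtain s where s: "\<And>i. i < M ==> t i < s i \<and> s i < t (Suc i) \<and> \<bar>p (s i)\<bar> <= D / 2" by metis
 have s0: "s 0 \<in> {a..b}" "\<bar>p (s 0)\<bar> <= D / 2"
  using s[OF M] tab(1)[of 0] tab(1)[of 1] M by auto
 \<comment> \<open>At \<open>s 0\<close> the slope is at most D/2 <= 1, and over \<open>U\<close>,
   of diameter at most 1/\<open>L\<close>, it changes by at most \<open>C\<close>.\<close>
 have pb: "norm (p u) <= 1 + C" if u: "u \<in> U" for u
 proof -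
  have s0U: "s 0 \<in> U" using s0 U by auto
  have "norm (p u - p (s 0)) <= (C * L) * norm (u - s 0)"
  proof (rule field_differentiable_bound[of U p p'])
   show "(p has_field_derivative p' x) (at x within U)" if "x \<in> U" for x
    using pr[OF that] has_field_derivative_at_within by blast
   show "norm (p' x) <= C * L" if "x \<in> U" for x using dbd_bound[OF p' that] .
  qed (use U u s0U in auto)
  also have "\<dots> = C * (L * \<bar>u - s 0\<bar>)" by simp
  also have "\<dots> <= C * 1" using U(3)[OF u s0U] C by (intro mult_left_mono) auto
  finally show ?thesis using s0(2) D by auto
 qed
 have dp: "dbd (Suc M) (1 + C) L U p"
  unfolding dbd.simps
 proof (intro conjI ballI exI[of _ p'])
  show "dbd M ((1 + C) * L) L U p'" by (rule dbd_mono[OF p']) (use L in auto)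
 qed (use pb p in auto)
 define B where "B = 2 ^ Suc M * (1 + C) * (1 + C)"
 have B0: "B >= 0" using C by (simp add: B_def)
 have "dbd (Suc M) B L U (\<lambda>t. p t * p t)"
  unfolding B_def by (rule dbd_mult[OF dp dp]) (use C L in auto)
 then obtain q' where q': "\<And>t. t \<in> U ==> ((\<lambda>t. p t * p t) has_vector_derivative q' t) (at t)"
  and dq': "dbd M (B * L) L U q'" unfolding dbd.simps by blast
 have qr: "((\<lambda>t. p t * p t) has_real_derivative q' t) (at t)" if "t \<in> {a..b}" for t
  unfolding has_real_derivative_iff_has_vector_derivative using q'[of t] that U(1) by auto
 have qs: "p (s i) * p (s i) <= D^2 / 4" if "i < M" for i
 proof -
  have "\<bar>p (s i)\<bar> * \<bar>p (s i)\<bar> <= D / 2 * (D / 2)" using s[OF that] D by (intro mult_mono) auto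
  then show ?thesis by (simp add: abs_mult[symmetric] power2_eq_square)
 qed
 have qt: "D^2 <= p (t i) * p (t i)" if "i <= M" for i
 proof -
  have "D * D <= \<bar>p (t i)\<bar> * \<bar>p (t i)\<bar>" using tab(3)[OF that] D by (intro mult_mono) auto
  then show ?thesis by (simp add: abs_mult[symmetric] power2_eq_square)
 qed
 have D2: "D^2 > 0" using D by simp
 have "\<exists>w. t i < w \<and> w < t (Suc i) \<and> q' w = 0" if i: "i < M" for i
 proof -
  have sub: "{t i..t (Suc i)} \<subseteq> {a..b}" using tab(1)[of i] tab(1)[of "Suc i"] i by auto
  have "continuous_on {t i..t (Suc i)} (\<lambda>t. p t * p t)"
   using sub by (intro continuous_at_imp_continuous_on ballI DERIV_isCont[OF qr]) auto
  then obtain w where w: "w \<in> {t i..t (Suc i)}" "\<And>y. y \<in> {t i..t (Suc i)} ==> p w * p w <= p y * p y"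
   using continuous_attains_inf[of "{t i..t (Suc i)}" "\<lambda>t. p t * p t"] lt[OF i] by auto
  have "p w * p w <= p (s i) * p (s i)" using s[OF i] by (intro w(2)) auto
  then have "p w * p w < D^2" using qs[OF i] D2 by linarith
  then have "w ~= t i" "w ~= t (Suc i)" using qt[of i] qt[of "Suc i"] i by auto
  then have w': "t i < w" "w < t (Suc i)" using w(1) by auto
  have "q' w = 0"
  proof (rule DERIV_local_min)
   show "((\<lambda>t. p t * p t) has_real_derivative q' w) (at w)" using qr w sub by auto
   show "0 < min (w - t i) (t (Suc i) - w)" using w' by auto
   show "\<forall>y. \<bar>w - y\<bar> < min (w - t i) (t (Suc i) - w) --> p w * p w <= p y * p y"
    by (intro allI impI w(2)) auto
  qed
  then show ?thesis using w' by auto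
 qed
 then obtain w where w: "\<And>i. i < M ==> t i < w i \<and> w i < t (Suc i) \<and> q' (w i) = 0" by metis
 have bd: "\<bar>q' x\<bar> <= B * L * (L * (b - a)) ^ M" if x: "x \<in> {a..b}" for x
 proof (rule dbd_zeros_bound[OF U(1) _ U(2) dq'])
  show "w i \<in> {a..b} \<and> q' (w i) = 0" if "i < M" for i
   using w[OF that] tab(1)[of i] tab(1)[of "Suc i"] that by auto
  show "w i < w (Suc i)" if "Suc i < M" for i
   using w[of i] w[of "Suc i"] that by auto
 qed (use L B0 x in auto)
 have t0: "t 0 \<in> {a..b}" using tab by auto
 have "norm (p (t 0) * p (t 0) - p (s 0) * p (s 0)) <= (B * L * (L * (b - a)) ^ M) * norm (t 0 - s 0)"
 proof (rule field_differentiable_bound[of "{a..b}" "\<lambda>t. p t * p t" q'])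
  show "((\<lambda>t. p t * p t) has_field_derivative q' x) (at x within {a..b})" if "x \<in> {a..b}" for x
   using qr[OF that] has_field_derivative_at_within by blast
  show "norm (q' x) <= B * L * (L * (b - a)) ^ M" if "x \<in> {a..b}" for x using bd[OF that] by simp
 qed (use t0 s0 in auto)
 also have "\<dots> <= (B * L * (L * (b - a)) ^ M) * (b - a)"
 proof (rule mult_left_mono)
  show "norm (t 0 - s 0) <= b - a" using s0 t0 by (auto simp: abs_if)
  show "0 <= B * L * (L * (b - a)) ^ M" using B0 L U(2) by simp
 qed
 also have "\<dots> = B * (L * (b - a)) ^ Suc M" by (simp add: mult_ac)
 also have "\<dots> < 3/4 * D^2" using small by (simp only: B_def)
 finally have "norm (p (t 0) * p (t 0) - p (s 0) * p (s 0)) < 3/4 * D^2" .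
 moreover have "p (t 0) * p (t 0) - p (s 0) * p (s 0) <= norm (p (t 0) * p (t 0) - p (s 0) * p (s 0))" by simp
 ultimately show False using qs[OF M] qt[of 0] by linarith
qed

section \<open>Families of iterated partial derivatives\<close>

text \<open>An abstract family of iterated partials. It is detached from \<open>iter_partial\<close>
  so that differences of two phases, and families set to zero for exceptional \<open>x\<close>, are
  treated alike.\<close>

definition jet :: "(real^'n) set => ('n list => real^'n => 'a::real_normed_field) => bool" where
 "jet S h \<longleftrightarrow> (\<forall>al. \<forall>xi\<in>S. (h al has_derivative (\<lambda>v. \<Sum>i\<in>UNIV. (v $ i) .* h (i # al) xi)) (at xi))"

definition amp_bound :: "nat => real => real => (real^'n) set => ('n list => real^'n => 'a::real_normed_field) => bool" where
 "amp_bound N l A R h \<longleftrightarrow> (\<forall>al xi. length al <= N --> xi \<in> R --> norm (h al xi) <= A * l ^ length al)"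

lemma jet_smooth_on:
 fixes f :: "real^'n => 'a::real_normed_field"
 assumes "smooth_on S f"
 shows "jet S (\<lambda>al. iter_partial al f)"
 unfolding jet_def
proof (intro allI ballI)
 fix al :: "'n list" and xi assume "xi \<in> S"
 then have d: "(iter_partial al f has_derivative frechet_derivative (iter_partial al f) (at xi)) (at xi)"
  using assms unfolding smooth_on_def by (simp add: frechet_derivative_works)
 let ?D = "frechet_derivative (iter_partial al f) (at xi)"
 have lin: "linear ?D" using d has_derivative_linear by blast
 have "?D v = (\<Sum>i\<in>UNIV. (v $ i) .* iter_partial (i # al) f xi)" for v
 proof -
  have "?D v = ?D (\<Sum>i\<in>UNIV. (v $ i) .* axis i 1)"
   using basis_expansion[of v] by (simp add: scalar_mult_eq_scaleR)
  also have "\<dots> = (\<Sum>i\<in>UNIV. (v $ i) .* ?D (axis i 1))"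
   using lin by (simp add: linear_sum linear_scale)
  finally show ?thesis by simp
 qed
 then have "?D = (\<lambda>v. \<Sum>i\<in>UNIV. (v $ i) .* iter_partial (i # al) f xi)" by (rule ext)
 with d show "(iter_partial al f has_derivative (\<lambda>v. \<Sum>i\<in>UNIV. (v $ i) .* iter_partial (i # al) f xi)) (at xi)"
  by (simp only:)
qed

lemma jet_diff:
 assumes "jet S h" "jet S g"
 shows "jet S (\<lambda>al xi. h al xi - g al xi)"
 unfolding jet_def
proof (intro allI ballI)
 fix al xi assume "xi \<in> S"
 then have "((\<lambda>xi. h al xi - g al xi) has_derivative (\<lambda>v. (\<Sum>i\<in>UNIV. (v $ i) .* h (i # al) xi) - (\<Sum>i\<in>UNIV. (v $ i) .* g (i # al) xi))) (at xi)"
  using assms unfolding jet_def by (intro has_derivative_diff) auto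
 then show "((\<lambda>xi. h al xi - g al xi) has_derivative (\<lambda>v. \<Sum>i\<in>UNIV. (v $ i) .* (h (i # al) xi - g (i # al) xi))) (at xi)"
  by (simp only: scaleR_diff_right sum_subtractf)
qed

lemma jet_vector_derivative:
 assumes "jet S h" "eta + t .* v \<in> S"
 shows "((\<lambda>t. h al (eta + t .* v)) has_vector_derivative (\<Sum>i\<in>UNIV. (v $ i) .* h (i # al) (eta + t .* v))) (at t)"
proof -
 have 1: "((\<lambda>t. eta + t .* v) has_derivative (\<lambda>s. s .* v)) (at t)"
  by (auto intro!: derivative_eq_intros)
 have "(h al has_derivative (\<lambda>w. \<Sum>i\<in>UNIV. (w $ i) .* h (i # al) (eta + t .* v))) (at (eta + t .* v))"
  using assms unfolding jet_def by blast
 from has_derivative_compose[OF 1 this] show ?thesis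
  unfolding has_vector_derivative_def by (simp add: scaleR_sum_right)
qed

lemma jet_continuous_on:
 assumes "jet S h" shows "continuous_on S (h al)"
 using assms unfolding jet_def
 by (meson continuous_at_imp_continuous_on has_derivative_continuous)

text \<open>A derivative along the line is a combination of partials with weights
  \<open>v $ i\<close>, which costs a factor (sum of |v_i|) l <= L. Differentiating puts new indices
  in front of \<open>al\<close>, hence the hypothesis on \<open>\<beta> @ al\<close>.\<close>

lemma dbd_jet:
 fixes h :: "'n::finite list => real^'n => 'a::real_normed_field"
 assumes "jet S h" "\<And>t. t \<in> U ==> eta + t .* v \<in> S" "0 <= l" "(\<Sum>i\<in>UNIV. \<bar>v $ i\<bar>) * l <= L"
 shows "(\<And>\<beta> t. length \<beta> <= N ==> t \<in> U ==> norm (h (\<beta> @ al) (eta + t .* v)) <= C * l ^ length \<beta>)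
  ==> 0 <= C ==> dbd N C L U (\<lambda>t. h al (eta + t .* v))"
proof (induction N arbitrary: al C)
 case 0
 show ?case using "0.prems"(1)[of "[]"] by simp
next
 case (Suc N)
 have L: "0 <= L" using assms(3,4) by (smt (verit) mult_nonneg_nonneg sum_nonneg abs_ge_zero)
 have 1: "dbd N (C * l) L U (\<lambda>t. h (i # al) (eta + t .* v))" for i
 proof (rule Suc.IH)
  fix \<beta> :: "'n list" and t assume "length \<beta> <= N" "t \<in> U"
  then show "norm (h (\<beta> @ i # al) (eta + t .* v)) <= C * l * l ^ length \<beta>"
   using Suc.prems(1)[of "\<beta> @ [i]" t] by simp
 qed (use assms Suc.prems in auto)
 have "dbd N (\<Sum>i\<in>UNIV. \<bar>v $ i\<bar> * (C * l)) L U (\<lambda>t. \<Sum>i\<in>UNIV. (v $ i) .* h (i # al) (eta + t .* v))"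
  by (rule dbd_sum) (use dbd_scaleR[OF 1] L in auto)
 moreover have "(\<Sum>i\<in>UNIV. \<bar>v $ i\<bar> * (C * l)) <= C * L"
 proof -
  have "(\<Sum>i\<in>UNIV. \<bar>v $ i\<bar> * (C * l)) = C * ((\<Sum>i\<in>UNIV. \<bar>v $ i\<bar>) * l)"
   by (simp add: sum_distrib_right[symmetric])
  also have "\<dots> <= C * L" using assms(4) Suc.prems(2) by (rule mult_left_mono)
  finally show ?thesis .
 qed
 ultimately have d: "dbd N (C * L) L U (\<lambda>t. \<Sum>i\<in>UNIV. (v $ i) .* h (i # al) (eta + t .* v))"
  using dbd_mono L by blast
 show ?case unfolding dbd.simps
 proof (intro conjI ballI exI[of _ "\<lambda>t. \<Sum>i\<in>UNIV. (v $ i) .* h (i # al) (eta + t .* v)"] d)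
  show "norm (h al (eta + t .* v)) <= C" if "t \<in> U" for t using Suc.prems(1)[of "[]" t] that by simp
  show "((\<lambda>t. h al (eta + t .* v)) has_vector_derivative (\<Sum>i\<in>UNIV. (v $ i) .* h (i # al) (eta + t .* v))) (at t)"
   if "t \<in> U" for t using jet_vector_derivative[OF assms(1) assms(2)[OF that]] .
 qed
qed

text \<open>The constants used below leave room for successive enlargements: centres of cubes lie in
  \<open>annulus 5\<close>, points of the cubes in \<open>annulus 10\<close>, sublevel sets in
  \<open>annulus 20\<close>, and the bounds on amplitude and phase are available on
  \<open>annulus 100\<close>.\<close>

definition annulus :: "real => real => (real^'n) set" where
 "annulus c lam = {xi. lam / c <= norm xi \<and> norm xi <= c * lam}"

lemma annulus_mono: "c <= c' ==> 0 < c ==> 0 < lam ==> annulus c lam \<subseteq> annulus c' lam"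
 unfolding annulus_def by (auto, smt (verit) divide_left_mono mult_pos_pos, smt (verit) mult_right_mono)

lemma annulus_nonzero: "0 < c ==> 0 < lam ==> xi \<in> annulus c lam ==> xi ~= 0"
 unfolding annulus_def by (auto simp: divide_le_0_iff)

lemma compact_annulus: "compact (annulus c lam :: (real^'n) set)"
proof -
 have "annulus c lam = cball 0 (c * lam) \<inter> {xi::real^'n. lam / c <= norm xi}"
  by (auto simp: annulus_def)
 moreover have "closed {xi::real^'n. lam / c <= norm xi}" by (intro closed_Collect_le continuous_intros)
 ultimately show ?thesis by (simp add: compact_Int_closed)
qed

lemma sum_abs_le_norm: "(\<Sum>i\<in>UNIV. \<bar>(v::real^'n) $ i\<bar>) <= real CARD('n) * norm v"
proof -
 have "(\<Sum>i\<in>UNIV. \<bar>v $ i\<bar>) <= (\<Sum>i\<in>(UNIV::'n set). norm v)" by (intro sum_mono component_le_norm_cart)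
 then show ?thesis by simp
qed

section \<open>Gain from integrating in the radial direction\<close>

definition radial_bump :: "nat => real => real" where
 "radial_bump M s = bump M ((s - 3/2) / (1/2))"

lemma radial_bump_eq_0: "M > 0 ==> s \<notin> {1<..<2} ==> radial_bump M s = 0"
 unfolding radial_bump_def by (intro bump_eq_0) (auto simp: abs_if not_less field_simps)

text \<open>The phase \<open>s * P\<close> is linear in \<open>s\<close>, so nonstationary phase
  applies with second derivative zero and slope |P|. The amplitude varies on the scale 1/(lam l),
  since moving \<open>s\<close> by one moves the argument by |eta| ~ lam.\<close>

lemma radial_decay:
 fixes M N :: nat
 assumes "N < M"
 shows "\<exists>K\<ge>0. \<forall>(a1 :: 'n::finite list => real^'n => complex) a2 A l lam eta P.
   jet UNIV a1 --> jet UNIV a2 --> amp_bound N l A (annulus 100 lam) a1 --> amp_bound N l A (annulus 100 lam) a2 -->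
   0 < lam --> 0 < l --> 1 <= lam * l --> 0 <= A --> eta \<in> annulus 10 lam --> P ~= 0 -->
   norm (integral {1..2} (\<lambda>s. exp (\<i> * of_real (s * P)) * (of_real (radial_bump M s) * (a1 [] (s .* eta) * cnj (a2 [] (s .* eta))))))
    <= K * A^2 * (lam * l / \<bar>P\<bar>) ^ N"
proof -
 obtain K0 where K0: "K0 >= 0" and ph: "\<And>f p p' g G D L a b U. phase_data N 0 f p p' g G D L a b U ==>
   norm (integral {a..b} (\<lambda>t. exp (\<i> * of_real (f t)) * g t)) <= K0 * G * (b - a) * (L / D) ^ N"
  using nonstationary_phase[of 0 N, OF order_refl] by blast
 \<comment> \<open>The first entry bounds the sum of |eta_i| by 10 n lam; the second is the inverse
   scale of the radial bump, whose half-width is 1/2.\<close>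
 define c0 where "c0 = max (10 * real CARD('n)) (2 * real M)"
 define B where "B = (2::real) ^ N * 3 ^ M * 3 ^ M"
 define K1 where "K1 = 2 ^ N * B * (2 ^ N)"
 have c0: "c0 >= 1" using assms by (auto simp: c0_def)
 have B: "B >= 1" unfolding B_def by (auto intro!: mult_ge1_I simp: one_le_power)
 have K1: "K1 >= 1" unfolding K1_def using B by (auto intro!: mult_ge1_I simp: one_le_power)
 have main: "norm (integral {1..2} (\<lambda>s. exp (\<i> * of_real (s * P)) * (of_real (radial_bump M s) * (a1 [] (s .* eta) * cnj (a2 [] (s .* eta))))))
    <= (K0 + 1) * K1 * c0 ^ N * A^2 * (lam * l / \<bar>P\<bar>) ^ N"
  if a: "jet UNIV a1" "jet UNIV a2" "amp_bound N l A (annulus 100 lam) a1" "amp_bound N l A (annulus 100 lam) a2"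
   and p: "0 < lam" "0 < l" "1 <= lam * l" "0 <= A" and eta: "eta \<in> annulus 10 lam" and P: "P ~= 0"
  for a1 a2 :: "'n list => real^'n => complex" and A l lam eta P
 proof -
  let ?U = "{1/2<..<5/2} :: real set"
  define L where "L = c0 * (lam * l)"
  have L1: "L >= 2 * real M"
  proof -
   have "2 * real M * 1 <= c0 * (lam * l)" using p by (intro mult_mono) (auto simp: c0_def)
   then show ?thesis by (simp add: L_def)
  qed
  have Lpos: "L > 0" using L1 assms by simp
  have in_ann: "s .* eta \<in> annulus 100 lam" if "s \<in> ?U" for s
  proof -
   have "1/2 * (lam / 10) <= s * norm eta" using eta p that by (intro mult_mono) (auto simp: annulus_def)
   moreover have "s * norm eta <= 5/2 * (10 * lam)" using eta p that by (intro mult_mono) (auto simp: annulus_def)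
   ultimately show ?thesis using p that by (auto simp: annulus_def)
  qed
  have suml: "(\<Sum>i\<in>UNIV. \<bar>eta $ i\<bar>) * l <= L"
  proof -
   have "norm eta <= 10 * lam" using eta by (simp add: annulus_def)
   then have "real CARD('n) * norm eta <= real CARD('n) * (10 * lam)"
    by (intro mult_left_mono) auto
   with sum_abs_le_norm[of eta] have "(\<Sum>i\<in>UNIV. \<bar>eta $ i\<bar>) <= 10 * real CARD('n) * lam" by linarith
   also have "\<dots> <= c0 * lam" using p(1) by (intro mult_right_mono) (simp_all add: c0_def)
   finally have "(\<Sum>i\<in>UNIV. \<bar>eta $ i\<bar>) * l <= c0 * lam * l" using p(2) by (intro mult_right_mono) auto
   then show ?thesis by (simp add: L_def mult.assoc)
  qed
  have da: "dbd N A L ?U (\<lambda>s. h [] (0 + s .* eta))" if "jet UNIV h" "amp_bound N l A (annulus 100 lam) h"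
   for h :: "'n list => real^'n => complex"
  proof (rule dbd_jet[OF that(1) _ _ suml])
   show "cmod (h (\<beta> @ []) (0 + t .* eta)) <= A * l ^ length \<beta>" if "length \<beta> <= N" "t \<in> ?U" for \<beta> t
    using \<open>amp_bound N l A (annulus 100 lam) h\<close> in_ann[OF that(2)] that(1) by (simp add: amp_bound_def)
  qed (use p in auto)
  have d1: "dbd N A L ?U (\<lambda>s. a1 [] (s .* eta))" using da[OF a(1,3)] by simp
  have d2: "dbd N A L ?U (\<lambda>s. cnj (a2 [] (s .* eta)))" using dbd_cnj[OF da[OF a(2,4)]] by simp
  have dk: "dbd N B L ?U (\<lambda>s. complex_of_real (radial_bump M s))"
  proof -
   have "dbd N B (real M / (1/2)) {3/2 - 2 * (1/2)<..<3/2 + 2 * (1/2)} (\<lambda>t. bump M ((t - 3/2) / (1/2)))"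
    unfolding B_def by (rule dbd_bump) (use assms in auto)
   then have "dbd N B (2 * real M) ?U (radial_bump M)" unfolding radial_bump_def by (simp add: mult.commute)
   then have "dbd N B L ?U (radial_bump M)" by (rule dbd_mono_scale) (use B L1 in auto)
   then show ?thesis by (rule dbd_of_real)
  qed
  let ?g = "\<lambda>s. complex_of_real (radial_bump M s) * (a1 [] (s .* eta) * cnj (a2 [] (s .* eta)))"
  have dg: "dbd N (2 ^ N * B * (2 ^ N * A * A)) L ?U ?g"
   by (rule dbd_mult[OF dk dbd_mult[OF d1 d2]]) (use p B Lpos in auto)
  then have dg: "dbd N (K1 * A^2) L ?U ?g" by (simp add: K1_def power2_eq_square mult_ac)
  have g0: "\<forall>t\<in>?U. t \<notin> {1<..<2} --> ?g t = 0" using radial_bump_eq_0 assms by auto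
  have KA: "0 <= K1 * A^2" using K1 by simp
  have cp: "c0 ^ N * (lam * l / \<bar>P\<bar>) ^ N = (L / \<bar>P\<bar>) ^ N"
   by (simp add: L_def power_mult_distrib[symmetric])
  show ?thesis
  proof (cases "L <= \<bar>P\<bar>")
   case True
   have "norm (integral {1..2} (\<lambda>s. exp (\<i> * of_real (s * P)) * ?g s)) <= K0 * (K1 * A^2) * (2 - 1) * (L / \<bar>P\<bar>) ^ N"
   proof (rule ph)
    show "phase_data N 0 (\<lambda>s. s * P) (\<lambda>s. P) (\<lambda>s. 0) ?g (K1 * A^2) \<bar>P\<bar> L 1 2 ?U"
     unfolding phase_data_def
    proof (intro conjI ballI impI)
     show "((\<lambda>s. s * P) has_vector_derivative P) (at t)" for t
      unfolding has_real_derivative_iff_has_vector_derivative[symmetric]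
      by (auto intro!: derivative_eq_intros)
     show "dbd N (0 * L^2) L ?U (\<lambda>s. 0::real)" using Lpos by (intro dbd_const) auto
     show "dbd N (K1 * A^2) L ?U ?g" by (rule dg)
     show "?g t = 0" if "t \<in> ?U" "t \<notin> {1<..<2}" for t using g0 that by blast
     show "((\<lambda>s. P) has_vector_derivative 0) (at t)" for t by simp
    qed (use True Lpos KA in auto)
   qed
   also have "\<dots> <= (K0 + 1) * (K1 * A^2) * 1 * (L / \<bar>P\<bar>) ^ N"
    using KA Lpos K0 K1 by (intro mult_mono) auto
   also have "\<dots> = (K0 + 1) * K1 * c0 ^ N * A^2 * (lam * l / \<bar>P\<bar>) ^ N"
    unfolding cp[symmetric] by (simp only: mult_ac mult_1)
   finally show ?thesis .
  next
   \<comment> \<open>For |P| < L there may be no oscillation, but then (L/|P|)^N >= 1 and the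
     trivial bound is good enough.\<close>
   case False
   let ?F = "\<lambda>s. exp (\<i> * of_real (s * P)) * ?g s"
   have "norm (integral {1..2} ?F) <= K1 * A^2 * (2 - 1)"
   proof (cases "?F integrable_on {1..2}")
    case True
    have "norm (?F t) <= K1 * A^2" if "t \<in> cbox 1 2" for t
    proof -
     have "norm (?g t) <= K1 * A^2" by (rule dbd_bound[OF dg]) (use that in auto)
     then show ?thesis by (simp add: norm_mult)
    qed
    then show ?thesis
     using has_integral_bound[of "K1 * A^2" ?F "integral {1..2} ?F" 1 2] True KA by auto
   qed (use KA in \<open>auto simp: not_integrable_integral\<close>)
   also have "\<dots> = 1 * (K1 * A^2) * 1" by simp
   also have "\<dots> <= (K0 + 1) * (K1 * A^2) * (L / \<bar>P\<bar>) ^ N"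
   proof (intro mult_mono)
    show "1 <= (L / \<bar>P\<bar>) ^ N" using False P by (intro one_le_power) (simp add: field_simps)
   qed (use K0 K1 KA in auto)
   also have "\<dots> = (K0 + 1) * K1 * c0 ^ N * A^2 * (lam * l / \<bar>P\<bar>) ^ N"
    unfolding cp[symmetric] by (simp only: mult_ac)
   finally show ?thesis .
  qed
 qed
 show ?thesis
  by (intro exI[of _ "(K0 + 1) * K1 * c0 ^ N"] conjI allI impI main) (use K0 K1 c0 in auto)
qed

lemma sum_axis_scaleR:
 fixes f :: "'n::finite => 'a::real_vector"
 shows "(\<Sum>j\<in>UNIV. (axis i (1::real) $ j) .* f j) = f i"
proof -
 have "(\<Sum>j\<in>UNIV. (axis i (1::real) $ j) .* f j) = (\<Sum>j\<in>UNIV. if j = i then f j else 0)"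
  by (intro sum.cong) (auto simp: axis_def)
 then show ?thesis by simp
qed

lemma sum_abs_axis: "(\<Sum>j\<in>UNIV. \<bar>axis i (1::real) $ j\<bar>) = 1"
proof -
 have "(\<Sum>j\<in>UNIV. \<bar>axis i (1::real) $ j\<bar>) = (\<Sum>j\<in>UNIV. if j = i then 1 else 0)"
  by (intro sum.cong) (auto simp: axis_def)
 then show ?thesis by simp
qed

section \<open>Averaging over translations\<close>

lemma nn_integral_lborel_translate:
 fixes f :: "'a::euclidean_space => ennreal"
 assumes [measurable]: "f \<in> bmeas"
 shows "(NN x. f (x + v)) = (NN x. f x)"
proof -
 have "(NN x. f x) = (\<integral>\<^sup>+x. f x \<partial>distr lborel borel ((+) v))" by (simp add: lborel_distr_plus)
 also have "\<dots> = (NN x. f (v + x))" by (subst nn_integral_distr) auto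
 finally show ?thesis by (simp add: add.commute)
qed

lemma integral_lborel_translate:
 fixes f :: "'a::euclidean_space => 'b::{banach, second_countable_topology}"
 assumes [measurable]: "f \<in> bmeas"
 shows "(LL x. f (x + v)) = (LL x. f x)"
proof -
 have "(LL x. f x) = (\<integral>x. f x \<partial>distr lborel borel ((+) v))" by (simp add: lborel_distr_plus)
 also have "\<dots> = (LL x. f (v + x))" by (subst integral_distr) auto
 finally show ?thesis by (simp add: add.commute)
qed

lemma borel_measurable_vec_component [measurable (raw)]:
 "f \<in> borel_measurable M ==> (\<lambda>x. f x $ i) \<in> borel_measurable M" for f :: "'a => real^'n"
 by (rule borel_measurable_continuous_on[where f="\<lambda>x. x $ i"]) (auto intro: continuous_intros)

lemma measurable_lborel_pair: "measurable (lborel \<Otimes>\<^sub>M lborel) N = measurable (borel \<Otimes>\<^sub>M borel) N"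
 by (rule measurable_cong_sets) (simp_all cong: sets_pair_measure_cong)

text \<open>Fubini: integrated over all starting points, the time that segments of length
  \<open>\<tau>\<close> spend in \<open>E\<close> counts every point of \<open>E\<close> with weight
  \<open>\<tau>\<close>. Only starting points within \<open>\<tau>\<close> of \<open>E\<close>
  contribute, whence the enlarged ball.\<close>

lemma emeasure_line_average:
 fixes E :: "(real^'n) set"
 assumes [measurable]: "E \<in> sets borel" and t: "0 <= \<tau>" and e: "norm e <= 1" and R: "E \<subseteq> cball 0 R"
  and bd: "\<And>eta. emeasure lborel {t\<in>{0..\<tau>}. eta + t .* e \<in> E} <= ennreal B"
 shows "emeasure lborel E * ennreal \<tau> <= ennreal B * emeasure lborel (cball (0::real^'n) (R + \<tau>))"
proof -
 have [measurable]: "(\<lambda>(t, eta). indicator E (eta + t .* e) * indicator {0..\<tau>} t :: ennreal) \<in> borel_measurable (lborel \<Otimes>\<^sub>M lborel)"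
  by measurable
 have "emeasure lborel E * ennreal \<tau> = (NN t. emeasure lborel E * indicator {0..\<tau>} t)"
  using t by (subst nn_integral_cmult) auto
 also have "\<dots> = (NN t. (NN eta. indicator E (eta + t .* e) * indicator {0..\<tau>} t))"
 proof (rule nn_integral_cong)
  fix t :: real
  have "(NN eta. indicator E (eta + t .* e) * indicator {0..\<tau>} t) = (NN eta. indicator E (eta + t .* e)) * indicator {0..\<tau>} t"
   by (rule nn_integral_multc) measurable
  also have "(NN eta. indicator E (eta + t .* e)) = (NN eta. indicator E eta)"
   by (rule nn_integral_lborel_translate) measurable
  finally show "emeasure lborel E * indicator {0..\<tau>} t = (NN eta. indicator E (eta + t .* e) * indicator {0..\<tau>} t)"
   by simp
 qed
 also have "\<dots> = (NN eta. (NN t. indicator E (eta + t .* e) * indicator {0..\<tau>} t))"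
  by (rule lborel_pair.Fubini'[symmetric]) measurable
 also have "\<dots> <= (NN eta. ennreal B * indicator (cball (0::real^'n) (R + \<tau>)) eta)"
 proof (rule nn_integral_mono)
  fix eta :: "real^'n"
  have "(NN t. indicator E (eta + t .* e) * indicator {0..\<tau>} t) = (NN t. indicator {t\<in>{0..\<tau>}. eta + t .* e \<in> E} t)"
   by (intro nn_integral_cong) (auto simp: indicator_def)
  also have "\<dots> = emeasure lborel {t\<in>{0..\<tau>}. eta + t .* e \<in> E}"
   by (subst nn_integral_indicator) (auto, measurable)
  finally have eq: "(NN t. indicator E (eta + t .* e) * indicator {0..\<tau>} t) = emeasure lborel {t\<in>{0..\<tau>}. eta + t .* e \<in> E}" .
  show "(NN t. indicator E (eta + t .* e) * indicator {0..\<tau>} t) <= ennreal B * indicator (cball (0::real^'n) (R + \<tau>)) eta"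
  proof (cases "{t\<in>{0..\<tau>}. eta + t .* e \<in> E} = {}")
   case True
   then show ?thesis unfolding eq by (simp only: True) simp
  next
   case False
   then obtain t where t: "t \<in> {0..\<tau>}" "eta + t .* e \<in> E" by auto
   have "norm eta <= norm (eta + t .* e) + norm (t .* e)" by (metis add_diff_cancel_right' norm_triangle_ineq4)
   moreover have "\<bar>t\<bar> * norm e <= \<tau> * 1" using t e by (intro mult_mono) auto
   moreover have "norm (eta + t .* e) <= R" using t R by auto
   ultimately have "eta \<in> cball 0 (R + \<tau>)" by simp
   then show ?thesis unfolding eq using bd[of eta] by simp
  qed
 qed
 also have "\<dots> = ennreal B * emeasure lborel (cball (0::real^'n) (R + \<tau>))"
  by (subst nn_integral_cmult_indicator) auto
 finally show ?thesis .
qed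

definition cube :: "real^'n => real => (real^'n) set" where
 "cube zeta r = {eta. \<forall>j. \<bar>eta $ j - zeta $ j\<bar> <= r}"

lemma cube_eq_cbox: "cube zeta r = cbox (zeta - (\<chi> j. r)) (zeta + (\<chi> j. r))"
 by (auto simp: cube_def mem_box_cart abs_le_iff algebra_simps)

lemma cube_sets [measurable]: "cube zeta r \<in> sets borel"
 unfolding cube_eq_cbox by simp

lemma emeasure_cube: "0 <= r ==> emeasure lborel (cube (zeta::real^'n) r) = ennreal ((2 * r) ^ CARD('n))"
proof -
 assume r: "0 <= r"
 have "cube zeta r ~= {}" using r by (auto simp: cube_def intro!: exI[of _ zeta])
 then have "measure lborel (cube zeta r) = (\<Prod>i\<in>(UNIV::'n set). 2 * r)"
  unfolding cube_eq_cbox by (subst content_cbox_cart) auto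
 then have "measure lborel (cube zeta r) = (2 * r) ^ CARD('n)" by simp
 moreover have "emeasure lborel (cube zeta r) < \<infinity>" unfolding cube_eq_cbox by (rule emeasure_lborel_cbox_finite)
 ultimately show ?thesis using emeasure_eq_ennreal_measure[of lborel "cube zeta r"] by (simp add: less_top)
qed

text \<open>Instead of splitting off the i-th coordinate, line integrals are averaged over base
  points in a slab of width 2r: by translation and Fubini the average reproduces 2r times the full
  integral, and only base points in the cube contribute.\<close>

lemma integral_line_bound:
 fixes f :: "real^'n => complex"
 assumes [measurable]: "f \<in> bmeas" and int: "integrable lborel f" and r: "0 <= r" and B: "0 <= B"
  and z: "\<And>eta. eta \<notin> cube zeta r ==> f eta = 0"
  and bd: "\<And>eta. eta \<in> cube zeta r ==> norm (LL t. f (eta + t .* axis i 1)) <= B"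
 shows "norm (LL eta. f eta) * (2 * r) <= B * (2 * r) ^ CARD('n)"
proof -
 let ?S = "{eta::real^'n. \<bar>eta $ i - zeta $ i\<bar> <= r}"
 let ?I = "\<lambda>eta. indicator ?S eta :: real"
 let ?F = "\<lambda>(t, eta). ?I eta .* f (eta + t .* axis i 1)"
 have [measurable]: "?S \<in> sets borel" by measurable
 have [measurable]: "?F \<in> borel_measurable (lborel \<Otimes>\<^sub>M lborel)" by measurable
 \<comment> \<open>The slab condition is rewritten in terms of the shifted point, so that the shift
   can be undone in the inner integral.\<close>
 have shift: "?I eta .* f (eta + t .* axis i 1) = (\<lambda>eta. (if \<bar>eta $ i - zeta $ i - t\<bar> <= r then 1 else 0 :: real) .* f eta) (eta + t .* axis i 1)" for eta t
  by (auto simp: indicator_def axis_def abs_le_iff)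
 have shift': "(LL eta. ?I eta .* f (eta + t .* axis i 1)) = (LL eta. (if \<bar>eta $ i - zeta $ i - t\<bar> <= r then 1 else 0 :: real) .* f eta)" for t
  unfolding shift by (rule integral_lborel_translate) measurable
 let ?G = "\<lambda>(t, eta::real^'n). (if \<bar>eta $ i - zeta $ i - t\<bar> <= r then 1 else 0 :: real) .* f eta"
 have [measurable]: "?G \<in> borel_measurable (lborel \<Otimes>\<^sub>M lborel)"
  unfolding measurable_lborel_pair split_beta by measurable
 have ind: "(if \<bar>c - t\<bar> <= r then 1 else 0 :: real) = indicator {c - r..c + r} t" for c t :: real
  by (auto simp: indicator_def abs_le_iff)
 have len: "(LL t. (if \<bar>c - t\<bar> <= r then 1 else 0 :: real) .* w) = (2 * r) .* w" for c :: real and w :: complex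
  unfolding ind using r by (subst integral_scaleR_left) (auto simp: integrable_indicator_iff)
 have nG: "(NN t. norm (?G (t, eta))) = ennreal (2 * r) * norm (f eta)" for eta
 proof -
  have "(NN t. norm (?G (t, eta))) = (NN t. ennreal (norm (f eta)) * indicator {eta $ i - zeta $ i - r..eta $ i - zeta $ i + r} t)"
   by (intro nn_integral_cong) (auto simp: indicator_def abs_le_iff)
  also have "\<dots> = norm (f eta) * ennreal (2 * r)" using r by (subst nn_integral_cmult) auto
  finally show ?thesis by (simp add: mult.commute)
 qed
 have iG: "integrable (lborel \<Otimes>\<^sub>M lborel) ?G"
 proof (rule integrableI_bounded)
  have "(\<integral>\<^sup>+p. norm (?G p) \<partial>(lborel \<Otimes>\<^sub>M lborel)) = (NN eta. (NN t. norm (?G (t, eta))))"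
   by (rule lborel_pair.nn_integral_snd[symmetric, of "\<lambda>p. ennreal (norm (?G p))"]) measurable
  also have "\<dots> = ennreal (2 * r) * (NN eta. norm (f eta))"
   unfolding nG by (rule nn_integral_cmult) measurable
  also have "\<dots> < \<infinity>" using int by (auto simp: integrable_iff_bounded ennreal_mult_less_top)
  finally show "(\<integral>\<^sup>+p. norm (?G p) \<partial>(lborel \<Otimes>\<^sub>M lborel)) < \<infinity>" .
 qed measurable
 have iF: "integrable (lborel \<Otimes>\<^sub>M lborel) ?F"
 proof (rule integrableI_bounded)
  have "(\<integral>\<^sup>+p. norm (?F p) \<partial>(lborel \<Otimes>\<^sub>M lborel)) = (NN t. (NN eta. norm (?F (t, eta))))"
   by (rule lborel.nn_integral_fst[symmetric, of "\<lambda>p. ennreal (norm (?F p))"]) measurable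
  also have "\<dots> = (NN t. (NN eta. norm (?G (t, eta))))"
  proof (rule nn_integral_cong)
   fix t :: real
   have "(NN eta. norm (?F (t, eta))) = (NN eta. (\<lambda>eta. ennreal (norm (?G (t, eta)))) (eta + t .* axis i 1))"
    by (intro nn_integral_cong) (simp add: indicator_def axis_def)
   also have "\<dots> = (NN eta. norm (?G (t, eta)))" by (rule nn_integral_lborel_translate) measurable
   finally show "(NN eta. norm (?F (t, eta))) = (NN eta. norm (?G (t, eta)))" .
  qed
  also have "\<dots> = (\<integral>\<^sup>+p. norm (?G p) \<partial>(lborel \<Otimes>\<^sub>M lborel))"
   by (rule lborel.nn_integral_fst[of "\<lambda>p. ennreal (norm (?G p))"]) measurable
  also have "\<dots> < \<infinity>" using iG by (simp add: integrable_iff_bounded)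
  finally show "(\<integral>\<^sup>+p. norm (?F p) \<partial>(lborel \<Otimes>\<^sub>M lborel)) < \<infinity>" .
 qed measurable
 have "(LL eta. (LL t. ?F (t, eta))) = (LL t. (LL eta. ?F (t, eta)))"
  using lborel_pair.Fubini_integral[of "\<lambda>t eta. ?F (t, eta)"] iF by simp
 also have "\<dots> = (LL t. (LL eta. ?G (t, eta)))"
  using shift' by simp
 also have "\<dots> = (LL eta. (LL t. ?G (t, eta)))"
  using lborel_pair.Fubini_integral[of "\<lambda>t eta. ?G (t, eta)"] iG by simp
 also have "\<dots> = (LL eta. (2 * r) .* f eta)" by (simp add: len)
 also have "\<dots> = (2 * r) .* (LL eta. f eta)" by simp
 finally have eq: "(2 * r) .* (LL eta. f eta) = (LL eta. (LL t. ?F (t, eta)))" by simp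
 have bF: "norm (LL t. ?F (t, eta)) <= B * indicator (cube zeta r) eta" for eta
 proof (cases "eta \<in> cube zeta r")
  case True
  then have "eta \<in> ?S" by (auto simp: cube_def)
  then show ?thesis using bd[OF True] True by simp
 next
  case False
  \<comment> \<open>A base point in the slab but outside the cube violates the condition for some j
    ~= i, and moving in direction i never repairs that.\<close>
  have z0: "?F (t, eta) = 0" for t
  proof (cases "eta \<in> ?S")
   case True
   from False obtain j where j: "\<not> \<bar>eta $ j - zeta $ j\<bar> <= r" unfolding cube_def by blast
   with True have "j ~= i" by auto
   with j have "\<not> \<bar>(eta + t .* axis i 1) $ j - zeta $ j\<bar> <= r" by (simp add: axis_def)
   then have "eta + t .* axis i 1 \<notin> cube zeta r" unfolding cube_def by blast
   then show ?thesis using z by simp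
  qed simp
  have "(LL t. ?F (t, eta)) = (\<integral>t. 0 \<partial>(lborel :: real measure))"
   by (intro Bochner_Integration.integral_cong refl z0)
  then have "norm (LL t. ?F (t, eta)) = 0"
   by (simp only: Bochner_Integration.integral_zero norm_zero)
  then show ?thesis using B by (simp only:) simp
 qed
 have "norm (LL eta. (LL t. ?F (t, eta))) <= (LL eta. B * indicator (cube zeta r) eta)"
 proof (rule Bochner_Integration.integral_norm_bound_integral)
  show "integrable lborel (\<lambda>eta. \<integral>t. ?F (t, eta) \<partial>lborel)"
   using lborel_pair.integrable_snd[of "\<lambda>t eta. ?F (t, eta)"] iF by simp
  show "integrable lborel (\<lambda>eta. B * indicator (cube zeta r) eta)"
   using emeasure_cube[OF r, of zeta] by (auto intro!: integrable_mult_right simp: integrable_indicator_iff)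
 qed (rule bF)
 also have "\<dots> = B * (2 * r) ^ CARD('n)"
  using emeasure_cube[OF r, of zeta] r by (simp add: measure_def)
 finally show ?thesis unfolding eq[symmetric] using r by (simp add: mult.commute)
qed

section \<open>The phase difference\<close>

text \<open>Orders 0 and 1 are left uncontrolled, as in \<open>Linf_Phi 2\<close>; only the
  variation of the gradient is bounded.\<close>

definition phase_bound :: "nat => real => real => ('n::finite list => real^'n => real) => bool" where
 "phase_bound N C lam P \<longleftrightarrow> (\<forall>al. \<forall>xi\<in>annulus 100 lam. 2 <= length al --> length al <= N -->
   \<bar>P al xi\<bar> <= C * lam * (1 / lam) ^ length al)"

lemma annulus_perturb:
 assumes "xi \<in> annulus 20 lam" "norm v <= lam / 30" "0 < lam"
 shows "xi + v \<in> annulus 100 lam"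
proof -
 have "norm xi - norm v <= norm (xi + v)" "norm (xi + v) <= norm xi + norm v"
  using norm_triangle_ineq[of xi v] norm_diff_ineq[of xi v] by auto
 then show ?thesis using assms unfolding annulus_def by auto
qed

lemma phase_line:
 fixes P :: "'n::finite list => real^'n => real"
 assumes "jet (-{0}) P" "phase_bound (N + 2) C lam P" "0 < lam" "0 <= C"
  and "\<And>t. t \<in> U ==> eta + t .* axis i 1 \<in> annulus 100 lam"
 shows "\<And>t. t \<in> U ==> ((\<lambda>t. P [] (eta + t .* axis i 1)) has_vector_derivative P [i] (eta + t .* axis i 1)) (at t)"
  and "\<And>t. t \<in> U ==> ((\<lambda>t. P [i] (eta + t .* axis i 1)) has_vector_derivative P [i, i] (eta + t .* axis i 1)) (at t)"
  and "dbd N (C * (1 / lam)) (1 / lam) U (\<lambda>t. P [i, i] (eta + t .* axis i 1))"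
proof -
 have nz: "eta + t .* axis i 1 \<in> -{0}" if "t \<in> U" for t
  using annulus_nonzero[OF _ assms(3) assms(5)[OF that]] by simp
 show "((\<lambda>t. P [] (eta + t .* axis i 1)) has_vector_derivative P [i] (eta + t .* axis i 1)) (at t)"
  "((\<lambda>t. P [i] (eta + t .* axis i 1)) has_vector_derivative P [i, i] (eta + t .* axis i 1)) (at t)"
  if "t \<in> U" for t
  using jet_vector_derivative[OF assms(1) nz[OF that], of "[]"] jet_vector_derivative[OF assms(1) nz[OF that], of "[i]"]
  by (simp_all only: sum_axis_scaleR)
 show "dbd N (C * (1 / lam)) (1 / lam) U (\<lambda>t. P [i, i] (eta + t .* axis i 1))"
 proof (rule dbd_jet[OF assms(1) nz])
  show "(\<Sum>j\<in>UNIV. \<bar>axis i 1 $ j\<bar>) * (1 / lam) <= 1 / lam" by (simp add: sum_abs_axis)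
  show "norm (P (\<beta> @ [i, i]) (eta + t .* axis i 1)) <= C * (1 / lam) * (1 / lam) ^ length \<beta>"
   if "length \<beta> <= N" "t \<in> U" for \<beta> t
  proof -
   have "\<bar>P (\<beta> @ [i, i]) (eta + t .* axis i 1)\<bar> <= C * lam * (1 / lam) ^ length (\<beta> @ [i, i])"
    using assms(2)[unfolded phase_bound_def, rule_format, OF assms(5)[OF that(2)], of "\<beta> @ [i, i]"] that(1) by simp
   also have "\<dots> = C * (1 / lam) * (1 / lam) ^ length \<beta>" using assms(3) by simp
   finally show ?thesis by simp
  qed
 qed (use assms in auto)
qed

text \<open>On a segment of length lam/q in direction i the one-variable estimate confines the set
  to \<open>M\<close> intervals of length 8H/D; averaging over segments turns this into a bound for
  the measure. In units of the phase scale the segment has length 1/q, hence the power of 1/q in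
  \<open>small\<close>.\<close>

lemma sublevel_measure:
 fixes P :: "'n::finite list => real^'n => real"
 assumes P: "jet (-{0}) P" "phase_bound (M + 2) C lam P" and lam: "0 < lam" and C: "0 <= C"
  and M: "0 < M" and D: "0 < D" "D <= 1" "0 < H" and q: "100 <= q"
  and small: "2 ^ Suc M * (1 + C) * (1 + C) * (1 / q) ^ Suc M < 3/4 * D^2"
 shows "emeasure lborel {eta\<in>annulus 20 lam. \<bar>P [] eta\<bar> <= H \<and> D <= \<bar>P [i] eta\<bar>} * ennreal (lam / q)
   <= ennreal (8 * real M * H / D) * emeasure lborel (cball (0::real^'n) (20 * lam + lam / q))"
proof -
 let ?E = "{eta\<in>annulus 20 lam. \<bar>P [] eta\<bar> <= H \<and> D <= \<bar>P [i] eta\<bar>}"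
 define \<tau> where "\<tau> = lam / q"
 \<comment> \<open>\<open>q >= 100\<close> keeps the enlarged segment, of three times the length,
   inside \<open>annulus 100\<close>.\<close>
 have \<tau>: "0 < \<tau>" "3 * \<tau> <= lam / 30" using lam q by (auto simp: \<tau>_def field_simps)
 have "closed ?E"
 proof -
  have sub: "annulus 20 lam \<subseteq> - {0::real^'n}" using annulus_nonzero[of 20 lam] lam by auto
  have cl: "closed (annulus 20 lam :: (real^'n) set)" using compact_annulus compact_imp_closed by blast
  have c: "continuous_on (annulus 20 lam) (P al)" for al
   using jet_continuous_on[OF P(1)] sub continuous_on_subset by blast
  have cv: "closed (annulus 20 lam \<inter> (\<lambda>eta. \<bar>P al eta\<bar>) -` B)" if "closed B" for B al
  proof -
   have "continuous_on (annulus 20 lam) (\<lambda>eta. \<bar>P al eta\<bar>)" by (intro continuous_on_rabs c)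
   then show ?thesis using continuous_on_closed_vimage[OF cl] that by (metis Int_commute)
  qed
  have "closed ((annulus 20 lam \<inter> (\<lambda>eta. \<bar>P [] eta\<bar>) -` {..H}) \<inter> (annulus 20 lam \<inter> (\<lambda>eta. \<bar>P [i] eta\<bar>) -` {D..}))"
   by (intro closed_Int cv closed_atMost closed_atLeast)
  moreover have "(annulus 20 lam \<inter> (\<lambda>eta. \<bar>P [] eta\<bar>) -` {..H}) \<inter> (annulus 20 lam \<inter> (\<lambda>eta. \<bar>P [i] eta\<bar>) -` {D..}) = ?E" by auto
  ultimately show ?thesis by simp
 qed
 then have meas[measurable]: "?E \<in> sets borel" by auto
 have "emeasure lborel ?E * ennreal \<tau> <= ennreal (8 * real M * H / D) * emeasure lborel (cball (0::real^'n) (20 * lam + \<tau>))"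
 proof (rule emeasure_line_average[OF meas, where e="axis i 1"])
  fix eta :: "real^'n"
  let ?L = "{t\<in>{0..\<tau>}. eta + t .* axis i 1 \<in> ?E}"
  show "emeasure lborel ?L <= ennreal (8 * real M * H / D)"
  proof (cases "?L = {}")
   case True
   then show ?thesis by (simp only: True) simp
  next
   case False
   then obtain t0 where t0: "t0 \<in> {0..\<tau>}" "eta + t0 .* axis i 1 \<in> annulus 20 lam" by auto
   let ?U = "{-\<tau><..<2 * \<tau>}"
   have ann: "eta + t .* axis i 1 \<in> annulus 100 lam" if "t \<in> ?U" for t
   proof -
    have "eta + t .* axis i 1 = (eta + t0 .* axis i 1) + (t - t0) .* axis i 1"
     by (simp add: algebra_simps)
    moreover have "norm ((t - t0) .* axis i (1::real)) <= lam / 30"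
     using that t0(1) \<tau> by (auto simp: abs_if)
    ultimately show ?thesis using annulus_perturb[OF t0(2) _ lam] by metis
   qed
   note pl = phase_line[of P M C lam ?U eta i, OF P lam C ann]
   have "\<exists>F. finite F \<and> card F <= M \<and> {t\<in>{0..\<tau>}. \<bar>P [] (eta + t .* axis i 1)\<bar> <= H \<and> D <= \<bar>P [i] (eta + t .* axis i 1)\<bar>} \<subseteq> (\<Union>x\<in>F. {x - 4 * H / D..x + 4 * H / D})"
   proof (rule sublevel_estimate[OF _ _ _ _ _ C pl(1) pl(2) pl(3) D M _ refl])
    show "1 / lam * \<bar>u - v\<bar> <= 1" if "u \<in> ?U" "v \<in> ?U" for u v
     using that \<tau> lam by (auto simp: field_simps abs_le_iff)
    show "2 ^ Suc M * (1 + C) * (1 + C) * (1 / lam * (\<tau> - 0)) ^ Suc M < 3 / 4 * D^2"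
     using small lam by (simp add: \<tau>_def)
   qed (use \<tau> lam in auto)
   then obtain F where F: "finite F" "card F <= M"
    "{t\<in>{0..\<tau>}. \<bar>P [] (eta + t .* axis i 1)\<bar> <= H \<and> D <= \<bar>P [i] (eta + t .* axis i 1)\<bar>} \<subseteq> (\<Union>x\<in>F. {x - 4 * H / D..x + 4 * H / D})" by blast
   have "?L \<subseteq> (\<Union>x\<in>F. {x - 4 * H / D..x + 4 * H / D})" using F(3) by auto
   then have "emeasure lborel ?L <= emeasure lborel (\<Union>x\<in>F. {x - 4 * H / D..x + 4 * H / D})"
    using F(1) by (intro emeasure_mono) auto
   also have "\<dots> <= (\<Sum>x\<in>F. emeasure lborel {x - 4 * H / D..x + 4 * H / D})"
    using F(1) by (intro emeasure_subadditive_finite) auto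
   also have "\<dots> = (\<Sum>x\<in>F. ennreal (8 * H / D))" using D by (intro sum.cong) auto
   also have "\<dots> = ennreal (real (card F) * (8 * H / D))"
    using D by (simp add: ennreal_of_nat_eq_real_of_nat ennreal_mult'[symmetric])
   also have "\<dots> <= ennreal (8 * real M * H / D)"
   proof (rule ennreal_leI)
    have "real (card F) * (8 * H / D) <= real M * (8 * H / D)"
     using F(2) D by (intro mult_right_mono) auto
    then show "real (card F) * (8 * H / D) <= 8 * real M * H / D" by (simp add: mult_ac)
   qed
   finally show ?thesis .
  qed
 next
  show "?E \<subseteq> cball 0 (20 * lam)" by (auto simp: annulus_def)
 qed (use \<tau> in auto)
 then show ?thesis by (simp only: \<tau>_def)
qed

section \<open>Gain from integrating in the tangential directions\<close>

definition psi :: "nat => real => real^'n => real" where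
 "psi M r z = (\<Prod>j\<in>UNIV. bump M (z $ j / r))"

lemma psi_nonneg: "0 <= psi M r z"
 unfolding psi_def by (intro prod_nonneg) (simp add: bump_nonneg)

lemma psi_le_1: "0 < M ==> psi M r z <= 1"
 unfolding psi_def by (intro prod_le_1) (simp add: bump_nonneg bump_le_1)

lemma psi_eq_0:
 assumes "0 < M" "0 < r" "eta \<notin> cube zeta r"
 shows "psi M r (eta - zeta) = 0"
proof -
 from assms(3) obtain j where "\<not> \<bar>eta $ j - zeta $ j\<bar> <= r" unfolding cube_def by blast
 then have "bump M ((eta - zeta) $ j / r) = 0"
  using assms(1,2) by (intro bump_eq_0) (auto simp: abs_divide)
 then show ?thesis unfolding psi_def by (intro prod_zero) auto
qed

lemma continuous_on_psi: "continuous_on S (psi M r)"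
 unfolding psi_def divide_inverse by (intro continuous_intros)

lemma borel_measurable_psi [measurable]: "psi M r \<in> bmeas"
 by (intro borel_measurable_continuous_onI continuous_on_psi)

lemma psi_line:
 "psi M r (eta + t .* axis i 1 - zeta) = (\<Prod>j\<in>UNIV - {i}. bump M ((eta - zeta) $ j / r)) * bump M ((t - (zeta $ i - eta $ i)) / r)"
proof -
 have "psi M r (eta + t .* axis i 1 - zeta) = bump M ((eta + t .* axis i 1 - zeta) $ i / r) * (\<Prod>j\<in>UNIV - {i}. bump M ((eta + t .* axis i 1 - zeta) $ j / r))"
  unfolding psi_def by (rule prod.remove) auto
 also have "(\<Prod>j\<in>UNIV - {i}. bump M ((eta + t .* axis i 1 - zeta) $ j / r)) = (\<Prod>j\<in>UNIV - {i}. bump M ((eta - zeta) $ j / r))"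
  by (intro prod.cong) (auto simp: axis_def)
 finally show ?thesis by (simp add: axis_def algebra_simps)
qed

lemma integral_lborel_eq_interval:
 fixes g :: "real => complex"
 assumes "continuous_on {a..b} g" "\<And>t. t \<notin> {a..b} ==> g t = 0"
 shows "(LL t. g t) = integral {a..b} g"
proof -
 have "set_integrable lborel {a..b} g" using assms(1) by (rule borel_integrable_atLeastAtMost')
 then have "(LINT t:{a..b}|lborel. g t) = integral {a..b} g" by (rule set_borel_integral_eq_integral)
 moreover have "(LINT t:{a..b}|lborel. g t) = (LL t. g t)"
  unfolding set_lebesgue_integral_def
  by (intro Bochner_Integration.integral_cong) (auto simp: indicator_def assms(2))
 ultimately show ?thesis by simp
qed

lemma compact_cube: "compact (cube zeta r)"
 unfolding cube_eq_cbox by (rule compact_cbox)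

lemma convex_cube: "convex (cube zeta r)"
 unfolding cube_eq_cbox by (rule convex_box)

lemma norm_cube: "eta \<in> cube (zeta::real^'n) r ==> norm (eta - zeta) <= real CARD('n) * r"
proof -
 assume "eta \<in> cube zeta r"
 have "norm (eta - zeta) <= (\<Sum>j\<in>UNIV. \<bar>(eta - zeta) $ j\<bar>)" by (rule norm_le_l1_cart)
 also have "\<dots> <= (\<Sum>j\<in>(UNIV::'n set). r)" using \<open>eta \<in> cube zeta r\<close> by (intro sum_mono) (auto simp: cube_def)
 finally show ?thesis by simp
qed

lemma annulus_5_perturb:
 assumes "xi \<in> annulus 5 lam" "norm (eta - xi) <= lam / 100" "0 < lam"
 shows "eta \<in> annulus 10 lam"
proof -
 have "norm xi - norm (eta - xi) <= norm eta" "norm eta <= norm xi + norm (eta - xi)"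
  using norm_triangle_sub[of xi eta] norm_triangle_sub[of eta xi] by (auto simp: norm_minus_commute)
 then show ?thesis using assms unfolding annulus_def by auto
qed

text \<open>Second derivatives are O(1/lam). On a cube of side comparable to \<open>sqrt lam\<close>
  the gradient therefore moves by O(1 / sqrt lam) only.\<close>

lemma grad_variation:
 fixes P :: "'n::finite list => real^'n => real"
 assumes P: "jet (-{0}) P" "phase_bound N C lam P" "2 <= N" and lam: "0 < lam" and C: "0 <= C"
  and S: "convex S" "S \<subseteq> annulus 100 lam" "zeta \<in> S" "eta \<in> S"
 shows "\<bar>P [i] eta - P [i] zeta\<bar> <= real CARD('n) * C / lam * norm (eta - zeta)"
proof -
 have "norm (P [i] eta - P [i] zeta) <= real CARD('n) * C / lam * norm (eta - zeta)"
 proof (rule differentiable_bound[OF S(1)])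
  fix xi assume xi: "xi \<in> S"
  then have ann: "xi \<in> annulus 100 lam" using S by auto
  then have "xi \<in> -{0}" using annulus_nonzero[of 100 lam] lam by auto
  then show "(P [i] has_derivative (\<lambda>v. \<Sum>j\<in>UNIV. (v $ j) .* P [j, i] xi)) (at xi within S)"
   using P(1) unfolding jet_def by (blast intro: has_derivative_at_withinI)
  show "onorm (\<lambda>v. \<Sum>j\<in>UNIV. (v $ j) .* P [j, i] xi) <= real CARD('n) * C / lam"
  proof (rule onorm_le)
   fix v :: "real^'n"
   have b: "\<bar>P [j, i] xi\<bar> <= C / lam" for j
    using P(2)[unfolded phase_bound_def, rule_format, OF ann, of "[j, i]"] P(3) lam by simp
   have "norm (\<Sum>j\<in>UNIV. (v $ j) .* P [j, i] xi) <= (\<Sum>j\<in>UNIV. \<bar>v $ j\<bar> * (C / lam))"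
   proof (rule order_trans[OF norm_sum sum_mono])
    show "norm ((v $ j) .* P [j, i] xi) <= \<bar>v $ j\<bar> * (C / lam)" for j
     unfolding norm_scaleR by (rule mult_left_mono) (use b[of j] in auto)
   qed
   also have "\<dots> = (\<Sum>j\<in>UNIV. \<bar>v $ j\<bar>) * (C / lam)" by (simp only: sum_distrib_right)
   also have "\<dots> <= (real CARD('n) * norm v) * (C / lam)"
    using sum_abs_le_norm C lam by (intro mult_right_mono) auto
   finally show "norm (\<Sum>j\<in>UNIV. (v $ j) .* P [j, i] xi) <= real CARD('n) * C / lam * norm v"
    by (simp add: mult_ac)
  qed
 qed (use S in auto)
 then show ?thesis by simp
qed

text \<open>Either the partial at the centre is O(1 / sqrt lam) and the trivial bound does, or it
  dominates its variation over the doubled cube. In the second case integration by parts in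
  direction i gains 1/(sqrt lam |P_i|) each time: the cut-off and, by
  \<open>l * sqrt lam <= 1\<close>, the amplitudes vary on the scale
  \<open>sqrt lam\<close>.\<close>

lemma tangential_decay:
 assumes NM: "N < M" and C: "0 <= C"
 shows "\<exists>K\<ge>0. \<forall>(a1 :: 'n::finite list => real^'n => complex) a2 A l lam P zeta i s.
   jet UNIV a1 --> jet UNIV a2 --> amp_bound N l A (annulus 100 lam) a1 --> amp_bound N l A (annulus 100 lam) a2 -->
   jet (-{0}) P --> phase_bound (N + 2) C lam P --> (200 * real CARD('n))^2 <= lam -->
   0 < l --> l * sqrt lam <= 1 --> 0 <= A --> s \<in> {1..2} --> zeta \<in> annulus 5 lam --> P [i] zeta ~= 0 -->
   norm (LL eta. of_real (psi M (sqrt lam) (eta - zeta)) * (exp (\<i> * of_real (s * P [] eta)) * (a1 [] (s .* eta) * cnj (a2 [] (s .* eta)))))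
    <= K * A^2 * (2 * sqrt lam) ^ CARD('n) * (1 / (sqrt lam * \<bar>P [i] zeta\<bar>)) ^ N"
proof -
 define n where "n = real CARD('n)"
 have n: "n >= 1" unfolding n_def by (simp add: Suc_leI)
 \<comment> \<open>The phase is \<open>s * P\<close> with \<open>s <= 2\<close>, so its second
   derivatives are bounded with \<open>2 * C\<close>.\<close>
 have C2: "0 <= 2 * C" using C by simp
 obtain K0 where K0: "K0 >= 0" and ph: "\<And>f p p' g G D L a b U. phase_data N (2 * C) f p p' g G D L a b U ==>
   norm (integral {a..b} (\<lambda>t. exp (\<i> * of_real (f t)) * g t)) <= K0 * G * (b - a) * (L / D) ^ N"
  using nonstationary_phase[OF C2, of N] by blast
 \<comment> \<open>In units of 1/r, \<open>c1\<close> dominates the inverse scales of the cut-off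
   and of the amplitudes. \<open>c2\<close> is so large that \<open>c2 / r <= D\<close> leaves |P_i|
   >= D/2 on the doubled cube and makes the inverse scale at most D/2.\<close>
 define c1 where "c1 = max (real M) 4"
 define c2 where "c2 = max (4 * n^2 * C) (2 * c1)"
 define B where "B = (2::real) ^ N * 3 ^ M * 3 ^ M"
 define K1 where "K1 = 2 ^ N * B * (2 ^ N)"
 define K where "K = (K0 + 1) * K1 * (2 * c2) ^ N"
 have c1: "c1 >= 4" "c1 >= real M" by (auto simp: c1_def)
 have c2: "c2 >= 2 * c1" "c2 >= 4 * n^2 * C" by (auto simp: c2_def)
 have B: "B >= 1" unfolding B_def by (auto intro!: mult_ge1_I simp: one_le_power)
 have K1: "K1 >= 1" unfolding K1_def using B by (auto intro!: mult_ge1_I simp: one_le_power)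
 have main: "norm (LL eta. of_real (psi M (sqrt lam) (eta - zeta)) * (exp (\<i> * of_real (s * P [] eta)) * (a1 [] (s .* eta) * cnj (a2 [] (s .* eta)))))
    <= K * A^2 * (2 * sqrt lam) ^ CARD('n) * (1 / (sqrt lam * \<bar>P [i] zeta\<bar>)) ^ N"
  if a: "jet UNIV a1" "jet UNIV a2" "amp_bound N l A (annulus 100 lam) a1" "amp_bound N l A (annulus 100 lam) a2"
   and P: "jet (-{0}) P" "phase_bound (N + 2) C lam P" and lam0: "(200 * real CARD('n))^2 <= lam"
   and l: "0 < l" "l * sqrt lam <= 1" and A: "0 <= A" and s: "s \<in> {1..2}" and zeta: "zeta \<in> annulus 5 lam" and nz: "P [i] zeta ~= 0"
  for a1 a2 :: "'n list => real^'n => complex" and A l lam P zeta i s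
 proof -
  define r where "r = sqrt lam"
  define D where "D = \<bar>P [i] zeta\<bar>"
  have D: "D > 0" using nz by (simp add: D_def)
  have lam1: "lam >= 1"
  proof -
   have "1 <= (200 * n)^2" using n by (intro one_le_power) auto
   then show ?thesis using lam0 unfolding n_def by linarith
  qed
  have r200: "200 * n <= r" unfolding r_def n_def using lam0 by (rule real_le_rsqrt)
  then have r1: "r >= 1" using n by linarith
  have rr: "r * r = lam" using lam1 by (simp add: r_def)
  have rlam: "r <= lam" using r1 rr by (metis mult_left_mono mult.right_neutral order_trans zero_le_one)
  have n2r: "n * (2 * r) <= lam / 100"
  proof -
   have "200 * n * r <= r * r" using r200 r1 by (intro mult_right_mono) auto
   then show ?thesis using rr by simp
  qed
  have cube10: "eta \<in> annulus 10 lam" if "eta \<in> cube zeta (2 * r)" for eta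
  proof -
   have "norm (eta - zeta) <= lam / 100" using norm_cube[OF that] n2r unfolding n_def by linarith
   then show ?thesis using annulus_5_perturb[OF zeta] lam1 by auto
  qed
  have a10: "annulus 10 lam \<subseteq> (annulus 100 lam :: (real^'n) set)" using lam1 by (intro annulus_mono) auto
  have s100: "s .* eta \<in> annulus 100 lam" if "eta \<in> annulus 10 lam" for eta
  proof -
   have "1 * (lam / 10) <= s * norm eta" using s that lam1 by (intro mult_mono) (auto simp: annulus_def)
   moreover have "s * norm eta <= 2 * (10 * lam)" using s that lam1 by (intro mult_mono) (auto simp: annulus_def)
   ultimately show ?thesis using s lam1 by (auto simp: annulus_def)
  qed
  have sub: "cube zeta r \<subseteq> cube zeta (2 * r)"
  proof
   fix eta assume "eta \<in> cube zeta r"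
   then have *: "\<bar>eta $ j - zeta $ j\<bar> <= r" for j by (simp add: cube_def)
   have "\<bar>eta $ j - zeta $ j\<bar> <= 2 * r" for j using *[of j] r1 by linarith
   then show "eta \<in> cube zeta (2 * r)" by (simp add: cube_def)
  qed
  let ?E = "\<lambda>eta. exp (\<i> * of_real (s * P [] eta)) * (a1 [] (s .* eta) * cnj (a2 [] (s .* eta)))"
  let ?f = "\<lambda>eta. complex_of_real (psi M r (eta - zeta)) * ?E eta"
  have contf: "continuous_on (cube zeta (2 * r)) ?f"
  proof -
   have 1: "continuous_on (cube zeta (2 * r)) (P [])"
    by (rule continuous_on_subset[OF jet_continuous_on[OF P(1)]])
     (use cube10 annulus_nonzero[of 10 lam] lam1 in force)
   have 2: "continuous_on (cube zeta (2 * r)) (\<lambda>eta. h [] (s .* eta))" if "jet UNIV h" for h :: "'n list => real^'n => complex"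
    by (rule continuous_on_compose2[OF jet_continuous_on[OF that]]) (auto intro: continuous_intros)
   have 3: "continuous_on (cube zeta (2 * r)) (\<lambda>eta. psi M r (eta - zeta))"
    by (rule continuous_on_compose2[OF continuous_on_psi[of UNIV]]) (auto intro: continuous_intros)
   show ?thesis by (intro continuous_intros 1 2 3 a)
  qed
  have contfr: "continuous_on (cube zeta r) ?f" using contf sub continuous_on_subset by blast
  have f0: "?f eta = 0" if "eta \<notin> cube zeta r" for eta using psi_eq_0[of M r eta zeta] that NM r1 by simp
  have fi: "?f = (\<lambda>eta. indicator (cube zeta r) eta .* ?f eta)" using f0 by (auto simp: indicator_def fun_eq_iff)
  have fm: "?f \<in> bmeas"
   by (subst fi, rule borel_measurable_continuous_on_indicator) (use contfr in auto)
  have fint: "integrable lborel ?f"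
   by (subst fi, rule borel_integrable_compact) (use contfr compact_cube in auto)
  have vol: "emeasure lborel (cube zeta r) = ennreal ((2 * r) ^ CARD('n))" using r1 by (intro emeasure_cube) auto
  have hb: "norm (h [] (s .* eta)) <= A" if "amp_bound N l A (annulus 100 lam) h" "eta \<in> annulus 10 lam"
   for h :: "'n list => real^'n => complex" and eta
   using that(1)[unfolded amp_bound_def, rule_format, of "[]", OF _ s100[OF that(2)]] by simp
  have K1A: "0 <= K1 * A^2" using K1 by simp
  show ?thesis
  proof (cases "c2 / r <= D")
   \<comment> \<open>Here r D < c2, so the claimed decay factor, which contains a power of c2 / (r
     D), is at least 1.\<close>
   case False
   have fb: "norm (?f eta) <= A^2 * indicator (cube zeta r) eta" for eta
   proof (cases "eta \<in> cube zeta r")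
    case True
    then have "eta \<in> annulus 10 lam" using cube10 sub by auto
    then have "cmod (a1 [] (s .* eta)) * cmod (a2 [] (s .* eta)) <= A * A"
     using hb a A by (intro mult_mono) auto
    moreover have "psi M r (eta - zeta) <= 1" using NM by (intro psi_le_1) auto
    ultimately have "psi M r (eta - zeta) * (cmod (a1 [] (s .* eta)) * cmod (a2 [] (s .* eta))) <= 1 * (A * A)"
     by - (rule mult_mono, auto simp: psi_nonneg)
    then show ?thesis using True by (simp add: norm_mult psi_nonneg power2_eq_square)
   qed (use f0 in simp)
   have "norm (LL eta. ?f eta) <= (LL eta. A^2 * indicator (cube zeta r) eta)"
    by (rule Bochner_Integration.integral_norm_bound_integral[OF fint _ fb]) (use vol in \<open>auto intro!: integrable_mult_right simp: integrable_indicator_iff\<close>)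
   also have "\<dots> = 1 * A^2 * (2 * r) ^ CARD('n) * 1" using vol r1 by (simp add: measure_def)
   also have "\<dots> <= (K0 + 1) * K1 * (A^2) * (2 * r) ^ CARD('n) * (2 * c2 / (r * D)) ^ N"
   proof -
    have "r * D <= 2 * c2" using False r1 c2 c1 by (auto simp: field_simps)
    then have 1: "1 <= (2 * c2 / (r * D)) ^ N" using r1 D by (intro one_le_power) (simp add: field_simps)
    have "1 * 1 <= (K0 + 1) * K1" using K0 K1 by (intro mult_mono) auto
    then show ?thesis using 1 r1 K0 K1 by (intro mult_mono) auto
   qed
   also have "\<dots> = K * A^2 * (2 * r) ^ CARD('n) * (1 / (r * D)) ^ N"
    unfolding K_def by (simp add: power_divide power_mult_distrib mult_ac)
   finally show ?thesis by (simp only: r_def D_def)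
  next
   case True
   define L where "L = c1 / r"
   have L: "L > 0" using c1 r1 by (simp add: L_def)
   have LD: "L <= D / 2"
   proof -
    have "2 * c1 / r <= c2 / r" using c2 r1 by (intro divide_right_mono) auto
    with True have "2 * c1 / r <= D" by linarith
    then have "2 * (c1 / r) <= D" by simp
    then show ?thesis unfolding L_def by linarith
   qed
   have PD: "D / 2 <= \<bar>P [i] eta\<bar>" if eta: "eta \<in> cube zeta (2 * r)" for eta
   proof -
    have "\<bar>P [i] eta - P [i] zeta\<bar> <= real CARD('n) * C / lam * norm (eta - zeta)"
     by (rule grad_variation[OF P _ _ C convex_cube[of zeta "2 * r"]])
      (use cube10 a10 lam1 r1 eta in \<open>auto simp: cube_def\<close>)
    also have "\<dots> <= n * C / lam * (n * (2 * r))"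
     using norm_cube[OF eta] C lam1 n unfolding n_def by (intro mult_left_mono) auto
    also have "\<dots> = (4 * n^2 * C / r) / 2" using rr[symmetric] r1 by (simp add: field_simps power2_eq_square)
    also have "\<dots> <= (c2 / r) / 2" using c2 r1 by (intro divide_right_mono) auto
    also have "\<dots> <= D / 2" using True by simp
    finally show ?thesis unfolding D_def by linarith
   qed
   have line: "norm (LL t. ?f (eta + t .* axis i 1)) <= (K0 + 1) * (K1 * A^2) * (2 * r) * (2 * L / D) ^ N"
    if eta: "eta \<in> cube zeta r" for eta
   proof -
    define c where "c = zeta $ i - eta $ i"
    let ?U = "{c - 2 * r<..<c + 2 * r}"
    let ?p = "\<lambda>t. eta + t .* axis i 1"
    have inc: "?p t \<in> cube zeta (2 * r)" if t: "t \<in> {c - 2 * r..c + 2 * r}" for t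
    proof -
     have "\<bar>?p t $ j - zeta $ j\<bar> <= 2 * r" for j
     proof (cases "j = i")
      case True
      then show ?thesis using t by (auto simp: c_def axis_def abs_le_iff)
     next
      case False
      then have "\<bar>?p t $ j - zeta $ j\<bar> = \<bar>eta $ j - zeta $ j\<bar>" by (simp add: axis_def)
      also have "\<dots> <= r" using eta by (simp add: cube_def)
      finally show ?thesis using r1 by linarith
     qed
     then show ?thesis by (simp add: cube_def)
    qed
    have inU: "?p t \<in> cube zeta (2 * r)" if "t \<in> ?U" for t using inc that by auto
    have in100: "?p t \<in> annulus 100 lam" if "t \<in> ?U" for t using cube10[OF inU[OF that]] a10 by auto
    have lam': "0 < lam" using lam1 by simp
    note pl = phase_line[of P N C lam ?U eta i, OF P lam' C in100]
    define w where "w = (\<Prod>j\<in>UNIV - {i}. bump M ((eta - zeta) $ j / r))"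
    have w: "\<bar>w\<bar> <= 1" unfolding w_def using NM
     by (subst abs_of_nonneg) (auto intro!: prod_nonneg prod_le_1 simp: bump_nonneg bump_le_1)
    let ?g = "\<lambda>t. (w .* complex_of_real (bump M ((t - c) / r))) * (a1 [] (s .* ?p t) * cnj (a2 [] (s .* ?p t)))"
    have feq: "?f (?p t) = exp (\<i> * of_real (s * P [] (?p t))) * ?g t" for t
     unfolding psi_line c_def w_def by (simp add: mult_ac scaleR_conv_of_real)
    have db: "dbd N B L ?U (\<lambda>t. complex_of_real (bump M ((t - c) / r)))"
    proof (rule dbd_of_real, rule dbd_mono_scale)
     show "dbd N B (real M / r) ?U (\<lambda>t. bump M ((t - c) / r))" unfolding B_def using NM r1 by (intro dbd_bump) auto
     show "real M / r <= L" unfolding L_def using c1 r1 by (intro divide_right_mono) auto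
    qed (use B r1 in auto)
    have dw: "dbd N B L ?U (\<lambda>t. w .* complex_of_real (bump M ((t - c) / r)))"
     by (rule dbd_mono[OF dbd_scaleR[OF db]]) (use w B L in \<open>auto intro: mult_left_le_one_le\<close>)
    have da: "dbd N A L ?U (\<lambda>t. h [] (s .* ?p t))" if h: "jet UNIV h" "amp_bound N l A (annulus 100 lam) h"
     for h :: "'n list => real^'n => complex"
    proof -
     have "dbd N A L ?U (\<lambda>t. h [] (s .* eta + t .* (s .* axis i 1)))"
     proof (rule dbd_jet[OF h(1)])
      have "(\<Sum>j\<in>UNIV. \<bar>(s .* axis i 1) $ j\<bar>) = s * (\<Sum>j\<in>UNIV. \<bar>axis i (1::real) $ j\<bar>)"
       unfolding sum_distrib_left using s by (intro sum.cong) (auto simp: abs_mult)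
      also have "\<dots> = s" by (simp add: sum_abs_axis)
      finally have "(\<Sum>j\<in>UNIV. \<bar>(s .* axis i 1) $ j\<bar>) * l = s * l" by simp
      also have "\<dots> <= 2 * (1 / r)" using s l r1 by (intro mult_mono) (auto simp: r_def field_simps)
      also have "\<dots> <= L" unfolding L_def using c1 r1 by (simp add: divide_right_mono)
      finally show "(\<Sum>j\<in>UNIV. \<bar>(s .* axis i 1) $ j\<bar>) * l <= L" .
      show "norm (h (\<beta> @ []) (s .* eta + t .* (s .* axis i 1))) <= A * l ^ length \<beta>"
       if "length \<beta> <= N" "t \<in> ?U" for \<beta> t
      proof -
       have "s .* eta + t .* (s .* axis i 1) = s .* ?p t" by (simp add: scaleR_add_right mult.commute)
       then have "s .* eta + t .* (s .* axis i 1) \<in> annulus 100 lam" using s100[OF cube10[OF inU[OF that(2)]]] by simp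
       then show ?thesis using h(2) that(1) unfolding amp_bound_def by simp
      qed
     qed (use l A in auto)
     then show ?thesis by (simp add: scaleR_add_right mult.commute)
    qed
    have "dbd N (2 ^ N * B * (2 ^ N * A * A)) L ?U ?g"
     by (rule dbd_mult[OF dw dbd_mult[OF da[OF a(1,3)] dbd_cnj[OF da[OF a(2,4)]]]]) (use A B L in auto)
    then have dg: "dbd N (K1 * A^2) L ?U ?g" by (simp add: K1_def power2_eq_square mult_ac)
    have g0: "?g t = 0" if "t \<notin> {c - r<..<c + r}" for t
    proof -
     have "bump M ((t - c) / r) = 0" using that NM r1 by (intro bump_eq_0) (auto simp: abs_if field_simps)
     then show ?thesis by simp
    qed
    have "(LL t. ?f (?p t)) = integral {c - r..c + r} (\<lambda>t. ?f (?p t))"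
    proof (rule integral_lborel_eq_interval)
     show "continuous_on {c - r..c + r} (\<lambda>t. ?f (?p t))"
      by (rule continuous_on_compose2[OF contf]) (use inc r1 in \<open>auto intro!: continuous_intros\<close>)
     show "?f (?p t) = 0" if "t \<notin> {c - r..c + r}" for t unfolding feq using g0[of t] that by auto
    qed
    also have "\<dots> = integral {c - r..c + r} (\<lambda>t. exp (\<i> * of_real (s * P [] (?p t))) * ?g t)"
     unfolding feq ..
    finally have "norm (LL t. ?f (?p t)) = norm (integral {c - r..c + r} (\<lambda>t. exp (\<i> * of_real (s * P [] (?p t))) * ?g t))"
     by (simp only:)
    also have "\<dots> <= K0 * (K1 * A^2) * ((c + r) - (c - r)) * (L / (D / 2)) ^ N"
    proof (rule ph)
     show "phase_data N (2 * C) (\<lambda>t. s * P [] (?p t)) (\<lambda>t. s * P [i] (?p t)) (\<lambda>t. s * P [i, i] (?p t)) ?g (K1 * A^2) (D / 2) L (c - r) (c + r) ?U"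
      unfolding phase_data_def
     proof (intro conjI ballI impI)
      show "((\<lambda>t. s * P [] (?p t)) has_vector_derivative s * P [i] (?p t)) (at t)" if "t \<in> ?U" for t
       by (rule has_vector_derivative_mult_right[OF pl(1)]) (use that in auto)
      show "((\<lambda>t. s * P [i] (?p t)) has_vector_derivative s * P [i, i] (?p t)) (at t)" if "t \<in> ?U" for t
       by (rule has_vector_derivative_mult_right[OF pl(2)]) (use that in auto)
      show "D / 2 <= \<bar>s * P [i] (?p t)\<bar>" if "t \<in> ?U" for t
      proof -
       have "1 * (D / 2) <= s * \<bar>P [i] (?p t)\<bar>" using s D PD[OF inU[OF that]] by (intro mult_mono) auto
       then show ?thesis using s by (simp add: abs_mult)
      qed
      have L2: "1 / lam <= L^2"
      proof -
       have "L^2 = c1^2 / lam" using rr by (simp add: L_def power_divide power2_eq_square)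
       moreover have "1 <= c1^2" using c1 by (intro one_le_power) auto
       ultimately show ?thesis using lam1 by (simp add: divide_right_mono)
      qed
      have L1: "1 / lam <= L"
      proof -
       have "1 / lam <= 1 / r" using rlam r1 by (intro divide_left_mono) auto
       also have "\<dots> <= L" unfolding L_def using c1 r1 by (intro divide_right_mono) auto
       finally show ?thesis .
      qed
      have "dbd N (C * (1 / lam)) L ?U (\<lambda>t. P [i, i] (?p t))"
       by (rule dbd_mono_scale[OF pl(3)]) (use C lam1 L1 in auto)
      then have "dbd N (\<bar>s\<bar> * (C * (1 / lam))) L ?U (\<lambda>t. s .* P [i, i] (?p t))" by (rule dbd_scaleR)
      then have "dbd N (2 * C * L^2) L ?U (\<lambda>t. s .* P [i, i] (?p t))"
      proof (rule dbd_mono)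
       have "\<bar>s\<bar> * (C * (1 / lam)) <= 2 * (C * L^2)" using s C L2 lam1 by (intro mult_mono mult_left_mono) auto
       then show "\<bar>s\<bar> * (C * (1 / lam)) <= 2 * C * L^2" by simp
      qed (use L in auto)
      then show "dbd N (2 * C * L^2) L ?U (\<lambda>t. s * P [i, i] (?p t))" by simp
      show "dbd N (K1 * A^2) L ?U ?g" by (rule dg)
      show "?g t = 0" if "t \<notin> {c - r<..<c + r}" for t using g0[OF that] .
     qed (use L LD K1A r1 in auto)
    qed
    also have "\<dots> <= (K0 + 1) * (K1 * A^2) * (2 * r) * (2 * L / D) ^ N"
    proof -
     have "K0 * (K1 * A^2) * ((c + r) - (c - r)) * (L / (D / 2)) ^ N = K0 * ((K1 * A^2) * (2 * r) * (2 * L / D) ^ N)"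
      by (simp add: mult.commute[of L 2])
     also have "\<dots> <= (K0 + 1) * ((K1 * A^2) * (2 * r) * (2 * L / D) ^ N)"
      using K1A r1 L D by (intro mult_right_mono) auto
     finally show ?thesis by (simp only: mult.assoc)
    qed
    finally show ?thesis .
   qed
   have "norm (LL eta. ?f eta) * (2 * r) <= ((K0 + 1) * (K1 * A^2) * (2 * r) * (2 * L / D) ^ N) * (2 * r) ^ CARD('n)"
    by (rule integral_line_bound[OF fm fint _ _ f0 line]) (use r1 K0 K1A L D in auto)
   then have "(2 * r) * norm (LL eta. ?f eta) <= (2 * r) * ((K0 + 1) * (K1 * A^2) * (2 * r) ^ CARD('n) * (2 * L / D) ^ N)"
    by (simp only: mult_ac)
   then have "norm (LL eta. ?f eta) <= (K0 + 1) * (K1 * A^2) * (2 * r) ^ CARD('n) * (2 * L / D) ^ N"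
    using r1 by (subst (asm) mult_le_cancel_left_pos) auto
   also have "\<dots> <= (K0 + 1) * (K1 * A^2) * (2 * r) ^ CARD('n) * (2 * c2 / (r * D)) ^ N"
   proof (intro mult_left_mono power_mono)
    have "2 * L / D = 2 * c1 / (r * D)" by (simp add: L_def)
    also have "\<dots> <= 2 * c2 / (r * D)" using c2 c1 r1 D by (intro divide_right_mono) auto
    finally show "2 * L / D <= 2 * c2 / (r * D)" .
   qed (use L D K0 K1A r1 in auto)
   also have "\<dots> = K * A^2 * (2 * r) ^ CARD('n) * (1 / (r * D)) ^ N"
    unfolding K_def by (simp add: power_divide power_mult_distrib mult_ac)
   finally show ?thesis by (simp only: r_def D_def)
  qed
 qed
 have K: "K >= 0" unfolding K_def using K0 K1 c2 c1 by simp
 show ?thesis by (intro exI[of _ K] conjI allI impI main K)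
qed

section \<open>Pointwise bounds for the kernel\<close>

text \<open>One frequency shell and one pair of space points: \<open>a1\<close> and
  \<open>a2\<close> are the amplitudes at the two points and \<open>P\<close> is the difference of
  the two phases. In the application \<open>l\<close> is lam to the power -rho and \<open>A\<close>
  a multiple of lam to the power m. The lower bound on \<open>lam\<close> makes the cubes small
  compared with the shell.\<close>

locale osc_setup =
 fixes N :: nat and C lam l A :: real
  and a1 a2 :: "'n::finite list => real^'n => complex" and P :: "'n list => real^'n => real"
 assumes a1: "jet UNIV a1" "amp_bound N l A (annulus 100 lam) a1"
  and a2: "jet UNIV a2" "amp_bound N l A (annulus 100 lam) a2"
  and P: "jet (-{0}) P" "phase_bound (N + 2) C lam P"
  and C: "0 <= C" and A: "0 <= A" and l: "0 < l" "1 <= lam * l"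
  and lam_large: "(200 * real CARD('n))^2 <= lam"
begin

abbreviation "r \<equiv> sqrt lam"

definition osc :: "(real^'n) \<times> (real^'n) \<times> real => complex" where
 "osc = (\<lambda>(zeta, eta, s). of_real (psi (Suc N) r (eta - zeta) * radial_bump (Suc N) s) *
   (exp (\<i> * of_real (s * P [] eta)) * (a1 [] (s .* eta) * cnj (a2 [] (s .* eta)))))"

text \<open>This is the kernel of the lifted operator composed with its adjoint. The weight
  \<open>\<Theta>\<close> depends on the centre alone, so it is differentiated neither in
  \<open>eta\<close> nor in \<open>s\<close> and may be rough.\<close>

definition kernel :: "(real^'n => real) => complex" where
 "kernel \<Theta> = (LL p. of_real (\<Theta> (fst p) * indicator (annulus 5 lam) (fst p)) * osc p)"

lemma card1: "real CARD('n) >= 1"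
 by (simp add: Suc_leI)

lemma r200: "200 * real CARD('n) <= r"
 using lam_large by (rule real_le_rsqrt)

lemma r1: "r >= 1"
 using r200 card1 by linarith

lemma lam1: "lam >= 1"
 using r1 by (metis real_sqrt_ge_1_iff)

lemma rr: "r * r = lam"
 using lam1 by simp

lemma ann10: assumes "(zeta::real^'n) \<in> annulus 5 lam" "eta \<in> cube zeta r" shows "eta \<in> annulus 10 lam"
proof -
 have "200 * real CARD('n) * r <= r * r" using r200 r1 by (intro mult_right_mono) auto
 then have "real CARD('n) * r <= lam / 100" using rr lam1 card1 by simp
 then have "norm (eta - zeta) <= lam / 100" using norm_cube[OF assms(2)] by linarith
 then show ?thesis using annulus_5_perturb[OF assms(1)] lam1 by auto
qed

lemma s100: assumes "(eta::real^'n) \<in> annulus 10 lam" "s \<in> {1..2}" shows "s .* eta \<in> annulus 100 lam"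
proof -
 have "1 * (lam / 10) <= s * norm eta" using assms lam1 by (intro mult_mono) (auto simp: annulus_def)
 moreover have "s * norm eta <= 2 * (10 * lam)" using assms lam1 by (intro mult_mono) (auto simp: annulus_def)
 ultimately show ?thesis using assms lam1 by (auto simp: annulus_def)
qed

lemma annulus_borel [measurable]: "annulus c lam \<in> sets borel"
 by (intro borel_closed compact_imp_closed compact_annulus)

lemma measurable_P [measurable]: "P al \<in> bmeas"
proof -
 have "(\<lambda>x. indicator (-{0}) x .* P al x) \<in> bmeas"
  by (intro borel_measurable_continuous_on_indicator jet_continuous_on[OF P(1)]) auto
 then have "(\<lambda>x. indicator (-{0}) x .* P al x + indicator {0} x * P al 0) \<in> bmeas"
  by measurable
 also have "(\<lambda>x. indicator (-{0}) x .* P al x + indicator {0} x * P al 0) = P al"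
  by (auto simp: indicator_def fun_eq_iff)
 finally show ?thesis .
qed

lemma measurable_a [measurable]: "a1 al \<in> bmeas" "a2 al \<in> bmeas"
 by (intro borel_measurable_continuous_onI jet_continuous_on a1 a2)+

lemma measurable_radial_bump [measurable]: "radial_bump M \<in> bmeas"
 unfolding radial_bump_def by measurable

lemma measurable_osc [measurable]: "osc \<in> bmeas"
proof -
 have 1: "(\<lambda>p::(real^'n) \<times> (real^'n) \<times> real. snd (snd p) .* fst (snd p)) \<in> bmeas"
  by (intro borel_measurable_continuous_onI continuous_intros)
 have 2: "(\<lambda>p::(real^'n) \<times> (real^'n) \<times> real. fst (snd p) - fst p) \<in> bmeas"
  by (intro borel_measurable_continuous_onI continuous_intros)
 have 3: "(\<lambda>p::(real^'n) \<times> (real^'n) \<times> real. fst (snd p)) \<in> bmeas"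
  "(\<lambda>p::(real^'n) \<times> (real^'n) \<times> real. snd (snd p)) \<in> bmeas"
  by (intro borel_measurable_continuous_onI continuous_intros)+
 note 4 = measurable_compose[OF 2 borel_measurable_psi[of "Suc N" r]] measurable_compose[OF 3(1) measurable_P[of "[]"]]
  measurable_compose[OF 3(2) measurable_radial_bump[of "Suc N"]] measurable_compose[OF 1 measurable_a(1)[of "[]"]]
  measurable_compose[OF 1 measurable_a(2)[of "[]"]]
 have 5: "(\<lambda>p::(real^'n) \<times> (real^'n) \<times> real. exp (\<i> * complex_of_real (snd (snd p) * P [] (fst (snd p))))) \<in> bmeas"
  by (intro measurable_compose[OF _ borel_measurable_exp] borel_measurable_times borel_measurable_const
    measurable_compose[OF _ borel_measurable_of_real] 3 4)
 have 6: "(\<lambda>p::(real^'n) \<times> (real^'n) \<times> real. cnj (a2 [] (snd (snd p) .* fst (snd p)))) \<in> bmeas"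
  by (rule measurable_compose[OF 4(5) borel_measurable_continuous_onI]) (intro continuous_intros)
 show ?thesis unfolding osc_def split_beta
  by (intro borel_measurable_times measurable_compose[OF _ borel_measurable_of_real] 4 5 6)
qed

lemma amp_le: assumes "eta \<in> annulus 10 lam" "s \<in> {1..2}"
 shows "norm (a1 [] (s .* eta) * cnj (a2 [] (s .* eta))) <= A^2"
proof -
 have "norm (a1 [] (s .* eta)) <= A" "norm (a2 [] (s .* eta)) <= A"
  using a1(2)[unfolded amp_bound_def, rule_format, of "[]", OF _ s100[OF assms]]
   a2(2)[unfolded amp_bound_def, rule_format, of "[]", OF _ s100[OF assms]] by auto
 then show ?thesis unfolding norm_mult complex_mod_cnj power2_eq_square by (rule mult_mono) (use A in auto)
qed

lemma radial_bump_bounds: "0 <= radial_bump (Suc N) s" "radial_bump (Suc N) s <= 1" "s \<notin> {1..2} ==> radial_bump (Suc N) s = 0"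
 using radial_bump_eq_0[of "Suc N" s] by (auto simp: radial_bump_def bump_nonneg bump_le_1)

lemma osc_bound: assumes "zeta \<in> annulus 5 lam"
 shows "norm (osc (zeta, eta, s)) <= A^2 * (indicator (cube zeta r) eta * indicator {1..2} s)"
proof (cases "eta \<in> cube zeta r \<and> s \<in> {1..2}")
 case True
 have "norm (osc (zeta, eta, s)) = (psi (Suc N) r (eta - zeta) * radial_bump (Suc N) s) * norm (a1 [] (s .* eta) * cnj (a2 [] (s .* eta)))"
  unfolding osc_def by (simp add: norm_mult psi_nonneg radial_bump_bounds)
 also have "\<dots> <= (1 * 1) * A^2"
  by (intro mult_mono amp_le ann10[OF assms]) (use True in \<open>auto simp: psi_nonneg psi_le_1 radial_bump_bounds\<close>)
 finally show ?thesis using True by simp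
next
 case False
 then have "psi (Suc N) r (eta - zeta) = 0 \<or> radial_bump (Suc N) s = 0"
  using psi_eq_0[of "Suc N" r eta zeta] r1 radial_bump_bounds(3)[of s] by auto
 then have "osc (zeta, eta, s) = 0" by (auto simp: osc_def)
 then show ?thesis by simp
qed

lemma bounded_cube: "bounded (cube zeta R)"
 using compact_cube compact_imp_bounded by blast

lemma osc_slice_measurable [measurable]: "(\<lambda>q. osc (zeta, q)) \<in> bmeas"
 by (rule measurable_compose[OF _ measurable_osc]) (intro borel_measurable_continuous_onI continuous_intros)

lemma osc_integrable: assumes zeta: "zeta \<in> annulus 5 lam" shows "integrable lborel (\<lambda>q. osc (zeta, q))"
proof (rule integrableI_bounded_set[of "cube zeta r \<times> {1..2}" _ _ "A^2"])
 have "cube zeta r \<times> {1..2::real} \<in> sets borel"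
  by (intro borel_closed closed_Times compact_imp_closed compact_cube) auto
 then show "cube zeta r \<times> {1..2::real} \<in> sets lborel" by simp
 show "emeasure lborel (cube zeta r \<times> {1..2::real}) < \<infinity>"
  by (intro emeasure_bounded_finite bounded_Times bounded_cube) auto
 show "AE q in lborel. q \<in> cube zeta r \<times> {1..2} --> norm (osc (zeta, q)) <= A^2"
 proof (intro AE_I2 impI)
  fix q :: "(real^'n) \<times> real" assume "q \<in> cube zeta r \<times> {1..2}"
  then show "norm (osc (zeta, q)) <= A^2" using osc_bound[OF zeta, of "fst q" "snd q"] by (auto simp: indicator_def)
 qed
 show "AE q in lborel. q \<notin> cube zeta r \<times> {1..2} --> osc (zeta, q) = 0"
 proof (intro AE_I2 impI)
  fix q :: "(real^'n) \<times> real" assume "q \<notin> cube zeta r \<times> {1..2}"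
  then have "norm (osc (zeta, q)) <= 0" using osc_bound[OF zeta, of "fst q" "snd q"] by (auto simp: indicator_def mem_Times_iff split: if_splits)
  then show "osc (zeta, q) = 0" by simp
 qed
qed measurable

text \<open>Fubini with the \<open>eta\<close>-integral inside, the form in which
  \<open>tangential_decay\<close> is applied.\<close>

lemma inner_tangential:
 assumes zeta: "zeta \<in> annulus 5 lam" and B: "0 <= B"
  and bd: "\<And>s. s \<in> {1..2} ==> norm (LL eta. of_real (psi (Suc N) r (eta - zeta)) * (exp (\<i> * of_real (s * P [] eta)) * (a1 [] (s .* eta) * cnj (a2 [] (s .* eta))))) <= B"
 shows "norm (LL q. osc (zeta, q)) <= B"
proof -
 have i: "integrable (lborel \<Otimes>\<^sub>M lborel) (\<lambda>(eta, s). osc (zeta, eta, s))"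
  using osc_integrable[OF zeta] unfolding lborel_prod by (simp add: case_prod_unfold)
 have "(LL q. osc (zeta, q)) = integral\<^sup>L (lborel \<Otimes>\<^sub>M lborel) (\<lambda>(eta, s). osc (zeta, eta, s))"
  unfolding lborel_prod by (simp add: case_prod_unfold)
 also have "\<dots> = (LL s. (LL eta. osc (zeta, eta, s)))"
  by (rule lborel_pair.integral_snd[OF i, symmetric])
 finally have eq: "(LL q. osc (zeta, q)) = (LL s. (LL eta. osc (zeta, eta, s)))" .
 have b: "norm (LL eta. osc (zeta, eta, s)) <= B * indicator {1..2} s" for s
 proof -
  have "(LL eta. osc (zeta, eta, s)) = (LL eta. of_real (radial_bump (Suc N) s) * (of_real (psi (Suc N) r (eta - zeta)) * (exp (\<i> * of_real (s * P [] eta)) * (a1 [] (s .* eta) * cnj (a2 [] (s .* eta))))))"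
   by (intro Bochner_Integration.integral_cong) (auto simp: osc_def mult_ac)
  also have "\<dots> = of_real (radial_bump (Suc N) s) * (LL eta. of_real (psi (Suc N) r (eta - zeta)) * (exp (\<i> * of_real (s * P [] eta)) * (a1 [] (s .* eta) * cnj (a2 [] (s .* eta)))))"
   by (rule integral_mult_right_zero)
  finally have e: "norm (LL eta. osc (zeta, eta, s)) = radial_bump (Suc N) s * norm (LL eta. of_real (psi (Suc N) r (eta - zeta)) * (exp (\<i> * of_real (s * P [] eta)) * (a1 [] (s .* eta) * cnj (a2 [] (s .* eta)))))"
   by (simp only: norm_mult norm_of_real abs_of_nonneg radial_bump_bounds(1))
  show ?thesis
  proof (cases "s \<in> {1..2}")
   case True
   have "norm (LL eta. osc (zeta, eta, s)) <= 1 * B"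
    unfolding e by (rule mult_mono) (use bd[OF True] radial_bump_bounds in auto)
   then show ?thesis using True by simp
  next
   case False
   then show ?thesis unfolding e radial_bump_bounds(3)[OF False] by simp
  qed
 qed
 have "norm (LL s. (LL eta. osc (zeta, eta, s))) <= (LL s. B * indicator {1..2::real} s)"
 proof (rule Bochner_Integration.integral_norm_bound_integral)
  show "integrable lborel (\<lambda>s. \<integral>eta. osc (zeta, eta, s) \<partial>lborel)"
   by (rule lborel_pair.integrable_snd[OF i])
 qed (use b in \<open>auto intro!: integrable_mult_right simp: integrable_indicator_iff\<close>)
 then show ?thesis unfolding eq by simp
qed

text \<open>Fubini with the \<open>s\<close>-integral inside. The bound \<open>R\<close> may vary
  with \<open>eta\<close>, because the radial gain depends on the size of the phase difference at
  \<open>eta\<close>.\<close>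

lemma inner_radial:
 assumes zeta: "zeta \<in> annulus 5 lam" and R0: "\<And>eta. 0 <= R eta"
  and bd: "\<And>eta. eta \<in> annulus 10 lam ==> norm (integral {1..2} (\<lambda>s. exp (\<i> * of_real (s * P [] eta)) * (of_real (radial_bump (Suc N) s) * (a1 [] (s .* eta) * cnj (a2 [] (s .* eta)))))) <= R eta"
 shows "ennreal (norm (LL q. osc (zeta, q))) <= (NN eta. ennreal (indicator (cube zeta r) eta * R eta))"
proof -
 have i: "integrable (lborel \<Otimes>\<^sub>M lborel) (\<lambda>(eta, s). osc (zeta, eta, s))"
  using osc_integrable[OF zeta] unfolding lborel_prod by (simp add: case_prod_unfold)
 have "(LL q. osc (zeta, q)) = integral\<^sup>L (lborel \<Otimes>\<^sub>M lborel) (\<lambda>(eta, s). osc (zeta, eta, s))"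
  unfolding lborel_prod by (simp add: case_prod_unfold)
 also have "\<dots> = (LL eta. (LL s. osc (zeta, eta, s)))"
  by (rule lborel_pair.integral_fst[OF i, symmetric])
 finally have eq: "(LL q. osc (zeta, q)) = (LL eta. (LL s. osc (zeta, eta, s)))" .
 have b: "norm (LL s. osc (zeta, eta, s)) <= indicator (cube zeta r) eta * R eta" for eta
 proof (cases "eta \<in> cube zeta r")
  case True
  let ?g = "\<lambda>s. exp (\<i> * of_real (s * P [] eta)) * (of_real (radial_bump (Suc N) s) * (a1 [] (s .* eta) * cnj (a2 [] (s .* eta))))"
  have "(LL s. osc (zeta, eta, s)) = (LL s. of_real (psi (Suc N) r (eta - zeta)) * ?g s)"
   by (intro Bochner_Integration.integral_cong) (auto simp: osc_def mult_ac)
  also have "\<dots> = of_real (psi (Suc N) r (eta - zeta)) * (LL s. ?g s)"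
   by (rule integral_mult_right_zero)
  also have "(LL s. ?g s) = integral {1..2} ?g"
  proof (rule integral_lborel_eq_interval)
   have ch: "continuous_on {1..2} (\<lambda>s. h [] (s .* eta))" if "jet UNIV h" for h :: "'n list => real^'n => complex"
    by (rule continuous_on_compose2[OF jet_continuous_on[OF that]]) (auto intro: continuous_intros)
   show "continuous_on {1..2} ?g"
    unfolding radial_bump_def divide_inverse by (intro continuous_intros ch[OF a1(1)] ch[OF a2(1)])
  qed (simp add: radial_bump_bounds(3))
  finally have e: "norm (LL s. osc (zeta, eta, s)) = psi (Suc N) r (eta - zeta) * norm (integral {1..2} ?g)"
   by (simp only: norm_mult norm_of_real abs_of_nonneg psi_nonneg)
  have "norm (LL s. osc (zeta, eta, s)) <= 1 * R eta"
   unfolding e by (rule mult_mono) (use bd[OF ann10[OF zeta True]] psi_le_1 psi_nonneg in auto)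
  then show ?thesis using True by simp
 next
  case False
  then have "osc (zeta, eta, s) = 0" for s
   using psi_eq_0[of "Suc N" r eta zeta] r1 by (simp add: osc_def)
  then show ?thesis using R0[of eta] by simp
 qed
 have "ennreal (norm (LL eta. (LL s. osc (zeta, eta, s)))) <= (NN eta. ennreal (norm (LL s. osc (zeta, eta, s))))"
  by (rule integral_norm_bound_ennreal[OF lborel_pair.integrable_fst[OF i]])
 also have "\<dots> <= (NN eta. ennreal (indicator (cube zeta r) eta * R eta))"
  by (intro nn_integral_mono ennreal_leI b)
 finally show ?thesis unfolding eq .
qed

text \<open>In the centre variable only absolute values are taken; no cancellation is sought
  there.\<close>

lemma kernel_outer:
 assumes [measurable]: "\<Theta> \<in> bmeas" and \<Theta>: "\<And>zeta. 0 <= \<Theta> zeta" "\<And>zeta. \<Theta> zeta <= 1"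
 shows "ennreal (norm (kernel \<Theta>)) <= (NN zeta. ennreal (\<Theta> zeta * indicator (annulus 5 lam) zeta) * ennreal (norm (LL q. osc (zeta, q))))"
proof -
 let ?G = "\<lambda>p. complex_of_real (\<Theta> (fst p) * indicator (annulus 5 lam) (fst p)) * osc p"
 have fstm: "(fst :: (real^'n) \<times> (real^'n) \<times> real => _) \<in> bmeas"
  by (intro borel_measurable_continuous_onI continuous_intros)
 have m: "?G \<in> bmeas"
  by (intro borel_measurable_times borel_measurable_of_real measurable_osc measurable_compose[OF fstm] borel_measurable_indicator) auto
 let ?S = "cball 0 (5 * lam) \<times> cball 0 (10 * lam) \<times> {1..2} :: ((real^'n) \<times> (real^'n) \<times> real) set"
 have G0: "norm (?G p) <= A^2 * indicator ?S p" for p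
 proof (cases "fst p \<in> annulus 5 lam")
  case True
  obtain zeta eta s where p: "p = (zeta, eta, s)" by (cases p) auto
  have "norm (?G p) = \<Theta> zeta * norm (osc (zeta, eta, s))" using True \<Theta> p by (simp add: norm_mult)
  also have "\<dots> <= 1 * (A^2 * (indicator (cube zeta r) eta * indicator {1..2} s))"
   by (rule mult_mono) (use \<Theta> True p osc_bound in auto)
  also have "\<dots> <= A^2 * indicator ?S p"
   using ann10[of zeta eta] True p by (auto simp: indicator_def annulus_def)
  finally show ?thesis .
 qed simp
 have "integrable lborel ?G"
 proof (rule integrableI_bounded_set[of ?S _ _ "A^2"])
  have "closed ?S" by (intro closed_Times) auto
  then show "?S \<in> sets lborel" by simp
  show "emeasure lborel ?S < \<infinity>" by (intro emeasure_bounded_finite bounded_Times) auto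
  show "AE p in lborel. p \<in> ?S --> norm (?G p) <= A^2"
   using G0 by (intro AE_I2 impI) (metis indicator_simps(1) mult.right_neutral)
  show "AE p in lborel. p \<notin> ?S --> ?G p = 0"
  proof (intro AE_I2 impI)
   fix p assume "p \<notin> ?S"
   then have "norm (?G p) <= 0" using G0[of p] by (simp only: indicator_simps(2) mult_zero_right if_False not_False_eq_True)
   then show "?G p = 0" by simp
  qed
 qed (use m in auto)
 then have i: "integrable (lborel \<Otimes>\<^sub>M lborel) (\<lambda>(zeta, q). ?G (zeta, q))"
  unfolding lborel_prod by (simp add: case_prod_unfold)
 have "kernel \<Theta> = integral\<^sup>L (lborel \<Otimes>\<^sub>M lborel) (\<lambda>(zeta, q). ?G (zeta, q))"
  unfolding kernel_def lborel_prod by (simp add: case_prod_unfold)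
 also have "\<dots> = (LL zeta. (LL q. ?G (zeta, q)))"
  by (rule lborel_pair.integral_fst[OF i, symmetric])
 finally have eq: "kernel \<Theta> = (LL zeta. (LL q. ?G (zeta, q)))" .
 have "ennreal (norm (kernel \<Theta>)) <= (NN zeta. ennreal (norm (LL q. ?G (zeta, q))))"
  unfolding eq by (rule integral_norm_bound_ennreal[OF lborel_pair.integrable_fst[OF i]])
 also have "\<dots> = (NN zeta. ennreal (\<Theta> zeta * indicator (annulus 5 lam) zeta) * ennreal (norm (LL q. osc (zeta, q))))"
 proof (rule nn_integral_cong)
  fix zeta :: "real^'n"
  have "(LL q. ?G (zeta, q)) = complex_of_real (\<Theta> zeta * indicator (annulus 5 lam) zeta) * (LL q. osc (zeta, q))"
   unfolding fst_conv by (rule integral_mult_right_zero)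
  then have "norm (LL q. ?G (zeta, q)) = \<Theta> zeta * indicator (annulus 5 lam) zeta * norm (LL q. osc (zeta, q))"
   using \<Theta> by (simp add: norm_mult)
  then show "ennreal (norm (LL q. ?G (zeta, q))) = ennreal (\<Theta> zeta * indicator (annulus 5 lam) zeta) * ennreal (norm (LL q. osc (zeta, q)))"
   using \<Theta> by (simp only: ennreal_mult' mult_nonneg_nonneg norm_ge_zero indicator_pos_le ennreal_mult)
 qed
 finally show ?thesis .
qed

lemma emeasure_annulus_5: "emeasure lborel (annulus 5 lam :: (real^'n) set) <= ennreal ((10 * lam) ^ CARD('n))"
proof -
 have "emeasure lborel (annulus 5 lam :: (real^'n) set) <= emeasure lborel (cube (0::real^'n) (5 * lam))"
 proof (rule emeasure_mono)
  show "annulus 5 lam \<subseteq> cube (0::real^'n) (5 * lam)"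
   unfolding annulus_def cube_def using component_le_norm_cart order_trans by fastforce
 qed (auto simp: cube_eq_cbox)
 also have "\<dots> = ennreal ((10 * lam) ^ CARD('n))" using lam1 by (subst emeasure_cube) auto
 finally show ?thesis .
qed

lemma kernel_uniform:
 assumes \<Theta>: "\<Theta> \<in> bmeas" "\<And>zeta. 0 <= \<Theta> zeta" "\<And>zeta. \<Theta> zeta <= 1" and B: "0 <= B"
  and bd: "\<And>zeta. zeta \<in> annulus 5 lam ==> \<Theta> zeta ~= 0 ==> norm (LL q. osc (zeta, q)) <= B"
 shows "norm (kernel \<Theta>) <= (10 * lam) ^ CARD('n) * B"
proof -
 have "ennreal (norm (kernel \<Theta>)) <= (NN zeta. ennreal (\<Theta> zeta * indicator (annulus 5 lam) zeta) * ennreal (norm (LL q. osc (zeta, q))))"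
  by (rule kernel_outer[OF \<Theta>])
 also have "\<dots> <= (NN zeta. ennreal B * indicator (annulus 5 lam :: (real^'n) set) zeta)"
 proof (rule nn_integral_mono)
  fix zeta :: "real^'n"
  show "ennreal (\<Theta> zeta * indicator (annulus 5 lam) zeta) * ennreal (norm (LL q. osc (zeta, q))) <= ennreal B * indicator (annulus 5 lam) zeta"
  proof (cases "zeta \<in> annulus 5 lam \<and> \<Theta> zeta ~= 0")
   case True
   have "\<Theta> zeta * norm (LL q. osc (zeta, q)) <= 1 * B"
    by (rule mult_mono) (use \<Theta> bd True in auto)
   then have "ennreal (\<Theta> zeta * norm (LL q. osc (zeta, q))) <= ennreal B" by (intro ennreal_leI) simp
   then show ?thesis using True \<Theta> by (simp add: ennreal_mult)
  qed auto
 qed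
 also have "\<dots> = ennreal B * emeasure lborel (annulus 5 lam :: (real^'n) set)"
  by (rule nn_integral_cmult_indicator) (simp add: annulus_borel)
 also have "\<dots> <= ennreal B * ennreal ((10 * lam) ^ CARD('n))"
  by (intro mult_left_mono emeasure_annulus_5) auto
 also have "\<dots> = ennreal ((10 * lam) ^ CARD('n) * B)" using B lam1 by (simp add: ennreal_mult mult.commute)
 finally show ?thesis using B lam1 by (subst (asm) ennreal_le_iff) auto
qed

end

section \<open>Kernel bounds from sublevel sets of the phase difference\<close>

context osc_setup
begin

lemma sublevel_set_closed: "closed {eta\<in>annulus 20 lam. \<bar>P [] eta\<bar> <= H \<and> D <= \<bar>P [i] eta\<bar>}"
proof -
 have cl: "closed (annulus 20 lam :: (real^'n) set)" using compact_annulus compact_imp_closed by blast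
 have cv: "closed ((\<lambda>eta. \<bar>P al eta\<bar>) -` B \<inter> annulus 20 lam)" if "closed B" for B al
 proof -
  have "annulus 20 lam \<subseteq> - {0::real^'n}" using annulus_nonzero[of 20 lam] lam1 by auto
  then have "continuous_on (annulus 20 lam) (\<lambda>eta. \<bar>P al eta\<bar>)"
   by (intro continuous_on_rabs continuous_on_subset[OF jet_continuous_on[OF P(1)]])
  then show ?thesis using continuous_on_closed_vimage[OF cl] that by blast
 qed
 have "closed (((\<lambda>eta. \<bar>P [] eta\<bar>) -` {..H} \<inter> annulus 20 lam) \<inter> ((\<lambda>eta. \<bar>P [i] eta\<bar>) -` {D..} \<inter> annulus 20 lam))"
  by (intro closed_Int cv closed_atMost closed_atLeast)
 moreover have "((\<lambda>eta. \<bar>P [] eta\<bar>) -` {..H} \<inter> annulus 20 lam) \<inter> ((\<lambda>eta. \<bar>P [i] eta\<bar>) -` {D..} \<inter> annulus 20 lam)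
   = {eta\<in>annulus 20 lam. \<bar>P [] eta\<bar> <= H \<and> D <= \<bar>P [i] eta\<bar>}" by auto
 ultimately show ?thesis by simp
qed

text \<open>The gradient is known at the centre, the smallness of \<open>P\<close> at another point
  of the cube. If some partial at the centre dominates the variation \<open>g\<close> over the cube,
  it survives at \<open>zeta + z\<close>, which then lies in a sublevel set. Otherwise all partials
  are O(g) on the cube, so \<open>P\<close> changes by at most 3 n^4 C <= H, and the centre itself
  lies in the set with threshold 2H. The second alternative is the one that copes with gradients
  below 1 / sqrt lam.\<close>

lemma shifted_sublevel:
 fixes zeta z :: "real^'n"
 assumes zeta: "zeta \<in> annulus 5 lam" and z: "z \<in> cube 0 r" and H: "3 * real CARD('n) ^ 4 * C <= H"
  and Pz: "\<bar>P [] (zeta + z)\<bar> <= H" and D: "D <= \<bar>P [i] zeta\<bar>" "0 < D"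
 shows "\<exists>i. zeta + z \<in> {eta\<in>annulus 20 lam. \<bar>P [] eta\<bar> <= 2 * H \<and> D / 2 <= \<bar>P [i] eta\<bar>} \<or>
  zeta \<in> {eta\<in>annulus 20 lam. \<bar>P [] eta\<bar> <= 2 * H \<and> D / 2 <= \<bar>P [i] eta\<bar>}"
proof -
 let ?n = "real CARD('n)"
 \<comment> \<open>The variation of a first partial over the cube: Lipschitz constant n C / lam
   times the diameter bound n r.\<close>
 define g where "g = ?n^2 * C / r"
 have g: "g >= 0" using C r1 by (simp add: g_def)
 have zc: "zeta + z \<in> cube zeta r" using z by (simp add: cube_def)
 have zetac: "zeta \<in> cube zeta r" using r1 by (simp add: cube_def)
 have c10: "cube zeta r \<subseteq> annulus 10 lam" using ann10[OF zeta] by auto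
 have sub: "annulus 10 lam \<subseteq> (annulus 20 lam :: (real^'n) set)" "annulus 10 lam \<subseteq> (annulus 100 lam :: (real^'n) set)"
  using lam1 by (intro annulus_mono; simp)+
 have c100: "cube zeta r \<subseteq> annulus 100 lam" using c10 sub by auto
 have H0: "0 <= H" using Pz by linarith
 have var: "\<bar>P [j] eta - P [j] zeta\<bar> <= g" if "eta \<in> cube zeta r" for j eta
 proof -
  have "\<bar>P [j] eta - P [j] zeta\<bar> <= ?n * C / lam * norm (eta - zeta)"
   by (rule grad_variation[OF P _ _ C convex_cube c100 zetac that]) (use lam1 in auto)
  also have "\<dots> <= ?n * C / lam * (?n * r)"
   using norm_cube[OF that] C lam1 by (intro mult_left_mono) auto
  also have "\<dots> = g"
  proof -
   have "?n * C / (x * x) * (?n * x) = ?n^2 * C / x" if "x >= 1" for x :: real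
    using that by (simp add: field_simps power2_eq_square)
   from this[OF r1] show ?thesis unfolding g_def by (simp only: rr)
  qed
  finally show ?thesis .
 qed
 show ?thesis
 proof (cases "\<exists>j. 2 * g <= \<bar>P [j] zeta\<bar> \<and> D <= \<bar>P [j] zeta\<bar>")
  case True
  then obtain j where j: "2 * g <= \<bar>P [j] zeta\<bar>" "D <= \<bar>P [j] zeta\<bar>" by blast
  have "\<bar>P [j] zeta\<bar> - g <= \<bar>P [j] (zeta + z)\<bar>" using var[OF zc, of j] by linarith
  then have "D / 2 <= \<bar>P [j] (zeta + z)\<bar>" using j by linarith
  then show ?thesis using Pz H0 zc c10 sub by auto
 next
  case False
  have small: "\<bar>P [j] zeta\<bar> <= 2 * g" for j
  proof (rule ccontr)
   assume a: "\<not> \<bar>P [j] zeta\<bar> <= 2 * g"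
   then have "\<not> D <= \<bar>P [j] zeta\<bar>" using False by auto
   moreover have "\<bar>P [i] zeta\<bar> < 2 * g" using False D by force
   ultimately show False using a D by linarith
  qed
  have "norm (P [] (zeta + z) - P [] zeta) <= (?n * (3 * g)) * norm (zeta + z - zeta)"
  proof (rule differentiable_bound[OF convex_cube[of zeta r] _ _ zc zetac])
   fix xi assume xi: "xi \<in> cube zeta r"
   then have "xi \<in> -{0}" using c100 annulus_nonzero[of 100 lam xi] lam1 by auto
   then show "(P [] has_derivative (\<lambda>v. \<Sum>j\<in>UNIV. (v $ j) .* P [j] xi)) (at xi within cube zeta r)"
    using P(1) unfolding jet_def by (blast intro: has_derivative_at_withinI)
   show "onorm (\<lambda>v. \<Sum>j\<in>UNIV. (v $ j) .* P [j] xi) <= ?n * (3 * g)"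
   proof (rule onorm_le)
    fix v :: "real^'n"
    have b: "\<bar>P [j] xi\<bar> <= 3 * g" for j using var[OF xi, of j] small[of j] by linarith
    have "norm (\<Sum>j\<in>UNIV. (v $ j) .* P [j] xi) <= (\<Sum>j\<in>UNIV. \<bar>v $ j\<bar> * (3 * g))"
    proof (rule order_trans[OF norm_sum sum_mono])
     show "norm ((v $ j) .* P [j] xi) <= \<bar>v $ j\<bar> * (3 * g)" for j
      unfolding norm_scaleR by (rule mult_left_mono) (use b[of j] in auto)
    qed
    also have "\<dots> = (\<Sum>j\<in>UNIV. \<bar>v $ j\<bar>) * (3 * g)" by (simp only: sum_distrib_right)
    also have "\<dots> <= (?n * norm v) * (3 * g)"
     using sum_abs_le_norm g by (intro mult_right_mono) auto
    finally show "norm (\<Sum>j\<in>UNIV. (v $ j) .* P [j] xi) <= ?n * (3 * g) * norm v" by (simp add: mult_ac)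
   qed
  qed
  also have "\<dots> <= (?n * (3 * g)) * (?n * r)"
   using norm_cube[OF zc] g by (intro mult_left_mono) auto
  also have "\<dots> = 3 * ?n ^ 4 * C"
  proof -
   have "(?n * (3 * (?n^2 * C / x))) * (?n * x) = 3 * ?n ^ 4 * C" if "x >= 1" for x :: real
    using that by (simp add: field_simps power2_eq_square power4_eq_xxxx)
   from this[OF r1] show ?thesis unfolding g_def .
  qed
  also have "\<dots> <= H" by (rule H)
  finally have "\<bar>P [] (zeta + z) - P [] zeta\<bar> <= H" unfolding real_norm_def .
  then have "\<bar>P [] zeta\<bar> <= 2 * H" using Pz by linarith
  moreover have "D / 2 <= \<bar>P [i] zeta\<bar>" using D by linarith
  ultimately show ?thesis using zetac c10 sub by blast
 qed
qed

lemma radial_trivial: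
 assumes eta: "eta \<in> annulus 10 lam"
 shows "norm (integral {1..2} (\<lambda>s. exp (\<i> * of_real (s * P [] eta)) * (of_real (radial_bump (Suc N) s) * (a1 [] (s .* eta) * cnj (a2 [] (s .* eta)))))) <= A^2"
  (is "norm (integral _ ?F) <= _")
proof (cases "?F integrable_on {1..2}")
 case True
 have b: "norm (?F s) <= A^2" if "s \<in> cbox 1 2" for s
 proof -
  have s: "s \<in> {1..2}" using that by simp
  have "norm (?F s) = radial_bump (Suc N) s * norm (a1 [] (s .* eta) * cnj (a2 [] (s .* eta)))"
   by (simp add: norm_mult radial_bump_bounds)
  also have "\<dots> <= 1 * A^2" by (rule mult_mono) (use radial_bump_bounds amp_le[OF eta s] in auto)
  finally show ?thesis by simp
 qed
 show ?thesis using has_integral_bound[of "A^2" ?F "integral {1..2} ?F" 1 2] True b by auto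
qed (auto simp: not_integrable_integral)

text \<open>Where |P| > H the radial integral gains \<open>k0\<close>; where |P| <= H nothing is
  gained, but pairs of a centre and a point with small \<open>P\<close> are rare by
  \<open>shifted_sublevel\<close>.\<close>

lemma kernel_sublevel:
 assumes \<Theta>: "\<Theta> \<in> bmeas" "\<And>zeta. 0 <= \<Theta> zeta" "\<And>zeta. \<Theta> zeta <= 1"
  and D: "0 < D" "\<And>zeta. zeta \<in> annulus 5 lam ==> \<Theta> zeta ~= 0 ==> \<exists>i. D <= \<bar>P [i] zeta\<bar>"
  and H: "3 * real CARD('n) ^ 4 * C <= H" and k0: "0 <= k0" and V0: "0 <= V"
  and bd: "\<And>eta. eta \<in> annulus 10 lam ==> norm (integral {1..2} (\<lambda>s. exp (\<i> * of_real (s * P [] eta)) * (of_real (radial_bump (Suc N) s) * (a1 [] (s .* eta) * cnj (a2 [] (s .* eta)))))) <= A^2 * (if \<bar>P [] eta\<bar> <= H then 1 else k0)"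
  and V: "\<And>i. emeasure lborel {eta\<in>annulus 20 lam. \<bar>P [] eta\<bar> <= 2 * H \<and> D / 2 <= \<bar>P [i] eta\<bar>} <= ennreal V"
 shows "norm (kernel \<Theta>) <= A^2 * (2 * r) ^ CARD('n) * (k0 * (10 * lam) ^ CARD('n) + 2 * real CARD('n) * V)"
proof -
 let ?Z = "{zeta\<in>annulus 5 lam. \<exists>i. D <= \<bar>P [i] zeta\<bar>} :: (real^'n) set"
 let ?E = "\<lambda>i. {eta\<in>annulus 20 lam. \<bar>P [] eta\<bar> <= 2 * H \<and> D / 2 <= \<bar>P [i] eta\<bar>}"
 let ?B = "{eta. \<bar>P [] eta\<bar> <= H}"
 have Em[measurable]: "?E i \<in> sets borel" for i using sublevel_set_closed by auto
 have Bm[measurable]: "?B \<in> sets borel" by measurable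
 have Zm[measurable]: "?Z \<in> sets borel" by measurable
 define w where "w = (\<lambda>eta. ennreal (A^2) * (ennreal k0 + indicator ?B eta))"
 have wm[measurable]: "w \<in> bmeas" unfolding w_def by measurable
 have "ennreal (norm (kernel \<Theta>)) <= (NN zeta. ennreal (\<Theta> zeta * indicator (annulus 5 lam) zeta) * ennreal (norm (LL q. osc (zeta, q))))"
  by (rule kernel_outer[OF \<Theta>])
 also have "\<dots> <= (NN zeta. (NN z. indicator ?Z zeta * (indicator (cube 0 r) z * w (z + zeta))))"
 proof (rule nn_integral_mono)
  fix zeta :: "real^'n"
  show "ennreal (\<Theta> zeta * indicator (annulus 5 lam) zeta) * ennreal (norm (LL q. osc (zeta, q))) <= (NN z. indicator ?Z zeta * (indicator (cube 0 r) z * w (z + zeta)))"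
  proof (cases "zeta \<in> annulus 5 lam \<and> \<Theta> zeta ~= 0")
   case True
   then have Z: "zeta \<in> ?Z" using D(2) by auto
   have "ennreal (\<Theta> zeta * indicator (annulus 5 lam) zeta) <= ennreal 1"
    using \<Theta>(3)[of zeta] True by (intro ennreal_leI) auto
   then have "ennreal (\<Theta> zeta * indicator (annulus 5 lam) zeta) * ennreal (norm (LL q. osc (zeta, q))) <= 1 * ennreal (norm (LL q. osc (zeta, q)))"
    by (intro mult_right_mono) auto
   also have "\<dots> <= (NN eta. ennreal (indicator (cube zeta r) eta * (A^2 * (if \<bar>P [] eta\<bar> <= H then 1 else k0))))"
    unfolding mult_1 by (rule inner_radial) (use True k0 bd in auto)
   also have "\<dots> <= (NN eta. indicator (cube zeta r) eta * w eta)"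
   proof (rule nn_integral_mono)
    fix eta :: "real^'n"
    have "ennreal (A^2 * (if \<bar>P [] eta\<bar> <= H then 1 else k0)) = ennreal (A^2) * ennreal (if \<bar>P [] eta\<bar> <= H then 1 else k0)"
     using k0 by (intro ennreal_mult) auto
    also have "\<dots> <= w eta" unfolding w_def by (intro mult_left_mono) auto
    finally show "ennreal (indicator (cube zeta r) eta * (A^2 * (if \<bar>P [] eta\<bar> <= H then 1 else k0))) <= indicator (cube zeta r) eta * w eta"
     by (cases "eta \<in> cube zeta r") simp_all
   qed
   also have "\<dots> = (NN z. indicator (cube zeta r) (z + zeta) * w (z + zeta))"
    by (rule nn_integral_lborel_translate[symmetric]) measurable
   also have "\<dots> = (NN z. indicator ?Z zeta * (indicator (cube 0 r) z * w (z + zeta)))"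
    using Z by (intro nn_integral_cong) (simp add: indicator_def cube_def)
   finally show ?thesis .
  qed auto
 qed
 \<comment> \<open>With the offset \<open>z\<close> fixed, the bad centres lie in n sublevel sets
   and their translates by \<open>z\<close>, each of measure at most \<open>V\<close>.\<close>
 also have "\<dots> = (NN z. (NN zeta. indicator ?Z zeta * (indicator (cube 0 r) z * w (z + zeta))))"
  by (rule lborel_pair.Fubini'[of "\<lambda>z zeta. indicator ?Z zeta * (indicator (cube 0 r) z * w (z + zeta))"])
   (simp only: measurable_lborel_pair case_prod_beta, measurable)
 also have "\<dots> <= (NN z. ennreal (A^2 * (k0 * (10 * lam) ^ CARD('n) + 2 * real CARD('n) * V)) * indicator (cube (0::real^'n) r) z)"
 proof (rule nn_integral_mono)
  fix z :: "real^'n"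
  show "(NN zeta. indicator ?Z zeta * (indicator (cube 0 r) z * w (z + zeta))) <= ennreal (A^2 * (k0 * (10 * lam) ^ CARD('n) + 2 * real CARD('n) * V)) * indicator (cube 0 r) z"
  proof (cases "z \<in> cube 0 r")
   case True
   let ?Y = "{zeta\<in>?Z. z + zeta \<in> ?B}"
   have Ym[measurable]: "?Y \<in> sets borel" by measurable
   have "(NN zeta. indicator ?Z zeta * (indicator (cube 0 r) z * w (z + zeta))) = (NN zeta. ennreal (A^2) * (ennreal k0 * indicator ?Z zeta + indicator ?Y zeta))"
    using True by (intro nn_integral_cong) (auto simp: w_def indicator_def)
   also have "\<dots> = ennreal (A^2) * (ennreal k0 * emeasure lborel ?Z + emeasure lborel ?Y)"
    by (subst nn_integral_cmult, measurable) (subst nn_integral_add, measurable, simp add: nn_integral_cmult_indicator)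
   also have "emeasure lborel ?Z <= ennreal ((10 * lam) ^ CARD('n))"
    by (rule order_trans[OF emeasure_mono emeasure_annulus_5]) auto
   also have "emeasure lborel ?Y <= ennreal (2 * real CARD('n) * V)"
   proof -
    have "?Y \<subseteq> (\<Union>i\<in>UNIV. (\<lambda>zeta. zeta + z) -` ?E i \<union> ?E i)"
    proof
     fix zeta assume "zeta \<in> ?Y"
     then obtain i where i: "zeta \<in> annulus 5 lam" "D <= \<bar>P [i] zeta\<bar>" "\<bar>P [] (zeta + z)\<bar> <= H"
      by (auto simp: add.commute)
     from shifted_sublevel[OF i(1) True H i(3,2) D(1)]
     show "zeta \<in> (\<Union>i\<in>UNIV. (\<lambda>zeta. zeta + z) -` ?E i \<union> ?E i)" by blast
    qed
    moreover have vm: "(\<lambda>zeta. zeta + z) -` ?E i \<in> sets borel" for i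
     using measurable_sets[of "\<lambda>zeta::real^'n. zeta + z" borel borel "?E i"] by simp
    ultimately have "emeasure lborel ?Y <= emeasure lborel (\<Union>i\<in>UNIV. (\<lambda>zeta. zeta + z) -` ?E i \<union> ?E i)"
     by (intro emeasure_mono) auto
    also have "\<dots> <= (\<Sum>i\<in>UNIV. emeasure lborel ((\<lambda>zeta. zeta + z) -` ?E i \<union> ?E i))"
     using vm by (intro emeasure_subadditive_finite) auto
    also have "\<dots> <= (\<Sum>i\<in>(UNIV::'n set). ennreal (2 * V))"
    proof (rule sum_mono)
     fix i
     have "emeasure lborel ((\<lambda>zeta. zeta + z) -` ?E i \<union> ?E i) <= emeasure lborel ((\<lambda>zeta. zeta + z) -` ?E i) + emeasure lborel (?E i)"
      using vm by (intro emeasure_subadditive) auto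
     also have "emeasure lborel ((\<lambda>zeta. zeta + z) -` ?E i) = (NN zeta. indicator (?E i) (zeta + z))"
     proof -
      have "(NN zeta. indicator ((\<lambda>zeta. zeta + z) -` ?E i) zeta) = emeasure lborel ((\<lambda>zeta. zeta + z) -` ?E i)"
       using vm[of i] by (intro nn_integral_indicator) simp
      then show ?thesis unfolding indicator_vimage by (rule sym)
     qed
     also have "\<dots> = (NN zeta. indicator (?E i) zeta)"
      by (rule nn_integral_lborel_translate) measurable
     also have "\<dots> = emeasure lborel (?E i)" by simp
     also have "emeasure lborel (?E i) + emeasure lborel (?E i) <= ennreal V + ennreal V"
      by (intro add_mono V)
     also have "\<dots> = ennreal (2 * V)" using V0 by (simp flip: ennreal_plus)
     finally show "emeasure lborel ((\<lambda>zeta. zeta + z) -` ?E i \<union> ?E i) <= ennreal (2 * V)" .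
    qed
    also have "\<dots> = ennreal (2 * real CARD('n) * V)"
     using V0 by (simp add: ennreal_of_nat_eq_real_of_nat ennreal_mult'[symmetric] mult_ac)
    finally show ?thesis .
   qed
   also have "ennreal (A^2) * (ennreal k0 * ennreal ((10 * lam) ^ CARD('n)) + ennreal (2 * real CARD('n) * V))
     = ennreal (A^2 * (k0 * (10 * lam) ^ CARD('n) + 2 * real CARD('n) * V)) * indicator (cube 0 r) z"
    using True k0 V0 lam1 by (simp add: ennreal_mult ennreal_plus)
   finally show ?thesis by (simp add: add_mono mult_left_mono)
  qed simp
 qed
 also have "\<dots> = ennreal (A^2 * (k0 * (10 * lam) ^ CARD('n) + 2 * real CARD('n) * V)) * ennreal ((2 * r) ^ CARD('n))"
  using r1 by (subst nn_integral_cmult_indicator) (auto simp: emeasure_cube)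
 also have "\<dots> = ennreal (A^2 * (2 * r) ^ CARD('n) * (k0 * (10 * lam) ^ CARD('n) + 2 * real CARD('n) * V))"
  using k0 V0 lam1 r1 by (simp add: ennreal_mult'[symmetric] mult_ac)
 finally show ?thesis using k0 V0 lam1 r1 by (subst (asm) ennreal_le_iff) auto
qed

lemma inner_trivial:
 assumes zeta: "zeta \<in> annulus 5 lam"
 shows "norm (LL q. osc (zeta, q)) <= A^2 * (2 * r) ^ CARD('n)"
proof -
 have "ennreal (norm (LL q. osc (zeta, q))) <= (NN eta. ennreal (indicator (cube zeta r) eta * A^2))"
 proof (rule inner_radial[OF zeta])
  fix eta :: "real^'n" assume eta: "eta \<in> annulus 10 lam"
  show "norm (integral {1..2} (\<lambda>s. exp (\<i> * of_real (s * P [] eta)) * (of_real (radial_bump (Suc N) s) * (a1 [] (s .* eta) * cnj (a2 [] (s .* eta)))))) <= A^2"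
   by (rule radial_trivial[OF eta])
 qed auto
 also have "\<dots> = (NN eta. ennreal (A^2) * indicator (cube zeta r) eta)"
  by (intro nn_integral_cong) (simp add: indicator_def)
 also have "\<dots> = ennreal (A^2) * ennreal ((2 * r) ^ CARD('n))"
  using r1 by (subst nn_integral_cmult_indicator) (auto simp: emeasure_cube)
 also have "\<dots> = ennreal (A^2 * (2 * r) ^ CARD('n))" using r1 by (simp add: ennreal_mult)
 finally show ?thesis using r1 by (subst (asm) ennreal_le_iff) auto
qed

end

lemma (in osc_setup) kernel_trivial:
 assumes "\<Theta> \<in> bmeas" "\<And>zeta. 0 <= \<Theta> zeta" "\<And>zeta. \<Theta> zeta <= 1"
 shows "norm (kernel \<Theta>) <= A^2 * (2 * r) ^ CARD('n) * (10 ^ CARD('n) * lam ^ CARD('n))"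
proof -
 have "norm (kernel \<Theta>) <= (10 * lam) ^ CARD('n) * (A^2 * (2 * r) ^ CARD('n))"
  by (rule kernel_uniform[OF assms]) (use inner_trivial r1 in auto)
 then show ?thesis by (simp add: power_mult_distrib mult_ac)
qed

text \<open>\<open>\<delta>\<close> stands for |x - y| and \<open>t\<close> for a small power of
  \<open>lam\<close>. The first bound comes from the radial integral and the sublevel estimate, the
  second from the tangential integral as soon as \<open>\<delta>\<close> exceeds 1 / sqrt lam by the
  factor \<open>t^2\<close>. \<open>W\<close> depends on none of the points, amplitudes or
  parameters.\<close>

lemma kernel_bounds:
 fixes c C :: real and N :: nat
 assumes c: "0 < c" "c <= 1" and C: "0 <= C" and N: "0 < N"
 shows "\<exists>W\<ge>1. \<forall>(a1 :: 'n::finite list => real^'n => complex) a2 P lam l A \<Theta> \<delta> t.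
   osc_setup N C lam l A a1 a2 P --> \<Theta> \<in> bmeas --> (\<forall>zeta. 0 <= \<Theta> zeta \<and> \<Theta> zeta <= 1) -->
   (\<forall>zeta\<in>annulus 5 lam. \<Theta> zeta ~= 0 --> (\<exists>i. c * \<delta> <= \<bar>P [i] zeta\<bar>)) --> 0 < \<delta> --> \<delta> <= 1 --> W <= t --> lam^2 <= t ^ N -->
   norm (osc_setup.kernel N lam a1 a2 P \<Theta>) <= W * A^2 * lam ^ CARD('n) * sqrt lam ^ CARD('n) * (1 / t ^ N + t^2 * min 1 (l / \<delta>)) \<and>
   (l * sqrt lam <= 1 --> t^2 <= sqrt lam * \<delta> -->
    norm (osc_setup.kernel N lam a1 a2 P \<Theta>) <= W * A^2 * lam ^ CARD('n) * sqrt lam ^ CARD('n) * (1 / t ^ N))"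
proof -
 let ?n = "CARD('n)"
 obtain KR where KR: "KR >= 0" and R: "\<forall>(a1 :: 'n list => real^'n => complex) a2 A l lam eta P.
   jet UNIV a1 --> jet UNIV a2 --> amp_bound N l A (annulus 100 lam) a1 --> amp_bound N l A (annulus 100 lam) a2 -->
   0 < lam --> 0 < l --> 1 <= lam * l --> 0 <= A --> eta \<in> annulus 10 lam --> P ~= 0 -->
   norm (integral {1..2} (\<lambda>s. exp (\<i> * of_real (s * P)) * (of_real (radial_bump (Suc N) s) * (a1 [] (s .* eta) * cnj (a2 [] (s .* eta))))))
    <= KR * A^2 * (lam * l / \<bar>P\<bar>) ^ N"
  using radial_decay[of N "Suc N", where 'n='n] by blast
 obtain KT where KT: "KT >= 0" and T: "\<forall>(a1 :: 'n list => real^'n => complex) a2 A l lam P zeta i s.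
   jet UNIV a1 --> jet UNIV a2 --> amp_bound N l A (annulus 100 lam) a1 --> amp_bound N l A (annulus 100 lam) a2 -->
   jet (-{0}) P --> phase_bound (N + 2) C lam P --> (200 * real CARD('n))^2 <= lam -->
   0 < l --> l * sqrt lam <= 1 --> 0 <= A --> s \<in> {1..2} --> zeta \<in> annulus 5 lam --> P [i] zeta ~= 0 -->
   norm (LL eta. of_real (psi (Suc N) (sqrt lam) (eta - zeta)) * (exp (\<i> * of_real (s * P [] eta)) * (a1 [] (s .* eta) * cnj (a2 [] (s .* eta)))))
    <= KT * A^2 * (2 * sqrt lam) ^ CARD('n) * (1 / (sqrt lam * \<bar>P [i] zeta\<bar>)) ^ N"
  using tangential_decay[of N "Suc N" C, where 'n='n] C by blast
 define V1 where "V1 = 3200 * real N * 42 ^ ?n / c"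
 define w1 where "w1 = 3 * real ?n ^ 4 * C"
 define w2 where "w2 = 2 ^ Suc N * (1 + C) * (1 + C) * 16 / (3 * c^2) + 1"
 define w3 where "w3 = 2 ^ ?n * (KR * 10 ^ ?n + 2 * real ?n * V1 + 10 ^ ?n * (KT + 1))"
 define W where "W = 1 + w1 + w2 + w3 + 1 / c"
 have V1: "V1 >= 0" using c by (simp add: V1_def)
 have w: "w1 >= 0" "w2 >= 0" "w3 >= 0" "1 / c >= 0" using C c KR KT V1 by (auto simp: w1_def w2_def w3_def)
 have W: "W >= 1" "W >= w1" "W >= w2" "W >= w3" "W >= 1 / c" using w by (auto simp: W_def)
 have main: "norm (osc_setup.kernel N lam a1 a2 P \<Theta>) <= W * A^2 * lam ^ ?n * sqrt lam ^ ?n * (1 / t ^ N + t^2 * min 1 (l / \<delta>)) \<and>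
   (l * sqrt lam <= 1 --> t^2 <= sqrt lam * \<delta> -->
    norm (osc_setup.kernel N lam a1 a2 P \<Theta>) <= W * A^2 * lam ^ ?n * sqrt lam ^ ?n * (1 / t ^ N))"
  if su: "osc_setup N C lam l A a1 a2 P" and \<Theta>m: "\<Theta> \<in> bmeas" and \<Theta>b: "\<forall>zeta. 0 <= \<Theta> zeta \<and> \<Theta> zeta <= 1"
   and grad: "\<forall>zeta\<in>annulus 5 lam. \<Theta> zeta ~= 0 --> (\<exists>i. c * \<delta> <= \<bar>P [i] zeta\<bar>)" and \<delta>: "0 < \<delta>" "\<delta> <= 1" and t: "W <= t" "lam^2 <= t ^ N"
  for a1 a2 :: "'n list => real^'n => complex" and P lam l A \<Theta> \<delta> t
 proof -
  interpret osc_setup N C lam l A a1 a2 P by (rule su)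
  have t1: "t >= 1" using W t by linarith
  have \<Theta>1: "\<And>zeta. 0 <= \<Theta> zeta" "\<And>zeta. \<Theta> zeta <= 1" using \<Theta>b by auto
  have scale: "A^2 * (2 * r) ^ ?n * (X * lam ^ ?n) = 2 ^ ?n * X * (A^2 * lam ^ ?n * r ^ ?n)" for X
   by (simp add: power_mult_distrib mult_ac)
  have AL: "0 <= A^2 * lam ^ ?n * r ^ ?n" using lam1 r1 by simp
  note triv = kernel_trivial[OF \<Theta>m \<Theta>1]
  have part1: "norm (kernel \<Theta>) <= W * (A^2 * lam ^ ?n * r ^ ?n) * (1 / t ^ N + t^2 * min 1 (l / \<delta>))"
  proof (cases "\<delta> <= l")
   \<comment> \<open>For \<open>\<delta> <= l\<close> the minimum is 1 and the trivial bound
     suffices.\<close>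
   case True
   have "norm (kernel \<Theta>) <= 2 ^ ?n * 10 ^ ?n * (A^2 * lam ^ ?n * r ^ ?n)" using triv unfolding scale .
   also have "\<dots> <= W * (A^2 * lam ^ ?n * r ^ ?n)"
   proof (rule mult_right_mono[OF _ AL])
    have "2 ^ ?n * (10 ^ ?n * 1) <= w3" unfolding w3_def using KR KT V1 by (intro mult_left_mono) (auto simp: algebra_simps intro!: add_increasing)
    then show "2 ^ ?n * 10 ^ ?n <= W" using W by simp
   qed
   also have "\<dots> = W * (A^2 * lam ^ ?n * r ^ ?n) * 1" by simp
   also have "\<dots> <= W * (A^2 * lam ^ ?n * r ^ ?n) * (1 / t ^ N + t^2 * min 1 (l / \<delta>))"
   proof (rule mult_left_mono)
    have "min 1 (l / \<delta>) = 1" using True \<delta> by (simp add: field_simps)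
    moreover have "1 <= t^2" using t1 by (rule one_le_power)
    ultimately show "1 <= 1 / t ^ N + t^2 * min 1 (l / \<delta>)" using t1 by (simp add: add_increasing)
    show "0 <= W * (A^2 * lam ^ ?n * r ^ ?n)" using W(1) AL by simp
   qed
   finally show ?thesis .
  next
   case False
   define D where "D = c * \<delta>"
   \<comment> \<open>Above this threshold the radial integral gains \<open>t\<close> to the power
     -N.\<close>
   define H where "H = t * (lam * l)"
   \<comment> \<open>Segments are shorter than \<open>lam\<close> by a factor comparable to
     \<open>t\<close>, which makes the polynomial-type remainder of the sublevel estimate
     tiny.\<close>
   define q where "q = 100 * t"
   have D: "0 < D" "D <= 1" unfolding D_def using c \<delta> by (auto intro: mult_le_one)
   have Ht: "t <= H" unfolding H_def using t1 l by (simp add: mult_left_le)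
   have H: "0 < H" "w1 <= H" using Ht t1 W t by linarith+
   \<comment> \<open>The remainder is of size t^-(N+1). One factor \<open>t >= W\<close> swallows
     the constants, and t^N >= lam^2 together with delta > l >= 1/lam turns the rest into a multiple
     of delta^2. This is the purpose of the hypothesis \<open>lam^2 <= t ^ N\<close>.\<close>
   have small: "2 ^ Suc N * (1 + C) * (1 + C) * (1 / q) ^ Suc N < 3/4 * (D / 2)^2"
   proof -
    have "2 ^ Suc N * (1 + C) * (1 + C) * 16 / (3 * c^2) < t" using t W unfolding w2_def by linarith
    then have a: "2 ^ Suc N * (1 + C) * (1 + C) < 3/16 * c^2 * t" using c by (simp add: field_simps)
    have "(1 / q) ^ Suc N <= (1 / t) ^ Suc N" unfolding q_def using t1 by (intro power_mono) (auto simp: field_simps)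
    then have "2 ^ Suc N * (1 + C) * (1 + C) * (1 / q) ^ Suc N <= 2 ^ Suc N * (1 + C) * (1 + C) * (1 / t) ^ Suc N"
     using C by (intro mult_left_mono) auto
    also have "\<dots> < (3/16 * c^2 * t) * (1 / t) ^ Suc N"
     using a t1 by (intro mult_strict_right_mono) auto
    also have "\<dots> = 3/16 * c^2 * (1 / t ^ N)" using t1 by (simp add: power_divide)
    also have "\<dots> <= 3/16 * c^2 * (1 / lam^2)"
     using t(2) lam1 t1 by (intro mult_left_mono divide_left_mono) auto
    also have "\<dots> <= 3/16 * c^2 * \<delta>^2"
    proof (intro mult_left_mono)
     have "1 / lam <= l" using l lam1 by (simp add: field_simps)
     then have "1 / lam <= \<delta>" using False by linarith
     then have "(1 / lam)^2 <= \<delta>^2" using lam1 by (intro power_mono) auto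
     then show "1 / lam^2 <= \<delta>^2" by (simp add: power_divide)
    qed (use c in auto)
    also have "\<dots> = 3/4 * (D / 2)^2" by (simp add: D_def power_mult_distrib power_divide)
    finally show ?thesis .
   qed
   \<comment> \<open>Of the two factors \<open>t\<close>, one comes from the threshold
     \<open>H\<close> and the other from the division by the segment length lam/q.\<close>
   define V where "V = V1 * t^2 * (l / \<delta>) * lam ^ ?n"
   have V0: "V >= 0" using V1 l \<delta> lam1 by (simp add: V_def)
   have lamq: "0 < lam / q" using lam1 t1 by (simp add: q_def)
   have Vb: "emeasure lborel {eta\<in>annulus 20 lam. \<bar>P [] eta\<bar> <= 2 * H \<and> D / 2 <= \<bar>P [i] eta\<bar>} <= ennreal V" for i
   proof -
    let ?E = "{eta\<in>annulus 20 lam. \<bar>P [] eta\<bar> <= 2 * H \<and> D / 2 <= \<bar>P [i] eta\<bar>}"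
    have "emeasure lborel ?E * ennreal (lam / q) <= ennreal (8 * real N * (2 * H) / (D / 2)) * emeasure lborel (cball (0::real^'n) (20 * lam + lam / q))"
     by (rule sublevel_measure[OF P _ C N _ _ _ _ small]) (use lam1 D H t1 in \<open>auto simp: q_def\<close>)
    also have "emeasure lborel (cball (0::real^'n) (20 * lam + lam / q)) <= emeasure lborel (cube (0::real^'n) (21 * lam))"
    proof (rule emeasure_mono)
     have "lam / q <= lam" using lam1 t1 by (simp add: q_def field_simps)
     then have "\<bar>x $ j\<bar> <= 21 * lam" if "norm x <= 20 * lam + lam / q" for x :: "real^'n" and j
      using component_le_norm_cart[of x j] that by linarith
     then show "cball 0 (20 * lam + lam / q) \<subseteq> cube (0::real^'n) (21 * lam)"
      unfolding cube_def by auto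
    qed (auto simp: cube_eq_cbox)
    also have "emeasure lborel (cube (0::real^'n) (21 * lam)) = ennreal ((42 * lam) ^ ?n)"
     using lam1 by (subst emeasure_cube) auto
    also have "ennreal (8 * real N * (2 * H) / (D / 2)) * ennreal ((42 * lam) ^ ?n) = ennreal (V * (lam / q))"
    proof -
     have "8 * real N * (2 * H) / (D / 2) * (42 * lam) ^ ?n = V * (lam / q)"
      unfolding V_def V1_def H_def D_def q_def power_mult_distrib using c \<delta> t1 lam1
      by (simp add: field_simps power2_eq_square)
     then show ?thesis using D H lam1 by (subst ennreal_mult[symmetric]) auto
    qed
    finally have le: "emeasure lborel ?E * ennreal (lam / q) <= ennreal (V * (lam / q))"
     by (simp add: mult_left_mono)
    have "emeasure lborel ?E < \<infinity>"
     by (rule emeasure_bounded_finite, rule bounded_subset[OF compact_imp_bounded[OF compact_annulus[of 20 lam]]]) auto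
    then obtain e where e: "e >= 0" "emeasure lborel ?E = ennreal e"
     by (cases "emeasure lborel ?E" rule: ennreal_cases) auto
    have "ennreal (e * (lam / q)) = ennreal e * ennreal (lam / q)"
     by (rule ennreal_mult) (use e lamq in auto)
    then have "ennreal (e * (lam / q)) <= ennreal (V * (lam / q))" using le unfolding e(2) by (simp only:)
    moreover have "0 <= V * (lam / q)" using V0 lamq by (intro mult_nonneg_nonneg) auto
    ultimately have "e * (lam / q) <= V * (lam / q)" by (rule ennreal_le_iff[THEN iffD1, rotated])
    then have "e <= V" using lamq by (rule mult_right_le_imp_le)
    then show ?thesis using e by (simp add: ennreal_leI)
   qed
   have "norm (kernel \<Theta>) <= A^2 * (2 * r) ^ ?n * (KR / t ^ N * (10 * lam) ^ ?n + 2 * real ?n * V)"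
   proof (rule kernel_sublevel[OF \<Theta>m \<Theta>1 D(1) _ _ _ V0 _ Vb])
    show "\<exists>i. D <= \<bar>P [i] zeta\<bar>" if "zeta \<in> annulus 5 lam" "\<Theta> zeta ~= 0" for zeta
     using grad that unfolding D_def by blast
    show "3 * real ?n ^ 4 * C <= H" using H by (simp add: w1_def)
    show "0 <= KR / t ^ N" using KR t1 by simp
    fix eta :: "real^'n" assume eta: "eta \<in> annulus 10 lam"
    let ?I = "norm (integral {1..2} (\<lambda>s. exp (\<i> * of_real (s * P [] eta)) * (of_real (radial_bump (Suc N) s) * (a1 [] (s .* eta) * cnj (a2 [] (s .* eta))))))"
    show "?I <= A^2 * (if \<bar>P [] eta\<bar> <= H then 1 else KR / t ^ N)"
    proof (cases "\<bar>P [] eta\<bar> <= H")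
     case True
     then show ?thesis using radial_trivial[OF eta] by simp
    next
     case False
     then have nz: "P [] eta ~= 0" using H by auto
     have "?I <= KR * A^2 * (lam * l / \<bar>P [] eta\<bar>) ^ N"
      using R a1 a2 l A eta nz lam1 by force
     also have "\<dots> <= KR * A^2 * (1 / t) ^ N"
     proof (intro mult_left_mono power_mono)
      have "t * (lam * l) <= \<bar>P [] eta\<bar>" using False unfolding H_def by linarith
      then show "lam * l / \<bar>P [] eta\<bar> <= 1 / t" using nz t1 by (simp add: field_simps)
     qed (use KR l lam1 in auto)
     finally show ?thesis using False by (simp add: power_divide mult.commute)
    qed
   qed
   also have "\<dots> = A^2 * (2 * r) ^ ?n * ((KR * 10 ^ ?n * (1 / t ^ N) + 2 * real ?n * V1 * (t^2 * (l / \<delta>))) * lam ^ ?n)"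
    unfolding V_def by (simp add: power_mult_distrib algebra_simps)
   also have "\<dots> = 2 ^ ?n * (KR * 10 ^ ?n * (1 / t ^ N) + 2 * real ?n * V1 * (t^2 * (l / \<delta>))) * (A^2 * lam ^ ?n * r ^ ?n)"
    by (rule scale)
   also have "\<dots> <= (W * (1 / t ^ N + t^2 * (l / \<delta>))) * (A^2 * lam ^ ?n * r ^ ?n)"
   proof (rule mult_right_mono[OF _ AL])
    have p: "0 <= 1 / t ^ N" "0 <= t^2 * (l / \<delta>)" using t1 l \<delta> by auto
    have "2 ^ ?n * (KR * 10 ^ ?n) <= w3" "2 ^ ?n * (2 * real ?n * V1) <= w3"
     unfolding w3_def using KR KT V1 by (intro mult_left_mono; simp)+
    then have "2 ^ ?n * (KR * 10 ^ ?n) <= W" "2 ^ ?n * (2 * real ?n * V1) <= W" using W by linarith+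
    then have "2 ^ ?n * (KR * 10 ^ ?n) * (1 / t ^ N) + 2 ^ ?n * (2 * real ?n * V1) * (t^2 * (l / \<delta>)) <= W * (1 / t ^ N) + W * (t^2 * (l / \<delta>))"
     using p by (intro add_mono mult_right_mono) auto
    then show "2 ^ ?n * (KR * 10 ^ ?n * (1 / t ^ N) + 2 * real ?n * V1 * (t^2 * (l / \<delta>))) <= W * (1 / t ^ N + t^2 * (l / \<delta>))"
     by (simp only: distrib_left mult.assoc)
   qed
   also have "l / \<delta> = min 1 (l / \<delta>)" using False \<delta> by (simp add: field_simps)
   finally show ?thesis by (simp only: mult_ac)
  qed
  have part2: "norm (kernel \<Theta>) <= W * (A^2 * lam ^ ?n * r ^ ?n) * (1 / t ^ N)" if lr: "l * r <= 1" and tr: "t^2 <= r * \<delta>"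
  proof -
   have "norm (kernel \<Theta>) <= (10 * lam) ^ ?n * (KT * A^2 * (2 * r) ^ ?n * (1 / t ^ N))"
   proof (rule kernel_uniform[OF \<Theta>m \<Theta>1])
    show "0 <= KT * A^2 * (2 * r) ^ ?n * (1 / t ^ N)" using KT r1 t1 by simp
    fix zeta assume zeta: "zeta \<in> annulus 5 lam" "\<Theta> zeta ~= 0"
    then obtain i where i: "c * \<delta> <= \<bar>P [i] zeta\<bar>" using grad by blast
    have cd: "0 < c * \<delta>" using c \<delta> by simp
    then have nz: "P [i] zeta ~= 0" using i by auto
    \<comment> \<open>The surplus factor \<open>t\<close> in
      \<open>t^2 <= sqrt lam * \<delta>\<close> pays for the constant \<open>c\<close>, since W >=
      1/c.\<close>
    have tle: "t <= r * \<bar>P [i] zeta\<bar>"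
    proof -
     have "1 <= c * t" using W t c by (metis (no_types, opaque_lifting) divide_le_eq mult.commute order_trans)
     then have "1 * t <= c * t * t" using t1 by (intro mult_right_mono) auto
     also have "\<dots> = c * t^2" by (simp add: power2_eq_square)
     also have "\<dots> <= c * (r * \<delta>)" using tr c by (intro mult_left_mono) auto
     also have "\<dots> = r * (c * \<delta>)" by simp
     also have "\<dots> <= r * \<bar>P [i] zeta\<bar>" using i r1 by (intro mult_left_mono) auto
     finally show ?thesis by simp
    qed
    show "norm (LL q. osc (zeta, q)) <= KT * A^2 * (2 * r) ^ ?n * (1 / t ^ N)"
    proof (rule inner_tangential[OF zeta(1)])
     show "0 <= KT * A^2 * (2 * r) ^ ?n * (1 / t ^ N)" using KT r1 t1 by simp
     fix s :: real assume s: "s \<in> {1..2}"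
     have "norm (LL eta. of_real (psi (Suc N) r (eta - zeta)) * (exp (\<i> * of_real (s * P [] eta)) * (a1 [] (s .* eta) * cnj (a2 [] (s .* eta)))))
      <= KT * A^2 * (2 * r) ^ ?n * (1 / (r * \<bar>P [i] zeta\<bar>)) ^ N"
      by (rule T[rule_format, OF a1(1) a2(1) a1(2) a2(2) P lam_large l(1) lr A s zeta(1) nz])
     also have "\<dots> <= KT * A^2 * (2 * r) ^ ?n * (1 / t) ^ N"
      using tle t1 KT r1 by (intro mult_left_mono power_mono divide_left_mono) auto
     finally show "norm (LL eta. of_real (psi (Suc N) r (eta - zeta)) * (exp (\<i> * of_real (s * P [] eta)) * (a1 [] (s .* eta) * cnj (a2 [] (s .* eta)))))
      <= KT * A^2 * (2 * r) ^ ?n * (1 / t ^ N)" by (simp add: power_divide)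
    qed
   qed
   also have "\<dots> = A^2 * (2 * r) ^ ?n * ((10 ^ ?n * KT * (1 / t ^ N)) * lam ^ ?n)"
    by (simp add: power_mult_distrib mult_ac)
   also have "\<dots> = 2 ^ ?n * (10 ^ ?n * KT * (1 / t ^ N)) * (A^2 * lam ^ ?n * r ^ ?n)" by (rule scale)
   also have "\<dots> <= (W * (1 / t ^ N)) * (A^2 * lam ^ ?n * r ^ ?n)"
   proof (rule mult_right_mono[OF _ AL])
    have "2 ^ ?n * (10 ^ ?n * KT) <= w3"
     unfolding w3_def using KR KT V1 by (intro mult_left_mono) (auto simp: algebra_simps intro!: add_nonneg_nonneg)
    then have "2 ^ ?n * (10 ^ ?n * KT) <= W" using W by linarith
    then have "2 ^ ?n * (10 ^ ?n * KT) * (1 / t ^ N) <= W * (1 / t ^ N)" using t1 by (intro mult_right_mono) auto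
    then show "2 ^ ?n * (10 ^ ?n * KT * (1 / t ^ N)) <= W * (1 / t ^ N)" by (simp only: mult.assoc)
   qed
   finally show ?thesis by (simp only: mult_ac)
  qed
  show ?thesis using part1 part2 unfolding mult.assoc by blast
 qed
 show ?thesis by (rule exI[of _ W], rule conjI[OF W(1)], intro allI impI, rule main) assumption+
qed

section \<open>Coordinate slices transversal to a subspace\<close>

text \<open>The lower bound for the projection is stated dually, by testing with vectors of
  \<open>V\<close>, so that it passes to subspaces. Induction: a unit vector w of \<open>V\<close>
  has a coordinate i of size at least 1/n; adjoin i to the set found for the vectors of
  \<open>V\<close> with vanishing i-th coordinate. The constant does not depend on
  \<open>V\<close>.\<close>

lemma coordinate_slice:
 "\<exists>c>0. \<forall>V::(real^'n) set. subspace V --> d <= dim V -->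
   (\<exists>I. card I = d \<and> (\<forall>z. (\<forall>i. i \<notin> I --> z $ i = 0) --> (\<exists>v\<in>V. norm v <= 1 \<and> c * norm z <= v \<bullet> z)))"
proof (induction d)
 case 0
 show ?case
 proof (intro exI[of _ 1] conjI allI impI)
  fix V :: "(real^'n) set" assume V: "subspace V"
  show "\<exists>I. card I = 0 \<and> (\<forall>z. (\<forall>i. i \<notin> I --> z $ i = 0) --> (\<exists>v\<in>V. norm v <= 1 \<and> 1 * norm z <= v \<bullet> z))"
  proof (intro exI[of _ "{}"] conjI allI impI bexI[of _ 0])
   fix z :: "real^'n" assume "\<forall>i. i \<notin> {} --> z $ i = 0"
   then have "z = 0" by (simp add: vec_eq_iff)
   then show "1 * norm z <= 0 \<bullet> z" by simp
  qed (use V in \<open>auto simp: subspace_0\<close>)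
 qed simp
next
 case (Suc d)
 then obtain c where c: "c > 0" and IH: "\<And>V::(real^'n) set. subspace V ==> d <= dim V ==>
   \<exists>I. card I = d \<and> (\<forall>z. (\<forall>i. i \<notin> I --> z $ i = 0) --> (\<exists>v\<in>V. norm v <= 1 \<and> c * norm z <= v \<bullet> z))"
  by blast
 let ?n = "real CARD('n)"
 have n: "?n >= 1" by (simp add: Suc_leI)
 \<comment> \<open>The two entries are the constants produced by the two cases for \<open>t\<close>
   and \<open>z'\<close> below.\<close>
 define c' where "c' = min (c / (2 * ?n + 1)) (1 / (4 * ?n))"
 have c': "c' > 0" using c n by (simp add: c'_def)
 show ?case
 proof (intro exI[of _ c'] conjI allI impI c')
  fix V :: "(real^'n) set" assume V: "subspace V" and dV: "Suc d <= dim V"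
  have "\<not> V \<subseteq> {0}"
  proof
   assume "V \<subseteq> {0}"
   then have "dim V = 0" by (simp only: dim_eq_0)
   then show False using dV by linarith
  qed
  then obtain w0 where w0: "w0 \<in> V" "w0 ~= 0" by blast
  define w where "w = (1 / norm w0) .* w0"
  have w: "w \<in> V" "norm w = 1" using w0 V by (auto simp: w_def subspace_scale)
  obtain i where i: "1 / ?n <= \<bar>w $ i\<bar>"
  proof -
   have "\<exists>i. 1 / ?n <= \<bar>w $ i\<bar>"
   proof (rule ccontr)
    assume "\<not> ?thesis"
    then have "(\<Sum>i\<in>UNIV. \<bar>w $ i\<bar>) < (\<Sum>i\<in>(UNIV::'n set). 1 / ?n)"
     by (intro sum_strict_mono) (auto simp: not_le)
    then have "(\<Sum>i\<in>UNIV. \<bar>w $ i\<bar>) < 1" by simp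
    then show False using norm_le_l1_cart[of w] w by simp
   qed
   then show ?thesis using that by blast
  qed
  have wi: "w $ i ~= 0" using i n by auto
  \<comment> \<open>Since w has a nonzero i-th coordinate, \<open>V'\<close> and w span
    \<open>V\<close>, so only one dimension is lost.\<close>
  define V' where "V' = {v\<in>V. v $ i = 0}"
  have V': "subspace V'" using V unfolding V'_def subspace_def by auto
  have "V \<subseteq> span (insert w V')"
  proof
   fix v assume v: "v \<in> V"
   let ?u = "v - (v $ i / w $ i) .* w"
   have "?u \<in> V'" using v w V wi by (auto simp: V'_def subspace_diff subspace_scale)
   then have "?u \<in> span (insert w V')" by (simp add: span_base)
   moreover have "(v $ i / w $ i) .* w \<in> span (insert w V')" by (simp add: span_base span_scale)
   ultimately have "?u + (v $ i / w $ i) .* w \<in> span (insert w V')" by (rule span_add)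
   then show "v \<in> span (insert w V')" by simp
  qed
  then have "dim V <= dim (insert w V')" by (metis dim_span dim_subset)
  also have "\<dots> <= dim V' + 1" by (simp add: dim_insert)
  finally have "d <= dim V'" using dV by simp
  from IH[OF V' this] obtain I where I: "card I = d"
   "\<And>z. (\<forall>i. i \<notin> I --> z $ i = 0) ==> \<exists>v\<in>V'. norm v <= 1 \<and> c * norm z <= v \<bullet> z" by blast
  \<comment> \<open>Otherwise the i-th unit vector would have to be detected by elements of
    \<open>V'\<close>, which are all orthogonal to it.\<close>
  have iI: "i \<notin> I"
  proof
   assume "i \<in> I"
   then have "\<forall>j. j \<notin> I --> (axis i (1::real) :: real^'n) $ j = 0" by (auto simp: axis_def)
   from I(2)[OF this] obtain v where v: "v \<in> V'" "c * norm (axis i (1::real) :: real^'n) <= v \<bullet> axis i 1"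
    by blast
   then show False using c by (simp add: V'_def inner_axis)
  qed
  show "\<exists>I. card I = Suc d \<and> (\<forall>z. (\<forall>i. i \<notin> I --> z $ i = 0) --> (\<exists>v\<in>V. norm v <= 1 \<and> c' * norm z <= v \<bullet> z))"
  proof (intro exI[of _ "insert i I"] conjI allI impI)
   show "card (insert i I) = Suc d" using iI I(1) by simp
   fix z :: "real^'n" assume z: "\<forall>j. j \<notin> insert i I --> z $ j = 0"
   define t where "t = z $ i"
   define z' where "z' = z - t .* axis i 1"
   have z'I: "\<forall>j. j \<notin> I --> z' $ j = 0" using z by (auto simp: z'_def t_def axis_def)
   have zz: "z = t .* axis i 1 + z'" by (simp add: z'_def)
   have nz: "norm z <= \<bar>t\<bar> + norm z'" unfolding zz by (rule norm_triangle_le) simp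
   show "\<exists>v\<in>V. norm v <= 1 \<and> c' * norm z <= v \<bullet> z"
   proof (cases "\<bar>t\<bar> <= 2 * ?n * norm z'")
    \<comment> \<open>The vector from \<open>V'\<close> does not see the i-th coordinate, so it
      tests \<open>z'\<close> alone, which carries a fixed share of the norm.\<close>
    case True
    obtain v where v: "v \<in> V'" "norm v <= 1" "c * norm z' <= v \<bullet> z'" using I(2)[OF z'I] by blast
    have "v \<bullet> z = v \<bullet> z'" using v(1) by (simp add: zz inner_add_right inner_axis V'_def)
    moreover have "c' * norm z <= c * norm z'"
    proof -
     have "c' * norm z <= c / (2 * ?n + 1) * ((2 * ?n + 1) * norm z')"
      using True nz c n by (intro mult_mono) (auto simp: c'_def algebra_simps)
     also have "\<dots> = c * norm z'" using n by simp
     finally show ?thesis .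
    qed
    ultimately show ?thesis using v by (intro bexI[of _ v]) (auto simp: V'_def)
   next
    \<comment> \<open>Here w, with the right sign, sees |t|/n and loses at most |z'| <=
      |t|/(2n).\<close>
    case False
    define s where "s = sgn (t * w $ i)"
    have t0: "t ~= 0" using False n by auto
    have s: "\<bar>s\<bar> = 1" using t0 wi by (simp add: s_def abs_sgn_eq)
    have "s * (t * w $ i) = \<bar>t\<bar> * \<bar>w $ i\<bar>" unfolding s_def by (metis abs_mult abs_sgn mult.commute)
    then have 1: "(s .* w) \<bullet> z = \<bar>t\<bar> * \<bar>w $ i\<bar> + s * (w \<bullet> z')"
     by (simp add: zz inner_add_right inner_axis algebra_simps)
    have "\<bar>s * (w \<bullet> z')\<bar> <= 1 * norm z'"
     using Cauchy_Schwarz_ineq2[of w z'] w s by (simp add: abs_mult)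
    then have 2: "- norm z' <= s * (w \<bullet> z')" by linarith
    have 3: "\<bar>t\<bar> * (1 / ?n) <= \<bar>t\<bar> * \<bar>w $ i\<bar>" using i by (intro mult_left_mono) auto
    have 4: "norm z' <= \<bar>t\<bar> * (1 / (2 * ?n))" using False n by (simp add: field_simps)
    have "c' * norm z <= 1 / (4 * ?n) * (2 * \<bar>t\<bar>)"
    proof (rule mult_mono)
     have "1 <= 2 * ?n" using n by linarith
     then have "1 / (2 * ?n) <= 1" by simp
     then have "\<bar>t\<bar> * (1 / (2 * ?n)) <= \<bar>t\<bar> * 1" by (intro mult_left_mono) auto
     then show "norm z <= 2 * \<bar>t\<bar>" using nz 4 by linarith
    qed (use n in \<open>auto simp: c'_def\<close>)
    also have "\<dots> = \<bar>t\<bar> * (1 / ?n) - \<bar>t\<bar> * (1 / (2 * ?n))" using n by (simp add: field_simps)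
    also have "\<dots> <= (s .* w) \<bullet> z" unfolding 1 using 2 3 4 by linarith
    finally show ?thesis using w V s by (intro bexI[of _ "s .* w"]) (auto simp: subspace_scale)
   qed
  qed
 qed
qed

lemma closest_point_subspace:
 fixes V :: "'a::euclidean_space set"
 assumes V: "subspace V" and v: "v \<in> V"
 shows "(z - closest_point V z) \<bullet> v = 0"
proof -
 have cl: "closed V" "convex V" "V ~= {}" using V v by (auto simp: closed_subspace subspace_imp_convex)
 have p: "closest_point V z \<in> V" using cl by (intro closest_point_in_set)
 have "(z - closest_point V z) \<bullet> ((closest_point V z + v) - closest_point V z) <= 0"
  by (rule closest_point_dot) (use cl p v V in \<open>auto simp: subspace_add\<close>)
 moreover have "(z - closest_point V z) \<bullet> ((closest_point V z - v) - closest_point V z) <= 0"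
  by (rule closest_point_dot) (use cl p v V in \<open>auto simp: subspace_diff\<close>)
 ultimately show ?thesis by simp
qed

lemma closest_point_subspace_unique:
 fixes V :: "'a::euclidean_space set"
 assumes V: "subspace V" and p: "p \<in> V" and o: "\<And>v. v \<in> V ==> (z - p) \<bullet> v = 0"
 shows "closest_point V z = p"
proof -
 let ?q = "closest_point V z"
 have q: "?q \<in> V" using V subspace_0[OF V] by (intro closest_point_in_set) (auto simp: closed_subspace)
 have "(p - ?q) \<bullet> (p - ?q) = (z - ?q) \<bullet> (p - ?q) - (z - p) \<bullet> (p - ?q)" by (simp add: inner_diff_left)
 also have "\<dots> = 0" using closest_point_subspace[OF V] o q p V by (simp add: subspace_diff)
 finally show ?thesis by simp
qed

lemma linear_closest_point:
 fixes V :: "'a::euclidean_space set"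
 assumes V: "subspace V"
 shows "linear (closest_point V)"
proof
 have q: "closest_point V z \<in> V" for z using V subspace_0[OF V] by (intro closest_point_in_set) (auto simp: closed_subspace)
 show "closest_point V (x + y) = closest_point V x + closest_point V y" for x y
 proof (rule closest_point_subspace_unique[OF V])
  show "closest_point V x + closest_point V y \<in> V" using q V by (simp add: subspace_add)
  show "(x + y - (closest_point V x + closest_point V y)) \<bullet> v = 0" if "v \<in> V" for v
   using closest_point_subspace[OF V that, of x] closest_point_subspace[OF V that, of y]
   by (simp add: inner_diff_left inner_add_left)
 qed
 show "closest_point V (a .* x) = a .* closest_point V x" for a x
 proof (rule closest_point_subspace_unique[OF V])
  show "a .* closest_point V x \<in> V" using q V by (simp add: subspace_scale)
  show "(a .* x - a .* closest_point V x) \<bullet> v = 0" if "v \<in> V" for v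
   using closest_point_subspace[OF V that, of x] by (simp add: inner_diff_left)
 qed
qed

text \<open>For v in \<open>V\<close> the product v.z equals v times the projection of z, so testing
  with unit vectors of \<open>V\<close> bounds the projection from below.\<close>

lemma coordinate_slice_proj:
 "\<exists>c>0. \<forall>V::(real^'n) set. subspace V --> dim V = d -->
   (\<exists>I. card I = d \<and> (\<forall>z. (\<forall>i. i \<notin> I --> z $ i = 0) --> c * norm z <= norm (closest_point V z)))"
proof -
 obtain c where c: "c > 0" "\<forall>V::(real^'n) set. subspace V --> d <= dim V -->
   (\<exists>I. card I = d \<and> (\<forall>z. (\<forall>i. i \<notin> I --> z $ i = 0) --> (\<exists>v\<in>V. norm v <= 1 \<and> c * norm z <= v \<bullet> z)))"
  using coordinate_slice by blast
 have "v \<bullet> z <= norm (closest_point V z)" if "subspace V" "v \<in> V" "norm v <= 1" for V :: "(real^'n) set" and v z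
 proof -
  have "v \<bullet> z = v \<bullet> closest_point V z"
   using closest_point_subspace[OF that(1,2), of z] by (simp add: inner_diff_right inner_commute[of _ v])
  also have "\<dots> <= norm v * norm (closest_point V z)" by (rule norm_cauchy_schwarz)
  also have "\<dots> <= 1 * norm (closest_point V z)" using that by (intro mult_right_mono) auto
  finally show ?thesis by simp
 qed
 then show ?thesis using c by (intro exI[of _ c]) (smt (verit, best) le_refl)
qed

section \<open>Schur's test for an operator composed with its adjoint\<close>

lemma norm_integral_mult_sq_le:
 fixes f g :: "'a => complex"
 assumes [measurable]: "f \<in> borel_measurable M" "g \<in> borel_measurable M"
 shows "sqn (\<integral>x. f x * g x \<partial>M) <= (\<integral>\<^sup>+x. sqn (f x) \<partial>M) * (\<integral>\<^sup>+x. sqn (g x) \<partial>M)"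
proof -
 have "ennreal (norm (\<integral>x. f x * g x \<partial>M)) <= (\<integral>\<^sup>+x. ennreal (norm (f x)) * ennreal (norm (g x)) \<partial>M)"
 proof (cases "integrable M (\<lambda>x. f x * g x)")
  case True
  then show ?thesis using integral_norm_bound_ennreal[OF True] by (simp add: norm_mult ennreal_mult)
 qed (simp add: not_integrable_integral_eq)
 then have "(ennreal (norm (\<integral>x. f x * g x \<partial>M)))^2 <= (\<integral>\<^sup>+x. ennreal (norm (f x)) * ennreal (norm (g x)) \<partial>M)^2"
  by (rule power_mono) simp
 also have "\<dots> <= (\<integral>\<^sup>+x. (ennreal (norm (f x)))^2 \<partial>M) * (\<integral>\<^sup>+x. (ennreal (norm (g x)))^2 \<partial>M)"
  by (rule Cauchy_Schwarz_nn_integral) measurable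
 finally show ?thesis by (simp add: ennreal_power)
qed

lemma ennreal_sq_le_imp_le:
 fixes U K :: ennreal
 assumes "U^2 <= K * U" "U < \<top>"
 shows "U <= K"
proof (cases "U = 0")
 case False
 show ?thesis
 proof (rule ccontr)
  assume "\<not> U <= K"
  then have "K < U" by simp
  then have "K * U < U * U" using False assms(2) by (intro ennreal_mult_strict_right_mono) (auto simp: zero_less_iff_neq_zero)
  then show False using assms(1) by (simp add: power2_eq_square)
 qed
qed simp

text \<open>With u the image of g and U its squared norm, duality gives U^2 <= |H|^2 |g|^2, and
  Schur's test for the composed kernel gives |H|^2 <= S U. Dividing by U needs U < infinity: this
  and all uses of Fubini rest on the finiteness of \<open>M\<close> and the qualitative bound
  \<open>B\<close>, which does not enter the conclusion.\<close>

lemma TT_star_bound: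
 fixes k :: "'x => 'p => complex" and g :: "'p => complex"
 assumes M: "finite_measure M" and N: "sigma_finite_measure N"
  and k[measurable]: "case_prod k \<in> borel_measurable (M \<Otimes>\<^sub>M N)"
  and kb: "\<And>x. x \<in> space M ==> (\<integral>\<^sup>+p. sqn (k x p) \<partial>N) <= ennreal B" and B: "0 <= B"
  and S: "\<And>x. x \<in> space M ==> (\<integral>\<^sup>+y. ennreal (norm (\<integral>p. k x p * cnj (k y p) \<partial>N)) \<partial>M) <= S"
  and g[measurable]: "g \<in> borel_measurable N" and gfin: "(\<integral>\<^sup>+p. sqn (g p) \<partial>N) < \<top>"
 shows "(\<integral>\<^sup>+x. sqn (\<integral>p. k x p * g p \<partial>N) \<partial>M) <= S * (\<integral>\<^sup>+p. sqn (g p) \<partial>N)"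
proof -
 interpret M: finite_measure M by (rule M)
 interpret N: sigma_finite_measure N by (rule N)
 interpret MN: pair_sigma_finite M N ..
 interpret MM: pair_sigma_finite M M ..
 interpret MMs: sigma_finite_measure "M \<Otimes>\<^sub>M M" by (rule MM.sigma_finite_measure_axioms)
 interpret MMN: pair_sigma_finite "M \<Otimes>\<^sub>M M" N ..
 have Mf: "emeasure M (space M) < \<top>" using M.emeasure_finite[of "space M"] unfolding less_top .
 define G where "G = (\<integral>\<^sup>+p. sqn (g p) \<partial>N)"
 obtain G0 where G0: "G = ennreal G0" "0 <= G0" using gfin unfolding G_def by (metis ennreal_cases less_irrefl)
 define u where "u x = (\<integral>p. k x p * g p \<partial>N)" for x
 have kx[measurable]: "k x \<in> borel_measurable N" if "x \<in> space M" for x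
  using measurable_Pair2[OF k that] by simp
 have um[measurable]: "u \<in> borel_measurable M" unfolding u_def by measurable
 have cj[measurable]: "cnj \<in> bmeas" by (intro borel_measurable_continuous_onI continuous_intros)
 define V where "V = sqrt (B * G0)"
 have ub: "norm (u x) <= V" if x: "x \<in> space M" for x
 proof -
  have "sqn (u x) <= (\<integral>\<^sup>+p. sqn (k x p) \<partial>N) * G"
   unfolding u_def G_def by (rule norm_integral_mult_sq_le) (use kx[OF x] in auto)
  also have "\<dots> <= ennreal B * ennreal G0" unfolding G0(1) by (intro mult_right_mono kb[OF x]) simp
  also have "\<dots> = ennreal (B * G0)" using B G0(2) by (simp add: ennreal_mult)
  finally have "(norm (u x))^2 <= B * G0" using B G0(2) by (subst (asm) ennreal_le_iff) auto
  then show ?thesis unfolding V_def by (rule real_le_rsqrt)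
 qed
 have V0: "V >= 0" using B G0 by (simp add: V_def)
 define U where "U = (\<integral>\<^sup>+x. sqn (u x) \<partial>M)"
 have "U <= (\<integral>\<^sup>+x. ennreal (V^2) \<partial>M)" unfolding U_def
  by (intro nn_integral_mono ennreal_leI power_mono ub) auto
 also have "\<dots> < \<top>" using Mf by (simp add: ennreal_mult_less_top)
 finally have Ufin: "U < \<top>" .
 \<comment> \<open>\<open>H\<close> is the complex conjugate of the adjoint applied to
   \<open>u\<close>.\<close>
 define H where "H p = (\<integral>x. cnj (u x) * k x p \<partial>M)" for p
 have Hm[measurable]: "H \<in> borel_measurable N" unfolding H_def
  by (rule M.borel_measurable_lebesgue_integral) measurable
 have CS1: "(\<integral>\<^sup>+p. ennreal (norm (k x p)) * ennreal (norm (f p)) \<partial>N)^2 <= ennreal B * (\<integral>\<^sup>+p. sqn (f p) \<partial>N)"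
  if x: "x \<in> space M" and [measurable]: "f \<in> borel_measurable N" for x and f :: "'p => complex"
 proof -
  have "(\<integral>\<^sup>+p. ennreal (norm (k x p)) * ennreal (norm (f p)) \<partial>N)^2 <= (\<integral>\<^sup>+p. (ennreal (norm (k x p)))^2 \<partial>N) * (\<integral>\<^sup>+p. (ennreal (norm (f p)))^2 \<partial>N)"
   by (rule Cauchy_Schwarz_nn_integral) (use kx[OF x] in measurable)
  also have "\<dots> <= ennreal B * (\<integral>\<^sup>+p. sqn (f p) \<partial>N)"
   using kb[OF x] by (simp add: ennreal_power mult_right_mono)
  finally show ?thesis .
 qed
 have CS1': "(\<integral>\<^sup>+p. ennreal (norm (k x p)) * ennreal (norm (f p)) \<partial>N) <= ennreal (sqrt (B * F))"
  if x: "x \<in> space M" and f: "f \<in> borel_measurable N" and F: "(\<integral>\<^sup>+p. sqn (f p) \<partial>N) <= ennreal F" "0 <= F"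
  for x F and f :: "'p => complex"
 proof -
  let ?I = "\<integral>\<^sup>+p. ennreal (norm (k x p)) * ennreal (norm (f p)) \<partial>N"
  have "?I^2 <= ennreal B * ennreal F"
   by (rule order_trans[OF CS1[OF x f]]) (rule mult_left_mono[OF F(1)], simp)
  then have I2: "?I^2 <= ennreal (B * F)" using B F by (simp add: ennreal_mult)
  show ?thesis
  proof (cases ?I rule: ennreal_cases)
   case (real i)
   then have "ennreal (i^2) <= ennreal (B * F)" using I2 by (simp add: ennreal_power)
   then have "i^2 <= B * F" using B F by (subst (asm) ennreal_le_iff) auto
   then have "i <= sqrt (B * F)" by (rule real_le_rsqrt)
   then show ?thesis using real by (simp add: ennreal_leI)
  next
   case top
   then show ?thesis using I2 by (simp add: power2_eq_square ennreal_mult_top top_unique)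
  qed
 qed
 have m1[measurable]: "(\<lambda>(x, p). cnj (u x) * k x p * g p) \<in> borel_measurable (M \<Otimes>\<^sub>M N)" by measurable
 have i1: "integrable (M \<Otimes>\<^sub>M N) (\<lambda>(x, p). cnj (u x) * k x p * g p)"
 proof (rule integrableI_bounded)
  have "(\<integral>\<^sup>+z. ennreal (norm (case z of (x, p) => cnj (u x) * k x p * g p)) \<partial>(M \<Otimes>\<^sub>M N))
    = (\<integral>\<^sup>+x. (\<integral>\<^sup>+p. ennreal (norm (cnj (u x) * k x p * g p)) \<partial>N) \<partial>M)"
   using N.nn_integral_fst[of "\<lambda>z. ennreal (norm (case z of (x, p) => cnj (u x) * k x p * g p))" M] m1 by simp
  also have "\<dots> <= (\<integral>\<^sup>+x. ennreal (V * sqrt (B * G0)) \<partial>M)"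
  proof (rule nn_integral_mono)
   fix x assume x: "x \<in> space M"
   have "(\<integral>\<^sup>+p. ennreal (norm (cnj (u x) * k x p * g p)) \<partial>N) = (\<integral>\<^sup>+p. ennreal (norm (u x)) * (ennreal (norm (k x p)) * ennreal (norm (g p))) \<partial>N)"
    by (intro nn_integral_cong) (simp add: norm_mult ennreal_mult mult.assoc)
   also have "\<dots> = ennreal (norm (u x)) * (\<integral>\<^sup>+p. ennreal (norm (k x p)) * ennreal (norm (g p)) \<partial>N)"
    by (rule nn_integral_cmult) (use kx[OF x] in measurable)
   also have "\<dots> <= ennreal V * ennreal (sqrt (B * G0))"
    by (intro mult_mono ennreal_leI ub x CS1' g) (use G0 in \<open>auto simp: G_def\<close>)
   also have "\<dots> = ennreal (V * sqrt (B * G0))" using V0 B G0 by (simp add: ennreal_mult)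
   finally show "(\<integral>\<^sup>+p. ennreal (norm (cnj (u x) * k x p * g p)) \<partial>N) <= ennreal (V * sqrt (B * G0))" .
  qed
  also have "\<dots> < \<infinity>" using Mf by (simp add: ennreal_mult_less_top)
  finally show "(\<integral>\<^sup>+z. ennreal (norm (case z of (x, p) => cnj (u x) * k x p * g p)) \<partial>(M \<Otimes>\<^sub>M N)) < \<infinity>" .
 qed measurable
 have Uint: "integrable M (\<lambda>x. complex_of_real ((norm (u x))^2))"
  using Ufin unfolding U_def by (intro integrableI_bounded) (auto simp: norm_power)
 have Ureal: "ennreal (norm (\<integral>x. complex_of_real ((norm (u x))^2) \<partial>M)) = U"
 proof -
  have "(\<integral>x. complex_of_real ((norm (u x))^2) \<partial>M) = complex_of_real (\<integral>x. (norm (u x))^2 \<partial>M)"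
   by (rule integral_complex_of_real)
  then have "norm (\<integral>x. complex_of_real ((norm (u x))^2) \<partial>M) = (\<integral>x. (norm (u x))^2 \<partial>M)" by simp
  also have "ennreal \<dots> = U" unfolding U_def
   using Ufin unfolding U_def by (intro nn_integral_eq_integral[symmetric] integrableI_bounded) (auto simp: norm_power)
  finally show ?thesis .
 qed
 have "(\<integral>x. complex_of_real ((norm (u x))^2) \<partial>M) = (\<integral>x. (\<integral>p. cnj (u x) * k x p * g p \<partial>N) \<partial>M)"
 proof (rule Bochner_Integration.integral_cong[OF refl])
  fix x
  have "(\<integral>p. cnj (u x) * k x p * g p \<partial>N) = (\<integral>p. cnj (u x) * (k x p * g p) \<partial>N)" by (simp only: mult.assoc)
  also have "\<dots> = cnj (u x) * u x" unfolding u_def by (rule integral_mult_right_zero)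
  finally have c: "(\<integral>p. cnj (u x) * k x p * g p \<partial>N) = cnj (u x) * u x" .
  show "complex_of_real ((norm (u x))^2) = (\<integral>p. cnj (u x) * k x p * g p \<partial>N)"
   unfolding c complex_norm_square by (rule mult.commute)
 qed
 also have "\<dots> = (\<integral>p. (\<integral>x. cnj (u x) * k x p * g p \<partial>M) \<partial>N)"
  using MN.Fubini_integral[OF i1] by simp
 also have "\<dots> = (\<integral>p. H p * g p \<partial>N)"
  unfolding H_def by (intro Bochner_Integration.integral_cong refl integral_mult_left_zero)
 finally have "U = ennreal (norm (\<integral>p. H p * g p \<partial>N))" using Ureal by simp
 then have "U^2 = sqn (\<integral>p. H p * g p \<partial>N)" by (simp add: ennreal_power)
 also have "\<dots> <= (\<integral>\<^sup>+p. sqn (H p) \<partial>N) * G"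
  unfolding G_def by (rule norm_integral_mult_sq_le) measurable
 finally have U2: "U^2 <= (\<integral>\<^sup>+p. sqn (H p) \<partial>N) * G" .
 define K where "K x y = (\<integral>p. k x p * cnj (k y p) \<partial>N)" for x y
 have Ksym: "norm (K x y) = norm (K y x)" for x y
 proof -
  have "cnj (K x y) = (\<integral>p. cnj (k x p * cnj (k y p)) \<partial>N)" unfolding K_def by (rule Bochner_Integration.integral_cnj[symmetric])
  also have "\<dots> = K y x" unfolding K_def by (intro Bochner_Integration.integral_cong) (auto simp: mult.commute)
  finally show ?thesis by (metis complex_mod_cnj)
 qed
 have kk1[measurable]: "(\<lambda>z. k (fst (fst z)) (snd z)) \<in> borel_measurable ((M \<Otimes>\<^sub>M M) \<Otimes>\<^sub>M N)"
  using measurable_compose[of "\<lambda>z. (fst (fst z), snd z)" "(M \<Otimes>\<^sub>M M) \<Otimes>\<^sub>M N" "M \<Otimes>\<^sub>M N" "case_prod k" borel] k by simp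
 have kk2[measurable]: "(\<lambda>z. k (snd (fst z)) (snd z)) \<in> borel_measurable ((M \<Otimes>\<^sub>M M) \<Otimes>\<^sub>M N)"
  using measurable_compose[of "\<lambda>z. (snd (fst z), snd z)" "(M \<Otimes>\<^sub>M M) \<Otimes>\<^sub>M N" "M \<Otimes>\<^sub>M N" "case_prod k" borel] k by simp
 let ?F = "\<lambda>z. cnj (u (fst (fst z))) * u (snd (fst z)) * (k (fst (fst z)) (snd z) * cnj (k (snd (fst z)) (snd z)))"
 have Fm[measurable]: "?F \<in> borel_measurable ((M \<Otimes>\<^sub>M M) \<Otimes>\<^sub>M N)" by measurable
 have i2: "integrable ((M \<Otimes>\<^sub>M M) \<Otimes>\<^sub>M N) ?F"
 proof (rule integrableI_bounded)
  have "(\<integral>\<^sup>+z. ennreal (norm (?F z)) \<partial>((M \<Otimes>\<^sub>M M) \<Otimes>\<^sub>M N)) = (\<integral>\<^sup>+w. (\<integral>\<^sup>+p. ennreal (norm (?F (w, p))) \<partial>N) \<partial>(M \<Otimes>\<^sub>M M))"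
   by (rule N.nn_integral_fst[symmetric]) measurable
  also have "\<dots> <= (\<integral>\<^sup>+w. ennreal (V * V * sqrt (B * B)) \<partial>(M \<Otimes>\<^sub>M M))"
  proof (rule nn_integral_mono)
   fix w assume "w \<in> space (M \<Otimes>\<^sub>M M)"
   then obtain x y where w: "w = (x, y)" "x \<in> space M" "y \<in> space M" by (auto simp: space_pair_measure)
   have "(\<integral>\<^sup>+p. ennreal (norm (?F (w, p))) \<partial>N) = (\<integral>\<^sup>+p. ennreal (norm (u x) * norm (u y)) * (ennreal (norm (k x p)) * ennreal (norm (k y p))) \<partial>N)"
    by (intro nn_integral_cong) (simp add: w norm_mult ennreal_mult mult.assoc)
   also have "\<dots> = ennreal (norm (u x) * norm (u y)) * (\<integral>\<^sup>+p. ennreal (norm (k x p)) * ennreal (norm (k y p)) \<partial>N)"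
    by (rule nn_integral_cmult) (use kx[OF w(2)] kx[OF w(3)] in measurable)
   also have "\<dots> <= ennreal (V * V) * ennreal (sqrt (B * B))"
    by (intro mult_mono ennreal_leI ub w CS1' kx kb B) (use V0 in auto)
   also have "\<dots> = ennreal (V * V * sqrt (B * B))" using V0 B by (simp add: ennreal_mult)
   finally show "(\<integral>\<^sup>+p. ennreal (norm (?F (w, p))) \<partial>N) <= ennreal (V * V * sqrt (B * B))" .
  qed
  also have "\<dots> < \<infinity>"
   using Mf by (simp add: space_pair_measure M.emeasure_pair_measure_Times ennreal_mult_less_top)
  finally show "(\<integral>\<^sup>+z. ennreal (norm (?F z)) \<partial>((M \<Otimes>\<^sub>M M) \<Otimes>\<^sub>M N)) < \<infinity>" .
 qed (rule Fm)
 have i2': "integrable ((M \<Otimes>\<^sub>M M) \<Otimes>\<^sub>M N) (\<lambda>(w, p). ?F (w, p))" using i2 by (simp add: case_prod_unfold)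
 have HH: "AE p in N. (\<integral>w. ?F (w, p) \<partial>(M \<Otimes>\<^sub>M M)) = complex_of_real ((norm (H p))^2)"
  using MMN.AE_integrable_snd[OF i2']
 proof eventually_elim
  case (elim p)
  have "integrable (M \<Otimes>\<^sub>M M) (\<lambda>(x, y). ?F ((x, y), p))" using elim by (simp add: case_prod_unfold)
  from MM.integral_fst[OF this]
  have "(\<integral>w. ?F (w, p) \<partial>(M \<Otimes>\<^sub>M M)) = (\<integral>x. (\<integral>y. ?F ((x, y), p) \<partial>M) \<partial>M)" by (simp add: case_prod_unfold)
  also have "\<dots> = (\<integral>x. (cnj (u x) * k x p) * cnj (H p) \<partial>M)"
  proof (rule Bochner_Integration.integral_cong[OF refl])
   fix x
   have "(\<integral>y. ?F ((x, y), p) \<partial>M) = (\<integral>y. (cnj (u x) * k x p) * cnj (cnj (u y) * k y p) \<partial>M)"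
    by (intro Bochner_Integration.integral_cong) (auto simp: mult_ac)
   also have "\<dots> = (cnj (u x) * k x p) * (\<integral>y. cnj (cnj (u y) * k y p) \<partial>M)" by (rule integral_mult_right_zero)
   also have "(\<integral>y. cnj (cnj (u y) * k y p) \<partial>M) = cnj (H p)" unfolding H_def by (rule Bochner_Integration.integral_cnj)
   finally show "(\<integral>y. ?F ((x, y), p) \<partial>M) = (cnj (u x) * k x p) * cnj (H p)" .
  qed
  also have "\<dots> = H p * cnj (H p)" unfolding H_def by (rule integral_mult_left_zero)
  finally show ?case unfolding complex_norm_square .
 qed
 have Hint: "integrable N (\<lambda>p. complex_of_real ((norm (H p))^2))"
  using MMN.integrable_snd[OF i2'] HH by (subst (asm) integrable_cong_AE) auto
 have "(\<integral>\<^sup>+p. sqn (H p) \<partial>N) = ennreal (norm (\<integral>p. complex_of_real ((norm (H p))^2) \<partial>N))"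
 proof -
  have ri: "integrable N (\<lambda>p. (norm (H p))^2)" using Hint unfolding complex_of_real_integrable_eq .
  have "(\<integral>\<^sup>+p. sqn (H p) \<partial>N) = ennreal (\<integral>p. (norm (H p))^2 \<partial>N)"
   by (rule nn_integral_eq_integral[OF ri]) simp
  moreover have "norm (\<integral>p. complex_of_real ((norm (H p))^2) \<partial>N) = (\<integral>p. (norm (H p))^2 \<partial>N)"
   by (subst integral_complex_of_real) simp
  ultimately show ?thesis by simp
 qed
 also have "(\<integral>p. complex_of_real ((norm (H p))^2) \<partial>N) = (\<integral>p. (\<integral>w. ?F (w, p) \<partial>(M \<Otimes>\<^sub>M M)) \<partial>N)"
  using HH by (intro integral_cong_AE) (auto intro!: borel_measurable_integrable[OF MMN.integrable_snd[OF i2']] elim: eventually_mono)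
 also have "\<dots> = (\<integral>w. (\<integral>p. ?F (w, p) \<partial>N) \<partial>(M \<Otimes>\<^sub>M M))" by (rule MMN.Fubini_integral[OF i2'])
 also have "ennreal (norm \<dots>) <= (\<integral>\<^sup>+w. ennreal (norm (\<integral>p. ?F (w, p) \<partial>N)) \<partial>(M \<Otimes>\<^sub>M M))"
  by (rule integral_norm_bound_ennreal[OF MMN.integrable_fst[OF i2']])
 also have "\<dots> = (\<integral>\<^sup>+w. ennreal (norm (u (fst w)) * norm (u (snd w)) * norm (K (fst w) (snd w))) \<partial>(M \<Otimes>\<^sub>M M))"
  unfolding K_def fst_conv snd_conv by (intro nn_integral_cong) (simp add: norm_mult)
 \<comment> \<open>By 2ab <= a^2 + b^2 and the symmetry of |K| both halves reduce to the row
   integrals bounded by \<open>S\<close>.\<close>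
 also have "\<dots> <= (\<integral>\<^sup>+w. ennreal (1/2) * (sqn (u (fst w)) * ennreal (norm (K (fst w) (snd w))) + sqn (u (snd w)) * ennreal (norm (K (snd w) (fst w)))) \<partial>(M \<Otimes>\<^sub>M M))"
 proof (rule nn_integral_mono)
  fix w :: "'x \<times> 'x"
  let ?a = "norm (u (fst w))" and ?b = "norm (u (snd w))" and ?K = "norm (K (fst w) (snd w))"
  have "?a * ?b * ?K <= 1/2 * (?a^2 * ?K + ?b^2 * ?K)"
  proof -
   have "0 <= (?a - ?b)^2" by simp
   then have "?a * ?b <= 1/2 * (?a^2 + ?b^2)" by (simp add: power2_eq_square algebra_simps)
   then have "?a * ?b * ?K <= 1/2 * (?a^2 + ?b^2) * ?K" by (rule mult_right_mono) simp
   then show ?thesis by (simp add: algebra_simps)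
  qed
  then have "ennreal (?a * ?b * ?K) <= ennreal (1/2 * (?a^2 * ?K + ?b^2 * ?K))" by (rule ennreal_leI)
  also have "\<dots> = ennreal (1/2) * (ennreal (?a^2) * ennreal ?K + ennreal (?b^2) * ennreal ?K)"
   by (subst ennreal_mult) (auto simp: ennreal_plus ennreal_mult)
  finally show "ennreal (?a * ?b * ?K) <= ennreal (1/2) * (ennreal (?a^2) * ennreal ?K + ennreal (?b^2) * ennreal (norm (K (snd w) (fst w))))"
   using Ksym[of "snd w" "fst w"] by simp
 qed
 also have "\<dots> = ennreal (1/2) * ((\<integral>\<^sup>+w. sqn (u (fst w)) * ennreal (norm (K (fst w) (snd w))) \<partial>(M \<Otimes>\<^sub>M M)) + (\<integral>\<^sup>+w. sqn (u (snd w)) * ennreal (norm (K (snd w) (fst w))) \<partial>(M \<Otimes>\<^sub>M M)))"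
 proof -
  have Km[measurable]: "(\<lambda>w. K (fst w) (snd w)) \<in> borel_measurable (M \<Otimes>\<^sub>M M)" "(\<lambda>w. K (snd w) (fst w)) \<in> borel_measurable (M \<Otimes>\<^sub>M M)"
   unfolding K_def by measurable
  show ?thesis by (subst nn_integral_cmult, measurable) (subst nn_integral_add, measurable)
 qed
 also have "\<dots> <= ennreal (1/2) * (S * U + S * U)"
 proof (intro mult_left_mono add_mono)
  have Km[measurable]: "(\<lambda>w. K (fst w) (snd w)) \<in> borel_measurable (M \<Otimes>\<^sub>M M)" "(\<lambda>w. K (snd w) (fst w)) \<in> borel_measurable (M \<Otimes>\<^sub>M M)"
   "(\<lambda>(x, y). K x y) \<in> borel_measurable (M \<Otimes>\<^sub>M M)"
   unfolding K_def by measurable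
  have one: "(\<integral>\<^sup>+x. (\<integral>\<^sup>+y. sqn (u x) * ennreal (norm (K x y)) \<partial>M) \<partial>M) <= S * U"
  proof -
   have "(\<integral>\<^sup>+x. (\<integral>\<^sup>+y. sqn (u x) * ennreal (norm (K x y)) \<partial>M) \<partial>M) <= (\<integral>\<^sup>+x. S * sqn (u x) \<partial>M)"
   proof (rule nn_integral_mono)
    fix x assume x: "x \<in> space M"
    have [measurable]: "K x \<in> borel_measurable M" using measurable_Pair2[OF Km(3) x] by simp
    have "(\<integral>\<^sup>+y. sqn (u x) * ennreal (norm (K x y)) \<partial>M) = sqn (u x) * (\<integral>\<^sup>+y. ennreal (norm (K x y)) \<partial>M)"
     by (rule nn_integral_cmult) measurable
    also have "\<dots> <= sqn (u x) * S" using S[OF x] unfolding K_def by (rule mult_left_mono) simp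
    finally show "(\<integral>\<^sup>+y. sqn (u x) * ennreal (norm (K x y)) \<partial>M) <= S * sqn (u x)" by (simp add: mult.commute)
   qed
   also have "\<dots> = S * U" unfolding U_def by (rule nn_integral_cmult) measurable
   finally show ?thesis .
  qed
  have "(\<integral>\<^sup>+w. sqn (u (fst w)) * ennreal (norm (K (fst w) (snd w))) \<partial>(M \<Otimes>\<^sub>M M)) = (\<integral>\<^sup>+x. (\<integral>\<^sup>+y. sqn (u x) * ennreal (norm (K x y)) \<partial>M) \<partial>M)"
   using M.nn_integral_fst[of "\<lambda>w. sqn (u (fst w)) * ennreal (norm (K (fst w) (snd w)))" M] by simp
  then show "(\<integral>\<^sup>+w. sqn (u (fst w)) * ennreal (norm (K (fst w) (snd w))) \<partial>(M \<Otimes>\<^sub>M M)) <= S * U" using one by simp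
  have "(\<integral>\<^sup>+w. sqn (u (snd w)) * ennreal (norm (K (snd w) (fst w))) \<partial>(M \<Otimes>\<^sub>M M)) = (\<integral>\<^sup>+x. (\<integral>\<^sup>+y. sqn (u x) * ennreal (norm (K x y)) \<partial>M) \<partial>M)"
   using MM.nn_integral_snd[of "\<lambda>w. sqn (u (snd w)) * ennreal (norm (K (snd w) (fst w)))"] by simp
  then show "(\<integral>\<^sup>+w. sqn (u (snd w)) * ennreal (norm (K (snd w) (fst w))) \<partial>(M \<Otimes>\<^sub>M M)) <= S * U" using one by simp
 qed simp
 also have "\<dots> = S * U"
 proof -
  have "ennreal (1/2) * (S * U + S * U) = (ennreal (1/2) * 2) * (S * U)" by (simp add: mult_2[symmetric] mult.assoc)
  also have "ennreal (1/2) * 2 = 1" by (metis ennreal_1 ennreal_mult'' ennreal_numeral mult.commute nonzero_mult_div_cancel_left times_divide_eq_right zero_le_numeral zero_neq_numeral mult.right_neutral)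
  finally show ?thesis by simp
 qed
 finally have "(\<integral>\<^sup>+p. sqn (H p) \<partial>N) <= S * U" .
 with U2 have "U^2 <= S * U * G" by (meson mult_right_mono order_trans zero_le)
 then have "U^2 <= (S * G) * U" by (simp add: mult_ac)
 then have "U <= S * G" using Ufin by (rule ennreal_sq_le_imp_le)
 then show ?thesis unfolding U_def u_def G_def .
qed

section \<open>The Fourier transform on square integrable functions\<close>

lemma integral_lborel_prod:
 fixes f :: "'a::euclidean_space => real => complex"
 assumes "\<And>b. b \<in> Basis ==> integrable lborel (f b)"
 shows "(LL x. (\<Prod>b\<in>Basis. f b (x \<bullet> b))) = (\<Prod>b\<in>Basis. \<integral>x. f b x \<partial>lborel)"
  and "integrable lborel (\<lambda>x::'a. \<Prod>b\<in>Basis. f b (x \<bullet> b))"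
proof -
 interpret product_sigma_finite "\<lambda>_::'a. lborel :: real measure" ..
 have [measurable]: "b \<in> Basis ==> f b \<in> bmeas" for b
  using borel_measurable_integrable[OF assms] by simp
 let ?T = "\<lambda>g. \<Sum>b\<in>Basis. g b .* b :: 'a"
 have T: "?T \<in> measurable (Pi\<^sub>M Basis (\<lambda>_. lborel)) borel" by measurable
 have m: "(\<lambda>x::'a. \<Prod>b\<in>Basis. f b (x \<bullet> b)) \<in> bmeas" by measurable
 have e: "(\<Prod>b\<in>Basis. f b (?T g \<bullet> b)) = (\<Prod>b\<in>Basis. f b (g b))" for g
  by (intro prod.cong refl) simp
 have "(LL x. (\<Prod>b\<in>Basis. f b (x \<bullet> b))) = (\<integral>x. (\<Prod>b\<in>Basis. f b (x \<bullet> b)) \<partial>distr (Pi\<^sub>M Basis (\<lambda>_. lborel)) borel ?T)"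
  by (subst lborel_eq) (rule refl)
 also have "\<dots> = (\<integral>g. (\<Prod>b\<in>Basis. f b (g b)) \<partial>Pi\<^sub>M Basis (\<lambda>_. lborel))"
  by (subst integral_distr[OF T m]) (simp only: e)
 also have "\<dots> = (\<Prod>b\<in>Basis. \<integral>x. f b x \<partial>lborel)"
  by (rule product_integral_prod) (use assms in auto)
 finally show "(LL x. (\<Prod>b\<in>Basis. f b (x \<bullet> b))) = (\<Prod>b\<in>Basis. \<integral>x. f b x \<partial>lborel)" .
 have "integrable (Pi\<^sub>M Basis (\<lambda>_. lborel)) (\<lambda>g. \<Prod>b\<in>Basis. f b (g b))"
  by (rule product_integrable_prod) (use assms in auto)
 then have "integrable (distr (Pi\<^sub>M Basis (\<lambda>_. lborel)) borel ?T) (\<lambda>x. \<Prod>b\<in>Basis. f b (x \<bullet> b))"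
  by (subst integrable_distr_eq[OF T m]) (simp only: e)
 then show "integrable lborel (\<lambda>x::'a. \<Prod>b\<in>Basis. f b (x \<bullet> b))" by (subst lborel_eq)
qed

lemma gaussian_integrable: "0 < \<sigma> ==> integrable lborel (\<lambda>x::real. exp (- (\<sigma> * x)\<^sup>2 / 2))"
proof -
 assume s: "0 < \<sigma>"
 have "(\<lambda>x. exp (- (\<sigma> * x)\<^sup>2 / 2)) = (\<lambda>x. sqrt (2 * pi * (1 / \<sigma>)^2) * normal_density 0 (1 / \<sigma>) x)"
  using s by (auto simp: normal_density_def power_mult_distrib power_divide field_simps fun_eq_iff)
 moreover have "integrable lborel (normal_density 0 (1 / \<sigma>))" using s by (intro integrable_normal_density) simp
 ultimately show ?thesis by simp
qed

text \<open>A rescaling of the characteristic function of the standard normal distribution; the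
  transform appears as a normal density so that its total mass is known.\<close>

lemma gaussian_fourier:
 assumes s: "0 < \<sigma>"
 shows "(LL x. exp (\<i> * of_real (t * x)) * of_real (exp (- (\<sigma> * x)\<^sup>2 / 2))) = complex_of_real (2 * pi * normal_density 0 \<sigma> t)"
  and "integrable lborel (\<lambda>x. exp (\<i> * of_real (t * x)) * complex_of_real (exp (- (\<sigma> * x)\<^sup>2 / 2)))"
proof -
 let ?f = "\<lambda>x. exp (\<i> * of_real (t / \<sigma> * x)) * complex_of_real (exp (- x\<^sup>2 / 2))"
 have "char std_normal_distribution (t / \<sigma>) = (LL x. std_normal_density x .* exp (\<i> * of_real (t / \<sigma> * x)))"
  unfolding char_def by (subst integral_density) (auto simp: normal_density_nonneg)
 also have "\<dots> = (LL x. of_real (1 / sqrt (2 * pi)) * ?f x)"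
  by (intro Bochner_Integration.integral_cong) (auto simp: std_normal_density_def scaleR_conv_of_real)
 also have "\<dots> = of_real (1 / sqrt (2 * pi)) * (LL x. ?f x)" by (rule integral_mult_right_zero)
 finally have "of_real (1 / sqrt (2 * pi)) * (LL x. ?f x) = complex_of_real (exp (- ((t / \<sigma>)^2) / 2))"
  by (simp add: char_std_normal_distribution)
 then have 1: "(LL x. ?f x) = complex_of_real (sqrt (2 * pi) * exp (- ((t / \<sigma>)^2) / 2))"
  by (simp add: field_simps)
 have "(LL x. ?f x) = \<bar>\<sigma>\<bar> .* (LL x. ?f (0 + \<sigma> * x))"
  by (rule lborel_integral_real_affine) (use s in auto)
 also have "(\<lambda>x. ?f (0 + \<sigma> * x)) = (\<lambda>x. exp (\<i> * of_real (t * x)) * complex_of_real (exp (- (\<sigma> * x)\<^sup>2 / 2)))"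
  using s by (auto simp: fun_eq_iff)
 finally have "(LL x. exp (\<i> * of_real (t * x)) * complex_of_real (exp (- (\<sigma> * x)\<^sup>2 / 2))) = (1 / \<sigma>) .* complex_of_real (sqrt (2 * pi) * exp (- ((t / \<sigma>)^2) / 2))"
  unfolding 1 using s by (simp add: scaleR_conv_of_real field_simps)
 also have "\<dots> = complex_of_real (2 * pi * normal_density 0 \<sigma> t)"
 proof -
  have "2 * pi / (sqrt (2 * pi) * \<sigma>) = sqrt (2 * pi) / \<sigma>"
  proof -
   have "2 * pi = sqrt (2 * pi) * sqrt (2 * pi)" by simp
   then have "2 * pi / (sqrt (2 * pi) * \<sigma>) = sqrt (2 * pi) * sqrt (2 * pi) / (sqrt (2 * pi) * \<sigma>)" by simp
   also have "\<dots> = sqrt (2 * pi) / \<sigma>" by (simp del: real_sqrt_mult_self)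
   finally show ?thesis .
  qed
  moreover have "normal_density 0 \<sigma> t = 1 / (sqrt (2 * pi) * \<sigma>) * exp (- ((t / \<sigma>)^2) / 2)"
  proof -
   have "sqrt (2 * pi * \<sigma>^2) = sqrt (2 * pi) * \<sigma>" using s by (simp add: real_sqrt_mult)
   moreover have "- (t - 0)\<^sup>2 / (2 * \<sigma>^2) = - ((t / \<sigma>)^2) / 2" by (simp add: power_divide)
   ultimately show ?thesis unfolding normal_density_def by (simp only:)
  qed
  ultimately have "2 * pi * normal_density 0 \<sigma> t = sqrt (2 * pi) / \<sigma> * exp (- ((t / \<sigma>)^2) / 2)"
   by (metis (no_types, lifting) mult.assoc mult.commute times_divide_eq_left mult_1)
  then show ?thesis by (simp add: scaleR_conv_of_real field_simps)
 qed
 finally show "(LL x. exp (\<i> * of_real (t * x)) * of_real (exp (- (\<sigma> * x)\<^sup>2 / 2))) = complex_of_real (2 * pi * normal_density 0 \<sigma> t)" .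
 show "integrable lborel (\<lambda>x. exp (\<i> * of_real (t * x)) * complex_of_real (exp (- (\<sigma> * x)\<^sup>2 / 2)))"
  by (rule Bochner_Integration.integrable_bound[OF gaussian_integrable[OF s]]) (auto simp: norm_mult)
qed

definition gaussian :: "real => 'a::euclidean_space => real" where
 "gaussian \<sigma> x = (\<Prod>b\<in>Basis. exp (- (\<sigma> * (x \<bullet> b))\<^sup>2 / 2))"

lemma gaussian_pos: "0 < gaussian \<sigma> x" by (simp add: gaussian_def prod_pos)

lemma gaussian_measurable [measurable]: "gaussian \<sigma> \<in> bmeas"
 unfolding gaussian_def by measurable

lemma gaussian_kernel:
 fixes z :: "'a::euclidean_space"
 assumes s: "0 < \<sigma>"
 shows "(LL xi. exp (\<i> * of_real (z \<bullet> xi)) * of_real (gaussian \<sigma> xi)) = complex_of_real (\<Prod>b\<in>Basis. 2 * pi * normal_density 0 \<sigma> (z \<bullet> b))"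
  and "integrable lborel (\<lambda>xi. exp (\<i> * of_real (z \<bullet> xi)) * complex_of_real (gaussian \<sigma> xi))"
proof -
 let ?f = "\<lambda>b x. exp (\<i> * of_real ((z \<bullet> b) * x)) * complex_of_real (exp (- (\<sigma> * x)\<^sup>2 / 2))"
 have e: "exp (\<i> * of_real (z \<bullet> xi)) * complex_of_real (gaussian \<sigma> xi) = (\<Prod>b\<in>Basis. ?f b (xi \<bullet> b))" for xi
 proof -
  have "exp (\<i> * complex_of_real (z \<bullet> xi)) = exp (\<Sum>b\<in>Basis. \<i> * of_real ((z \<bullet> b) * (xi \<bullet> b)))"
   by (subst euclidean_inner) (simp add: sum_distrib_left)
  also have "\<dots> = (\<Prod>b\<in>Basis. exp (\<i> * of_real ((z \<bullet> b) * (xi \<bullet> b))))" by (rule exp_sum) simp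
  finally show ?thesis by (simp add: gaussian_def prod.distrib)
 qed
 show "(LL xi. exp (\<i> * of_real (z \<bullet> xi)) * of_real (gaussian \<sigma> xi)) = complex_of_real (\<Prod>b\<in>Basis. 2 * pi * normal_density 0 \<sigma> (z \<bullet> b))"
  unfolding e by (subst integral_lborel_prod) (auto simp only: gaussian_fourier[OF s] of_real_prod)
 show "integrable lborel (\<lambda>xi. exp (\<i> * of_real (z \<bullet> xi)) * complex_of_real (gaussian \<sigma> xi))"
  unfolding e by (rule integral_lborel_prod(2)) (rule gaussian_fourier(2)[OF s])
qed

lemma gaussian_kernel_mass:
 fixes x :: "'a::euclidean_space"
 assumes s: "0 < \<sigma>"
 shows "(NN y. ennreal (\<Prod>b\<in>Basis. 2 * pi * normal_density 0 \<sigma> ((x - y) \<bullet> b))) = ennreal ((2 * pi) ^ DIM('a))"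
proof -
 have nd: "normal_density 0 \<sigma> (a - t) = normal_density a \<sigma> t" for a t
  by (simp add: normal_density_def power2_commute)
 have 1: "(NN t. ennreal (2 * pi * normal_density a \<sigma> t)) = ennreal (2 * pi)" for a
 proof -
  have "(NN t. ennreal (2 * pi * normal_density a \<sigma> t)) = ennreal (LL t. 2 * pi * normal_density a \<sigma> t)"
   by (rule nn_integral_eq_integral) (auto intro!: integrable_normal_density s)
  then show ?thesis using s by simp
 qed
 have "(NN y. ennreal (\<Prod>b\<in>Basis. 2 * pi * normal_density 0 \<sigma> ((x - y) \<bullet> b)))
  = (NN y. (\<Prod>b\<in>Basis. ennreal (2 * pi * normal_density (x \<bullet> b) \<sigma> (y \<bullet> b))))"
  by (intro nn_integral_cong) (simp add: prod_ennreal inner_diff_left nd)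
 also have "\<dots> = (\<Prod>b\<in>(Basis::'a set). \<integral>\<^sup>+t. ennreal (2 * pi * normal_density (x \<bullet> b) \<sigma> t) \<partial>lborel)"
  by (rule nn_integral_lborel_prod) auto
 also have "\<dots> = ennreal ((2 * pi) ^ DIM('a))" by (simp only: 1) (simp add: ennreal_power)
 finally show ?thesis .
qed

text \<open>The inequality half of Plancherel, again through \<open>TT_star_bound\<close>: in a
  Gaussian measure on the frequency side the composed kernel is a product of normal densities, whose
  row integrals are at most (2 pi)^n for every width. Pairing the image of the transform with u
  gives I^2 <= (2 pi)^n |u|^2 I for the weighted norm I.\<close>

lemma plancherel_bound:
 fixes u :: "'a::euclidean_space => complex"
 assumes um[measurable]: "u \<in> bmeas" and supp: "\<And>x. x \<notin> cball 0 R ==> u x = 0"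
  and u2: "(NN x. sqn (u x)) < \<top>"
 defines "uh \<equiv> \<lambda>xi. \<integral>x. wave x xi * u x \<partial>lborel"
 shows "(NN xi. sqn (uh xi)) <= ennreal ((2 * pi) ^ DIM('a)) * (NN x. sqn (u x))"
  and "integrable lborel u" and "uh \<in> bmeas"
proof -
 let ?B = "cball 0 R :: 'a set"
 define M where "M = density lborel (\<lambda>x. ennreal (indicator ?B x))"
 have [measurable_cong, simp]: "sets M = sets borel" and [simp]: "space M = UNIV" by (simp_all add: M_def)
 have Bfin: "emeasure lborel ?B < \<top>" using emeasure_bounded_finite[of ?B] by simp
 have Bm[measurable]: "?B \<in> sets borel" by simp
 have "emeasure M UNIV = emeasure lborel ?B"
  unfolding M_def by (subst emeasure_density) (auto simp: ennreal_indicator)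
 then have Mfin: "finite_measure M"
  by (intro finite_measureI) (use Bfin in simp)
 interpret M: finite_measure M by (rule Mfin)
 have nnM: "(\<integral>\<^sup>+x. f x \<partial>M) = (NN x. indicator ?B x * f x)" if "f \<in> bmeas" for f
  unfolding M_def using that by (subst nn_integral_density) (simp_all add: ennreal_indicator)
 have "(NN x. ennreal (norm (u x)))^2 < \<top>"
 proof -
  have "(NN x. ennreal (norm (u x))) = (NN x. ennreal (norm (u x)) * indicator ?B x)"
   using supp by (intro nn_integral_cong) (auto simp: indicator_def)
  also have "\<dots>^2 <= (NN x. (ennreal (norm (u x)))^2) * (NN x. (indicator ?B x)^2)"
   by (rule Cauchy_Schwarz_nn_integral) auto
  also have "(NN x. (indicator ?B x :: ennreal)^2) = emeasure lborel ?B"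
  proof -
   have "(indicator ?B x :: ennreal)^2 = indicator ?B x" for x by (simp add: indicator_def)
   then show ?thesis by (simp only: nn_integral_indicator Bm sets_lborel)
  qed
  also have "(NN x. (ennreal (norm (u x)))^2) * emeasure lborel ?B < \<top>"
   using u2 Bfin by (simp add: ennreal_power ennreal_mult_less_top)
  finally show ?thesis .
 qed
 then have u1: "(NN x. ennreal (norm (u x))) < \<top>" by (simp add: power2_eq_square ennreal_mult_less_top) (auto simp: less_top)
 show ui: "integrable lborel u" by (rule integrableI_bounded) (use u1 in auto)
 define L where "L = (LL x. norm (u x))"
 have em[measurable]: "(\<lambda>(xi, x). exp (- \<i> * complex_of_real (x \<bullet> xi)) * u x) \<in> borel_measurable (lborel \<Otimes>\<^sub>M lborel)"
  unfolding measurable_lborel_pair by measurable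
 show uhm[measurable]: "uh \<in> bmeas"
  unfolding uh_def using lborel.borel_measurable_lebesgue_integral[OF em] by simp
 have uhL: "norm (uh xi) <= L" for xi
 proof -
  have "norm (uh xi) <= (LL x. norm (wave x xi * u x))"
   unfolding uh_def by (rule integral_norm_bound)
  then show ?thesis by (simp add: norm_mult L_def)
 qed
 have "(\<lambda>x. indicator ?B x .* u x) = u" using supp by (auto simp: indicator_def fun_eq_iff)
 then have uint: "integrable M u" unfolding M_def using ui by (subst integrable_density) auto
 have cj[measurable]: "cnj \<in> bmeas" by (intro borel_measurable_continuous_onI continuous_intros)
 have main: "(NN xi. ennreal (gaussian \<sigma> xi) * sqn (uh xi)) <= ennreal ((2 * pi) ^ DIM('a)) * (NN x. sqn (u x))"
  if s: "0 < \<sigma>" for \<sigma>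
 proof -
  \<comment> \<open>The Gaussian weight makes the frequency measure finite, so that all integrals
    converge absolutely.\<close>
  define N where "N = density lborel (\<lambda>xi::'a. ennreal (gaussian \<sigma> xi))"
  have [measurable_cong, simp]: "sets N = sets borel" and [simp]: "space N = UNIV" by (simp_all add: N_def)
  have g0: "0 <= gaussian \<sigma> x" for x :: 'a using gaussian_pos less_imp_le by blast
  have Gi: "integrable lborel (gaussian \<sigma> :: 'a => real)"
   using gaussian_kernel(2)[OF s, of 0] by (simp add: complex_of_real_integrable_eq)
  define B where "B = (LL xi. gaussian \<sigma> (xi::'a))"
  have B0: "B >= 0" unfolding B_def using g0 by (intro integral_nonneg_AE) auto
  have NB: "emeasure N UNIV = ennreal B"
   unfolding N_def B_def by (subst emeasure_density) (auto simp: nn_integral_eq_integral[OF Gi] g0)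
  have Nfin: "finite_measure N" by (rule finite_measureI) (simp add: NB)
  interpret N: finite_measure N by (rule Nfin)
  interpret MN: pair_sigma_finite M N ..
  have mMN: "measurable (M \<Otimes>\<^sub>M N) L = measurable (borel \<Otimes>\<^sub>M borel) L" for L :: "complex measure"
   by (rule measurable_cong_sets) (simp_all cong: sets_pair_measure_cong)
  let ?k = "\<lambda>(x::'a) xi. exp (\<i> * complex_of_real (x \<bullet> xi))"
  have km: "case_prod ?k \<in> borel_measurable (M \<Otimes>\<^sub>M N)" by measurable
  have nnN: "(\<integral>\<^sup>+x. f x \<partial>N) = (NN x. ennreal (gaussian \<sigma> x) * f x)" if "f \<in> bmeas" for f
   unfolding N_def using that by (subst nn_integral_density) auto
  have intN: "(\<integral>xi. f xi \<partial>N) = (LL xi. gaussian \<sigma> xi .* f xi)" if "f \<in> bmeas" for f :: "'a => complex"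
   unfolding N_def using that g0 by (subst integral_density) auto
  have K: "(\<integral>xi. ?k x xi * cnj (?k y xi) \<partial>N) = complex_of_real (\<Prod>b\<in>Basis. 2 * pi * normal_density 0 \<sigma> ((x - y) \<bullet> b))" for x y
  proof -
   have "(\<integral>xi. ?k x xi * cnj (?k y xi) \<partial>N) = (\<integral>xi. exp (\<i> * of_real ((x - y) \<bullet> xi)) \<partial>N)"
    by (intro Bochner_Integration.integral_cong) (auto simp: exp_cnj mult_exp_exp inner_diff_left algebra_simps)
   also have "\<dots> = (LL xi. exp (\<i> * of_real ((x - y) \<bullet> xi)) * of_real (gaussian \<sigma> xi))"
    by (subst intN) (auto simp: scaleR_conv_of_real mult.commute)
   finally show ?thesis by (simp only: gaussian_kernel(1)[OF s])
  qed
  have uhfin: "(\<integral>\<^sup>+xi. sqn (uh xi) \<partial>N) < \<top>"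
  proof -
   have "(\<integral>\<^sup>+xi. sqn (uh xi) \<partial>N) <= (\<integral>\<^sup>+xi. ennreal (L^2) \<partial>N)"
    by (intro nn_integral_mono ennreal_leI power_mono uhL) auto
   also have "\<dots> < \<top>" by (simp add: NB ennreal_mult_less_top)
   finally show ?thesis .
  qed
  define v where "v x = (\<integral>xi. ?k x xi * uh xi \<partial>N)" for x
  have vm[measurable]: "v \<in> bmeas"
  proof -
   have "v \<in> borel_measurable M" unfolding v_def
    by (rule N.borel_measurable_lebesgue_integral) measurable
   then show ?thesis by (simp cong: measurable_cong_sets)
  qed
  have TT: "(\<integral>\<^sup>+x. sqn (v x) \<partial>M) <= ennreal ((2 * pi) ^ DIM('a)) * (\<integral>\<^sup>+xi. sqn (uh xi) \<partial>N)"
   unfolding v_def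
  proof (rule TT_star_bound[OF Mfin N.sigma_finite_measure_axioms km _ B0])
   show "(\<integral>\<^sup>+p. sqn (?k x p) \<partial>N) <= ennreal B" for x by (simp add: NB)
   show "(\<integral>\<^sup>+y. ennreal (norm (\<integral>p. ?k x p * cnj (?k y p) \<partial>N)) \<partial>M) <= ennreal ((2 * pi) ^ DIM('a))" for x
   proof -
    have p0: "0 <= (\<Prod>b\<in>Basis. 2 * pi * normal_density 0 \<sigma> ((x - y) \<bullet> b))" for y
     by (intro prod_nonneg) (auto simp: normal_density_nonneg)
    have "(\<integral>\<^sup>+y. ennreal (norm (\<integral>p. ?k x p * cnj (?k y p) \<partial>N)) \<partial>M) = (\<integral>\<^sup>+y. ennreal (\<Prod>b\<in>Basis. 2 * pi * normal_density 0 \<sigma> ((x - y) \<bullet> b)) \<partial>M)"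
     unfolding K using p0 by (simp del: of_real_prod)
    also have "\<dots> = (NN y. indicator ?B y * ennreal (\<Prod>b\<in>Basis. 2 * pi * normal_density 0 \<sigma> ((x - y) \<bullet> b)))"
     by (rule nnM) measurable
    also have "\<dots> <= (NN y. ennreal (\<Prod>b\<in>Basis. 2 * pi * normal_density 0 \<sigma> ((x - y) \<bullet> b)))"
     by (intro nn_integral_mono) (auto simp: indicator_def)
    also have "\<dots> = ennreal ((2 * pi) ^ DIM('a))" by (rule gaussian_kernel_mass[OF s])
    finally show ?thesis .
   qed
   show "uh \<in> borel_measurable N" by simp
  qed (rule uhfin)
  define I where "I = (\<integral>\<^sup>+xi. sqn (uh xi) \<partial>N)"
  have u2M: "(\<integral>\<^sup>+x. sqn (u x) \<partial>M) <= (NN x. sqn (u x))"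
   by (subst nnM, measurable) (intro nn_integral_mono, auto simp: indicator_def)
  have uhM: "uh xi = (\<integral>x. wave x xi * u x \<partial>M)" for xi
   unfolding uh_def M_def
   by (subst integral_density) (auto intro!: Bochner_Integration.integral_cong simp: indicator_def supp)
  have mF: "(\<lambda>(x, xi). cnj (uh xi) * (wave x xi * u x)) \<in> borel_measurable (M \<Otimes>\<^sub>M N)"
   unfolding mMN by measurable
  have L0: "0 <= L" using order_trans[OF norm_ge_zero uhL] .
  have iF: "integrable (M \<Otimes>\<^sub>M N) (\<lambda>(x, xi). cnj (uh xi) * (wave x xi * u x))"
  proof (rule integrableI_bounded)
   show "(\<lambda>(x, xi). cnj (uh xi) * (wave x xi * u x)) \<in> borel_measurable (M \<Otimes>\<^sub>M N)" by (rule mF)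
   have "(\<integral>\<^sup>+z. ennreal (norm (case z of (x, xi) => cnj (uh xi) * (wave x xi * u x))) \<partial>(M \<Otimes>\<^sub>M N))
    = (\<integral>\<^sup>+x. (\<integral>\<^sup>+xi. ennreal (norm (cnj (uh xi) * (wave x xi * u x))) \<partial>N) \<partial>M)"
    using N.nn_integral_fst[of "\<lambda>z. ennreal (norm (case z of (x, xi) => cnj (uh xi) * (wave x xi * u x)))" M] mF by simp
   also have "\<dots> <= (\<integral>\<^sup>+x. (\<integral>\<^sup>+xi. ennreal (L * norm (u x)) \<partial>N) \<partial>M)"
    by (intro nn_integral_mono ennreal_leI) (auto simp: norm_mult intro!: mult_right_mono uhL)
   also have "\<dots> = (\<integral>\<^sup>+x. ennreal (norm (u x)) * ennreal (L * B) \<partial>M)"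
    by (intro nn_integral_cong) (simp add: NB ennreal_mult L0 B0 mult_ac)
   also have "\<dots> = (\<integral>\<^sup>+x. ennreal (norm (u x)) \<partial>M) * ennreal (L * B)" by (rule nn_integral_multc) simp
   also have "\<dots> < \<infinity>" using uint by (auto simp: integrable_iff_bounded ennreal_mult_less_top)
   finally show "(\<integral>\<^sup>+z. ennreal (norm (case z of (x, xi) => cnj (uh xi) * (wave x xi * u x))) \<partial>(M \<Otimes>\<^sub>M N)) < \<infinity>" .
  qed
  have ri: "integrable N (\<lambda>xi. (norm (uh xi))^2)" by (rule integrableI_bounded) (use uhfin in auto)
  have "I = ennreal (\<integral>xi. (norm (uh xi))^2 \<partial>N)" unfolding I_def by (rule nn_integral_eq_integral[OF ri]) simp
  also have "\<dots> = ennreal (norm (\<integral>xi. complex_of_real ((norm (uh xi))^2) \<partial>N))"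
   by (subst integral_complex_of_real) (simp add: integral_nonneg_AE)
  also have "(\<integral>xi. complex_of_real ((norm (uh xi))^2) \<partial>N) = (\<integral>xi. (\<integral>x. cnj (uh xi) * (wave x xi * u x) \<partial>M) \<partial>N)"
  proof (rule Bochner_Integration.integral_cong[OF refl])
   fix xi
   have "(\<integral>x. cnj (uh xi) * (wave x xi * u x) \<partial>M) = cnj (uh xi) * (\<integral>x. wave x xi * u x \<partial>M)"
    by (rule integral_mult_right_zero)
   then have c: "(\<integral>x. cnj (uh xi) * (wave x xi * u x) \<partial>M) = cnj (uh xi) * uh xi"
    unfolding uhM[of xi, symmetric] .
   show "complex_of_real ((norm (uh xi))^2) = (\<integral>x. cnj (uh xi) * (wave x xi * u x) \<partial>M)"
    unfolding c complex_norm_square by (rule mult.commute)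
  qed
  also have "\<dots> = (\<integral>x. (\<integral>xi. cnj (uh xi) * (wave x xi * u x) \<partial>N) \<partial>M)"
   using MN.Fubini_integral[OF iF] by simp
  also have "\<dots> = (\<integral>x. cnj (v x) * u x \<partial>M)"
  proof (rule Bochner_Integration.integral_cong[OF refl])
   fix x
   have "(\<integral>xi. cnj (uh xi) * (wave x xi * u x) \<partial>N) = (\<integral>xi. cnj (?k x xi * uh xi) * u x \<partial>N)"
    by (intro Bochner_Integration.integral_cong) (auto simp: exp_cnj mult_ac)
   also have "\<dots> = (\<integral>xi. cnj (?k x xi * uh xi) \<partial>N) * u x" by (rule integral_mult_left_zero)
   also have "(\<integral>xi. cnj (?k x xi * uh xi) \<partial>N) = cnj (v x)" unfolding v_def by (rule Bochner_Integration.integral_cnj)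
   finally show "(\<integral>xi. cnj (uh xi) * (wave x xi * u x) \<partial>N) = cnj (v x) * u x" .
  qed
  finally have "I^2 = sqn (\<integral>x. cnj (v x) * u x \<partial>M)" by (simp add: ennreal_power)
  also have "\<dots> <= (\<integral>\<^sup>+x. sqn (cnj (v x)) \<partial>M) * (\<integral>\<^sup>+x. sqn (u x) \<partial>M)"
   by (rule norm_integral_mult_sq_le) measurable
  also have "\<dots> <= (ennreal ((2 * pi) ^ DIM('a)) * I) * (NN x. sqn (u x))"
   using TT u2M unfolding I_def complex_mod_cnj by (intro mult_mono) auto
  finally have "I^2 <= (ennreal ((2 * pi) ^ DIM('a)) * (NN x. sqn (u x))) * I"
   by (simp add: mult_ac)
  then have "I <= ennreal ((2 * pi) ^ DIM('a)) * (NN x. sqn (u x))"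
   by (rule ennreal_sq_le_imp_le) (use uhfin in \<open>simp add: I_def\<close>)
  then show ?thesis unfolding I_def by (subst (asm) nnN) measurable
 qed
 \<comment> \<open>The bound does not depend on the Gaussian parameter, so Fatou's lemma removes the
   weight as the parameter tends to 0.\<close>
 let ?f = "\<lambda>n xi. ennreal (gaussian (1 / real (Suc n)) xi) * sqn (uh xi)"
 have lim: "(\<lambda>n. ?f n xi) \<longlonglongrightarrow> sqn (uh xi)" for xi :: 'a
 proof -
  have 0: "(\<lambda>n. 1 / real (Suc n)) \<longlonglongrightarrow> 0" using LIMSEQ_inverse_real_of_nat by (simp add: inverse_eq_divide)
  have "(\<lambda>n. gaussian (1 / real (Suc n)) xi) \<longlonglongrightarrow> (\<Prod>b\<in>Basis. exp (- (0 * (xi \<bullet> b))\<^sup>2 / 2))"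
   unfolding gaussian_def by (intro tendsto_intros 0) auto
  then have "(\<lambda>n. gaussian (1 / real (Suc n)) xi * (norm (uh xi))^2) \<longlonglongrightarrow> 1 * (norm (uh xi))^2"
   by (intro tendsto_mult tendsto_const) simp
  then have "(\<lambda>n. ennreal (gaussian (1 / real (Suc n)) xi * (norm (uh xi))^2)) \<longlonglongrightarrow> sqn (uh xi)"
   using tendsto_ennrealI by fastforce
  then show ?thesis by (simp add: ennreal_mult gaussian_pos less_imp_le)
 qed
 have "(NN xi. sqn (uh xi)) = (NN xi. liminf (\<lambda>n. ?f n xi))"
  by (intro nn_integral_cong) (rule lim_imp_Liminf[OF _ lim, symmetric], simp)
 also have "\<dots> <= liminf (\<lambda>n. \<integral>\<^sup>+xi. ?f n xi \<partial>lborel)" by (rule nn_integral_liminf) measurable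
 also have "\<dots> <= ennreal ((2 * pi) ^ DIM('a)) * (NN x. sqn (u x))"
  by (intro Liminf_le always_eventually allI main) simp_all
 finally show "(NN xi. sqn (uh xi)) <= ennreal ((2 * pi) ^ DIM('a)) * (NN x. sqn (u x))" .
qed

section \<open>Lifting to the frequency cubes\<close>

lemma measurable_fst_borel [measurable (raw)]:
 "f \<in> borel_measurable M ==> (\<lambda>x. fst (f x)) \<in> borel_measurable M"
 for f :: "_ => 'a::second_countable_topology \<times> 'b::second_countable_topology"
 by (rule measurable_compose[of f M borel fst]) (simp_all add: borel_prod[symmetric])

lemma measurable_snd_borel [measurable (raw)]:
 "f \<in> borel_measurable M ==> (\<lambda>x. snd (f x)) \<in> borel_measurable M"
 for f :: "_ => 'a::second_countable_topology \<times> 'b::second_countable_topology"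
 by (rule measurable_compose[of f M borel snd]) (simp_all add: borel_prod[symmetric])

lemma nn_integral_lborel_scale:
 fixes F :: "real^'n => ennreal"
 assumes [measurable]: "F \<in> bmeas" and s: "0 < s"
 shows "(NN eta. ennreal (s ^ CARD('n)) * F (s .* eta)) = (NN eta. F eta)"
proof -
 have "(NN eta. F eta) = (\<integral>\<^sup>+eta. F eta \<partial>density (distr lborel borel (\<lambda>x. 0 + s .* x)) (\<lambda>_. ennreal (\<bar>s\<bar> ^ DIM(real^'n))))"
  using lborel_affine[of s "0::real^'n"] s by simp
 also have "\<dots> = (\<integral>\<^sup>+eta. ennreal (s ^ CARD('n)) * F eta \<partial>distr lborel borel (\<lambda>x. s .* x))"
  using s by (subst nn_integral_density) auto
 also have "\<dots> = (NN eta. ennreal (s ^ CARD('n)) * F (s .* eta))"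
  by (subst nn_integral_distr) auto
 finally show ?thesis by simp
qed

lemma integral_lborel_scale:
 fixes F :: "real^'n => complex"
 assumes [measurable]: "F \<in> bmeas" and s: "0 < s"
 shows "(LL eta. of_real (s ^ CARD('n)) * F (s .* eta)) = (LL eta. F eta)"
proof -
 have "(LL eta. F eta) = (\<integral>eta. F eta \<partial>density (distr lborel borel (\<lambda>x. 0 + s .* x)) (\<lambda>_. ennreal (\<bar>s\<bar> ^ DIM(real^'n))))"
  using lborel_affine[of s "0::real^'n"] s by simp
 also have "\<dots> = (\<integral>eta. (s ^ CARD('n)) .* F eta \<partial>distr lborel borel (\<lambda>x. s .* x))"
  using s by (subst integral_density) auto
 also have "\<dots> = (LL eta. (s ^ CARD('n)) .* F (s .* eta))"
  by (subst integral_distr) auto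
 finally show ?thesis by (simp add: scaleR_conv_of_real)
qed

lemma nn_integral_lborel_reflect:
 fixes f :: "'a::euclidean_space => ennreal"
 assumes [measurable]: "f \<in> bmeas"
 shows "(NN x. f (v - x)) = (NN x. f x)"
proof -
 have "(NN x. f x) = (\<integral>\<^sup>+x. f x \<partial>density (distr lborel borel (\<lambda>x. v + (-1) .* x)) (\<lambda>_. ennreal (\<bar>-1::real\<bar> ^ DIM('a))))"
  using lborel_affine[of "-1" v] by simp
 also have "\<dots> = (\<integral>\<^sup>+x. f x \<partial>distr lborel borel (\<lambda>x. v - x))"
  by (subst nn_integral_density) auto
 also have "\<dots> = (NN x. f (v - x))"
  by (subst nn_integral_distr) auto
 finally show ?thesis by simp
qed

lemma radial_bump_nonneg: "0 <= radial_bump M s"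
 by (simp add: radial_bump_def bump_nonneg)

lemma borel_measurable_radial_bump [measurable]: "radial_bump M \<in> bmeas"
 unfolding radial_bump_def by measurable

text \<open>The first argument fixes the dimension, which the other arguments do not
  determine.\<close>

definition psi_mass :: "'n::finite itself => nat => real => real" where
 "psi_mass _ M r = (LL z. psi M r (z::real^'n))"

definition radial_mass :: "nat => real" where
 "radial_mass M = (LL s. radial_bump M s)"

lemma psi_mass:
 assumes "0 < M" "0 < r"
 shows nn_integral_psi: "(NN z. ennreal (psi M r (z::real^'n))) = ennreal (psi_mass TYPE('n) M r)"
  and integrable_psi: "integrable lborel (psi M r :: real^'n => real)"
  and psi_mass_ge: "((1/4) ^ M) ^ CARD('n) * r ^ CARD('n) <= psi_mass TYPE('n) M r"
proof -
 have le: "psi M r (z::real^'n) <= indicator (cube 0 r) z" for z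
  using psi_eq_0[of M r z 0] psi_le_1[of M r z] assms by (auto simp: indicator_def)
 have fin: "integrable lborel (indicator (cube (0::real^'n) r) :: real^'n => real)"
  using assms by (simp add: integrable_indicator_iff emeasure_cube)
 show i: "integrable lborel (psi M r :: real^'n => real)"
  by (rule Bochner_Integration.integrable_bound[OF fin]) (use le in \<open>auto simp: psi_nonneg\<close>)
 show nn: "(NN z. ennreal (psi M r (z::real^'n))) = ennreal (psi_mass TYPE('n) M r)"
  unfolding psi_mass_def by (rule nn_integral_eq_integral[OF i]) (simp add: psi_nonneg)
 have pm0: "0 <= psi_mass TYPE('n) M r"
  unfolding psi_mass_def by (rule Bochner_Integration.integral_nonneg) (rule psi_nonneg)
 have "ennreal (((1/4) ^ M) ^ CARD('n) * r ^ CARD('n)) = (NN z. ennreal (((1/4) ^ M) ^ CARD('n)) * indicator (cube (0::real^'n) (r/2)) z)"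
  using assms by (subst nn_integral_cmult_indicator) (auto simp: emeasure_cube ennreal_mult'')
 also have "\<dots> <= (NN z. ennreal (psi M r (z::real^'n)))"
 proof (rule nn_integral_mono)
  fix z :: "real^'n"
  show "ennreal (((1/4) ^ M) ^ CARD('n)) * indicator (cube (0::real^'n) (r/2)) z <= ennreal (psi M r z)"
  proof (cases "z \<in> cube 0 (r/2)")
   case True
   have "(\<Prod>j\<in>(UNIV::'n set). (1/4::real) ^ M) <= psi M r z"
    unfolding psi_def by (intro prod_mono conjI bump_ge) (use True assms in \<open>auto simp: cube_def abs_divide field_simps\<close>)
   then show ?thesis using True by (simp add: ennreal_leI)
  qed simp
 qed
 finally show "((1/4) ^ M) ^ CARD('n) * r ^ CARD('n) <= psi_mass TYPE('n) M r"
  unfolding nn using pm0 by (simp only: ennreal_le_iff)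
qed

lemma radial_mass:
 assumes "0 < M"
 shows nn_integral_radial_bump: "(NN s. ennreal (radial_bump M s)) = ennreal (radial_mass M)"
  and integrable_radial_bump: "integrable lborel (radial_bump M)"
  and radial_mass_pos: "0 < radial_mass M"
proof -
 have le1: "radial_bump M s <= indicator {1..2} s" for s
  using radial_bump_eq_0[of M s] bump_le_1[of M] assms by (auto simp: indicator_def radial_bump_def)
 have fin: "integrable lborel (indicator {1..2::real} :: real => real)"
  by (simp add: integrable_indicator_iff)
 show i: "integrable lborel (radial_bump M)"
  by (rule Bochner_Integration.integrable_bound[OF fin]) (use le1 in \<open>auto simp: radial_bump_nonneg\<close>)
 show nn: "(NN s. ennreal (radial_bump M s)) = ennreal (radial_mass M)"
  unfolding radial_mass_def by (rule nn_integral_eq_integral[OF i]) (simp add: radial_bump_nonneg)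
 have rm0: "0 <= radial_mass M"
  unfolding radial_mass_def by (rule Bochner_Integration.integral_nonneg) (rule radial_bump_nonneg)
 have "ennreal ((1/4) ^ M * (1/2)) = (NN s. ennreal ((1/4) ^ M) * indicator {5/4..7/4::real} s)"
 proof -
  have "emeasure lborel {5/4..7/4::real} = ennreal (7/4 - 5/4)" by (rule emeasure_lborel_Icc) simp
  also have "(7/4 - 5/4 :: real) = 1/2" by simp
  finally show ?thesis by (simp only: nn_integral_cmult_indicator sets_lborel borel_closed closed_atLeastAtMost) (rule ennreal_mult, simp_all only: zero_le_power zero_le_divide_iff zero_le_numeral zero_le_one simp_thms)
 qed
 also have "\<dots> <= (NN s. ennreal (radial_bump M s))"
 proof (rule nn_integral_mono)
  fix s :: real
  show "ennreal ((1/4) ^ M) * indicator {5/4..7/4} s <= ennreal (radial_bump M s)"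
  proof (cases "s \<in> {5/4..7/4}")
   case True
   have "\<bar>(s - 3/2) / (1/2)\<bar> <= 1/2" unfolding abs_le_iff using True by simp
   from bump_ge[OF this, of M] have "ennreal ((1/4) ^ M) <= ennreal (radial_bump M s)"
    unfolding radial_bump_def by (rule ennreal_leI)
   then show ?thesis using True by (simp only: indicator_simps mult_1_right)
  next
   case False
   then have "indicator {5/4..7/4} s = (0::ennreal)" by (rule indicator_simps(2))
   then show ?thesis by (simp only: mult_zero_right zero_le)
  qed
 qed
 finally have "(1/4) ^ M * (1/2) <= radial_mass M"
  unfolding nn using rm0 by (simp only: ennreal_le_iff)
 then show "0 < radial_mass M" by (rule less_le_trans[rotated]) (rule mult_pos_pos, simp_all)
qed

text \<open>The factor \<open>s ^ CARD('n)\<close> is the Jacobian of eta -> s eta. With it the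
  integrals over the centre and over \<open>s\<close> separate, and the lifted integral is a
  constant multiple of the original one.\<close>

lemma nn_integral_lift:
 fixes F :: "real^'n => ennreal"
 assumes F[measurable]: "F \<in> bmeas" and M: "0 < M" and r: "0 < r"
 shows "(NN p. (case p of (zeta, eta, s) => ennreal (psi M r (eta - zeta) * radial_bump M s * s ^ CARD('n)) * F (s .* eta)))
  = ennreal (psi_mass TYPE('n) M r * radial_mass M) * (NN xi. F xi)" (is "(NN p. ?h p) = _")
proof -
 have s0: "ennreal (psi M r z * radial_bump M s * s ^ CARD('n)) = ennreal (psi M r z) * (ennreal (radial_bump M s) * ennreal (s ^ CARD('n)))"
  for z :: "real^'n" and s
 proof (cases "s \<in> {1<..<2}")
  case True
  then show ?thesis by (simp add: ennreal_mult'' ennreal_mult psi_nonneg radial_bump_nonneg mult.assoc)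
 next
  case False
  then show ?thesis using radial_bump_eq_0[OF M False] by simp
 qed
 have hm[measurable]: "?h \<in> borel_measurable (lborel \<Otimes>\<^sub>M lborel)"
  unfolding measurable_lborel_pair borel_prod by measurable
 have "(NN p. ?h p) = (\<integral>\<^sup>+p. ?h p \<partial>(lborel \<Otimes>\<^sub>M lborel))" by (simp only: lborel_prod)
 also have "\<dots> = (NN q. \<integral>\<^sup>+zeta. ?h (zeta, q) \<partial>lborel)"
  using lborel_pair.nn_integral_snd[OF hm] by simp
 also have "\<dots> = (NN q. ennreal (psi_mass TYPE('n) M r) * (ennreal (radial_bump M (snd q)) * (ennreal (snd q ^ CARD('n)) * F (snd q .* fst q))))"
 proof (rule nn_integral_cong)
  fix q :: "(real^'n) \<times> real"
  obtain eta s where q: "q = (eta, s)" by (cases q)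
  have "(NN zeta. ?h (zeta, q)) = (NN zeta. ennreal (psi M r (eta - zeta)) * (ennreal (radial_bump M s) * ennreal (s ^ CARD('n)) * F (s .* eta)))"
   unfolding q prod.case s0 by (simp only: mult.assoc)
  also have "\<dots> = (NN zeta. ennreal (psi M r (eta - zeta))) * (ennreal (radial_bump M s) * ennreal (s ^ CARD('n)) * F (s .* eta))"
   by (rule nn_integral_multc) measurable
  also have "(NN zeta. ennreal (psi M r (eta - zeta))) = ennreal (psi_mass TYPE('n) M r)"
   by (subst nn_integral_lborel_reflect[of "\<lambda>z. ennreal (psi M r z)"]) (auto simp: nn_integral_psi M r)
  finally show "(NN zeta. ?h (zeta, q)) = ennreal (psi_mass TYPE('n) M r) * (ennreal (radial_bump M (snd q)) * (ennreal (snd q ^ CARD('n)) * F (snd q .* fst q)))"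
   by (simp add: q mult.assoc)
 qed
 also have "\<dots> = ennreal (psi_mass TYPE('n) M r) * (NN q. ennreal (radial_bump M (snd q)) * (ennreal (snd q ^ CARD('n)) * F (snd q .* fst q)))"
  by (rule nn_integral_cmult) measurable
 also have "(NN q. ennreal (radial_bump M (snd q)) * (ennreal (snd q ^ CARD('n)) * F (snd q .* fst q))) =
   (\<integral>\<^sup>+q. ennreal (radial_bump M (snd q)) * (ennreal (snd q ^ CARD('n)) * F (snd q .* fst q)) \<partial>(lborel \<Otimes>\<^sub>M lborel))"
  by (simp only: lborel_prod)
 also have "\<dots> = (NN s. \<integral>\<^sup>+eta. ennreal (radial_bump M s) * (ennreal (s ^ CARD('n)) * F (s .* eta)) \<partial>lborel)"
  by (subst lborel_pair.nn_integral_snd[symmetric]) (simp_all add: measurable_lborel_pair borel_prod)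
 also have "\<dots> = (NN s. ennreal (radial_bump M s) * (NN xi. F xi))"
 proof (rule nn_integral_cong)
  fix s :: real
  show "(NN eta. ennreal (radial_bump M s) * (ennreal (s ^ CARD('n)) * F (s .* eta))) = ennreal (radial_bump M s) * (NN xi. F xi)"
  proof (cases "s \<in> {1<..<2}")
   case True
   then show ?thesis using nn_integral_lborel_scale[OF F, of s] by (subst nn_integral_cmult) auto
  next
   case False
   then show ?thesis using radial_bump_eq_0[OF M False] by simp
  qed
 qed
 also have "\<dots> = ennreal (radial_mass M) * (NN xi. F xi)"
  by (subst nn_integral_multc) (auto simp: nn_integral_radial_bump M)
 finally show ?thesis by (simp add: ennreal_mult' mult.assoc psi_mass_def integral_nonneg_AE psi_nonneg)
qed

lemma integral_lift:
 fixes F :: "real^'n => complex"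
 assumes i: "integrable lborel F" and M: "0 < M" and r: "0 < r"
 shows "integrable lborel (\<lambda>(zeta::real^'n, eta, s). of_real (psi M r (eta - zeta) * radial_bump M s * s ^ CARD('n)) * F (s .* eta))" (is "integrable lborel ?h")
  and "(LL p. (case p of (zeta::real^'n, eta, s) => of_real (psi M r (eta - zeta) * radial_bump M s * s ^ CARD('n)) * F (s .* eta)))
  = of_real (psi_mass TYPE('n) M r * radial_mass M) * (LL xi. F xi)"
proof -
 have F[measurable]: "F \<in> bmeas" using borel_measurable_integrable[OF i] by simp
 have hm0: "?h \<in> borel_measurable (borel :: ((real^'n) \<times> (real^'n) \<times> real) measure)" by measurable
 have nh: "norm (?h p) = (case p of (zeta::real^'n, eta, s) => psi M r (eta - zeta) * radial_bump M s * s ^ CARD('n) * norm (F (s .* eta)))" for p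
 proof -
  obtain zeta eta s where p: "p = (zeta, eta, s)" by (cases p) auto
  have "0 <= psi M r (eta - zeta) * radial_bump M s * s ^ CARD('n)"
  proof (cases "s \<in> {1<..<2}")
   case True then show ?thesis by (simp add: psi_nonneg radial_bump_nonneg)
  next
   case False then show ?thesis using radial_bump_eq_0[OF M False] by simp
  qed
  then show ?thesis unfolding p by (simp only: prod.case norm_mult norm_of_real abs_of_nonneg)
 qed
 have "(NN p. ennreal (norm (?h p))) = (NN p. (case p of (zeta::real^'n, eta, s) => ennreal (psi M r (eta - zeta) * radial_bump M s * s ^ CARD('n)) * ennreal (norm (F (s .* eta)))))"
  unfolding nh by (intro nn_integral_cong) (auto simp: ennreal_mult'')
 also have "\<dots> = ennreal (psi_mass TYPE('n) M r * radial_mass M) * (NN xi. ennreal (norm (F xi)))"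
  by (rule nn_integral_lift[OF _ M r]) measurable
 also have "\<dots> < \<infinity>" using i by (simp add: integrable_iff_bounded ennreal_mult_less_top)
 finally show hi: "integrable lborel ?h" using hm0 by (simp add: integrable_iff_bounded)
 have hi2: "integrable (lborel \<Otimes>\<^sub>M lborel) ?h" using hi by (simp only: lborel_prod)
 have "(LL p. ?h p) = (\<integral>p. ?h p \<partial>(lborel \<Otimes>\<^sub>M lborel))" by (simp only: lborel_prod)
 also have "\<dots> = (LL q. \<integral>zeta. ?h (zeta, q) \<partial>lborel)"
  using lborel_pair.integral_snd[of "\<lambda>zeta q. ?h (zeta, q)"] hi2 by (simp add: case_prod_beta')
 finally have h1: "(LL p. ?h p) = (LL q. \<integral>zeta. ?h (zeta, q) \<partial>lborel)" .
 have e1: "(\<lambda>q. \<integral>zeta. ?h (zeta, q) \<partial>lborel) = (\<lambda>q. of_real (psi_mass TYPE('n) M r) * (of_real (radial_bump M (snd q)) * (of_real (snd q ^ CARD('n)) * F (snd q .* fst q))))"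
 proof
  fix q :: "(real^'n) \<times> real"
  obtain eta s where q: "q = (eta, s)" by (cases q)
  have "(LL zeta. ?h (zeta, q)) = (LL zeta. of_real (psi M r (eta - zeta)) * (of_real (radial_bump M s) * of_real (s ^ CARD('n)) * F (s .* eta)))"
   unfolding q by (simp add: mult.assoc)
  also have "\<dots> = of_real (LL zeta. psi M r (eta - zeta)) * (of_real (radial_bump M s) * of_real (s ^ CARD('n)) * F (s .* eta))"
   by simp
  also have "(LL zeta. psi M r (eta - zeta)) = psi_mass TYPE('n) M r"
  proof -
   have "(NN zeta. ennreal (psi M r (eta - zeta))) = ennreal (psi_mass TYPE('n) M r)"
    by (subst nn_integral_lborel_reflect[of "\<lambda>z. ennreal (psi M r z)"]) (auto simp: nn_integral_psi M r)
   then show ?thesis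
    by (subst integral_eq_nn_integral) (auto simp: psi_nonneg psi_mass_def intro!: enn2real_ennreal integral_nonneg_AE)
  qed
  finally show "(LL zeta. ?h (zeta, q)) = of_real (psi_mass TYPE('n) M r) * (of_real (radial_bump M (snd q)) * (of_real (snd q ^ CARD('n)) * F (snd q .* fst q)))"
   by (simp add: q mult.assoc)
 qed
 let ?h2 = "\<lambda>q. of_real (radial_bump M (snd q)) * (of_real (snd q ^ CARD('n)) * F (snd q .* fst q))"
 have pm: "psi_mass TYPE('n) M r ~= 0"
 proof -
  have "(0::real) < ((1/4) ^ M) ^ CARD('n) * r ^ CARD('n)" using r by simp
  then show ?thesis using psi_mass_ge[OF M r, where 'n='n] by linarith
 qed
 have "integrable lborel (\<lambda>q. \<integral>zeta. ?h (zeta, q) \<partial>lborel)"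
  using lborel_pair.integrable_snd[of "\<lambda>zeta q. ?h (zeta, q)"] hi2 by (simp add: case_prod_beta')
 then have "integrable lborel (\<lambda>q. of_real (psi_mass TYPE('n) M r) * ?h2 q)" unfolding e1 .
 then have "integrable lborel (\<lambda>q. of_real (1 / psi_mass TYPE('n) M r) * (of_real (psi_mass TYPE('n) M r) * ?h2 q))"
  by (rule integrable_mult_right)
 moreover have "of_real (1 / psi_mass TYPE('n) M r) * (of_real (psi_mass TYPE('n) M r) * z) = z" for z :: complex
  using pm by simp
 ultimately have "integrable lborel ?h2" by (simp only:)
 then have h2i: "integrable (lborel \<Otimes>\<^sub>M lborel) ?h2" by (simp only: lborel_prod)
 have "(LL q. of_real (psi_mass TYPE('n) M r) * ?h2 q) = of_real (psi_mass TYPE('n) M r) * (LL q. ?h2 q)"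
  by simp
 also have "(LL q. ?h2 q) = (\<integral>q. ?h2 q \<partial>(lborel \<Otimes>\<^sub>M lborel))" by (simp only: lborel_prod)
 also have "\<dots> = (LL s. \<integral>eta. ?h2 (eta, s) \<partial>lborel)"
  using lborel_pair.integral_snd[of "\<lambda>eta s. ?h2 (eta, s)"] h2i by (simp add: case_prod_beta')
 also have "\<dots> = (LL s. of_real (radial_bump M s) * (LL xi. F xi))"
 proof (rule Bochner_Integration.integral_cong[OF refl])
  fix s :: real
  show "(LL eta. ?h2 (eta, s)) = of_real (radial_bump M s) * (LL xi. F xi)"
  proof (cases "s \<in> {1<..<2}")
   case True
   then show ?thesis using integral_lborel_scale[OF F, of s] by simp
  next
   case False
   then show ?thesis using radial_bump_eq_0[OF M False] by simp
  qed
 qed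
 also have "\<dots> = of_real (radial_mass M) * (LL xi. F xi)"
  by (simp add: radial_mass_def)
 finally show "(LL p. ?h p) = of_real (psi_mass TYPE('n) M r * radial_mass M) * (LL xi. F xi)"
  unfolding h1 e1 by (simp only: of_real_mult mult.assoc)
qed

section \<open>A one-sided Schur integral over boxes\<close>

text \<open>A majorant by step functions with geometric thresholds: beyond the k-th threshold t^k l
  the ratio l/s is at most t^-k.\<close>

lemma min_ladder:
 fixes t l s :: real
 assumes t: "1 <= t" and l: "0 < l" and s: "0 < s"
 shows "min 1 (l / s) <= (\<Sum>k<N. (1 / t ^ k) * indicator {..t ^ Suc k * l} s) + 1 / t ^ N"
proof (induction N)
 case 0
 then show ?case by simp
next
 case (Suc N)
 have nn: "0 <= (\<Sum>k<N. (1 / t ^ k) * indicator {..t ^ Suc k * l} s)"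
  using t by (intro sum_nonneg) auto
 show ?case
 proof (cases "s <= t ^ Suc N * l")
  case True
  have t0: "0 <= 1 / t ^ Suc N" using t by simp
  have "(\<Sum>k<Suc N. (1 / t ^ k) * indicator {..t ^ Suc k * l} s) = (\<Sum>k<N. (1 / t ^ k) * indicator {..t ^ Suc k * l} s) + 1 / t ^ N"
   using True by simp
  then show ?thesis using t0 Suc by linarith
 next
  case False
  have "l / s <= 1 / t ^ Suc N" using False t l s by (simp add: field_simps)
  moreover have "0 <= (\<Sum>k<Suc N. (1 / t ^ k) * indicator {..t ^ Suc k * l} s)"
   using t by (intro sum_nonneg) auto
  ultimately show ?thesis by linarith
 qed
qed

lemma emeasure_box_le:
 fixes v :: "real^'n"
 assumes I: "i0 \<in> I" and u: "0 <= u" and D: "0 <= D"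
 shows "emeasure lborel {w \<in> cube (0::real^'n) (1/2). \<bar>v $ i0 - w $ i0\<bar> <= u \<and> (\<forall>i\<in>I. \<bar>v $ i - w $ i\<bar> <= D)}
  <= ennreal (2 ^ CARD('n) * u * D ^ (card I - 1))" (is "emeasure _ ?E <= _")
proof -
 define b where "b = (\<lambda>i. if i = i0 then u else if i \<in> I then D else 1/2)"
 define c where "c = (\<lambda>i. if i \<in> I then v $ i else 0)"
 have b0: "0 <= b i" for i using u D by (simp add: b_def)
 let ?B = "cbox (\<chi> i. c i - b i) (\<chi> i. c i + b i) :: (real^'n) set"
 have sub: "?E \<subseteq> ?B"
 proof
  fix w assume w: "w \<in> ?E"
  have "\<bar>w $ i - c i\<bar> <= b i" for i
  proof (cases "i \<in> I")
   case True
   then show ?thesis using w by (auto simp: b_def c_def abs_minus_commute)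
  next
   case False
   then have "i ~= i0" using I by blast
   moreover have "\<bar>w $ i\<bar> <= 1/2" using w by (simp add: cube_def)
   ultimately show ?thesis using False by (simp add: b_def c_def)
  qed
  then show "w \<in> ?B" by (auto simp: mem_box_cart abs_le_iff algebra_simps)
 qed
 have ne: "?B ~= {}" using b0 by (auto simp: interval_ne_empty_cart)
 have "emeasure lborel ?E <= emeasure lborel ?B" by (rule emeasure_mono[OF sub]) simp
 also have "\<dots> = ennreal (measure lborel ?B)"
  using emeasure_lborel_cbox_finite by (intro emeasure_eq_ennreal_measure) (auto simp: less_top)
 also have "measure lborel ?B = (\<Prod>i\<in>UNIV. 2 * b i)"
  using content_cbox_cart[OF ne] by simp
 also have "\<dots> = 2 ^ CARD('n) * (\<Prod>i\<in>UNIV. b i)" by (simp add: prod.distrib)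
 also have "(\<Prod>i\<in>UNIV. b i) = u * (\<Prod>i\<in>UNIV - {i0}. b i)"
  by (subst prod.remove[of UNIV i0]) (auto simp: b_def)
 also have "(\<Prod>i\<in>UNIV - {i0}. b i) = (\<Prod>i\<in>I - {i0}. b i) * (\<Prod>i\<in>(UNIV - {i0}) - (I - {i0}). b i)"
  by (subst prod.subset_diff[of "I - {i0}"]) (auto simp: mult.commute)
 also have "(\<Prod>i\<in>I - {i0}. b i) = D ^ (card I - 1)"
 proof -
  have "(\<Prod>i\<in>I - {i0}. b i) = (\<Prod>i\<in>I - {i0}. D)" by (intro prod.cong) (auto simp: b_def)
  then show ?thesis using I by (simp add: card_Diff_singleton)
 qed
 finally have "emeasure lborel ?E <= ennreal (2 ^ CARD('n) * (u * (D ^ (card I - 1) * (\<Prod>i\<in>(UNIV - {i0}) - (I - {i0}). b i))))" .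
 also have "\<dots> <= ennreal (2 ^ CARD('n) * (u * (D ^ (card I - 1) * 1)))"
 proof (intro ennreal_leI mult_left_mono)
  show "(\<Prod>i\<in>(UNIV - {i0}) - (I - {i0}). b i) <= 1"
   by (intro prod_le_1) (auto simp: b_def)
 qed (use u D in auto)
 finally show ?thesis by (simp add: mult.assoc)
qed

definition slice :: "'n::finite set => real^'n => real^'n" where
 "slice I v = (\<chi> i. if i \<in> I then v $ i else 0)"

text \<open>In a box one coordinate of \<open>I\<close> is confined by the ladder threshold and the
  remaining ones by \<open>D\<close>. The gain t^-k of a layer times its width t^(k+1) l is t l for
  every k, so the \<open>N\<close> layers contribute equally.\<close>

lemma schur_slice:
 fixes v :: "real^'n" and f :: "real^'n => real"
 assumes I: "I ~= {}" and t: "1 <= t" and l: "0 < l" and D: "0 <= D" and K: "0 <= K" and N: "0 < N"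
  and f: "\<And>w. w \<in> cube 0 (1/2) ==> slice I (v - w) ~= 0 ==>
   f w <= K * (1 / t ^ N + t^2 * min 1 (l / norm (slice I (v - w))) * (if norm (slice I (v - w)) <= D then 1 else 0))"
 shows "(\<integral>\<^sup>+w\<in>cube 0 (1/2). ennreal (f w) \<partial>lborel) <= ennreal (2 ^ CARD('n) * real (N + 2) * K * (t^2 / t ^ N + t ^ 3 * l * D ^ (card I - 1)))"
proof -
 obtain i0 where i0: "i0 \<in> I" using I by blast
 let ?c = "\<lambda>i w. \<bar>v $ i - w $ i\<bar>"
 \<comment> \<open>The bound on \<open>f\<close> says nothing on the diagonal of the slice; those
   \<open>w\<close> lie in a hyperplane.\<close>
 have null: "AE w in lborel. slice I (v - w) ~= 0"
 proof (rule AE_I)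
  show "{w \<in> space lborel. \<not> slice I (v - w) ~= 0} \<subseteq> {w. axis i0 1 \<bullet> w = v $ i0}"
   using i0 by (auto simp: slice_def vec_eq_iff inner_axis' split: if_splits)
  have "negligible {w::real^'n. axis i0 1 \<bullet> w = v $ i0}" by (rule negligible_hyperplane) (simp add: axis_eq_0_iff)
  moreover have m: "{w::real^'n. axis i0 1 \<bullet> w = v $ i0} \<in> sets borel"
   by (intro borel_closed closed_hyperplane)
  ultimately show "emeasure lborel {w::real^'n. axis i0 1 \<bullet> w = v $ i0} = 0"
   by (simp add: negligible_iff_null_sets null_sets_completion_iff null_sets_def)
  show "{w::real^'n. axis i0 1 \<bullet> w = v $ i0} \<in> sets lborel" using m by simp
 qed
 define E where "E = (\<lambda>k. {w \<in> cube (0::real^'n) (1/2). ?c i0 w <= t ^ Suc k * l \<and> (\<forall>i\<in>I. ?c i w <= D)})"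
 have Em[measurable]: "E k \<in> sets borel" for k
  unfolding E_def cube_def by measurable
 have Eb: "emeasure lborel (E k) <= ennreal (2 ^ CARD('n) * (t ^ Suc k * l) * D ^ (card I - 1))" for k
  unfolding E_def by (rule emeasure_box_le) (use i0 t l D in auto)
 have pt: "ennreal (f w) * indicator (cube 0 (1/2)) w <=
   ennreal (K * (2 * t^2 / t ^ N)) * indicator (cube 0 (1/2)) w + (\<Sum>k<N. ennreal (K * t^2 * (1 / t ^ k)) * indicator (E k) w)"
  if nz: "slice I (v - w) ~= 0" for w
 proof (cases "w \<in> cube 0 (1/2)")
  case True
  let ?s = "norm (slice I (v - w))"
  have s0: "0 < ?s" using nz by simp
  have comp: "?c i w <= ?s" if "i \<in> I" for i
   using component_le_norm_cart[of "slice I (v - w)" i] that by (simp add: slice_def)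
  have t2: "1 <= t^2" using t by simp
  have "t^2 * min 1 (l / ?s) * (if ?s <= D then 1 else 0) <=
    t^2 * ((\<Sum>k<N. (1 / t ^ k) * indicator (E k) w) + 1 / t ^ N)"
  proof (cases "?s <= D")
   case sD: True
   have "min 1 (l / ?s) <= (\<Sum>k<N. (1 / t ^ k) * indicator {..t ^ Suc k * l} ?s) + 1 / t ^ N"
    by (rule min_ladder) (use t l s0 in auto)
   also have "\<dots> <= (\<Sum>k<N. (1 / t ^ k) * indicator (E k) w) + 1 / t ^ N"
   proof (intro add_right_mono sum_mono mult_left_mono)
    fix k
    show "(indicator {..t ^ Suc k * l} ?s :: real) <= indicator (E k) w"
     using comp sD True i0 by (auto simp: indicator_def E_def intro: order_trans)
   qed (use t in auto)
   finally show ?thesis using sD t2 by (simp add: mult_left_mono)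
  next
   case False
   have "0 <= (\<Sum>k<N. (1 / t ^ k) * indicator (E k) w) + 1 / t ^ N"
    using t by (intro add_nonneg_nonneg sum_nonneg mult_nonneg_nonneg) auto
   then have "0 <= t^2 * ((\<Sum>k<N. (1 / t ^ k) * indicator (E k) w) + 1 / t ^ N)" using t2 by (intro mult_nonneg_nonneg) linarith+
   then show ?thesis using False by simp
  qed
  then have "f w <= K * (1 / t ^ N + t^2 * ((\<Sum>k<N. (1 / t ^ k) * indicator (E k) w) + 1 / t ^ N))"
   using f[OF True nz] K by (smt (verit) mult_left_mono)
  also have "\<dots> <= K * (t^2 / t ^ N + t^2 * ((\<Sum>k<N. (1 / t ^ k) * indicator (E k) w) + 1 / t ^ N))"
   using K t2 t by (intro mult_left_mono add_right_mono divide_right_mono) auto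
  also have "\<dots> = K * (2 * t^2 / t ^ N) + (\<Sum>k<N. K * t^2 * (1 / t ^ k) * indicator (E k) w)"
   by (simp add: algebra_simps sum_distrib_left)
  finally have "ennreal (f w) <= ennreal (K * (2 * t^2 / t ^ N) + (\<Sum>k<N. K * t^2 * (1 / t ^ k) * indicator (E k) w))"
   by (rule ennreal_leI)
  also have "\<dots> = ennreal (K * (2 * t^2 / t ^ N)) + (\<Sum>k<N. ennreal (K * t^2 * (1 / t ^ k)) * indicator (E k) w)"
  proof -
   have s: "0 <= K * t^2 * (1 / t ^ k) * indicator (E k) w" for k using K t by simp
   have "ennreal (K * (2 * t^2 / t ^ N) + (\<Sum>k<N. K * t^2 * (1 / t ^ k) * indicator (E k) w)) =
    ennreal (K * (2 * t^2 / t ^ N)) + ennreal (\<Sum>k<N. K * t^2 * (1 / t ^ k) * indicator (E k) w)"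
    using K t by (intro ennreal_plus sum_nonneg s) simp
   also have "ennreal (\<Sum>k<N. K * t^2 * (1 / t ^ k) * indicator (E k) w) = (\<Sum>k<N. ennreal (K * t^2 * (1 / t ^ k) * indicator (E k) w))"
    by (rule sum_ennreal[symmetric]) (rule s)
   also have "\<dots> = (\<Sum>k<N. ennreal (K * t^2 * (1 / t ^ k)) * indicator (E k) w)"
   proof (rule sum.cong[OF refl])
    fix k show "ennreal (K * t^2 * (1 / t ^ k) * indicator (E k) w) = ennreal (K * t^2 * (1 / t ^ k)) * indicator (E k) w"
     by (cases "w \<in> E k") simp_all
   qed
   finally show ?thesis .
  qed
  finally show ?thesis using True by simp
 qed simp
 have "(\<integral>\<^sup>+w\<in>cube 0 (1/2). ennreal (f w) \<partial>lborel) <=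
  (NN w. (ennreal (K * (2 * t^2 / t ^ N)) * indicator (cube 0 (1/2)) w + (\<Sum>k<N. ennreal (K * t^2 * (1 / t ^ k)) * indicator (E k) w)))"
  by (rule nn_integral_mono_AE) (use null pt in \<open>auto elim!: eventually_mono\<close>)
 also have "\<dots> = ennreal (K * (2 * t^2 / t ^ N)) * emeasure lborel (cube (0::real^'n) (1/2)) + (\<Sum>k<N. ennreal (K * t^2 * (1 / t ^ k)) * emeasure lborel (E k))"
  by (subst nn_integral_add, measurable, subst nn_integral_sum, measurable) (simp only: nn_integral_cmult_indicator Em cube_sets sets_lborel)
 also have "\<dots> <= ennreal (K * (2 * t^2 / t ^ N)) * 1 + (\<Sum>k<N. ennreal (K * t^2 * (1 / t ^ k)) * ennreal (2 ^ CARD('n) * (t ^ Suc k * l) * D ^ (card I - 1)))"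
  by (intro add_mono mult_left_mono sum_mono Eb) (auto simp: emeasure_cube)
 also have "\<dots> = ennreal (K * (2 * t^2 / t ^ N) + (\<Sum>k<N. K * t^2 * (1 / t ^ k) * (2 ^ CARD('n) * (t ^ Suc k * l) * D ^ (card I - 1))))"
 proof -
  have "(\<Sum>k<N. ennreal (K * t^2 * (1 / t ^ k)) * ennreal (2 ^ CARD('n) * (t ^ Suc k * l) * D ^ (card I - 1))) =
    (\<Sum>k<N. ennreal (K * t^2 * (1 / t ^ k) * (2 ^ CARD('n) * (t ^ Suc k * l) * D ^ (card I - 1))))"
   using K t l D by (intro sum.cong refl ennreal_mult[symmetric]) auto
  also have "\<dots> = ennreal (\<Sum>k<N. K * t^2 * (1 / t ^ k) * (2 ^ CARD('n) * (t ^ Suc k * l) * D ^ (card I - 1)))"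
   using K t l D by (intro sum_ennreal) auto
  finally show ?thesis using K t l D by (simp add: ennreal_plus sum_nonneg)
 qed
 also have "(\<Sum>k<N. K * t^2 * (1 / t ^ k) * (2 ^ CARD('n) * (t ^ Suc k * l) * D ^ (card I - 1))) = real N * (2 ^ CARD('n) * K * (t ^ 3 * l * D ^ (card I - 1)))"
 proof -
  \<comment> \<open>All layers weigh the same: the powers of t depending on k cancel, leaving t from
    the ladder and t^2 from the kernel bound.\<close>
  have "K * t^2 * (1 / t ^ k) * (2 ^ CARD('n) * (t ^ Suc k * l) * D ^ (card I - 1)) = 2 ^ CARD('n) * K * (t ^ 3 * l * D ^ (card I - 1))" for k
   using t by (simp add: field_simps power2_eq_square power3_eq_cube)
  then show ?thesis by simp
 qed
 also have "K * (2 * t^2 / t ^ N) + real N * (2 ^ CARD('n) * K * (t ^ 3 * l * D ^ (card I - 1)))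
   <= 2 ^ CARD('n) * real (N + 2) * K * (t^2 / t ^ N + t ^ 3 * l * D ^ (card I - 1))"
 proof -
  define X Y where "X = t^2 / t ^ N" and "Y = t ^ 3 * l * D ^ (card I - 1)"
  have X: "0 <= X" and Y: "0 <= Y" using t l D by (auto simp: X_def Y_def)
  have n1: "(1::real) <= 2 ^ CARD('n)" by simp
  have "K * (2 * X) <= (2 ^ CARD('n) * real (N + 2)) * (K * X)"
  proof -
   have "1 * 2 <= 2 ^ CARD('n) * real (N + 2)" by (rule mult_mono) auto
   then have "2 * (K * X) <= (2 ^ CARD('n) * real (N + 2)) * (K * X)" using K X by (intro mult_right_mono) auto
   then show ?thesis by (simp add: mult_ac)
  qed
  moreover have "real N * (2 ^ CARD('n) * K * Y) <= real (N + 2) * (2 ^ CARD('n) * K * Y)"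
   using K Y by (intro mult_right_mono) auto
  moreover have "K * (2 * t^2 / t ^ N) = K * (2 * X)" by (simp add: X_def)
  moreover have "2 ^ CARD('n) * real (N + 2) * K * (X + Y) = (2 ^ CARD('n) * real (N + 2)) * (K * X) + real (N + 2) * (2 ^ CARD('n) * K * Y)"
   by (simp only: distrib_left distrib_right mult_ac)
  ultimately show ?thesis unfolding X_def[symmetric] Y_def[symmetric] by linarith
 qed
 finally show ?thesis by (simp add: ennreal_leI)
qed

section \<open>Dyadic pieces of the operator\<close>

lemma linear_slice: "linear (slice I)"
 by (rule linearI) (auto simp: slice_def vec_eq_iff)

lemma borel_measurable_slice [measurable]: "slice I \<in> bmeas"
 by (intro borel_measurable_continuous_onI linear_continuous_on)
   (simp add: linear_conv_bounded_linear[symmetric] linear_slice)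

lemma slice_diff: "slice I v - slice I w = slice I (v - w)"
 by (auto simp: slice_def vec_eq_iff)

lemma slice_slice: "slice I (slice I v) = slice I v"
 by (auto simp: slice_def vec_eq_iff)

lemma norm_slice_le: "norm (slice I v) <= norm v"
 unfolding norm_vec_def L2_set_def by (intro real_sqrt_le_mono sum_mono) (auto simp: slice_def)

text \<open>A bound on all small slices parallel to the coordinates in \<open>I\<close> implies one
  on a cube: average over the slices through all base points. Only base points in the cube of side
  enlarged by \<open>r1\<close> matter.\<close>

lemma slice_average:
 fixes F :: "real^'n => ennreal"
 assumes F[measurable]: "F \<in> bmeas" and r1: "0 <= r1"
  and S: "\<And>x0. (\<integral>\<^sup>+v\<in>cube 0 r1. F (x0 + slice I v) \<partial>lborel) <= S"
 shows "emeasure lborel (cube (0::real^'n) r1) * (\<integral>\<^sup>+x\<in>cube 0 R. F x \<partial>lborel) <= S * emeasure lborel (cube (0::real^'n) (R + r1))"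
proof -
 have "emeasure lborel (cube (0::real^'n) r1) * (\<integral>\<^sup>+x\<in>cube 0 R. F x \<partial>lborel) = (NN v. indicator (cube (0::real^'n) r1) v * (\<integral>\<^sup>+x\<in>cube 0 R. F x \<partial>lborel))"
  by (subst nn_integral_multc) auto
 also have "\<dots> <= (NN v. \<integral>\<^sup>+x0. F (x0 + slice I v) * indicator (cube 0 r1) v * indicator (cube 0 (R + r1)) x0 \<partial>lborel)"
 proof (rule nn_integral_mono)
  fix v :: "real^'n"
  show "indicator (cube (0::real^'n) r1) v * (\<integral>\<^sup>+x\<in>cube 0 R. F x \<partial>lborel) <=
   (NN x0. F (x0 + slice I v) * indicator (cube 0 r1) v * indicator (cube 0 (R + r1)) x0)"
  proof (cases "v \<in> cube 0 r1")
   case True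
   have "(\<integral>\<^sup>+x\<in>cube 0 R. F x \<partial>lborel) = (NN x0. F (x0 + slice I v) * indicator (cube 0 R) (x0 + slice I v))"
    by (rule nn_integral_lborel_translate[symmetric]) measurable
   also have "\<dots> <= (NN x0. F (x0 + slice I v) * indicator (cube 0 (R + r1)) x0)"
   proof (rule nn_integral_mono)
    fix x0 :: "real^'n"
    have "x0 \<in> cube 0 (R + r1)" if x: "x0 + slice I v \<in> cube 0 R"
     unfolding cube_def
    proof (intro CollectI allI)
     fix j
     have "\<bar>x0 $ j + slice I v $ j\<bar> <= R" using x by (auto simp: cube_def)
     moreover have "\<bar>slice I v $ j\<bar> <= r1" using True r1 by (auto simp: cube_def slice_def)
     ultimately show "\<bar>x0 $ j - 0 $ j\<bar> <= R + r1" by simp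
    qed
    then show "F (x0 + slice I v) * indicator (cube 0 R) (x0 + slice I v) <= F (x0 + slice I v) * indicator (cube 0 (R + r1)) x0"
     by (auto simp: indicator_def)
   qed
   finally show ?thesis using True by simp
  qed simp
 qed
 also have "\<dots> = (NN x0. \<integral>\<^sup>+v. F (x0 + slice I v) * indicator (cube 0 r1) v * indicator (cube 0 (R + r1)) x0 \<partial>lborel)"
  by (rule lborel_pair.Fubini'[of "\<lambda>x0 v. F (x0 + slice I v) * indicator (cube 0 r1) v * indicator (cube 0 (R + r1)) x0"])
    (simp only: measurable_lborel_pair borel_prod, measurable)
 also have "\<dots> = (NN x0. (\<integral>\<^sup>+v\<in>cube 0 r1. F (x0 + slice I v) \<partial>lborel) * indicator (cube 0 (R + r1)) x0)"
  by (intro nn_integral_cong nn_integral_multc) measurable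
 also have "\<dots> <= (NN x0. S * indicator (cube (0::real^'n) (R + r1)) x0)"
  by (intro nn_integral_mono mult_right_mono S) simp
 also have "\<dots> = S * emeasure lborel (cube (0::real^'n) (R + r1))"
  by (rule nn_integral_cmult_indicator) simp
 finally show ?thesis .
qed

text \<open>The operator after removal of a null set: all bounds hold for every \<open>x\<close> and
  the symbols are jointly Borel. \<open>Xi I\<close> collects the pairs of a point and a direction
  for which the coordinates in \<open>I\<close> are admissible, and \<open>ndeg\<close> is all that
  remains of the corank condition, used only along slices and at small distances. With d = n - k the
  hypothesis on m takes the form of the last assumption.\<close>

locale clean_fio =
 fixes a :: "real^'n::finite => 'n list => real^'n => complex"
  and P :: "real^'n => 'n list => real^'n => real"
  and Xi :: "'n set => ((real^'n) \<times> (real^'n)) set"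
  and m \<rho> cg r0 :: real and d :: nat
 assumes a_jet: "\<And>x. jet UNIV (a x)" and P_jet: "\<And>x. jet (-{0}) (P x)"
  and a_bd: "\<And>N. \<exists>C\<ge>0. \<forall>al x xi. length al <= N --> norm (a x al xi) <= C * japanese xi powr (m - \<rho> * real (length al))"
  and P_bd: "\<And>N. \<exists>C\<ge>0. \<forall>al x xi. 2 <= length al --> length al <= N --> xi ~= 0 --> \<bar>P x al xi\<bar> <= C * norm xi powr (1 - real (length al))"
  and P_hom: "\<And>x xi s. xi ~= 0 ==> 0 < s ==> P x [] (s .* xi) = s * P x [] xi"
  and P_hom1: "\<And>x i xi s. xi ~= 0 ==> 0 < s ==> P x [i] (s .* xi) = P x [i] xi"
  and a_meas [measurable]: "(\<lambda>p. a (fst p) [] (snd p)) \<in> bmeas"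
  and P_meas [measurable]: "(\<lambda>p. P (fst p) [] (snd p)) \<in> bmeas"
  and Xi_meas [measurable]: "\<And>I. Xi I \<in> sets borel"
  and Xi_card: "\<And>I. Xi I ~= {} ==> card I = d"
  and cover: "\<And>x xi \<omega>. a x [] xi ~= 0 ==> norm \<omega> = 1 ==> \<exists>I. (x, \<omega>) \<in> Xi I"
  and ndeg: "\<And>I x y \<omega>. (x, \<omega>) \<in> Xi I ==> (y, \<omega>) \<in> Xi I ==> norm \<omega> = 1 ==> slice I (x - y) = x - y ==> norm (x - y) <= r0 ==>
    \<exists>i. cg * norm (x - y) <= \<bar>P x [i] \<omega> - P y [i] \<omega>\<bar>"
  and cg: "0 < cg" "cg <= 1" and r0: "0 < r0" "r0 <= 1" and d: "1 <= d" "d <= CARD('n)"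
  and \<rho>: "0 <= \<rho>" "\<rho> <= 1"
  and m: "2 * m < - real CARD('n) + 1/2 - real d / 2 + real d * \<rho>"
begin

lemma a_meas' [measurable (raw)]: "f \<in> borel_measurable M ==> g \<in> borel_measurable M ==> (\<lambda>z. a (f z) [] (g z)) \<in> borel_measurable M"
 using measurable_compose[OF _ a_meas, of "\<lambda>z. (f z, g z)" M] by (simp add: borel_prod[symmetric])

lemma P_meas' [measurable (raw)]: "f \<in> borel_measurable M ==> g \<in> borel_measurable M ==> (\<lambda>z. P (f z) [] (g z)) \<in> borel_measurable M"
 using measurable_compose[OF _ P_meas, of "\<lambda>z. (f z, g z)" M] by (simp add: borel_prod[symmetric])

text \<open>A partition of unity made of normalised indicator functions, homogeneous of degree 0 in
  \<open>zeta\<close>. Where no set is admissible the quotient 0/0 gives the value 0.\<close>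

definition theta :: "'n set => real^'n => real^'n => real" where
 "theta I x zeta = indicator (Xi I) (x, zeta /\<^sub>R norm zeta) / (\<Sum>J\<in>UNIV. indicator (Xi J) (x, zeta /\<^sub>R norm zeta))"

lemma theta_measurable [measurable (raw)]:
 assumes [measurable]: "f \<in> borel_measurable M" "g \<in> borel_measurable M"
 shows "(\<lambda>z. theta I (f z) (g z)) \<in> borel_measurable M"
proof -
 have [measurable]: "(\<lambda>z. indicator (Xi J) (f z, g z /\<^sub>R norm (g z)) :: real) \<in> borel_measurable M" for J
  by (rule measurable_compose[of "\<lambda>z. (f z, g z /\<^sub>R norm (g z))" M borel]) (simp, simp add: Xi_meas)
 show ?thesis unfolding theta_def by measurable
qed

lemma theta_nonneg: "0 <= theta I x zeta"
 unfolding theta_def by (intro divide_nonneg_nonneg sum_nonneg) auto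

lemma theta_le_1: "theta I x zeta <= 1"
proof -
 have "(indicator (Xi I) (x, zeta /\<^sub>R norm zeta) :: real) <= (\<Sum>J\<in>UNIV. indicator (Xi J) (x, zeta /\<^sub>R norm zeta))"
  by (rule member_le_sum) auto
 moreover have "0 <= (\<Sum>J\<in>UNIV. indicator (Xi J) (x, zeta /\<^sub>R norm zeta) :: real)" by (rule sum_nonneg) simp
 ultimately show ?thesis unfolding theta_def by (auto simp: divide_le_eq_1)
qed

lemma theta_sum:
 assumes "a x [] xi ~= 0" "zeta ~= 0"
 shows "(\<Sum>I\<in>UNIV. theta I x zeta) = 1"
proof -
 let ?s = "\<Sum>J\<in>UNIV. indicator (Xi J) (x, zeta /\<^sub>R norm zeta) :: real"
 obtain I where I: "(x, zeta /\<^sub>R norm zeta) \<in> Xi I" using cover[OF assms(1), of "zeta /\<^sub>R norm zeta"] assms(2) by auto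
 have "(indicator (Xi I) (x, zeta /\<^sub>R norm zeta) :: real) <= ?s" by (rule member_le_sum) auto
 then have "?s ~= 0" using I by auto
 then show ?thesis unfolding theta_def sum_divide_distrib[symmetric] by simp
qed

text \<open>The weight is shared between \<open>kk\<close> and \<open>gg\<close> as two square
  roots, so that \<open>kk * cnj kk\<close> and \<open>kk * gg\<close> both carry it exactly once.
  The phase appears as \<open>s * P x [] eta\<close>, linear in \<open>s\<close>, in place of its
  value at s eta; homogeneity makes them equal.\<close>

definition kk :: "'n set => real => nat => real^'n => (real^'n) \<times> (real^'n) \<times> real => complex" where
 "kk I lam M x = (\<lambda>(zeta, eta, s). of_real (theta I x zeta * indicator (annulus 5 lam) zeta * sqrt (psi M (sqrt lam) (eta - zeta) * radial_bump M s)) *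
   (exp (\<i> * of_real (s * P x [] eta)) * a x [] (s .* eta)))"

definition gg :: "real => nat => (real^'n => complex) => (real^'n) \<times> (real^'n) \<times> real => complex" where
 "gg lam M f = (\<lambda>(zeta, eta, s). of_real (sqrt (psi M (sqrt lam) (eta - zeta) * radial_bump M s) * s ^ CARD('n)) * f (s .* eta))"

lemma annulus_sets [measurable]: "annulus c lam \<in> sets (borel :: (real^'n) measure)"
 by (intro borel_closed compact_imp_closed compact_annulus)

lemma kk_measurable: "(\<lambda>z. kk I lam M (fst z) (snd z)) \<in> bmeas"
 unfolding kk_def by (simp add: case_prod_beta) measurable

lemma kk_measurable': "f \<in> borel_measurable M' ==> g \<in> borel_measurable M' ==> (\<lambda>z. kk I lam M (f z) (g z)) \<in> borel_measurable M'"
 using measurable_compose[OF _ kk_measurable, of "\<lambda>z. (f z, g z)" M'] by (simp add: borel_prod[symmetric])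

lemma gg_measurable [measurable]:
 assumes [measurable]: "f \<in> bmeas"
 shows "gg lam M f \<in> bmeas"
 unfolding gg_def case_prod_beta by measurable

text \<open>On the shell, with l = lam^-rho and A = C lam^m, the symbol classes are exactly the
  bounds of \<open>osc_setup\<close>, with constants independent of \<open>lam\<close> and of the
  two points.\<close>

lemma osc_setup_clean:
 "\<exists>C\<ge>1. \<exists>lam0\<ge>1. \<forall>lam\<ge>lam0. \<forall>x y. osc_setup N C lam (lam powr - \<rho>) (C * lam powr m) (a x) (a y) (\<lambda>al xi. P x al xi - P y al xi)"
proof -
 obtain Ca where Ca: "Ca >= 0" and ab: "\<And>al x xi. length al <= N ==> norm (a x al xi) <= Ca * japanese xi powr (m - \<rho> * real (length al))"
  using a_bd[of N] by blast
 obtain Cp where Cp: "Cp >= 0" and pb: "\<And>al x xi. 2 <= length al ==> length al <= N + 2 ==> xi ~= 0 ==> \<bar>P x al xi\<bar> <= Cp * norm xi powr (1 - real (length al))"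
  using P_bd[of "N + 2"] by blast
 \<comment> \<open>On \<open>annulus 100\<close> the Japanese bracket lies between lam/101 and 101
   lam, and the exponents that occur are at most |m| + N in absolute value.\<close>
 define E where "E = (101::real) powr (\<bar>m\<bar> + real N)"
 define C where "C = max 1 (max (Ca * E) (2 * Cp * 100 ^ (N + 2)))"
 have C1: "1 <= C" and CE: "Ca * E <= C" and C2: "2 * Cp * 100 ^ (N + 2) <= C" by (auto simp: C_def)
 show ?thesis
 proof (rule exI[of _ C], rule conjI[OF C1], rule exI[of _ "(200 * real CARD('n))^2"], intro conjI allI impI)
  have c1: "1 <= real CARD('n)" by (simp add: Suc_leI)
  have "1 <= 200 * real CARD('n)" using c1 by linarith
  then show 1: "1 <= (200 * real CARD('n))^2" by (rule one_le_power)
  fix lam :: real and x y :: "real^'n"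
  assume lam: "(200 * real CARD('n))^2 <= lam"
  have lam1: "1 <= lam" using lam 1 by linarith
  have amp: "amp_bound N (lam powr - \<rho>) (C * lam powr m) (annulus 100 lam) (a x)" for x
   unfolding amp_bound_def
  proof (intro allI impI)
   fix al :: "'n list" and xi :: "real^'n" assume al: "length al <= N" and xi: "xi \<in> annulus 100 lam"
   let ?e = "m - \<rho> * real (length al)"
   have nxi: "lam / 100 <= norm xi" "norm xi <= 100 * lam" using xi by (auto simp: annulus_def)
   have "norm xi <= japanese xi" unfolding japanese_def by (intro real_le_rsqrt) auto
   then have j1: "lam / 101 <= japanese xi" using nxi lam1 by linarith
   have "japanese xi <= 1 + norm xi" unfolding japanese_def
    by (intro real_le_lsqrt) (auto simp: power2_eq_square algebra_simps)
   then have j2: "japanese xi <= 101 * lam" using nxi lam1 by linarith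
   have jp: "0 < japanese xi" using j1 lam1 by linarith
   have r: "(japanese xi / lam) powr ?e <= E"
   proof (cases "?e >= 0")
    case True
    have "(japanese xi / lam) powr ?e <= 101 powr ?e"
     using True j2 lam1 jp by (intro powr_mono2) (auto simp: field_simps)
    also have "\<dots> <= E" unfolding E_def
    proof (intro powr_mono)
     have "0 <= \<rho> * real (length al)" using \<rho> by simp
     then show "?e <= \<bar>m\<bar> + real N" by linarith
    qed simp
    finally show ?thesis .
   next
    case False
    have "(japanese xi / lam) powr ?e <= (1/101) powr ?e"
     using False j1 lam1 jp by (intro powr_mono2') (auto simp: field_simps)
    also have "\<dots> = 101 powr (- ?e)" by (subst powr_minus_divide) (simp add: powr_divide)
    also have "\<dots> <= E" unfolding E_def
    proof (intro powr_mono)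
     have "\<rho> * real (length al) <= 1 * real N" using \<rho> al by (intro mult_mono) auto
     then show "- ?e <= \<bar>m\<bar> + real N" by linarith
    qed simp
    finally show ?thesis .
   qed
   have "japanese xi powr ?e = (japanese xi / lam) powr ?e * lam powr ?e"
    using jp lam1 by (simp add: powr_mult[symmetric])
   also have "\<dots> <= E * lam powr ?e" using r by (intro mult_right_mono) auto
   finally have "norm (a x al xi) <= Ca * (E * lam powr ?e)"
    using ab[OF al, of x xi] Ca by (meson mult_left_mono order_trans)
   also have "\<dots> <= C * lam powr ?e" using CE by (simp add: mult.assoc[symmetric] mult_right_mono)
   also have "lam powr ?e = lam powr m * (lam powr - \<rho>) ^ length al"
    using lam1 by (simp add: powr_realpow[symmetric] powr_powr powr_add[symmetric])
   finally show "norm (a x al xi) <= C * lam powr m * (lam powr - \<rho>) ^ length al" by (simp add: mult.assoc)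
  qed
  show "osc_setup N C lam (lam powr - \<rho>) (C * lam powr m) (a x) (a y) (\<lambda>al xi. P x al xi - P y al xi)"
  proof
   show "jet UNIV (a x)" "jet UNIV (a y)" by (rule a_jet)+
   show "jet (- {0}) (\<lambda>al xi. P x al xi - P y al xi)" by (rule jet_diff) (rule P_jet)+
   show "amp_bound N (lam powr - \<rho>) (C * lam powr m) (annulus 100 lam) (a x)" "amp_bound N (lam powr - \<rho>) (C * lam powr m) (annulus 100 lam) (a y)"
    by (rule amp)+
   show "phase_bound (N + 2) C lam (\<lambda>al xi. P x al xi - P y al xi)"
    unfolding phase_bound_def
   proof (intro allI ballI impI)
    fix al :: "'n list" and xi :: "real^'n" assume xi: "xi \<in> annulus 100 lam" and al: "2 <= length al" "length al <= N + 2"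
    have nxi: "lam / 100 <= norm xi" using xi by (auto simp: annulus_def)
    have xi0: "xi ~= 0" using annulus_nonzero[OF _ _ xi] lam1 by auto
    have "norm xi powr (1 - real (length al)) <= (lam / 100) powr (1 - real (length al))"
     using nxi al lam1 by (intro powr_mono2') auto
    also have "\<dots> = lam * (1 / lam) ^ length al * (100 powr (real (length al) - 1))"
     using lam1 by (simp add: powr_divide powr_diff powr_realpow power_divide)
    also have "\<dots> <= lam * (1 / lam) ^ length al * (100 powr real (N + 2))"
     using al lam1 by (intro mult_left_mono powr_mono) auto
    also have "(100::real) powr real (N + 2) = 100 ^ (N + 2)" by (rule powr_realpow) simp
    finally have le: "Cp * norm xi powr (1 - real (length al)) <= Cp * (lam * (1 / lam) ^ length al * 100 ^ (N + 2))"
     using Cp by (intro mult_left_mono)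
    have "\<bar>P x al xi - P y al xi\<bar> <= \<bar>P x al xi\<bar> + \<bar>P y al xi\<bar>" by simp
    also have "\<dots> <= 2 * (Cp * (lam * (1 / lam) ^ length al * 100 ^ (N + 2)))"
     using pb[OF al xi0, of x] pb[OF al xi0, of y] le by linarith
    also have "\<dots> = (2 * Cp * 100 ^ (N + 2)) * (lam * (1 / lam) ^ length al)" by (simp only: mult_ac)
    also have "\<dots> <= C * (lam * (1 / lam) ^ length al)" using lam1 by (intro mult_right_mono C2) auto
    finally show "\<bar>P x al xi - P y al xi\<bar> <= C * lam * (1 / lam) ^ length al" by (simp only: mult.assoc)
   qed
   show "0 <= C" "0 <= C * lam powr m" using C1 by auto
   show "0 < lam powr - \<rho>" using lam1 by simp
   have "lam * lam powr - \<rho> = lam powr (1 - \<rho>)" using lam1 by (simp add: powr_diff powr_minus divide_inverse)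
   then show "1 <= lam * lam powr - \<rho>" using lam1 \<rho> by (simp add: ge_one_powr_ge_zero)
   show "(200 * real CARD('n))^2 <= lam" by (rule lam)
  qed
 qed
qed

lemma kk_cnj:
 assumes "osc_setup N C lam l A (a x) (a y) (\<lambda>al xi. P x al xi - P y al xi)"
 shows "kk I lam (Suc N) x p * cnj (kk I lam (Suc N) y p) =
  of_real ((theta I x (fst p) * theta I y (fst p)) * indicator (annulus 5 lam) (fst p)) * osc_setup.osc N lam (a x) (a y) (\<lambda>al xi. P x al xi - P y al xi) p"
proof -
 obtain zeta eta s where p: "p = (zeta, eta, s)" by (cases p) auto
 let ?w = "psi (Suc N) (sqrt lam) (eta - zeta) * radial_bump (Suc N) s"
 have w: "of_real (sqrt ?w) * of_real (sqrt ?w) = (of_real ?w :: complex)"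
  unfolding of_real_mult[symmetric] by (subst real_sqrt_mult_self) (simp add: psi_nonneg radial_bump_nonneg)
 have ex: "exp (\<i> * of_real (s * P x [] eta)) * cnj (exp (\<i> * of_real (s * P y [] eta))) = exp (\<i> * of_real (s * (P x [] eta - P y [] eta)))"
 proof -
  have "cnj (exp (\<i> * of_real (s * P y [] eta))) = exp (- (\<i> * of_real (s * P y [] eta)))"
   by (simp add: exp_cnj)
  then show ?thesis by (simp add: exp_add[symmetric] exp_minus algebra_simps exp_diff divide_inverse)
 qed
 have ii: "(indicator (annulus 5 lam) zeta :: real) * indicator (annulus 5 lam) zeta = indicator (annulus 5 lam) zeta"
  by (simp add: indicator_def)
 have "kk I lam (Suc N) x p * cnj (kk I lam (Suc N) y p) =
  of_real (theta I x zeta * theta I y zeta * (indicator (annulus 5 lam) zeta * indicator (annulus 5 lam) zeta)) * (of_real (sqrt ?w) * of_real (sqrt ?w)) *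
  ((exp (\<i> * of_real (s * P x [] eta)) * cnj (exp (\<i> * of_real (s * P y [] eta)))) * (a x [] (s .* eta) * cnj (a y [] (s .* eta))))"
  unfolding p kk_def by (simp only: prod.case complex_cnj_mult complex_cnj_complex_of_real of_real_mult mult_ac)
 also have "\<dots> = of_real ((theta I x zeta * theta I y zeta) * indicator (annulus 5 lam) zeta) * osc_setup.osc N lam (a x) (a y) (\<lambda>al xi. P x al xi - P y al xi) p"
  unfolding ii w ex osc_setup.osc_def[OF assms] p by (simp only: prod.case mult_ac)
 finally show ?thesis by (simp only: p fst_conv)
qed

text \<open>The qualitative bound \<open>B\<close> that \<open>TT_star_bound\<close> asks for; its
  size is irrelevant because \<open>B\<close> does not enter the estimate.\<close>

lemma kk_L2:
 assumes "\<And>x y. osc_setup N C lam l A (a x) (a y) (\<lambda>al xi. P x al xi - P y al xi)"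
 shows "\<exists>B\<ge>0. \<forall>x. (NN p. sqn (kk I lam (Suc N) x p)) <= ennreal B"
proof -
 let ?Q = "(cball 0 (5 * lam) :: (real^'n) set) \<times> (cball 0 (10 * lam) :: (real^'n) set) \<times> {1..2::real}"
 have Q: "emeasure lborel ?Q < \<infinity>" by (intro emeasure_compact_finite compact_Times) auto
 have Qm: "?Q \<in> sets lborel" using borel_closed[of ?Q] by (simp add: closed_Times)
 have "(NN p. sqn (kk I lam (Suc N) x p)) <= ennreal (A^2 * measure lborel ?Q)" for x
 proof -
  interpret osc_setup N C lam l A "a x" "a x" "\<lambda>al xi. P x al xi - P x al xi" by (rule assms)
  have "sqn (kk I lam (Suc N) x p) <= ennreal (A^2) * indicator ?Q p" for p
  proof -
   obtain zeta eta s where p: "p = (zeta, eta, s)" by (cases p) auto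
   have "(norm (kk I lam (Suc N) x p))^2 = norm (kk I lam (Suc N) x p * cnj (kk I lam (Suc N) x p))"
    by (simp add: norm_mult power2_eq_square)
   also have "\<dots> = theta I x zeta * theta I x zeta * indicator (annulus 5 lam) zeta * norm (osc p)"
    unfolding kk_cnj[OF assms] norm_mult norm_of_real by (simp add: p theta_nonneg)
   also have "\<dots> <= 1 * (A^2 * indicator ?Q p)"
   proof (cases "zeta \<in> annulus 5 lam")
    case True
    have "norm (osc p) <= A^2 * (indicator (cube zeta r) eta * indicator {1..2} s)" unfolding p by (rule osc_bound[OF True])
    also have "\<dots> <= A^2 * indicator ?Q p"
    proof (rule mult_left_mono)
     show "indicator (cube zeta r) eta * indicator {1..2} s <= (indicator ?Q p :: real)"
      using True ann10[OF True, of eta] unfolding p by (auto simp: indicator_def annulus_def)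
    qed simp
    finally have o: "norm (osc p) <= A^2 * indicator ?Q p" .
    have "theta I x zeta * theta I x zeta <= 1 * 1" by (rule mult_mono) (auto simp: theta_nonneg theta_le_1)
    then have "(theta I x zeta * theta I x zeta) * norm (osc p) <= 1 * (A^2 * indicator ?Q p)"
     using o by (intro mult_mono) auto
    then show ?thesis using True by simp
   qed simp
   finally show ?thesis by (auto simp: indicator_def split: if_splits intro: ennreal_leI)
  qed
  then have "(NN p. sqn (kk I lam (Suc N) x p)) <= (NN p. ennreal (A^2) * indicator ?Q p)"
   by (rule nn_integral_mono)
  also have "\<dots> = ennreal (A^2) * emeasure lborel ?Q" by (rule nn_integral_cmult_indicator[OF Qm])
  also have "\<dots> = ennreal (A^2 * measure lborel ?Q)"
   using Q by (subst emeasure_eq_ennreal_measure) (auto simp: ennreal_mult)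
  finally show ?thesis .
 qed
 then show ?thesis by (intro exI[of _ "A^2 * measure lborel ?Q"]) auto
qed

text \<open>Along a slice x - y has only coordinates in \<open>I\<close>, so \<open>ndeg\<close>
  turns the distance into a lower bound for the gradient. With \<open>D = t^2 / sqrt lam\<close> the
  tangential bound removes all pairs farther apart than \<open>D\<close>; with \<open>D = 1\<close>
  only the radial bound is used.\<close>

lemma slice_estimate:
 assumes N: "0 < N" and C: "0 <= C"
 shows "\<exists>W\<ge>1. \<forall>lam l A t D I x0 g. (\<forall>x y. osc_setup N C lam l A (a x) (a y) (\<lambda>al xi. P x al xi - P y al xi)) -->
   W <= t --> lam^2 <= t ^ N --> (l * sqrt lam <= 1 \<and> D = t^2 / sqrt lam \<or> D = 1) -->
   g \<in> bmeas --> (NN p. sqn (g p)) < \<top> -->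
   (\<integral>\<^sup>+v\<in>cube 0 (r0 / (2 * real CARD('n))). sqn (LL p. kk I lam (Suc N) (x0 + slice I v) p * g p) \<partial>lborel)
    <= ennreal (W * A^2 * lam ^ CARD('n) * sqrt lam ^ CARD('n) * (t^2 / t ^ N + t ^ 3 * l * D ^ (d - 1))) * (NN p. sqn (g p))"
proof -
 obtain W where W: "W >= 1" and KB: "\<forall>(a1 :: 'n list => real^'n => complex) a2 P lam l A \<Theta> \<delta> t.
   osc_setup N C lam l A a1 a2 P --> \<Theta> \<in> bmeas --> (\<forall>zeta. 0 <= \<Theta> zeta \<and> \<Theta> zeta <= 1) -->
   (\<forall>zeta\<in>annulus 5 lam. \<Theta> zeta ~= 0 --> (\<exists>i. cg * \<delta> <= \<bar>P [i] zeta\<bar>)) --> 0 < \<delta> --> \<delta> <= 1 --> W <= t --> lam^2 <= t ^ N -->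
   norm (osc_setup.kernel N lam a1 a2 P \<Theta>) <= W * A^2 * lam ^ CARD('n) * sqrt lam ^ CARD('n) * (1 / t ^ N + t^2 * min 1 (l / \<delta>)) \<and>
   (l * sqrt lam <= 1 --> t^2 <= sqrt lam * \<delta> -->
    norm (osc_setup.kernel N lam a1 a2 P \<Theta>) <= W * A^2 * lam ^ CARD('n) * sqrt lam ^ CARD('n) * (1 / t ^ N))"
  using kernel_bounds[OF cg C N, where 'n='n] by blast
 \<comment> \<open>Two points of this cube have distance at most n * 2 r1 = r0, the range of
   \<open>ndeg\<close>, and the cube lies in the unit cube of \<open>schur_slice\<close>.\<close>
 let ?r1 = "r0 / (2 * real CARD('n))"
 have c1: "1 <= real CARD('n)" by (simp add: Suc_leI)
 have r1: "0 < ?r1" "?r1 <= 1/2"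
 proof -
  show "0 < ?r1" using r0 c1 by simp
  have "r0 <= 1 * real CARD('n)" using r0 c1 by linarith
  then show "?r1 <= 1/2" using c1 by (simp add: field_simps)
 qed
 define W' where "W' = 2 ^ CARD('n) * real (N + 2) * W"
 have W': "1 <= W'" "W <= W'"
 proof -
  have "1 * 1 <= (2::real) ^ CARD('n) * real (N + 2)" by (rule mult_mono) auto
  then have "1 * W <= 2 ^ CARD('n) * real (N + 2) * W" using W by (intro mult_right_mono) auto
  then show "W <= W'" by (simp add: W'_def)
  then show "1 <= W'" using W by linarith
 qed
 show ?thesis
 proof (intro exI[of _ W'] conjI allI impI W'(1))
  fix lam l A t D :: real and I :: "'n set" and x0 :: "real^'n" and g :: "(real^'n) \<times> (real^'n) \<times> real => complex"
  assume st: "\<forall>x y. osc_setup N C lam l A (a x) (a y) (\<lambda>al xi. P x al xi - P y al xi)"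
   and Wt: "W' <= t" and tN: "lam^2 <= t ^ N" and D: "l * sqrt lam <= 1 \<and> D = t^2 / sqrt lam \<or> D = 1"
   and g[measurable]: "g \<in> bmeas" and gfin: "(NN p. sqn (g p)) < \<top>"
  have st': "\<And>x y. osc_setup N C lam l A (a x) (a y) (\<lambda>al xi. P x al xi - P y al xi)" using st by blast
  interpret s0: osc_setup N C lam l A "a x0" "a x0" "\<lambda>al xi. P x0 al xi - P x0 al xi" by (rule st')
  have t1: "1 <= t" and Wt': "W <= t" using W' Wt by linarith+
  have lam1: "1 <= lam" by (rule s0.lam1)
  have D0: "0 <= D" using D lam1 by auto
  define K where "K = W * A^2 * lam ^ CARD('n) * sqrt lam ^ CARD('n)"
  have K0: "0 <= K" using W lam1 by (simp add: K_def)
  define S where "S = 2 ^ CARD('n) * real (N + 2) * K * (t^2 / t ^ N + t ^ 3 * l * D ^ (d - 1))"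
  show "(\<integral>\<^sup>+v\<in>cube 0 ?r1. sqn (LL p. kk I lam (Suc N) (x0 + slice I v) p * g p) \<partial>lborel)
    <= ennreal (W' * A^2 * lam ^ CARD('n) * sqrt lam ^ CARD('n) * (t^2 / t ^ N + t ^ 3 * l * D ^ (d - 1))) * (NN p. sqn (g p))"
  proof (cases "card I = d")
   \<comment> \<open>A set of the wrong cardinality has empty \<open>Xi I\<close>, hence weight
     \<open>theta\<close> zero.\<close>
   case False
   then have "Xi I = {}" using Xi_card by blast
   then have "kk I lam (Suc N) x p = 0" for x p by (simp add: kk_def theta_def case_prod_beta)
   then show ?thesis by simp
  next
   case cI: True
   then have Ine: "I ~= {}" using d(1) by auto
   let ?M = "restrict_space lborel (cube (0::real^'n) ?r1)"
   let ?k = "\<lambda>v p. kk I lam (Suc N) (x0 + slice I v) p"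
   obtain B where B: "0 <= B" and kb: "\<And>x. (NN p. sqn (kk I lam (Suc N) x p)) <= ennreal B"
    using kk_L2[OF st', of I] by blast
   have sp: "space ?M = cube 0 ?r1" by (simp add: space_restrict_space)
   have cm: "cube (0::real^'n) ?r1 \<inter> space lborel \<in> sets lborel" by simp
   have "(\<integral>\<^sup>+v. sqn (LL p. ?k v p * g p) \<partial>?M) <= ennreal S * (NN p. sqn (g p))"
   proof (rule TT_star_bound[OF _ _ _ _ B])
    show "finite_measure ?M"
    proof
     have "emeasure ?M (space ?M) = ennreal ((2 * ?r1) ^ CARD('n))"
      unfolding sp using less_imp_le[OF r1(1)] by (subst emeasure_restrict_space) (simp_all only: cm emeasure_cube subset_refl sets_restrict_space)
     then show "emeasure ?M (space ?M) ~= \<infinity>" by (simp only:) simp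
    qed
    show "sigma_finite_measure (lborel :: ((real^'n) \<times> (real^'n) \<times> real) measure)" by (rule sigma_finite_lborel)
    have [measurable]: "(\<lambda>v. v) \<in> measurable ?M borel" by (rule measurable_restrict_space1) simp
    show "case_prod ?k \<in> borel_measurable (?M \<Otimes>\<^sub>M lborel)"
     unfolding case_prod_beta' by (rule kk_measurable') measurable
    show "(NN p. sqn (?k v p)) <= ennreal B" for v by (rule kb)
    show "g \<in> borel_measurable lborel" by simp
    show "(NN p. sqn (g p)) < \<top>" by (rule gfin)
    fix v assume "v \<in> space ?M"
    then have v: "v \<in> cube 0 ?r1" by (simp add: sp)
    let ?f = "\<lambda>w. indicator (cube 0 ?r1) w * norm (LL p. ?k v p * cnj (?k w p))"
    have "(\<integral>\<^sup>+w. ennreal (norm (LL p. ?k v p * cnj (?k w p))) \<partial>?M) = (\<integral>\<^sup>+w\<in>cube 0 ?r1. ennreal (norm (LL p. ?k v p * cnj (?k w p))) \<partial>lborel)"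
     by (rule nn_integral_restrict_space[OF cm])
    also have "\<dots> <= (\<integral>\<^sup>+w\<in>cube 0 (1/2). ennreal (?f w) \<partial>lborel)"
    proof (rule nn_integral_mono)
     fix w :: "real^'n"
     have "w \<in> cube 0 (1/2)" if "w \<in> cube 0 ?r1"
      using that r1(2) unfolding cube_def mem_Collect_eq by (meson order_trans)
     then show "ennreal (norm (LL p. ?k v p * cnj (?k w p))) * indicator (cube 0 ?r1) w <= ennreal (?f w) * indicator (cube 0 (1/2)) w"
      by (auto simp: indicator_def)
    qed
    also have "\<dots> <= ennreal (2 ^ CARD('n) * real (N + 2) * K * (t^2 / t ^ N + t ^ 3 * l * D ^ (card I - 1)))"
    proof (rule schur_slice[OF Ine t1 s0.l(1) D0 K0 N, of v])
     fix w :: "real^'n" assume w: "w \<in> cube 0 (1/2)" and nz: "slice I (v - w) ~= 0"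
     let ?d = "norm (slice I (v - w))"
     let ?x = "x0 + slice I v" let ?y = "x0 + slice I w"
     let ?P = "\<lambda>al xi. P ?x al xi - P ?y al xi"
     show "?f w <= K * (1 / t ^ N + t^2 * min 1 (l / ?d) * (if ?d <= D then 1 else 0))"
     proof (cases "w \<in> cube 0 ?r1")
      case False
      then show ?thesis using K0 t1 s0.l(1) by (auto intro!: mult_nonneg_nonneg add_nonneg_nonneg)
     next
      case True
      have "v \<in> cube w (2 * ?r1)" unfolding cube_def
      proof (intro CollectI allI)
       fix j
       have "\<bar>v $ j\<bar> <= ?r1" "\<bar>w $ j\<bar> <= ?r1" using v True by (auto simp: cube_def)
       then show "\<bar>v $ j - w $ j\<bar> <= 2 * ?r1" by linarith
      qed
      from norm_cube[OF this] have "norm (v - w) <= r0" using c1 by simp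
      then have dr: "?d <= r0" using norm_slice_le[of I "v - w"] by linarith
      have d0: "0 < ?d" using nz by simp
      have xy: "?x - ?y = slice I (v - w)" by (simp add: slice_diff)
      define Th where "Th = (\<lambda>zeta. theta I ?x zeta * theta I ?y zeta)"
      have Thm: "Th \<in> bmeas" unfolding Th_def by measurable
      have Th01: "\<forall>zeta. 0 <= Th zeta \<and> Th zeta <= 1"
       unfolding Th_def by (auto intro!: mult_nonneg_nonneg mult_le_one simp: theta_nonneg theta_le_1)
      have nd: "\<forall>zeta\<in>annulus 5 lam. Th zeta ~= 0 --> (\<exists>i. cg * ?d <= \<bar>?P [i] zeta\<bar>)"
      proof (intro ballI impI)
       fix zeta :: "real^'n" assume zeta: "zeta \<in> annulus 5 lam" and nz: "Th zeta ~= 0"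
       have zeta0: "zeta ~= 0" using annulus_nonzero[OF _ _ zeta] lam1 by auto
       let ?\<omega> = "zeta /\<^sub>R norm zeta"
       have "(?x, ?\<omega>) \<in> Xi I" "(?y, ?\<omega>) \<in> Xi I" using nz by (auto simp: Th_def theta_def indicator_def split: if_splits)
       from ndeg[OF this] have "\<exists>i. cg * norm (?x - ?y) <= \<bar>P ?x [i] ?\<omega> - P ?y [i] ?\<omega>\<bar>"
        using zeta0 dr unfolding xy by (simp add: slice_slice)
       then show "\<exists>i. cg * ?d <= \<bar>?P [i] zeta\<bar>"
        using P_hom1[OF zeta0, of "inverse (norm zeta)"] zeta0 unfolding xy by simp
      qed
      have ke: "(LL p. ?k v p * cnj (?k w p)) = osc_setup.kernel N lam (a ?x) (a ?y) ?P Th"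
       unfolding kk_cnj[OF st'] osc_setup.kernel_def[OF st'] Th_def ..
      have B1: "norm (osc_setup.kernel N lam (a ?x) (a ?y) ?P Th) <= K * (1 / t ^ N + t^2 * min 1 (l / ?d))"
       and B2: "l * sqrt lam <= 1 ==> t^2 <= sqrt lam * ?d ==> norm (osc_setup.kernel N lam (a ?x) (a ?y) ?P Th) <= K * (1 / t ^ N)"
       using KB[rule_format, OF st' Thm Th01[rule_format] nd[rule_format] d0 _ Wt' tN] dr r0(2) unfolding K_def by auto
      show ?thesis
      proof (cases "?d <= D")
       case True
       then show ?thesis using B1 \<open>w \<in> cube 0 ?r1\<close> ke by simp
      next
       \<comment> \<open>All distances are at most r0 <= 1, so a distance beyond \<open>D\<close>
         excludes D = 1 and means that the tangential bound is available.\<close>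
       case False
       then have "l * sqrt lam <= 1" "t^2 <= sqrt lam * ?d"
        using D dr r0(2) lam1 by (auto simp: divide_le_eq not_le divide_less_eq mult.commute)
       then show ?thesis using B2 False \<open>w \<in> cube 0 ?r1\<close> ke by simp
      qed
     qed
    qed
    also have "\<dots> = ennreal S" by (simp only: S_def cI)
    finally show "(\<integral>\<^sup>+w. ennreal (norm (LL p. ?k v p * cnj (?k w p))) \<partial>?M) <= ennreal S" .
   qed
   also have "(\<integral>\<^sup>+v. sqn (LL p. ?k v p * g p) \<partial>?M) = (\<integral>\<^sup>+v\<in>cube 0 ?r1. sqn (LL p. ?k v p * g p) \<partial>lborel)"
    by (rule nn_integral_restrict_space[OF cm])
   also have "S = W' * A^2 * lam ^ CARD('n) * sqrt lam ^ CARD('n) * (t^2 / t ^ N + t ^ 3 * l * D ^ (d - 1))"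
    by (simp only: S_def K_def W'_def mult_ac)
   finally show ?thesis .
  qed
 qed
qed

end

lemma ennreal_divide_le:
 assumes "0 < c" "0 <= b" "ennreal c * X <= ennreal b * Y"
 shows "X <= ennreal (b / c) * Y"
proof -
 have "X = ennreal (1 / c) * (ennreal c * X)" using assms(1) by (simp add: mult.assoc[symmetric] ennreal_mult[symmetric])
 also have "\<dots> <= ennreal (1 / c) * (ennreal b * Y)" by (intro mult_left_mono assms(3)) simp
 also have "\<dots> = ennreal (b / c) * Y" using assms(1,2) by (simp add: mult.assoc[symmetric] ennreal_mult[symmetric])
 finally show ?thesis .
qed

lemma norm_sum_sq_le:
 fixes f :: "'i => complex"
 shows "(norm (\<Sum>i\<in>I. f i))^2 <= real (card I) * (\<Sum>i\<in>I. (norm (f i))^2)"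
proof -
 have "(norm (\<Sum>i\<in>I. f i))^2 <= (\<Sum>i\<in>I. norm (f i))^2" by (intro power_mono norm_sum) simp
 also have "\<dots> <= (\<Sum>i\<in>I. (norm (f i))^2) * real (card I)" by (rule sum_squared_le_sum_of_squares)
 finally show ?thesis by (simp add: mult.commute)
qed

lemma integrable_L2_bounded_support:
 fixes f :: "'a::euclidean_space => complex"
 assumes f[measurable]: "f \<in> bmeas" and fin: "(NN xi. sqn (f xi)) < \<top>"
  and supp: "\<And>xi. f xi ~= 0 ==> norm xi <= R"
 shows "integrable lborel f"
proof (rule integrableI_bounded)
 have "(NN xi. ennreal (norm (f xi))) <= (NN xi. indicator (cball 0 R) xi + sqn (f xi))"
 proof (rule nn_integral_mono)
  fix xi :: 'a
  have "norm (f xi) <= 1 + (norm (f xi))^2" using sum_squares_bound[of 1 "norm (f xi)"] by (simp, smt (verit) norm_ge_zero)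
  then have "ennreal (norm (f xi)) <= 1 + sqn (f xi)"
   by (metis ennreal_1 ennreal_leI ennreal_plus zero_le_one zero_le_power2)
  then show "ennreal (norm (f xi)) <= indicator (cball 0 R) xi + sqn (f xi)"
   using supp[of xi] by (cases "f xi = 0") (auto simp: indicator_def)
 qed
 also have "\<dots> = emeasure lborel (cball (0::'a) R) + (NN xi. sqn (f xi))"
 proof (subst nn_integral_add)
  show "(indicator (cball (0::'a) R) :: 'a => ennreal) \<in> borel_measurable lborel"
   by (intro borel_measurable_indicator) (simp add: borel_closed)
 qed auto
 also have "\<dots> < \<top>" using fin emeasure_bounded_finite[of "cball (0::'a) R"] by simp
 finally show "(NN xi. ennreal (norm (f xi))) < \<infinity>" by simp
qed simp

text \<open>The piece j = 0 is the whole ball of radius 2, so that the pieces partition the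
  frequency space.\<close>

definition dyadic :: "nat => (real^'n) set" where
 "dyadic j = {xi. (j = 0 \<or> 2 ^ j <= norm xi) \<and> norm xi < 2 ^ Suc j}"

lemma dyadic_sets [measurable]: "dyadic j \<in> sets borel"
 unfolding dyadic_def by measurable

section \<open>Decay of the dyadic pieces\<close>

context clean_fio
begin

lemma m_neg: "m < 0"
proof -
 have "real d * \<rho> <= real d * 1" using \<rho> by (intro mult_left_mono) auto
 moreover have "real d <= real CARD('n)" "1 <= real CARD('n)" using d by auto
 ultimately show ?thesis using m by linarith
qed

lemma a_bounded: "\<exists>C\<ge>0. \<forall>x xi. norm (a x [] xi) <= C"
proof -
 obtain C where C: "C >= 0" "\<And>al x xi. length al <= 0 ==> norm (a x al xi) <= C * japanese xi powr (m - \<rho> * real (length al))"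
  using a_bd[of 0] by blast
 have "norm (a x [] xi) <= C" for x xi
 proof -
  have "1 <= japanese xi" unfolding japanese_def by simp
  then have "japanese xi powr m <= japanese xi powr 0" using m_neg by (intro powr_mono) auto
  then have "C * japanese xi powr m <= C * 1" using C(1) \<open>1 <= japanese xi\<close> by (intro mult_left_mono) auto
  then show ?thesis using C(2)[of "[]" x xi] by simp
 qed
 then show ?thesis using C(1) by blast
qed

definition opT :: "(real^'n => complex) => real^'n => complex" where
 "opT f x = (LL xi. exp (\<i> * of_real (P x [] xi)) * a x [] xi * f xi)"

lemma opT_measurable [measurable]:
 assumes f: "f \<in> bmeas"
 shows "opT f \<in> bmeas"
proof -
 have 1: "(\<lambda>z. fst z) \<in> borel_measurable ((borel :: (real^'n) measure) \<Otimes>\<^sub>M (lborel :: (real^'n) measure))" by measurable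
 have 2: "(\<lambda>z. snd z) \<in> borel_measurable (borel \<Otimes>\<^sub>M (lborel :: (real^'n) measure))" by measurable
 have 3: "(\<lambda>z. f (snd z)) \<in> borel_measurable (borel \<Otimes>\<^sub>M lborel)" by (rule measurable_compose[OF 2 f])
 have 4[measurable]: "(\<lambda>z. P (fst z) [] (snd z)) \<in> borel_measurable (borel \<Otimes>\<^sub>M lborel)" by (rule P_meas'[OF 1 2])
 have 5: "(\<lambda>z. exp (\<i> * of_real (P (fst z) [] (snd z)))) \<in> borel_measurable (borel \<Otimes>\<^sub>M lborel)" by measurable
 have "(\<lambda>z. exp (\<i> * of_real (P (fst z) [] (snd z))) * a (fst z) [] (snd z) * f (snd z)) \<in> borel_measurable (borel \<Otimes>\<^sub>M lborel)"
  by (intro borel_measurable_times 3 a_meas'[OF 1 2] 5)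
 then show ?thesis unfolding opT_def by (intro lborel.borel_measurable_lebesgue_integral) (simp add: case_prod_beta')
qed

lemma opT_integrable:
 assumes "integrable lborel f"
 shows "integrable lborel (\<lambda>xi. exp (\<i> * of_real (P x [] xi)) * a x [] xi * f xi)"
proof -
 obtain C where C: "C >= 0" "\<And>x xi. norm (a x [] xi) <= C" using a_bounded by blast
 have f[measurable]: "f \<in> bmeas" using borel_measurable_integrable[OF assms] by simp
 have i: "integrable lborel (\<lambda>xi. C .* norm (f xi))" using assms by auto
 show ?thesis
  by (rule Bochner_Integration.integrable_bound[OF i]) (use C in \<open>auto simp: norm_mult intro!: mult_right_mono\<close>)
qed

text \<open>Integrating out the lifted variables returns the integral over the shell times the two
  masses, and the weights \<open>theta\<close> add up to 1 at every centre that contributes. Summing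
  over \<open>I\<close> therefore restores the operator.\<close>

lemma opT_lift:
 assumes M: "0 < M" and lam: "(200 * real CARD('n))^2 <= lam"
  and f: "integrable lborel f" and supp: "\<And>xi. f xi ~= 0 ==> lam <= norm xi \<and> norm xi < 2 * lam"
 shows "of_real (psi_mass TYPE('n) M (sqrt lam) * radial_mass M) * opT f x = (\<Sum>I\<in>UNIV. \<integral>p. kk I lam M x p * gg lam M f p \<partial>lborel)"
proof -
 define \<Phi> where "\<Phi> = (\<lambda>xi. exp (\<i> * of_real (P x [] xi)) * a x [] xi * f xi)"
 have \<Phi>i: "integrable lborel \<Phi>" unfolding \<Phi>_def by (rule opT_integrable[OF f])
 have fm[measurable]: "f \<in> bmeas" using borel_measurable_integrable[OF f] by simp
 have c1: "1 <= real CARD('n)" by (simp add: Suc_leI)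
 have "1 <= 200 * real CARD('n)" using c1 by linarith
 then have "1 <= (200 * real CARD('n))^2" by (rule one_le_power)
 then have lam1: "1 <= lam" using lam by linarith
 have r0: "0 < sqrt lam" using lam1 by simp
 have "200 * real CARD('n) <= sqrt lam" using lam by (rule real_le_rsqrt)
 then have "200 * real CARD('n) * sqrt lam <= sqrt lam * sqrt lam" using r0 by (intro mult_right_mono) auto
 then have nr: "real CARD('n) * sqrt lam <= lam / 100" using lam1 c1 by simp
 define h where "h = (\<lambda>(zeta::real^'n, eta, s). of_real (psi M (sqrt lam) (eta - zeta) * radial_bump M s * s ^ CARD('n)) * \<Phi> (s .* eta))"
 have hi: "integrable lborel h" and hint: "(LL p. h p) = of_real (psi_mass TYPE('n) M (sqrt lam) * radial_mass M) * (LL xi. \<Phi> xi)"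
  unfolding h_def by (rule integral_lift[OF \<Phi>i M r0])+
 have kg: "kk I lam M x p * gg lam M f p = of_real (theta I x (fst p) * indicator (annulus 5 lam) (fst p)) * h p" for I p
 proof -
  obtain zeta eta s where p: "p = (zeta, eta, s)" by (cases p) auto
  let ?w = "psi M (sqrt lam) (eta - zeta) * radial_bump M s"
  show ?thesis
  proof (cases "radial_bump M s = 0 \<or> f (s .* eta) = 0")
   case True
   then show ?thesis by (auto simp: p kk_def gg_def h_def \<Phi>_def)
  next
   case False
   then have s: "0 < s" using radial_bump_eq_0[OF M, of s] by force
   have "s .* eta ~= 0" using supp[of "s .* eta"] False lam1 by auto
   then have eta: "eta ~= 0" by auto
   have w: "of_real (sqrt ?w) * of_real (sqrt ?w) = (of_real ?w :: complex)"
    unfolding of_real_mult[symmetric] by (subst real_sqrt_mult_self) (simp add: psi_nonneg radial_bump_nonneg)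
   have "kk I lam M x p * gg lam M f p = of_real (theta I x zeta * indicator (annulus 5 lam) zeta) * ((of_real (sqrt ?w) * of_real (sqrt ?w)) * of_real (s ^ CARD('n)) *
     (exp (\<i> * of_real (s * P x [] eta)) * a x [] (s .* eta) * f (s .* eta)))"
    unfolding p kk_def gg_def by (simp only: prod.case of_real_mult mult_ac)
   also have "\<dots> = of_real (theta I x zeta * indicator (annulus 5 lam) zeta) * h p"
    unfolding w p h_def \<Phi>_def P_hom[OF eta s] by (simp only: prod.case P_hom[OF eta s] of_real_mult mult_ac)
   finally show ?thesis by (simp only: p fst_conv)
  qed
 qed
 \<comment> \<open>A point s eta of the shell with 1 < s < 2 forces lam/2 <= |eta| <= 2 lam, and the
   centre is within lam/100 of eta; so the cut-off to \<open>annulus 5\<close> equals 1.\<close>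
 have sum: "(\<Sum>I\<in>UNIV. kk I lam M x p * gg lam M f p) = h p" for p
 proof (cases "h p = 0")
  case True
  then show ?thesis by (simp add: kg)
 next
  case False
  obtain zeta eta s where p: "p = (zeta, eta, s)" by (cases p) auto
  have nz: "psi M (sqrt lam) (eta - zeta) ~= 0" "radial_bump M s ~= 0" "a x [] (s .* eta) ~= 0" "f (s .* eta) ~= 0"
   using False by (auto simp: p h_def \<Phi>_def)
  have s: "1 < s" "s < 2" using radial_bump_eq_0[OF M, of s] nz by force+
  have "eta \<in> cube zeta (sqrt lam)" using psi_eq_0[OF M r0, of eta zeta] nz by blast
  from norm_cube[OF this] have ne: "norm (eta - zeta) <= lam / 100" using nr by linarith
  have sn: "lam <= s * norm eta" "s * norm eta < 2 * lam" using supp[OF nz(4)] s by auto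
  have "s * norm eta <= 2 * norm eta" "1 * norm eta <= s * norm eta" using s by (intro mult_right_mono; simp)+
  then have neta: "lam / 2 <= norm eta" "norm eta <= 2 * lam" using sn by linarith+
  have "norm eta <= norm (eta - zeta) + norm zeta" "norm zeta <= norm (eta - zeta) + norm eta"
   using norm_triangle_ineq[of "eta - zeta" zeta] norm_triangle_ineq[of "zeta - eta" eta] by (auto simp: norm_minus_commute)
  then have zeta: "lam / 5 <= norm zeta" "norm zeta <= 5 * lam" using neta ne lam1 by linarith+
  then have z: "zeta ~= 0" "zeta \<in> annulus 5 lam" using lam1 by (auto simp: annulus_def)
  have "(\<Sum>I\<in>UNIV. kk I lam M x p * gg lam M f p) = of_real (\<Sum>I\<in>UNIV. theta I x zeta) * h p"
   unfolding kg using z(2) by (simp add: p sum_distrib_right)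
  then show ?thesis using theta_sum[OF nz(3) z(1)] by simp
 qed
 have ki: "integrable lborel (\<lambda>p. kk I lam M x p * gg lam M f p)" for I
  unfolding kg
 proof (rule Bochner_Integration.integrable_bound[OF hi])
  have hm: "h \<in> bmeas" using borel_measurable_integrable[OF hi] by simp
  show "(\<lambda>p. of_real (theta I x (fst p) * indicator (annulus 5 lam) (fst p)) * h p) \<in> borel_measurable lborel"
   using hm by measurable
  have "\<bar>theta I x zeta * indicator (annulus 5 lam) zeta\<bar> <= 1" for zeta
   using theta_nonneg[of I x zeta] theta_le_1[of I x zeta] by (auto simp: indicator_def)
  then show "AE p in lborel. norm (of_real (theta I x (fst p) * indicator (annulus 5 lam) (fst p)) * h p) <= norm (h p)"
   by (intro always_eventually allI) (simp only: norm_mult norm_of_real, rule mult_left_le_one_le, auto)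
 qed
 have "(\<Sum>I\<in>UNIV. \<integral>p. kk I lam M x p * gg lam M f p \<partial>lborel) = (LL p. (\<Sum>I\<in>UNIV. kk I lam M x p * gg lam M f p))"
  by (rule Bochner_Integration.integral_sum[symmetric]) (rule ki)
 also have "\<dots> = of_real (psi_mass TYPE('n) M (sqrt lam) * radial_mass M) * opT f x"
  unfolding sum hint by (simp add: opT_def \<Phi>_def)
 finally show ?thesis by simp
qed

lemma gg_L2:
 assumes M: "0 < M" and lam: "0 < lam" and [measurable]: "f \<in> bmeas"
 shows "(NN p. sqn (gg lam M f p)) <=
  ennreal (2 ^ CARD('n) * (psi_mass TYPE('n) M (sqrt lam) * radial_mass M)) * (NN xi. sqn (f xi))"
proof -
 have r0: "0 < sqrt lam" using lam by simp
 have "sqn (gg lam M f p) <= ennreal (2 ^ CARD('n)) *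
   (case p of (zeta, eta, s) => ennreal (psi M (sqrt lam) (eta - zeta) * radial_bump M s * s ^ CARD('n)) * sqn (f (s .* eta)))" for p
 proof -
  obtain zeta eta s where p: "p = (zeta, eta, s)" by (cases p) auto
  let ?w = "psi M (sqrt lam) (eta - zeta) * radial_bump M s"
  have w0: "0 <= ?w" by (simp add: psi_nonneg radial_bump_nonneg)
  have g: "(norm (gg lam M f p))^2 = ?w * (s ^ CARD('n) * s ^ CARD('n)) * (norm (f (s .* eta)))^2"
  proof -
   have "(norm (gg lam M f p))^2 = (sqrt ?w)^2 * (s ^ CARD('n))^2 * (norm (f (s .* eta)))^2"
    unfolding p gg_def by (simp only: prod.case norm_mult norm_of_real power_mult_distrib power2_abs)
   then show ?thesis using w0 by (simp only: real_sqrt_pow2 power2_eq_square[of "s ^ _"])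
  qed
  show ?thesis
  proof (cases "s \<in> {1<..<2}")
   case True
   have "s ^ CARD('n) <= 2 ^ CARD('n)" using True by (intro power_mono) auto
   then have "?w * (s ^ CARD('n) * s ^ CARD('n)) * (norm (f (s .* eta)))^2 <= ?w * (2 ^ CARD('n) * s ^ CARD('n)) * (norm (f (s .* eta)))^2"
    using w0 True by (intro mult_right_mono mult_left_mono) auto
   also have "\<dots> = 2 ^ CARD('n) * (?w * s ^ CARD('n) * (norm (f (s .* eta)))^2)" by (simp only: mult_ac)
   finally have "sqn (gg lam M f p) <= ennreal (2 ^ CARD('n) * (?w * s ^ CARD('n) * (norm (f (s .* eta)))^2))"
    unfolding g by (rule ennreal_leI)
   also have "\<dots> = ennreal (2 ^ CARD('n)) * (ennreal (?w * s ^ CARD('n)) * sqn (f (s .* eta)))"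
    using w0 True by (subst ennreal_mult'', simp, subst ennreal_mult'') auto
   finally show ?thesis by (simp only: p prod.case)
  next
   case False
   then show ?thesis unfolding g using radial_bump_eq_0[OF M False] by simp
  qed
 qed
 then have "(NN p. sqn (gg lam M f p)) <= (NN p. ennreal (2 ^ CARD('n)) *
   (case p of (zeta, eta, s) => ennreal (psi M (sqrt lam) (eta - zeta) * radial_bump M s * s ^ CARD('n)) * sqn (f (s .* eta))))"
  by (rule nn_integral_mono)
 also have "\<dots> = ennreal (2 ^ CARD('n)) * (\<integral>\<^sup>+p.
   (case p of (zeta, eta, s) => ennreal (psi M (sqrt lam) (eta - zeta) * radial_bump M s * s ^ CARD('n)) * sqn (f (s .* eta))) \<partial>lborel)"
  by (rule nn_integral_cmult) measurable
 also have "\<dots> = ennreal (2 ^ CARD('n)) * (ennreal (psi_mass TYPE('n) M (sqrt lam) * radial_mass M) * (NN xi. sqn (f xi)))"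
  by (subst nn_integral_lift[OF _ M r0]) auto
 finally show ?thesis by (simp add: ennreal_mult' mult.assoc)
qed

text \<open>The lift costs no power of \<open>lam\<close>: the kernel on the slices carries a factor
  (sqrt lam)^n, the lifted function a factor \<open>pm\<close>, and opT is recovered after dividing
  by \<open>pm\<close> squared, where \<open>pm\<close> is at least a multiple of (sqrt
  lam)^n.\<close>

lemma opT_estimate:
 assumes N: "0 < N" and C: "0 <= C" and R: "0 <= R"
 shows "\<exists>W\<ge>1. \<forall>lam l A t D f. (\<forall>x y. osc_setup N C lam l A (a x) (a y) (\<lambda>al xi. P x al xi - P y al xi)) -->
   W <= t --> lam^2 <= t ^ N --> (l * sqrt lam <= 1 \<and> D = t^2 / sqrt lam \<or> D = 1) -->
   f \<in> bmeas --> (NN xi. sqn (f xi)) < \<top> -->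
   (\<forall>xi. f xi ~= 0 --> lam <= norm xi \<and> norm xi < 2 * lam) -->
   (\<integral>\<^sup>+x\<in>cube 0 R. sqn (opT f x) \<partial>lborel)
    <= ennreal (W * A^2 * lam ^ CARD('n) * (t^2 / t ^ N + t ^ 3 * l * D ^ (d - 1))) * (NN xi. sqn (f xi))"
proof -
 let ?n = "CARD('n)" let ?M = "Suc N"
 obtain W where W: "W >= 1" and sl: "\<forall>lam l A t D I x0 g. (\<forall>x y. osc_setup N C lam l A (a x) (a y) (\<lambda>al xi. P x al xi - P y al xi)) -->
   W <= t --> lam^2 <= t ^ N --> (l * sqrt lam <= 1 \<and> D = t^2 / sqrt lam \<or> D = 1) -->
   g \<in> bmeas --> (NN p. sqn (g p)) < \<top> -->
   (\<integral>\<^sup>+v\<in>cube 0 (r0 / (2 * real CARD('n))). sqn (LL p. kk I lam (Suc N) (x0 + slice I v) p * g p) \<partial>lborel)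
    <= ennreal (W * A^2 * lam ^ CARD('n) * sqrt lam ^ CARD('n) * (t^2 / t ^ N + t ^ 3 * l * D ^ (d - 1))) * (NN p. sqn (g p))"
  using slice_estimate[OF N C] by blast
 define r1 where "r1 = r0 / (2 * real CARD('n))"
 have c1: "1 <= real ?n" by (simp add: Suc_leI)
 have r1p: "0 < r1" unfolding r1_def using r0 c1 by simp
 define c where "c = ((1/4) ^ ?M) ^ ?n * radial_mass ?M"
 have rm: "0 < radial_mass ?M" by (rule radial_mass_pos) simp
 have c0: "0 < c" unfolding c_def using rm by simp
 \<comment> \<open>One factor counts the sets \<open>I\<close> in the sum over \<open>I\<close>, the
   other comes from Cauchy-Schwarz for that sum; the ratio of volumes is that of
   \<open>slice_average\<close>, and 2^n bounds the Jacobian in \<open>gg_L2\<close>.\<close>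
 define Q where "Q = real (card (UNIV :: 'n set set)) * real (card (UNIV :: 'n set set)) * (2 * (R + r1)) ^ ?n / (2 * r1) ^ ?n * 2 ^ ?n / c"
 have Q0: "0 <= Q" unfolding Q_def using R r1p c0 by (intro divide_nonneg_nonneg mult_nonneg_nonneg zero_le_power) auto
 show ?thesis
 proof (intro exI[of _ "max W (Q * W)"] conjI allI impI)
  show "1 <= max W (Q * W)" using W by simp
  fix lam l A t D :: real and f :: "real^'n => complex"
  assume st: "\<forall>x y. osc_setup N C lam l A (a x) (a y) (\<lambda>al xi. P x al xi - P y al xi)"
   and Wt: "max W (Q * W) <= t" and tN: "lam^2 <= t ^ N" and D: "l * sqrt lam <= 1 \<and> D = t^2 / sqrt lam \<or> D = 1"
   and f[measurable]: "f \<in> bmeas" and fin: "(NN xi. sqn (f xi)) < \<top>"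
   and supp: "\<forall>xi. f xi ~= 0 --> lam <= norm xi \<and> norm xi < 2 * lam"
  have Wt': "W <= t" using Wt by simp
  have t1: "1 <= t" using Wt' W by linarith
  interpret s0: osc_setup N C lam l A "a 0" "a 0" "\<lambda>al xi. P 0 al xi - P 0 al xi" using st by blast
  have lam1: "1 <= lam" by (rule s0.lam1)
  have D0: "0 <= D" using D lam1 by auto
  define pm where "pm = psi_mass TYPE('n) ?M (sqrt lam) * radial_mass ?M"
  let ?F = "\<integral>\<^sup>+xi. sqn (f xi) \<partial>lborel"
  let ?g = "gg lam ?M f"
  define X where "X = W * A^2 * lam ^ ?n * (t^2 / t ^ N + t ^ 3 * l * D ^ (d - 1))"
  have X0: "0 <= X" unfolding X_def using W lam1 t1 s0.l(1) D0 by auto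
  have pmge: "c * sqrt lam ^ ?n <= pm"
  proof -
   have "((1/4) ^ ?M) ^ ?n * sqrt lam ^ ?n <= psi_mass TYPE('n) ?M (sqrt lam)"
    by (rule psi_mass_ge) (use lam1 in auto)
   then have "((1/4) ^ ?M) ^ ?n * sqrt lam ^ ?n * radial_mass ?M <= pm" unfolding pm_def using rm by (intro mult_right_mono) auto
   then show ?thesis by (simp only: c_def mult_ac)
  qed
  have pm0: "0 < pm"
  proof -
   have "0 < c * sqrt lam ^ ?n" using c0 lam1 by simp
   then show ?thesis using pmge by linarith
  qed
  have gL: "(NN p. sqn (?g p)) <= ennreal (2 ^ ?n * pm) * ?F"
   unfolding pm_def by (rule gg_L2) (use lam1 in auto)
  have gfin: "(NN p. sqn (?g p)) < \<top>"
  proof (rule le_less_trans[OF gL])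
   show "ennreal (2 ^ ?n * pm) * ?F < \<top>" using fin by (simp add: ennreal_mult_less_top)
  qed
  have gm: "?g \<in> bmeas" by measurable
  define G where "G = (\<lambda>I x. \<integral>p. kk I lam ?M x p * ?g p \<partial>lborel)"
  have Gm[measurable]: "G I \<in> bmeas" for I
  proof -
   have "(\<lambda>z. kk I lam ?M (fst z) (snd z) * ?g (snd z)) \<in> borel_measurable (borel \<Otimes>\<^sub>M lborel)"
    by (intro borel_measurable_times kk_measurable') (use gm in measurable)
   then show ?thesis unfolding G_def
    by (intro lborel.borel_measurable_lebesgue_integral) (simp add: case_prod_beta')
  qed
  have GI: "(\<integral>\<^sup>+x\<in>cube 0 R. sqn (G I x) \<partial>lborel) <= ennreal (X * sqrt lam ^ ?n * (2 ^ ?n * pm) * (2 * (R + r1)) ^ ?n / (2 * r1) ^ ?n) * ?F" for I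
  proof (rule ennreal_divide_le)
   have "(\<integral>\<^sup>+v\<in>cube 0 r1. sqn (G I (x0 + slice I v)) \<partial>lborel)
     <= ennreal (X * sqrt lam ^ ?n) * (ennreal (2 ^ ?n * pm) * ?F)" for x0
   proof -
    have "(\<integral>\<^sup>+v\<in>cube 0 r1. sqn (G I (x0 + slice I v)) \<partial>lborel)
     <= ennreal (W * A^2 * lam ^ ?n * sqrt lam ^ ?n * (t^2 / t ^ N + t ^ 3 * l * D ^ (d - 1))) * (NN p. sqn (?g p))"
     unfolding G_def r1_def using sl st Wt' tN D gm gfin by blast
    also have "W * A^2 * lam ^ ?n * sqrt lam ^ ?n * (t^2 / t ^ N + t ^ 3 * l * D ^ (d - 1)) = X * sqrt lam ^ ?n"
     by (simp only: X_def mult_ac)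
    finally show ?thesis by (rule order_trans) (rule mult_left_mono[OF gL], simp)
   qed
   then have "emeasure lborel (cube (0::real^'n) r1) * (\<integral>\<^sup>+x\<in>cube 0 R. sqn (G I x) \<partial>lborel)
     <= (ennreal (X * sqrt lam ^ ?n) * (ennreal (2 ^ ?n * pm) * ?F)) * emeasure lborel (cube (0::real^'n) (R + r1))"
    by (intro slice_average) (use r1p in auto)
   also have "\<dots> = ennreal (X * sqrt lam ^ ?n) * ennreal (2 ^ ?n * pm) * ennreal ((2 * (R + r1)) ^ ?n) * ?F"
    using R r1p by (subst emeasure_cube) (auto simp: mult_ac)
   also have "\<dots> = ennreal (X * sqrt lam ^ ?n * (2 ^ ?n * pm) * (2 * (R + r1)) ^ ?n) * ?F"
    using X0 lam1 pm0 R r1p by (simp only: ennreal_mult[symmetric] mult_nonneg_nonneg zero_le_power real_sqrt_ge_zero less_imp_le zero_le_numeral add_nonneg_nonneg)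
   finally show "ennreal ((2 * r1) ^ ?n) * (\<integral>\<^sup>+x\<in>cube 0 R. sqn (G I x) \<partial>lborel)
     <= ennreal (X * sqrt lam ^ ?n * (2 ^ ?n * pm) * (2 * (R + r1)) ^ ?n) * ?F"
    using r1p by (subst (asm) emeasure_cube) auto
  qed (use X0 lam1 pm0 R r1p in auto)
  have fi: "integrable lborel f" by (rule integrable_L2_bounded_support[OF f fin, of "2 * lam"]) (use supp in force)
  have lift: "of_real pm * opT f x = (\<Sum>I\<in>UNIV. G I x)" for x
   unfolding G_def pm_def by (rule opT_lift[OF _ s0.lam_large fi]) (use supp in auto)
  let ?s = "real (card (UNIV :: 'n set set))"
  have pt: "ennreal (pm^2) * sqn (opT f x) <= (\<Sum>I\<in>UNIV. ennreal ?s * sqn (G I x))" for x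
  proof -
   have "pm^2 * (norm (opT f x))^2 = (norm (of_real pm * opT f x))^2"
    by (simp only: norm_mult norm_of_real power_mult_distrib power2_abs)
   also have "\<dots> <= ?s * (\<Sum>I\<in>UNIV. (norm (G I x))^2)" unfolding lift by (rule norm_sum_sq_le)
   finally have "ennreal (pm^2 * (norm (opT f x))^2) <= ennreal (\<Sum>I\<in>UNIV. ?s * (norm (G I x))^2)"
    by (intro ennreal_leI) (simp only: sum_distrib_left)
   also have "\<dots> = (\<Sum>I\<in>UNIV. ennreal (?s * (norm (G I x))^2))" by (rule sum_ennreal[symmetric]) simp
   finally show ?thesis by (simp only: ennreal_mult'' zero_le_power2)
  qed
  have "ennreal (pm^2) * (\<integral>\<^sup>+x\<in>cube 0 R. sqn (opT f x) \<partial>lborel) =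
   (NN x. ennreal (pm^2) * (sqn (opT f x) * indicator (cube 0 R) x))"
   by (rule nn_integral_cmult[symmetric]) measurable
  also have "\<dots> <= (NN x. (\<Sum>I\<in>UNIV. ennreal ?s * (sqn (G I x) * indicator (cube 0 R) x)))"
  proof (rule nn_integral_mono)
   fix x
   show "ennreal (pm^2) * (sqn (opT f x) * indicator (cube 0 R) x) <= (\<Sum>I\<in>UNIV. ennreal ?s * (sqn (G I x) * indicator (cube 0 R) x))"
    using pt[of x] by (cases "x \<in> cube 0 R") simp_all
  qed
  also have "\<dots> = (\<Sum>I\<in>UNIV. ennreal ?s * (\<integral>\<^sup>+x\<in>cube 0 R. sqn (G I x) \<partial>lborel))"
   by (subst nn_integral_sum, measurable) (intro sum.cong refl nn_integral_cmult, measurable)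
  also have "\<dots> <= (\<Sum>I\<in>(UNIV::'n set set). ennreal ?s * (ennreal (X * sqrt lam ^ ?n * (2 ^ ?n * pm) * (2 * (R + r1)) ^ ?n / (2 * r1) ^ ?n) * ?F))"
   by (intro sum_mono mult_left_mono GI) auto
  also have "\<dots> = ennreal (?s * (?s * (X * sqrt lam ^ ?n * (2 ^ ?n * pm) * (2 * (R + r1)) ^ ?n / (2 * r1) ^ ?n))) * ?F"
  proof -
   have Y: "0 <= X * sqrt lam ^ ?n * (2 ^ ?n * pm) * (2 * (R + r1)) ^ ?n / (2 * r1) ^ ?n"
    by (intro divide_nonneg_nonneg mult_nonneg_nonneg zero_le_power X0) (use X0 lam1 pm0 R r1p in auto)
   have "of_nat (card (UNIV::'n set set)) = ennreal ?s" by (simp add: ennreal_of_nat_eq_real_of_nat)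
   then show ?thesis unfolding sum_constant using Y by (simp only: ennreal_mult of_nat_0_le_iff mult_nonneg_nonneg mult_ac)
  qed
  finally have "(\<integral>\<^sup>+x\<in>cube 0 R. sqn (opT f x) \<partial>lborel) <=
    ennreal ((?s * (?s * (X * sqrt lam ^ ?n * (2 ^ ?n * pm) * (2 * (R + r1)) ^ ?n / (2 * r1) ^ ?n))) / pm^2) * ?F"
   by (rule ennreal_divide_le[rotated 2]) (use pm0 X0 lam1 R r1p in auto)
  also have "\<dots> <= ennreal (max W (Q * W) * A^2 * lam ^ ?n * (t^2 / t ^ N + t ^ 3 * l * D ^ (d - 1))) * ?F"
  proof (intro mult_right_mono ennreal_leI)
   let ?Z = "?s * ?s * (2 * (R + r1)) ^ ?n / (2 * r1) ^ ?n * 2 ^ ?n"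
   have Z0: "0 <= ?Z" using R r1p by (intro mult_nonneg_nonneg divide_nonneg_nonneg zero_le_power) auto
   have "(?s * (?s * (X * sqrt lam ^ ?n * (2 ^ ?n * pm) * (2 * (R + r1)) ^ ?n / (2 * r1) ^ ?n))) / pm^2 = (?Z * X) * (sqrt lam ^ ?n / pm)"
    using pm0 by (simp add: power2_eq_square)
   also have "\<dots> <= (?Z * X) * (1 / c)"
   proof (rule mult_left_mono[OF _ mult_nonneg_nonneg[OF Z0 X0]])
    show "sqrt lam ^ ?n / pm <= 1 / c" using pmge pm0 c0 by (simp add: field_simps)
   qed
   also have "\<dots> = Q * X" by (simp add: Q_def)
   also have "Q * X = (Q * W) * (A^2 * lam ^ ?n * (t^2 / t ^ N + t ^ 3 * l * D ^ (d - 1)))" by (simp only: X_def mult_ac)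
   also have "\<dots> <= max W (Q * W) * (A^2 * lam ^ ?n * (t^2 / t ^ N + t ^ 3 * l * D ^ (d - 1)))"
    using lam1 t1 s0.l(1) D0 by (intro mult_right_mono mult_nonneg_nonneg add_nonneg_nonneg) auto
   finally show "(?s * (?s * (X * sqrt lam ^ ?n * (2 ^ ?n * pm) * (2 * (R + r1)) ^ ?n / (2 * r1) ^ ?n))) / pm^2
    <= max W (Q * W) * A^2 * lam ^ ?n * (t^2 / t ^ N + t ^ 3 * l * D ^ (d - 1))" by (simp only: mult.assoc)
  qed simp
  finally show "(\<integral>\<^sup>+x\<in>cube 0 R. sqn (opT f x) \<partial>lborel)
    <= ennreal (max W (Q * W) * A^2 * lam ^ ?n * (t^2 / t ^ N + t ^ 3 * l * D ^ (d - 1))) * ?F" .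
 qed
qed

text \<open>Cauchy-Schwarz on a set of finite measure, used for the finitely many low frequency
  pieces that are too small for the asymptotic estimate.\<close>

lemma opT_trivial:
 fixes S :: "(real^'n) set"
 assumes S[measurable]: "S \<in> sets borel" and fS: "emeasure lborel S < \<infinity>"
  and f[measurable]: "f \<in> bmeas" and supp: "\<And>xi. f xi ~= 0 ==> xi \<in> S"
  and Ca: "0 <= Ca" "\<And>x xi. norm (a x [] xi) <= Ca" and R: "0 <= R"
 shows "(\<integral>\<^sup>+x\<in>cube 0 R. sqn (opT f x) \<partial>lborel) <= ennreal (Ca^2 * measure lborel S * (2 * R) ^ CARD('n)) * (NN xi. sqn (f xi))"
proof -
 let ?F = "\<integral>\<^sup>+xi. sqn (f xi) \<partial>lborel"
 have "sqn (opT f x) <= ennreal (Ca^2 * measure lborel S) * ?F" for x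
 proof -
  let ?k = "\<lambda>xi. of_real (indicator S xi) * (exp (\<i> * of_real (P x [] xi)) * a x [] xi)"
  have "opT f x = (LL xi. ?k xi * f xi)"
   unfolding opT_def using supp by (intro Bochner_Integration.integral_cong) (auto simp: indicator_def)
  then have "sqn (opT f x) <= (NN xi. sqn (?k xi)) * ?F"
   by (simp only:) (rule norm_integral_mult_sq_le, measurable)
  also have "(NN xi. sqn (?k xi)) <= (NN xi. ennreal (Ca^2) * indicator S xi)"
   by (intro nn_integral_mono) (auto simp: indicator_def norm_mult Ca intro!: ennreal_leI power_mono)
  also have "\<dots> = ennreal (Ca^2) * emeasure lborel S" by (rule nn_integral_cmult_indicator) simp
  also have "\<dots> = ennreal (Ca^2 * measure lborel S)"
   using fS by (subst emeasure_eq_ennreal_measure) (auto simp: ennreal_mult)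
  finally show ?thesis by (simp add: mult_right_mono)
 qed
 then have "(\<integral>\<^sup>+x\<in>cube 0 R. sqn (opT f x) \<partial>lborel) <= (NN x. (ennreal (Ca^2 * measure lborel S) * ?F) * indicator (cube (0::real^'n) R) x)"
  by (intro nn_integral_mono mult_right_mono) auto
 also have "\<dots> = (ennreal (Ca^2 * measure lborel S) * ?F) * emeasure lborel (cube (0::real^'n) R)"
  by (rule nn_integral_cmult_indicator) simp
 finally show ?thesis using R by (simp add: emeasure_cube ennreal_mult' mult_ac)
qed

text \<open>The hypothesis on m reads 2m + n - rho < (d-1)(rho - 1/2). The estimates need 2m + n -
  rho < 0 for rho < 1/2 and 2m + n - rho < (d-1)/2 for rho >= 1/2, the extra (d-1)/2 being the gain
  from restricting d - 1 coordinates to length 1 / sqrt lam. Both follow because rho <= 1.\<close>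

lemma dyadic_exponents:
 obtains \<epsilon> e :: real and N :: nat where "0 < \<epsilon>" "0 < e" "0 < N" "2 <= real N * \<epsilon>"
  "2 * m + real CARD('n) + 2 * \<epsilon> - real N * \<epsilon> <= - e"
  "\<rho> < 1/2 ==> 2 * m + real CARD('n) + 3 * \<epsilon> - \<rho> <= - e"
  "1/2 <= \<rho> ==> 2 * m + real CARD('n) + 3 * \<epsilon> - \<rho> + (real d - 1) * (2 * \<epsilon> - 1/2) <= - e"
proof -
 define X where "X = (if \<rho> < 1/2 then 2 * m + real CARD('n) - \<rho> else 2 * m + real CARD('n) - \<rho> - (real d - 1) / 2)"
 have d1: "1 <= real d" using d by simp
 have "2 * m + real CARD('n) - \<rho> < (real d - 1) * (\<rho> - 1/2)" using m by (simp only: left_diff_distrib right_diff_distrib)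
 moreover have "(real d - 1) * (\<rho> - 1/2) <= 0" if "\<rho> < 1/2" using that d1 by (intro mult_nonneg_nonpos) auto
 moreover have "(real d - 1) * (\<rho> - 1/2) - (real d - 1) / 2 <= 0"
 proof -
  have "(real d - 1) * (\<rho> - 1) <= 0" using \<rho> d1 by (intro mult_nonneg_nonpos) auto
  then show ?thesis by (simp add: algebra_simps)
 qed
 ultimately have X: "X < 0" unfolding X_def by (smt (verit))
 \<comment> \<open>Half of the available room -X is kept as decay, the other half is spent on the
   powers of t: at most 3 from the kernel and Schur bounds and 2(d-1) from the power of
   \<open>D\<close>, which the choice of epsilon covers.\<close>
 define e where "e = - X / 2"
 define \<epsilon> where "\<epsilon> = e / (3 + 2 * real d)"
 have e: "0 < e" using X by (simp add: e_def)
 have \<epsilon>: "0 < \<epsilon>" using e d1 by (simp add: \<epsilon>_def)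
 have ee: "3 * \<epsilon> + 2 * real d * \<epsilon> = e"   proof -
  have "(3 + 2 * real d) * \<epsilon> = e" using d1 by (simp add: \<epsilon>_def)
  then show ?thesis by (simp only: distrib_right)
 qed
 obtain N :: nat where N: "max 2 (2 * m + real CARD('n) + 2 * \<epsilon> + e) / \<epsilon> <= real N" using real_arch_simple by blast
 then have N': "max 2 (2 * m + real CARD('n) + 2 * \<epsilon> + e) <= real N * \<epsilon>" using \<epsilon> by (simp add: pos_divide_le_eq)
 have d\<epsilon>: "1 * \<epsilon> <= real d * \<epsilon>" using d1 \<epsilon> by (intro mult_right_mono) auto
 show ?thesis
 proof (rule that[OF \<epsilon> e])
  show "0 < N" using N' \<epsilon> by (cases N) auto
  show "2 <= real N * \<epsilon>" using N' by simp
  show "2 * m + real CARD('n) + 2 * \<epsilon> - real N * \<epsilon> <= - e" using N' by simp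
  show "2 * m + real CARD('n) + 3 * \<epsilon> - \<rho> <= - e" if "\<rho> < 1/2"
  proof -
   have "X = 2 * m + real CARD('n) - \<rho>" using that by (simp add: X_def)
   moreover have "X = - 2 * e" by (simp add: e_def)
   ultimately show ?thesis using ee d\<epsilon> \<epsilon> by linarith
  qed
  show "2 * m + real CARD('n) + 3 * \<epsilon> - \<rho> + (real d - 1) * (2 * \<epsilon> - 1/2) <= - e" if "1/2 <= \<rho>"
  proof -
   have "X = 2 * m + real CARD('n) - \<rho> - (real d - 1) / 2" using that by (simp add: X_def)
   moreover have "X = - 2 * e" by (simp add: e_def)
   moreover have "(real d - 1) * (2 * \<epsilon> - 1/2) = 2 * real d * \<epsilon> - 2 * \<epsilon> - (real d - 1) / 2" by (simp add: algebra_simps diff_divide_distrib)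
   ultimately show ?thesis using ee \<epsilon> by linarith
  qed
 qed
qed

text \<open>With t = lam^epsilon every term of \<open>opT_estimate\<close> becomes a power of
  \<open>lam\<close>, and \<open>dyadic_exponents\<close> makes all of them at most -e.\<close>

lemma opT_decay:
 assumes R: "0 <= R"
 shows "\<exists>K\<ge>0. \<exists>e>0. \<exists>L\<ge>1. \<forall>lam\<ge>L. \<forall>f. f \<in> bmeas --> (NN xi. sqn (f xi)) < \<top> -->
   (\<forall>xi. f xi ~= 0 --> lam <= norm xi \<and> norm xi < 2 * lam) -->
   (\<integral>\<^sup>+x\<in>cube 0 R. sqn (opT f x) \<partial>lborel) <= ennreal (K * lam powr - e) * (NN xi. sqn (f xi))"
proof -
 let ?n = "real CARD('n)"
 obtain \<epsilon> e :: real and N :: nat where \<epsilon>: "0 < \<epsilon>" and e: "0 < e" and N: "0 < N" "2 <= real N * \<epsilon>"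
  and e1: "2 * m + ?n + 2 * \<epsilon> - real N * \<epsilon> <= - e"
  and e2: "\<rho> < 1/2 ==> 2 * m + ?n + 3 * \<epsilon> - \<rho> <= - e"
  and e3: "1/2 <= \<rho> ==> 2 * m + ?n + 3 * \<epsilon> - \<rho> + (real d - 1) * (2 * \<epsilon> - 1/2) <= - e"
  using dyadic_exponents by blast
 obtain C L where C: "1 <= C" and L: "1 <= L" and st: "\<And>lam x y. L <= lam ==> osc_setup N C lam (lam powr - \<rho>) (C * lam powr m) (a x) (a y) (\<lambda>al xi. P x al xi - P y al xi)"
  using osc_setup_clean[of N] by blast
 have C0: "0 <= C" using C by simp
 obtain W where W: "W >= 1" and est: "\<forall>lam l A t D f. (\<forall>x y. osc_setup N C lam l A (a x) (a y) (\<lambda>al xi. P x al xi - P y al xi)) -->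
   W <= t --> lam^2 <= t ^ N --> (l * sqrt lam <= 1 \<and> D = t^2 / sqrt lam \<or> D = 1) -->
   f \<in> bmeas --> (NN xi. sqn (f xi)) < \<top> -->
   (\<forall>xi. f xi ~= 0 --> lam <= norm xi \<and> norm xi < 2 * lam) -->
   (\<integral>\<^sup>+x\<in>cube 0 R. sqn (opT f x) \<partial>lborel)
    <= ennreal (W * A^2 * lam ^ CARD('n) * (t^2 / t ^ N + t ^ 3 * l * D ^ (d - 1))) * (NN xi. sqn (f xi))"
  using opT_estimate[OF N(1) C0 R] by blast
 show ?thesis
 proof (rule exI[of _ "W * C^2 * 2"], rule conjI, goal_cases)
  case 1 show ?case using W by auto
 next
  case 2
  show ?case
  proof (rule exI[of _ e], rule conjI[OF e], rule exI[of _ "max L (W powr (1 / \<epsilon>))"], intro conjI allI impI)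
  show "1 <= max L (W powr (1 / \<epsilon>))" using L by auto
  fix lam :: real and f :: "real^'n => complex"
  assume lam: "max L (W powr (1 / \<epsilon>)) <= lam" and f: "f \<in> bmeas" "(NN xi. sqn (f xi)) < \<top>"
   "\<forall>xi. f xi ~= 0 --> lam <= norm xi \<and> norm xi < 2 * lam"
  have lam1: "1 <= lam" and lL: "L <= lam" using lam L by auto
  define t where "t = lam powr \<epsilon>"
  define l where "l = lam powr - \<rho>"
  \<comment> \<open>The tangential bound requires l sqrt lam <= 1, that is rho >= 1/2; below that
    only the radial gain is available.\<close>
  define D where "D = (if \<rho> < 1/2 then 1 else t^2 / sqrt lam)"
  have pw: "t ^ k = lam powr (real k * \<epsilon>)" for k
   unfolding t_def using lam1 by (simp add: powr_realpow[symmetric] powr_powr mult.commute)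
  have sq: "sqrt lam = lam powr (1/2)" using lam1 by (simp add: powr_half_sqrt)
  have Wt: "W <= t"
  proof -
   have "W = (W powr (1 / \<epsilon>)) powr \<epsilon>" using W \<epsilon> by (simp add: powr_powr)
   also have "\<dots> <= t" unfolding t_def using lam \<epsilon> by (intro powr_mono2) auto
   finally show ?thesis .
  qed
  have tN: "lam^2 <= t ^ N"
  proof -
   have "lam^2 = lam powr 2" using lam1 by (simp add: powr_numeral)
   also have "\<dots> <= lam powr (real N * \<epsilon>)" using N lam1 by (intro powr_mono) auto
   finally show ?thesis by (simp add: pw)
  qed
  have DD: "l * sqrt lam <= 1 \<and> D = t^2 / sqrt lam \<or> D = 1"
  proof (cases "\<rho> < 1/2")
   case False
   have "l * sqrt lam = lam powr (1/2 - \<rho>)" unfolding l_def sq by (simp add: powr_add[symmetric])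
   also have "\<dots> <= lam powr 0" using False lam1 by (intro powr_mono) auto
   finally show ?thesis using False lam1 by (simp add: D_def)
  qed (simp add: D_def)
  have main: "(C * lam powr m)^2 * lam ^ CARD('n) * (t^2 / t ^ N + t ^ 3 * l * D ^ (d - 1)) <= C^2 * 2 * lam powr - e"
  proof -
   have m2: "(C * lam powr m)^2 * lam ^ CARD('n) = C^2 * lam powr (2 * m + ?n)"
   proof -
    have "lam ^ CARD('n) = lam powr ?n" using lam1 by (simp add: powr_realpow)
    then show ?thesis by (simp only: power_mult_distrib power2_eq_square[of "lam powr m"] powr_add mult_2 mult.assoc)
   qed
   have p1: "lam powr (2 * m + ?n) * (t^2 / t ^ N) <= lam powr - e"
   proof -
    have "lam powr (2 * m + ?n) * (t^2 / t ^ N) = lam powr (2 * m + ?n + 2 * \<epsilon> - real N * \<epsilon>)"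
     by (simp add: pw powr_add powr_diff)
    also have "\<dots> <= lam powr - e" using e1 lam1 by (intro powr_mono) auto
    finally show ?thesis .
   qed
   have p2: "lam powr (2 * m + ?n) * (t ^ 3 * l * D ^ (d - 1)) <= lam powr - e"
   proof (cases "\<rho> < 1/2")
    case True
    have "lam powr (2 * m + ?n) * (t ^ 3 * l * D ^ (d - 1)) = lam powr (2 * m + ?n + 3 * \<epsilon> - \<rho>)"
    proof -
     have "D ^ (d - 1) = lam powr 0" using True lam1 by (simp add: D_def)
     then show ?thesis by (simp only: pw l_def powr_add[symmetric]) (simp add: algebra_simps)
    qed
    also have "\<dots> <= lam powr - e" using e2[OF True] lam1 by (intro powr_mono) auto
    finally show ?thesis .
   next
    case False
    have "D = lam powr (2 * \<epsilon> - 1/2)" using False by (simp add: D_def pw sq powr_diff)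
    then have "D ^ (d - 1) = lam powr ((real d - 1) * (2 * \<epsilon> - 1/2))"
     using lam1 d by (simp add: powr_realpow[symmetric] powr_powr mult.commute of_nat_diff)
    then have "lam powr (2 * m + ?n) * (t ^ 3 * l * D ^ (d - 1)) = lam powr (2 * m + ?n + 3 * \<epsilon> - \<rho> + (real d - 1) * (2 * \<epsilon> - 1/2))"
     by (simp only: pw l_def powr_add[symmetric]) (simp add: algebra_simps)
    also have "\<dots> <= lam powr - e" using e3 False lam1 by (intro powr_mono) auto
    finally show ?thesis .
   qed
   have "lam powr (2 * m + ?n) * (t^2 / t ^ N + t ^ 3 * l * D ^ (d - 1)) <= 2 * lam powr - e"
    using p1 p2 by (simp only: distrib_left)
   then have "C^2 * (lam powr (2 * m + ?n) * (t^2 / t ^ N + t ^ 3 * l * D ^ (d - 1))) <= C^2 * (2 * lam powr - e)"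
    by (intro mult_left_mono) auto
   then show ?thesis unfolding m2 by (simp only: mult.assoc)
  qed
  have "(\<integral>\<^sup>+x\<in>cube 0 R. sqn (opT f x) \<partial>lborel)
    <= ennreal (W * (C * lam powr m)^2 * lam ^ CARD('n) * (t^2 / t ^ N + t ^ 3 * l * D ^ (d - 1))) * (NN xi. sqn (f xi))"
   using est[rule_format, of lam l "C * lam powr m" t D f] st[OF lL] Wt tN DD f by (simp only: l_def simp_thms)
  also have "\<dots> <= ennreal (W * C^2 * 2 * lam powr - e) * (NN xi. sqn (f xi))"
  proof (intro mult_right_mono ennreal_leI)
   have "W * ((C * lam powr m)^2 * lam ^ CARD('n) * (t^2 / t ^ N + t ^ 3 * l * D ^ (d - 1))) <= W * (C^2 * 2 * lam powr - e)"
    using main W by (intro mult_left_mono) auto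
   then show "W * (C * lam powr m)^2 * lam ^ CARD('n) * (t^2 / t ^ N + t ^ 3 * l * D ^ (d - 1)) <= W * C^2 * 2 * lam powr - e"
    by (simp only: mult.assoc)
  qed simp
  finally show "(\<integral>\<^sup>+x\<in>cube 0 R. sqn (opT f x) \<partial>lborel) <= ennreal (W * C^2 * 2 * lam powr - e) * (NN xi. sqn (f xi))" .
  qed
 qed
qed

lemma dyadic_decay:
 assumes R: "0 <= R"
 shows "\<exists>K\<ge>0. \<exists>q. 0 < q \<and> q < 1 \<and> (\<forall>j f. f \<in> bmeas --> (NN xi. sqn (f xi)) < \<top> -->
   (\<integral>\<^sup>+x\<in>cube 0 R. sqn (opT (\<lambda>xi. of_real (indicator (dyadic j) xi) * f xi) x) \<partial>lborel)
    <= ennreal (K * q ^ j) * (NN xi. sqn (f xi)))"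
proof -
 obtain K e L where K: "0 <= K" and e: "0 < e" and L: "1 <= L" and dec: "\<And>lam f. L <= lam ==> f \<in> bmeas ==> (NN xi. sqn (f xi)) < \<top> ==>
   (\<forall>xi. f xi ~= 0 --> lam <= norm xi \<and> norm xi < 2 * lam) ==>
   (\<integral>\<^sup>+x\<in>cube 0 R. sqn (opT f x) \<partial>lborel) <= ennreal (K * lam powr - e) * (NN xi. sqn (f xi))"
  using opT_decay[OF R] by blast
 obtain Ca where Ca: "0 <= Ca" "\<And>x xi. norm (a x [] xi) <= Ca" using a_bounded by blast
 define q where "q = (2::real) powr - e"
 have q: "0 < q" "q < 1"
 proof -
  show "0 < q" by (simp add: q_def)
  have "(2::real) powr - e < 2 powr 0" using e by (intro powr_less_mono) auto
  then show "q < 1" by (simp add: q_def)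
 qed
 obtain j0 where j0: "L < 2 ^ j0" using real_arch_pow[of 2 L] by auto
 \<comment> \<open>Dividing by q^(j0 + 1) makes the trivial bound fit the geometric form for all of
   the finitely many j <= j0.\<close>
 define K' where "K' = Ca^2 * measure lborel (cball (0::real^'n) (2 ^ Suc j0)) * (2 * R) ^ CARD('n) / q ^ Suc j0"
 have K': "0 <= K'" unfolding K'_def using R q by auto
 show ?thesis
 proof (rule exI[of _ "max K K'"], rule conjI, goal_cases)
  case 1 show ?case using K by simp
 next
  case 2
  show ?case
  proof (rule exI[of _ q], intro conjI allI impI q)
  fix j and f :: "real^'n => complex"
  assume f[measurable]: "f \<in> bmeas" and fin: "(NN xi. sqn (f xi)) < \<top>"
  let ?f = "\<lambda>xi. of_real (indicator (dyadic j) xi) * f xi :: complex"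
  have fm: "?f \<in> bmeas" by measurable
  have le: "(NN xi. sqn (?f xi)) <= (NN xi. sqn (f xi))"
   by (intro nn_integral_mono) (auto simp: indicator_def)
  then have fin': "(NN xi. sqn (?f xi)) < \<top>" using fin by (rule le_less_trans)
  show "(\<integral>\<^sup>+x\<in>cube 0 R. sqn (opT ?f x) \<partial>lborel) <= ennreal (max K K' * q ^ j) * (NN xi. sqn (f xi))"
  proof (cases "j <= j0")
   case True
   have "(\<integral>\<^sup>+x\<in>cube 0 R. sqn (opT ?f x) \<partial>lborel) <=
     ennreal (Ca^2 * measure lborel (cball (0::real^'n) (2 ^ Suc j0)) * (2 * R) ^ CARD('n)) * (NN xi. sqn (?f xi))"
   proof (rule opT_trivial[OF _ _ fm _ Ca R])
    show "cball 0 (2 ^ Suc j0) \<in> sets (borel :: (real^'n) measure)" by simp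
    show "emeasure lborel (cball (0::real^'n) (2 ^ Suc j0)) < \<infinity>" by (rule emeasure_bounded_finite) simp
    have "(2::real) ^ Suc j <= 2 ^ Suc j0" using True by (intro power_increasing) auto
    then show "xi \<in> cball 0 (2 ^ Suc j0)" if "?f xi ~= 0" for xi
     proof -
     have "norm xi < 2 ^ Suc j" using that by (auto simp: indicator_def dyadic_def split: if_splits)
     then show ?thesis using \<open>(2::real) ^ Suc j <= 2 ^ Suc j0\<close> by (simp only: mem_cball dist_0_norm)
    qed
   qed
   also have "\<dots> <= ennreal (max K K' * q ^ j) * (NN xi. sqn (f xi))"
   proof (rule mult_mono[OF ennreal_leI le])
    have "Ca^2 * measure lborel (cball (0::real^'n) (2 ^ Suc j0)) * (2 * R) ^ CARD('n) = K' * q ^ Suc j0"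
     unfolding K'_def using q by simp
    also have "\<dots> <= K' * q ^ j" using True q K' by (intro mult_left_mono power_decreasing) auto
    also have "\<dots> <= max K K' * q ^ j" using q by (intro mult_right_mono) auto
    finally show "Ca^2 * measure lborel (cball (0::real^'n) (2 ^ Suc j0)) * (2 * R) ^ CARD('n) <= max K K' * q ^ j" .
   qed auto
   finally show ?thesis .
  next
   case False
   have "(2::real) ^ j0 <= 2 ^ j" using False by (intro power_increasing) auto
   then have lam: "L <= 2 ^ j" using j0 by linarith
   have "(\<integral>\<^sup>+x\<in>cube 0 R. sqn (opT ?f x) \<partial>lborel) <= ennreal (K * (2 ^ j) powr - e) * (NN xi. sqn (?f xi))"
    by (rule dec[OF lam fm fin']) (use False in \<open>auto simp: indicator_def dyadic_def split: if_splits\<close>)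
   also have "\<dots> <= ennreal (max K K' * q ^ j) * (NN xi. sqn (f xi))"
   proof (rule mult_mono[OF ennreal_leI le])
    have "((2::real) ^ j) powr - e = q ^ j" unfolding q_def by (simp add: powr_realpow[symmetric] powr_powr mult.commute)
    then show "K * (2 ^ j) powr - e <= max K K' * q ^ j" using q by (simp add: mult_right_mono)
   qed auto
   finally show ?thesis .
  qed
  qed
 qed
qed

end

section \<open>From essential bounds to pointwise bounds\<close>

lemma esssup_weighted_AE:
 fixes f :: "real^'n => real^'n => 'b::real_normed_vector"
 assumes fin: "(SUP xi\<in>S. ereal (w xi) * Linf_norm (\<lambda>x. f x xi)) < \<infinity>" and w: "\<And>xi. xi \<in> S ==> 0 < w xi"
 shows "\<exists>C\<ge>0. \<forall>xi\<in>S. AE x in lebesgue. norm (f x xi) <= C / w xi"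
proof -
 let ?s = "SUP xi\<in>S. ereal (w xi) * Linf_norm (\<lambda>x. f x xi)"
 define C where "C = max 0 (real_of_ereal ?s)"
 have sC: "?s <= ereal C"
 proof (cases ?s)
  case (real r) then show ?thesis by (simp add: C_def)
 next
  case PInf then show ?thesis using fin by simp
 next
  case MInf then show ?thesis by simp
 qed
 have "AE x in lebesgue. norm (f x xi) <= C / w xi" if xi: "xi \<in> S" for xi
 proof -
  let ?e = "Linf_norm (\<lambda>x. f x xi)"
  have "ereal (w xi) * ?e <= ?s" using xi by (rule SUP_upper)
  then have le: "ereal (w xi) * ?e <= ereal C" using sC by (rule order_trans)
  have "?e <= ereal (C / w xi)"
  proof (cases ?e)
   case (real r)
   then have "w xi * r <= C" using le by simp
   then show ?thesis using real w[OF xi] by (simp add: pos_le_divide_eq mult.commute)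
  next
   case PInf then show ?thesis using le w[OF xi] by simp
  next
   case MInf then show ?thesis by simp
  qed
  moreover have "AE x in lebesgue. ereal (norm (f x xi)) <= ?e"
   unfolding Linf_norm_def by (rule esssup_AE)
  ultimately show ?thesis by (auto elim!: eventually_mono dest: order_trans)
 qed
 then show ?thesis by (intro exI[of _ C]) (auto simp: C_def)
qed

text \<open>The exceptional null set depends on \<open>xi\<close>. Taking countably many
  \<open>xi\<close> in a dense set yields one null set, and continuity in \<open>xi\<close> extends
  the bound to all of the open set.\<close>

lemma AE_bound_continuous:
 fixes f :: "real^'n => real^'n => 'b::real_normed_vector"
 assumes ae: "\<And>xi. xi \<in> S ==> AE x in lebesgue. norm (f x xi) <= b xi" and S: "open S"
  and f: "\<And>x. continuous_on S (f x)" and b: "continuous_on S b"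
 shows "AE x in lebesgue. \<forall>xi\<in>S. norm (f x xi) <= b xi"
proof -
 obtain D :: "(real^'n) set" where D: "countable D" "\<And>X. open X ==> X ~= {} ==> \<exists>d\<in>D. d \<in> X"
  by (rule countable_dense_setE) blast
 have "AE x in lebesgue. \<forall>xi\<in>D \<inter> S. norm (f x xi) <= b xi"
  using D(1) ae by (subst AE_ball_countable) auto
 then show ?thesis
 proof (rule eventually_mono)
  fix x assume D': "\<forall>xi\<in>D \<inter> S. norm (f x xi) <= b xi"
  show "\<forall>xi\<in>S. norm (f x xi) <= b xi"
  proof (rule ccontr)
   assume "\<not> ?thesis"
   then have ne: "S \<inter> (\<lambda>xi. norm (f x xi) - b xi) -` {0<..} ~= {}" by auto
   have "open (S \<inter> (\<lambda>xi. norm (f x xi) - b xi) -` {0<..})"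
    using S by (intro continuous_open_preimage continuous_intros f b) auto
   from D(2)[OF this ne] obtain d where "d \<in> D" "d \<in> S" "0 < norm (f x d) - b d" by auto
   then show False using D' by force
  qed
 qed
qed

text \<open>A function Borel in x and continuous in xi is a limit of f(x, e), with e running through
  a countable dense set and chosen measurably near xi. Continuity may fail at 0, so 0 belongs to
  \<open>D\<close> and is hit exactly.\<close>

lemma joint_borel_measurable:
 fixes f :: "real^'n => real^'n => 'b::{metric_space, second_countable_topology}"
 assumes D: "countable D" "0 \<in> D" "\<And>X. open X ==> X ~= {} ==> \<exists>d\<in>D. d \<in> X"
  and f: "\<And>d. d \<in> D ==> (\<lambda>x. f x d) \<in> bmeas" and c: "\<And>x. continuous_on (-{0}) (f x)"
 shows "(\<lambda>p. f (fst p) (snd p)) \<in> bmeas"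
proof -
 define e where "e = from_nat_into D"
 have Dne: "D ~= {}" using D(2) by auto
 have eD: "e i \<in> D" for i unfolding e_def by (rule from_nat_into[OF Dne])
 have fe[measurable]: "(\<lambda>x. f x (e i)) \<in> bmeas" for i by (rule f[OF eD])
 \<comment> \<open>Taking the least index of a suitable point makes the choice measurable.\<close>
 define N where "N = (\<lambda>k (xi::real^'n). LEAST i. dist (e i) xi < (if xi = 0 then 1 else norm xi) / real (Suc k) \<and> (xi = 0 --> e i = 0))"
 have N: "dist (e (N k xi)) xi < (if xi = 0 then 1 else norm xi) / real (Suc k) \<and> (xi = 0 --> e (N k xi) = 0)" for k xi
 proof -
  have "\<exists>i. dist (e i) xi < (if xi = 0 then 1 else norm xi) / real (Suc k) \<and> (xi = 0 --> e i = 0)"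
  proof (cases "xi = 0")
   case True
   obtain i where "e i = 0" using from_nat_into_surj[OF D(1,2)] by (auto simp: e_def)
   then show ?thesis using True by (intro exI[of _ i]) simp
  next
   case False
   have "0 < norm xi / real (Suc k)" using False by simp
   then have "ball xi (norm xi / real (Suc k)) ~= {}" by (simp only: ball_eq_empty not_le)
   from D(3)[OF open_ball this] obtain d where "d \<in> D" "dist xi d < norm xi / real (Suc k)" by auto
   moreover obtain i where "e i = d" using from_nat_into_surj[OF D(1) \<open>d \<in> D\<close>] by (auto simp: e_def)
   ultimately show ?thesis using False by (intro exI[of _ i]) (simp add: dist_commute)
  qed
  then show ?thesis unfolding N_def by (rule LeastI_ex)
 qed
 have Nm[measurable]: "N k \<in> measurable borel (count_space UNIV)" for k
  unfolding N_def by measurable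
 show ?thesis
 proof (rule borel_measurable_LIMSEQ_metric)
  fix k
  have 1: "(\<lambda>p::(real^'n) \<times> (real^'n). f (fst p) (e i)) \<in> bmeas" for i
   by (rule measurable_compose[of fst borel borel, OF _ fe]) measurable
  have 2: "(\<lambda>p::(real^'n) \<times> (real^'n). N k (snd p)) \<in> measurable borel (count_space UNIV)"
   by (rule measurable_compose[of snd borel borel, OF _ Nm]) measurable
  show "(\<lambda>p::(real^'n) \<times> (real^'n). f (fst p) (e (N k (snd p)))) \<in> bmeas"
   by (rule measurable_compose_countable[OF 1 2])
 next
  fix p :: "(real^'n) \<times> (real^'n)"
  obtain x xi where p: "p = (x, xi)" by (cases p) auto
  show "(\<lambda>k. f (fst p) (e (N k (snd p)))) \<longlonglongrightarrow> f (fst p) (snd p)"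
  proof (cases "xi = 0")
   case True
   then show ?thesis using N[of _ xi] by (simp add: p)
  next
   case False
   have "(\<lambda>k. norm xi / real (Suc k)) \<longlonglongrightarrow> 0" by (rule LIMSEQ_Suc[OF lim_const_over_n])
   then have "(\<lambda>k. dist (e (N k xi)) xi) \<longlonglongrightarrow> 0"
   proof (rule Lim_null_comparison[rotated])
    show "\<forall>\<^sub>F k in sequentially. norm (dist (e (N k xi)) xi) <= norm xi / real (Suc k)"
    proof (rule always_eventually, rule allI)
     fix k show "norm (dist (e (N k xi)) xi) <= norm xi / real (Suc k)" using N[of k xi] False by simp
    qed
   qed
   then have "(\<lambda>k. e (N k xi)) \<longlonglongrightarrow> xi" by (rule tendsto_dist_iff[THEN iffD2])
   moreover have "isCont (f x) xi" using c[of x] False continuous_on_eq_continuous_at[OF open_Compl[OF closed_singleton], of "0::real^'n" "f x"] by simp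
   ultimately show ?thesis unfolding p fst_conv snd_conv by (rule isCont_tendsto_compose[rotated])
  qed
 qed
qed

lemma lebesgue_ex_borel_complex:
 fixes f :: "'a::euclidean_space => complex"
 assumes "f \<in> borel_measurable lebesgue"
 shows "\<exists>g\<in>bmeas. AE x in lborel. f x = g x"
proof -
 have "(\<lambda>x. Re (f x)) \<in> borel_measurable lebesgue" "(\<lambda>x. Im (f x)) \<in> borel_measurable lebesgue"
  using assms by measurable
 then obtain u v where uv: "u \<in> borel_measurable lborel" "AE x in lborel. Re (f x) = u x" "v \<in> borel_measurable lborel" "AE x in lborel. Im (f x) = v x"
  using completion_ex_borel_measurable_real by metis
 have [measurable]: "u \<in> bmeas" "v \<in> bmeas" using uv by simp_all
 have "(\<lambda>x. of_real (u x) + \<i> * of_real (v x) :: complex) \<in> bmeas" by measurable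
 moreover have "AE x in lborel. f x = of_real (u x) + \<i> * of_real (v x)"
  using uv(2,4) by eventually_elim (simp add: complex_eq_iff)
 ultimately show ?thesis by (intro bexI[where x="\<lambda>x. of_real (u x) + \<i> * of_real (v x)"])
qed

text \<open>A projection of a closed set need not be closed, but it is a countable union of compact
  sets.\<close>

lemma space_support_borel: "space_support a \<in> sets borel"
proof -
 let ?K = "closure {(x, xi). a x xi ~= 0}"
 have "space_support a = (\<Union>n::nat. fst ` (?K \<inter> cball 0 (real n)))"
 proof -
  have "?K = (\<Union>n::nat. ?K \<inter> cball 0 (real n))" by (auto intro: real_arch_simple)
  then show ?thesis unfolding space_support_def by (metis image_UN)
 qed
 moreover have "fst ` (?K \<inter> cball 0 (real n)) \<in> sets borel" for n
 proof -
  have "compact (?K \<inter> cball 0 (real n))" by (intro closed_Int_compact closed_closure compact_cball)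
  then show ?thesis by (intro borel_closed compact_imp_closed compact_continuous_image continuous_intros)
 qed
 ultimately show ?thesis by simp
qed

lemma space_support_nonzero: "a x xi ~= 0 ==> x \<in> space_support a"
 unfolding space_support_def using closure_subset[of "{(x, xi). a x xi ~= 0}"] by force

text \<open>First partials of a function homogeneous of degree 1 have degree 0; this carries the
  corank condition from the sphere to a whole shell.\<close>

lemma homogeneous_partial:
 fixes f :: "real^'n => real"
 assumes hom: "\<And>xi t. xi ~= 0 ==> 0 < t ==> f (t .* xi) = t * f xi" and sm: "smooth_on (-{0}) f" and xi: "xi ~= 0" and s: "0 < s"
 shows "iter_partial [i] f (s .* xi) = iter_partial [i] f xi"
proof -
 have d: "f differentiable (at xi)" using sm xi unfolding smooth_on_def by (metis ComplI iter_partial.simps(1) singletonD)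
 let ?D = "frechet_derivative f (at xi)"
 have D: "(f has_derivative ?D) (at xi)" using d by (simp add: frechet_derivative_works)
 have lin: "linear ?D" by (rule linear_frechet_derivative[OF d])
 have 1: "((\<lambda>eta. (1 / s) .* eta) has_derivative (\<lambda>v. (1 / s) .* v)) (at (s .* xi))"
  by (auto intro!: derivative_eq_intros)
 have 2: "(f has_derivative ?D) (at ((1 / s) .* (s .* xi)))" using D s by simp
 have "((\<lambda>eta. s * f ((1 / s) .* eta)) has_derivative (\<lambda>v. s * ?D ((1 / s) .* v))) (at (s .* xi))"
  by (rule has_derivative_mult_right) (rule has_derivative_compose[OF 1 2])
 moreover have "(\<lambda>v. s * ?D ((1 / s) .* v)) = ?D"
  using s by (auto simp: linear_scale[OF lin])
 ultimately have "((\<lambda>eta. s * f ((1 / s) .* eta)) has_derivative ?D) (at (s .* xi))" by simp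
 then have "(f has_derivative ?D) (at (s .* xi))"
 proof (rule has_derivative_transform_within_open[of _ _ _ _ "-{0}"])
  show "s * f ((1 / s) .* eta) = f eta" if "eta \<in> -{0}" for eta
   using hom[of "(1 / s) .* eta" s] s that by simp
 qed (use s xi in auto)
 then show ?thesis using frechet_derivative_at by fastforce
qed

text \<open>\<open>b\<close> will be the statement that \<open>x\<close> belongs to the exceptional
  set; the second disjunct normalises values outside the open set \<open>S\<close>, where no
  derivative is asked for.\<close>

lemma jet_cutoff:
 fixes h :: "'n::finite list => real^'n => 'a::real_normed_field"
 assumes "jet S h" "open S"
 shows "jet S (\<lambda>al xi. if b \<or> xi \<notin> S then 0 else h al xi)"
 unfolding jet_def
proof (intro allI ballI)
 fix al :: "'n list" and xi assume xi: "xi \<in> S"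
 show "((\<lambda>xi. if b \<or> xi \<notin> S then 0 else h al xi) has_derivative (\<lambda>v. \<Sum>i\<in>UNIV. v $ i .* (if b \<or> xi \<notin> S then 0 else h (i # al) xi))) (at xi)"
 proof (cases b)
  case True
  then show ?thesis by simp
 next
  case False
  have "(h al has_derivative (\<lambda>v. \<Sum>i\<in>UNIV. v $ i .* h (i # al) xi)) (at xi)" using assms(1) xi by (simp add: jet_def)
  then have "((\<lambda>xi. if b \<or> xi \<notin> S then 0 else h al xi) has_derivative (\<lambda>v. \<Sum>i\<in>UNIV. v $ i .* h (i # al) xi)) (at xi)"
   by (rule has_derivative_transform_within_open[OF _ assms(2) xi]) (use False in auto)
  then show ?thesis using False xi by simp
 qed
qed

lemma continuous_on_japanese: "continuous_on S (japanese :: real^'n => real)"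
 unfolding japanese_def by (intro continuous_intros)

lemma japanese_pos: "0 < japanese xi"
 unfolding japanese_def by (simp add: add_pos_nonneg)

lemma Linf_S_AE:
 assumes "a \<in> Linf_S m \<rho>"
 shows "\<exists>C. \<forall>al. 0 <= C al \<and> (AE x in lebesgue. \<forall>xi. norm (iter_partial al (a x) xi) <= C al * japanese xi powr (m - \<rho> * real (length al)))"
proof (intro choice allI)
 fix al :: "'a list"
 have sm: "\<And>x. smooth_on UNIV (a x)" and fin: "(SUP xi\<in>UNIV. ereal (japanese xi powr (- m + \<rho> * real (length al))) * Linf_norm (\<lambda>x. iter_partial al (a x) xi)) < \<infinity>"
  using assms by (auto simp: Linf_S_def)
 obtain C where C: "0 <= C" and ae: "\<And>xi. AE x in lebesgue. norm (iter_partial al (a x) xi) <= C / japanese xi powr (- m + \<rho> * real (length al))"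
  using esssup_weighted_AE[OF fin] by (auto simp: japanese_pos less_imp_neq[OF japanese_pos, symmetric])
 have eq: "C / japanese xi powr (- m + \<rho> * real (length al)) = C * japanese xi powr (m - \<rho> * real (length al))" for xi :: "real^'a"
  using powr_minus_divide[of "japanese xi" "- m + \<rho> * real (length al)"] by simp
 have "AE x in lebesgue. \<forall>xi\<in>UNIV. norm (iter_partial al (a x) xi) <= C * japanese xi powr (m - \<rho> * real (length al))"
 proof (rule AE_bound_continuous)
  show "continuous_on UNIV (iter_partial al (a x))" for x
   using jet_continuous_on[OF jet_smooth_on[OF sm]] by simp
  show "continuous_on UNIV (\<lambda>xi. C * japanese xi powr (m - \<rho> * real (length al)))"
   by (intro continuous_intros continuous_on_powr continuous_on_japanese) (simp_all add: less_imp_neq[OF japanese_pos, symmetric])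
 qed (use ae eq in auto)
 then show "\<exists>C. 0 <= C \<and> (AE x in lebesgue. \<forall>xi. norm (iter_partial al (a x) xi) <= C * japanese xi powr (m - \<rho> * real (length al)))"
  using C by auto
qed

lemma Linf_Phi_AE:
 assumes "\<phi> \<in> Linf_Phi 2"
 shows "\<exists>C. \<forall>al. 0 <= C al \<and> (AE x in lebesgue. 2 <= length al --> (\<forall>xi. xi ~= 0 --> \<bar>iter_partial al (\<phi> x) xi\<bar> <= C al * norm xi powr (1 - real (length al))))"
proof (intro choice allI)
 fix al :: "'a list"
 show "\<exists>C. 0 <= C \<and> (AE x in lebesgue. 2 <= length al --> (\<forall>xi. xi ~= 0 --> \<bar>iter_partial al (\<phi> x) xi\<bar> <= C * norm xi powr (1 - real (length al))))"
 proof (cases "2 <= length al")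
  case False
  then show ?thesis by (intro exI[of _ 0]) simp
 next
  case True
  have sm: "\<And>x. smooth_on (-{0}) (\<phi> x)" and fin: "(SUP xi\<in>-{0}. ereal (norm xi powr (- 1 + real (length al))) * Linf_norm (\<lambda>x. iter_partial al (\<phi> x) xi)) < \<infinity>"
   using assms True by (auto simp: Linf_Phi_def)
  obtain C where C: "0 <= C" and ae: "\<And>xi. xi \<in> -{0} ==> AE x in lebesgue. norm (iter_partial al (\<phi> x) xi) <= C / norm xi powr (- 1 + real (length al))"
   using esssup_weighted_AE[OF fin] by auto
  have eq: "C / norm xi powr (- 1 + real (length al)) = C * norm xi powr (1 - real (length al))" for xi :: "real^'a"
   using powr_minus_divide[of "norm xi" "- 1 + real (length al)"] by simp
  have "AE x in lebesgue. \<forall>xi\<in>-{0}. norm (iter_partial al (\<phi> x) xi) <= C * norm xi powr (1 - real (length al))"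
  proof (rule AE_bound_continuous)
   show "continuous_on (-{0}) (iter_partial al (\<phi> x))" for x
    using jet_continuous_on[OF jet_smooth_on[OF sm]] by simp
   show "continuous_on (-{0}) (\<lambda>xi::real^'a. C * norm xi powr (1 - real (length al)))"
    by (intro continuous_intros continuous_on_powr) auto
  qed (use ae eq in auto)
  then show ?thesis using C by (intro exI[of _ C]) auto
 qed
qed

lemma finite_list_bound:
 fixes C :: "'n::finite list => real"
 assumes "\<And>al. 0 <= C al"
 shows "\<exists>B\<ge>0. \<forall>al. length al <= N --> C al <= B"
proof -
 have fin: "finite {al :: 'n list. length al <= N}" using finite_lists_length_le[of "UNIV :: 'n set" N] by simp
 show ?thesis
  by (intro exI[of _ "\<Sum>al | length al <= N. C al"]) (use assms fin in \<open>auto intro!: sum_nonneg member_le_sum\<close>)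
qed

lemma exists_borel_null_cover:
 fixes Q :: "real^'n => bool"
 assumes "AE x in lebesgue. Q x"
 obtains Z where "Z \<in> sets borel" "AE x in lborel. x \<notin> Z" "\<And>x. x \<notin> Z ==> Q x"
proof -
 have "AE x in lborel. Q x" using assms by (simp only: AE_completion_iff)
 then obtain Z where Z: "{x \<in> space lborel. \<not> Q x} \<subseteq> Z" "emeasure lborel Z = 0" "Z \<in> sets lborel"
  by (rule AE_E)
 have "AE x in lborel. x \<notin> Z" using Z(2,3) by (intro AE_not_in) auto
 then show thesis using that[of Z] Z by auto
qed

text \<open>For |x - y| <= r0 the quadratic term is absorbed by half of the right-hand side. If x -
  y has only coordinates in an admissible \<open>I\<close>, the projection is at least c |x - y|, so
  the gradient difference is of that order and some component of it too.\<close>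

lemma rough_corank_local:
 fixes a :: "real^'n => real^'n => complex"
 assumes rc: "rough_corank k a \<phi>"
 obtains Xi :: "'n set => ((real^'n) \<times> (real^'n)) set" and cg r0 :: real
 where "\<And>I. Xi I \<in> sets borel" "\<And>I. Xi I ~= {} ==> card I = CARD('n) - k"
  "\<And>x \<omega>. x \<in> space_support a ==> norm \<omega> = 1 ==> \<exists>I. (x, \<omega>) \<in> Xi I"
  "0 < cg" "cg <= 1" "0 < r0" "r0 <= 1"
  "\<And>I x y \<omega>. (x, \<omega>) \<in> Xi I ==> (y, \<omega>) \<in> Xi I ==> norm \<omega> = 1 ==> slice I (x - y) = x - y ==> norm (x - y) <= r0 ==>
    \<exists>i. cg * norm (x - y) <= \<bar>iter_partial [i] (\<phi> x) \<omega> - iter_partial [i] (\<phi> y) \<omega>\<bar>"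
proof -
 let ?d = "CARD('n) - k" let ?X = "space_support a" let ?n = "real CARD('n)"
 obtain V c1 c2 where V: "\<And>x xi. x \<in> ?X ==> xi \<in> sphere 0 1 ==> V x xi \<in> grassmannian ?d"
  and cont: "continuous_on (?X \<times> sphere 0 1) (\<lambda>(x, xi). matrix (subspace_proj (V x xi)))"
  and c1: "c1 > 0" and c2: "c2 > 0"
  and est: "\<And>x y xi. x \<in> ?X ==> y \<in> ?X ==> xi \<in> sphere 0 1 ==>
    c2 * norm (subspace_proj (V x xi) (x - y)) <= norm (grad (\<phi> x) xi - grad (\<phi> y) xi) + c1 * (norm (x - y))^2"
  using rc unfolding rough_corank_def by blast
 obtain c where c: "c > 0" and slc: "\<And>V::(real^'n) set. subspace V ==> dim V = ?d ==>
   \<exists>I. card I = ?d \<and> (\<forall>z. (\<forall>i. i \<notin> I --> z $ i = 0) --> c * norm z <= norm (closest_point V z))"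
  using coordinate_slice_proj[of ?d, where 'n='n] by blast
 define Mx where "Mx = (\<lambda>p. matrix (subspace_proj (V (fst p) (snd p))))"
 have Mc: "continuous_on (?X \<times> sphere 0 1) Mx" using cont by (simp add: Mx_def case_prod_beta')
 have Mv: "Mx (x, \<omega>) *v z = subspace_proj (V x \<omega>) z" if "x \<in> ?X" "norm \<omega> = 1" for x \<omega> z
 proof -
  have "subspace (V x \<omega>)" using V[OF that(1), of \<omega>] that(2) by (auto simp: grassmannian_def)
  then show ?thesis unfolding Mx_def by (simp add: matrix_works linear_closest_point)
 qed
 \<comment> \<open>Admissibility is stated through the matrix of the projection, in which
   \<open>V\<close> is continuous, and with a non-strict inequality, so that it is a closed
   condition.\<close>
 define Xi where "Xi = (\<lambda>I. if card I = ?d then {p \<in> ?X \<times> sphere 0 1. \<forall>z. (\<forall>i. i \<notin> I --> z $ i = 0) --> c * norm z <= norm (Mx p *v z)} else {})"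
 \<comment> \<open>Half of c2 c is left after absorption and is divided among n components.\<close>
 define cg where "cg = min 1 (c2 * c / (2 * ?n))"
 define r0 where "r0 = min 1 (c2 * c / (2 * c1))"
 have n1: "1 <= ?n" by (simp add: Suc_leI)
 have XiD: "x \<in> ?X \<and> norm \<omega> = 1 \<and> (\<forall>z. slice I z = z --> c * norm z <= norm (subspace_proj (V x \<omega>) z))" if "(x, \<omega>) \<in> Xi I" for x \<omega> I
 proof -
  have x: "x \<in> ?X" "norm \<omega> = 1" and z: "\<And>z. (\<forall>i. i \<notin> I --> z $ i = 0) ==> c * norm z <= norm (Mx (x, \<omega>) *v z)"
   using that by (auto simp: Xi_def split: if_splits)
  have "c * norm z <= norm (subspace_proj (V x \<omega>) z)" if sz: "slice I z = z" for z
  proof -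
   have "z $ i = 0" if "i \<notin> I" for i
   proof -
    have "slice I z $ i = 0" using that by (simp add: slice_def)
    then show ?thesis by (simp add: sz)
   qed
   then show ?thesis using z[of z] Mv[OF x] by simp
  qed
  then show ?thesis using x by blast
 qed
 show thesis
 proof (rule that)
  fix I
  show "Xi I \<in> sets borel"
  proof (cases "card I = ?d")
   case True
   let ?T = "?X \<times> sphere (0::real^'n) 1"
   \<comment> \<open>One relatively closed condition for each vector supported in \<open>I\<close>;
     an arbitrary intersection of these is relatively closed in a Borel set.\<close>
   have "closedin (top_of_set ?T) (\<Inter>z\<in>{z. \<forall>i. i \<notin> I --> z $ i = 0}. {p \<in> ?T. c * norm z <= norm (Mx p *v z)})"
   proof (rule closedin_INT)
    show "{z::real^'n. \<forall>i. i \<notin> I --> z $ i = 0} ~= {}" by (auto intro!: exI[of _ 0])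
    fix z :: "real^'n"
    have "continuous_on ?T (\<lambda>p. norm (Mx p *v z))"
    proof -
     have "linear (\<lambda>A::real^'n^'n. A *v z)"
      by (rule linearI) (simp_all add: matrix_vector_mult_add_rdistrib scaleR_matrix_vector_assoc)
     then have "continuous_on UNIV (\<lambda>A::real^'n^'n. A *v z)" by (intro linear_continuous_on) (simp add: linear_conv_bounded_linear)
     from continuous_on_compose2[OF this Mc] show ?thesis by (intro continuous_on_norm) simp
    qed
    from continuous_closedin_preimage[OF this closed_atLeast[of "c * norm z"]]
    show "closedin (top_of_set ?T) {p \<in> ?T. c * norm z <= norm (Mx p *v z)}"
    proof -
     have "?T \<inter> (\<lambda>p. norm (Mx p *v z)) -` {c * norm z..} = {p \<in> ?T. c * norm z <= norm (Mx p *v z)}" by auto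
     then show ?thesis using \<open>closedin (top_of_set ?T) (?T \<inter> (\<lambda>p. norm (Mx p *v z)) -` {c * norm z..})\<close> by (simp only:)
    qed
   qed
   then obtain U where U: "closed U" "(\<Inter>z\<in>{z. \<forall>i. i \<notin> I --> z $ i = 0}. {p \<in> ?T. c * norm z <= norm (Mx p *v z)}) = ?T \<inter> U"
    unfolding closedin_closed by blast
   have "Xi I = (\<Inter>z\<in>{z. \<forall>i. i \<notin> I --> z $ i = 0}. {p \<in> ?T. c * norm z <= norm (Mx p *v z)})"
   proof -
    have "\<forall>i. i \<notin> I --> (0::real^'n) $ i = 0" by simp
    then show ?thesis unfolding Xi_def if_P[OF True] by blast
   qed
   then have "Xi I = ?T \<inter> U" using U(2) by simp
   moreover have "?T \<in> sets (borel \<Otimes>\<^sub>M borel)"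
    by (intro pair_measureI space_support_borel borel_closed closed_sphere)
   then have "?T \<in> sets borel" by (simp only: borel_prod)
   ultimately show ?thesis using U(1) by auto
  qed (simp add: Xi_def)
  show "card I = ?d" if "Xi I ~= {}" using that by (auto simp: Xi_def split: if_splits)
 next
  fix x \<omega> :: "real^'n" assume x: "x \<in> ?X" "norm \<omega> = 1"
  have "V x \<omega> \<in> grassmannian ?d" using V[of x \<omega>] x by simp
  then obtain I where "card I = ?d" "\<And>z. (\<forall>i. i \<notin> I --> z $ i = 0) ==> c * norm z <= norm (closest_point (V x \<omega>) z)"
   using slc[of "V x \<omega>"] unfolding grassmannian_def by blast
  then have "(x, \<omega>) \<in> Xi I" using x Mv[OF x] by (auto simp: Xi_def)
  then show "\<exists>I. (x, \<omega>) \<in> Xi I" by blast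
 next
  show "0 < cg" "cg <= 1" "0 < r0" "r0 <= 1" using c c1 c2 n1 by (auto simp: cg_def r0_def)
 next
  fix I and x y \<omega> :: "real^'n"
  assume X: "(x, \<omega>) \<in> Xi I" "(y, \<omega>) \<in> Xi I" and \<omega>: "norm \<omega> = 1" and sl: "slice I (x - y) = x - y" and r: "norm (x - y) <= r0"
  let ?t = "norm (x - y)" let ?G = "grad (\<phi> x) \<omega> - grad (\<phi> y) \<omega>"
  have 1: "c * ?t <= norm (subspace_proj (V x \<omega>) (x - y))" using XiD[OF X(1)] sl by blast
  have "c2 * (c * ?t) <= norm ?G + c1 * ?t^2"
  proof -
   have "c2 * (c * ?t) <= c2 * norm (subspace_proj (V x \<omega>) (x - y))" using c2 by (intro mult_left_mono 1) simp
   then show ?thesis using est[of x y \<omega>] XiD[OF X(1)] XiD[OF X(2)] by simp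
  qed
  moreover have "c1 * ?t^2 <= (c2 * c / 2) * ?t"
  proof -
   have "c1 * ?t <= c1 * (c2 * c / (2 * c1))" using r c1 by (intro mult_left_mono) (auto simp: r0_def)
   then have "c1 * ?t <= c2 * c / 2" using c1 by simp
   then have "(c1 * ?t) * ?t <= (c2 * c / 2) * ?t" by (intro mult_right_mono) auto
   then show ?thesis by (simp add: power2_eq_square mult.assoc)
  qed
  ultimately have G: "(c2 * c / 2) * ?t <= norm ?G" by (simp add: field_simps)
  show "\<exists>i. cg * ?t <= \<bar>iter_partial [i] (\<phi> x) \<omega> - iter_partial [i] (\<phi> y) \<omega>\<bar>"
  proof (rule ccontr)
   assume "\<not> ?thesis"
   then have lt: "\<bar>?G $ i\<bar> < cg * ?t" for i by (simp add: grad_def not_le)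
   have "norm ?G <= (\<Sum>i\<in>UNIV. \<bar>?G $ i\<bar>)" by (rule norm_le_l1_cart)
   also have "\<dots> < (\<Sum>i\<in>(UNIV::'n set). cg * ?t)" by (rule sum_strict_mono) (use lt in auto)
   also have "\<dots> = (?n * cg) * ?t" by simp
   also have "\<dots> <= (c2 * c / 2) * ?t"
   proof (rule mult_right_mono)
    have "?n * cg <= ?n * (c2 * c / (2 * ?n))" using n1 by (intro mult_left_mono) (auto simp: cg_def)
    then show "?n * cg <= c2 * c / 2" using n1 by simp
   qed simp
   finally show False using G by simp
  qed
 qed
qed

text \<open>Multi-indices and a dense set of frequencies are countable, so all exceptional sets fit
  into a single Borel null set \<open>Z\<close>. Setting the symbols to zero there makes every bound
  hold pointwise and changes the operator only for \<open>x\<close> in \<open>Z\<close>; the value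
  of the phase at xi = 0 is set to zero as well.\<close>

lemma clean_exists:
 fixes a :: "real^'n => real^'n => complex"
 assumes \<rho>: "0 <= \<rho>" "\<rho> <= 1" and k: "k < CARD('n)"
  and a: "a \<in> Linf_S m \<rho>" and \<phi>: "\<phi> \<in> Linf_Phi 2" and rc: "rough_corank k a \<phi>"
  and m: "m < - (real CARD('n) + real k - 1) / 4 + (real CARD('n) - real k) * (\<rho> - 1) / 2"
 obtains a' P Xi cg r0 where "clean_fio a' P Xi m \<rho> cg r0 (CARD('n) - k)"
  "AE x in lborel. \<forall>xi. xi ~= 0 --> a' x [] xi = a x xi \<and> P x [] xi = \<phi> x xi"
proof (rule rough_corank_local[OF rc], goal_cases)
 case (1 Xi0 cg r0)
 note Xcov = 1(4) and cg = 1(5,6) and r0 = 1(7,8)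
 have Xm: "Xi0 I \<in> sets borel" for I by (rule 1(2))
 have Xc: "card I = CARD('n) - k" if "Xi0 I ~= {}" for I using that by (rule 1(3))
 have sma: "\<And>x. smooth_on UNIV (a x)" and am: "\<And>xi. (\<lambda>x. a x xi) \<in> borel_measurable lebesgue" using a by (auto simp: Linf_S_def)
 have sm\<phi>: "\<And>x. smooth_on (-{0}) (\<phi> x)" and \<phi>m: "\<And>xi. xi ~= 0 ==> (\<lambda>x. \<phi> x xi) \<in> borel_measurable lebesgue"
  and hom: "\<And>x xi t. xi ~= 0 ==> t > 0 ==> \<phi> x (t .* xi) = t * \<phi> x xi" using \<phi> by (auto simp: Linf_Phi_def)
 obtain Ca where Ca: "\<And>al. 0 <= Ca al" "\<And>al. AE x in lebesgue. \<forall>xi. norm (iter_partial al (a x) xi) <= Ca al * japanese xi powr (m - \<rho> * real (length al))"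
  using Linf_S_AE[OF a] by blast
 obtain Cp where Cp: "\<And>al. 0 <= Cp al" "\<And>al. AE x in lebesgue. 2 <= length al --> (\<forall>xi. xi ~= 0 --> \<bar>iter_partial al (\<phi> x) xi\<bar> <= Cp al * norm xi powr (1 - real (length al)))"
  using Linf_Phi_AE[OF \<phi>] by blast
 obtain D0 :: "(real^'n) set" where D0: "countable D0" "\<And>X. open X ==> X ~= {} ==> \<exists>d\<in>D0. d \<in> X"
  by (rule countable_dense_setE) blast
 define D where "D = insert 0 D0"
 have D: "countable D" "0 \<in> D" "\<And>X. open X ==> X ~= {} ==> \<exists>d\<in>D. d \<in> X" using D0 by (auto simp: D_def)
 have "\<forall>xi. \<exists>g. g \<in> bmeas \<and> (AE x in lborel. a x xi = g x)"
  using lebesgue_ex_borel_complex[OF am] by blast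
 then obtain ga where ga: "\<And>xi. ga xi \<in> bmeas" "\<And>xi. AE x in lborel. a x xi = ga xi x" by metis
 have "\<forall>xi. \<exists>g. g \<in> bmeas \<and> (xi ~= 0 --> (AE x in lborel. \<phi> x xi = g x))"
 proof
  fix xi :: "real^'n"
  show "\<exists>g. g \<in> bmeas \<and> (xi ~= 0 --> (AE x in lborel. \<phi> x xi = g x))"
  proof (cases "xi = 0")
   case True then show ?thesis by (intro exI[of _ "\<lambda>_. 0"]) simp
  next
   case False
   then show ?thesis using completion_ex_borel_measurable_real[OF \<phi>m[OF False]] by auto
  qed
 qed
 then obtain g\<phi> where g\<phi>: "\<And>xi. g\<phi> xi \<in> bmeas" "\<And>xi. xi ~= 0 ==> AE x in lborel. \<phi> x xi = g\<phi> xi x" by metis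
 \<comment> \<open>Everything required of a good point: all symbol bounds, and agreement with Borel
   representatives at the frequencies of the dense set.\<close>
 define Q where "Q = (\<lambda>x. (\<forall>al::'n list. \<forall>xi. norm (iter_partial al (a x) xi) <= Ca al * japanese xi powr (m - \<rho> * real (length al))) \<and>
   (\<forall>al::'n list. 2 <= length al --> (\<forall>xi. xi ~= 0 --> \<bar>iter_partial al (\<phi> x) xi\<bar> <= Cp al * norm xi powr (1 - real (length al)))) \<and>
   (\<forall>d\<in>D. a x d = ga d x) \<and> (\<forall>d\<in>D - {0}. \<phi> x d = g\<phi> d x))"
 have "AE x in lborel. \<forall>al::'n list. \<forall>xi. norm (iter_partial al (a x) xi) <= Ca al * japanese xi powr (m - \<rho> * real (length al))"
  using Ca(2) by (subst AE_all_countable) (simp add: AE_completion_iff)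
 moreover have "AE x in lborel. \<forall>al::'n list. 2 <= length al --> (\<forall>xi. xi ~= 0 --> \<bar>iter_partial al (\<phi> x) xi\<bar> <= Cp al * norm xi powr (1 - real (length al)))"
  using Cp(2) by (subst AE_all_countable) (simp add: AE_completion_iff)
 moreover have "AE x in lborel. \<forall>d\<in>D. a x d = ga d x" using D(1) ga(2) by (subst AE_ball_countable) auto
 moreover have "AE x in lborel. \<forall>d\<in>D - {0}. \<phi> x d = g\<phi> d x" using D(1) g\<phi>(2) by (subst AE_ball_countable) auto
 ultimately have "AE x in lborel. (\<forall>al::'n list. \<forall>xi. norm (iter_partial al (a x) xi) <= Ca al * japanese xi powr (m - \<rho> * real (length al))) \<and>
   (\<forall>al::'n list. 2 <= length al --> (\<forall>xi. xi ~= 0 --> \<bar>iter_partial al (\<phi> x) xi\<bar> <= Cp al * norm xi powr (1 - real (length al)))) \<and>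
   (\<forall>d\<in>D. a x d = ga d x) \<and> (\<forall>d\<in>D - {0}. \<phi> x d = g\<phi> d x)"
  by eventually_elim blast
 then have "AE x in lebesgue. (\<forall>al::'n list. \<forall>xi. norm (iter_partial al (a x) xi) <= Ca al * japanese xi powr (m - \<rho> * real (length al))) \<and>
   (\<forall>al::'n list. 2 <= length al --> (\<forall>xi. xi ~= 0 --> \<bar>iter_partial al (\<phi> x) xi\<bar> <= Cp al * norm xi powr (1 - real (length al)))) \<and>
   (\<forall>d\<in>D. a x d = ga d x) \<and> (\<forall>d\<in>D - {0}. \<phi> x d = g\<phi> d x)"
  by (simp only: AE_completion_iff)
 then have Q0: "AE x in lebesgue. Q x" by (simp only: Q_def)
 obtain Z where Z[measurable]: "Z \<in> sets borel" and Zn: "AE x in lborel. x \<notin> Z" and Q1: "\<And>x. x \<notin> Z ==> Q x"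
  using exists_borel_null_cover[OF Q0] by blast
 note Q = Q1[unfolded Q_def]
 have ab: "norm (iter_partial al (a x) xi) <= Ca al * japanese xi powr (m - \<rho> * real (length al))" if "x \<notin> Z" for x al xi
  using Q[OF that] by simp
 have pb: "\<bar>iter_partial al (\<phi> x) xi\<bar> <= Cp al * norm xi powr (1 - real (length al))" if "x \<notin> Z" "2 <= length al" "xi ~= 0" for x al xi
  using Q[OF that(1)] that(2,3) by simp
 have ad: "a x d = ga d x" if "x \<notin> Z" "d \<in> D" for x d using Q[OF that(1)] that(2) by simp
 have pd: "\<phi> x d = g\<phi> d x" if "x \<notin> Z" "d \<in> D - {0}" for x d using Q[OF that(1)] that(2) by simp
 define a' where "a' = (\<lambda>x al xi. if x \<in> Z \<or> xi \<notin> (UNIV :: (real^'n) set) then 0 else iter_partial al (a x) xi)"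
 define P where "P = (\<lambda>x al xi. if x \<in> Z \<or> xi \<notin> -{0::real^'n} then 0 else iter_partial al (\<phi> x) xi)"
 \<comment> \<open>The null set is removed from the sectors as well, since the modified phase
   vanishes there and could not be nondegenerate.\<close>
 define Xi where "Xi = (\<lambda>I. Xi0 I \<inter> ((-Z) \<times> UNIV))"
 have a'j: "jet UNIV (a' x)" for x unfolding a'_def by (rule jet_cutoff[OF jet_smooth_on[OF sma]]) simp
 have Pj: "jet (-{0}) (P x)" for x unfolding P_def by (rule jet_cutoff[OF jet_smooth_on[OF sm\<phi>]]) (simp add: open_Compl)
 have kd: "real (CARD('n) - k) = real CARD('n) - real k" using k by simp
 have "clean_fio a' P Xi m \<rho> cg r0 (CARD('n) - k)"
 proof (rule clean_fio.intro)
  show "jet UNIV (a' x)" for x by (rule a'j)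
  show "jet (-{0}) (P x)" for x by (rule Pj)
  show "\<exists>C\<ge>0. \<forall>al x xi. length al <= N --> norm (a' x al xi) <= C * japanese xi powr (m - \<rho> * real (length al))" for N
  proof -
   obtain B where B: "B >= 0" "\<And>al. length al <= N ==> Ca al <= B" using finite_list_bound[of Ca N, OF Ca(1)] by blast
   have "norm (a' x al xi) <= B * japanese xi powr (m - \<rho> * real (length al))" if "length al <= N" for al x xi
   proof (cases "x \<in> Z")
    case False
    have "Ca al * japanese xi powr (m - \<rho> * real (length al)) <= B * japanese xi powr (m - \<rho> * real (length al))"
     by (rule mult_right_mono[OF B(2)[OF that]]) simp
    moreover have "a' x al xi = iter_partial al (a x) xi" using False by (simp add: a'_def)
    ultimately show ?thesis using ab[OF False, of al xi] by simp
   qed (simp add: a'_def B(1))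
   then show ?thesis using B(1) by blast
  qed
  show "\<exists>C\<ge>0. \<forall>al x xi. 2 <= length al --> length al <= N --> xi ~= 0 --> \<bar>P x al xi\<bar> <= C * norm xi powr (1 - real (length al))" for N
  proof -
   obtain B where B: "B >= 0" "\<And>al. length al <= N ==> Cp al <= B" using finite_list_bound[of Cp N, OF Cp(1)] by blast
   have "\<bar>P x al xi\<bar> <= B * norm xi powr (1 - real (length al))" if "length al <= N" "2 <= length al" "xi ~= 0" for al x xi
   proof (cases "x \<in> Z")
    case False
    have "Cp al * norm xi powr (1 - real (length al)) <= B * norm xi powr (1 - real (length al))"
     by (rule mult_right_mono[OF B(2)[OF that(1)]]) simp
    moreover have "P x al xi = iter_partial al (\<phi> x) xi" using False that(3) by (simp add: P_def)
    ultimately show ?thesis using pb[OF False that(2,3)] by linarith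
   qed (simp add: P_def B(1))
   then show ?thesis using B(1) by blast
  qed
  show "P x [] (s .* xi) = s * P x [] xi" if "xi ~= 0" "0 < s" for x xi s using that hom by (simp add: P_def)
  show "P x [i] (s .* xi) = P x [i] xi" if "xi ~= 0" "0 < s" for x i xi s
   using that homogeneous_partial[where f="\<phi> x" and i=i, OF hom sm\<phi> that] by (simp add: P_def del: iter_partial.simps)
  show "(\<lambda>p. a' (fst p) [] (snd p)) \<in> bmeas"
  proof (rule joint_borel_measurable[OF D])
   fix d assume d: "d \<in> D"
   have "(\<lambda>x. a' x [] d) = (\<lambda>x. if x \<in> Z then 0 else ga d x)" using ad[OF _ d] by (auto simp: a'_def)
   then show "(\<lambda>x. a' x [] d) \<in> bmeas" using ga(1)[of d] by simp
  next
   show "continuous_on (-{0}) (a' x [])" for x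
    using jet_continuous_on[OF a'j[of x], of "[]"] continuous_on_subset by blast
  qed
  show "(\<lambda>p. P (fst p) [] (snd p)) \<in> bmeas"
  proof (rule joint_borel_measurable[OF D])
   fix d assume d: "d \<in> D"
   have "(\<lambda>x. P x [] d) = (\<lambda>x. if x \<in> Z \<or> d = 0 then 0 else g\<phi> d x)" using pd[of _ d] d by (auto simp: P_def)
   then show "(\<lambda>x. P x [] d) \<in> bmeas" using g\<phi>(1)[of d] by (cases "d = 0") simp_all
  next
   show "continuous_on (-{0}) (P x [])" for x
    using jet_continuous_on[OF Pj[of x], of "[]"] by simp
  qed
  show "Xi I \<in> sets borel" for I
  proof -
   have "(-Z) \<times> (UNIV :: (real^'n) set) \<in> sets (borel \<Otimes>\<^sub>M borel)" by (intro pair_measureI) auto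
   then show ?thesis unfolding Xi_def using Xm[of I] by (simp only: borel_prod sets.Int)
  qed
  show "card I = CARD('n) - k" if "Xi I ~= {}" for I using that Xc[of I] by (auto simp: Xi_def)
  show "\<exists>I. (x, \<omega>) \<in> Xi I" if "a' x [] xi ~= 0" "norm \<omega> = 1" for x xi \<omega>
  proof -
   have "x \<notin> Z" "a x xi ~= 0" using that(1) by (auto simp: a'_def split: if_splits)
   then show ?thesis using Xcov[OF space_support_nonzero[of a x xi] that(2)] by (auto simp: Xi_def)
  qed
  show "\<exists>i. cg * norm (x - y) <= \<bar>P x [i] \<omega> - P y [i] \<omega>\<bar>"
   if "(x, \<omega>) \<in> Xi I" "(y, \<omega>) \<in> Xi I" "norm \<omega> = 1" "slice I (x - y) = x - y" "norm (x - y) <= r0" for I x y \<omega>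
  proof -
   have z: "x \<notin> Z" "y \<notin> Z" "\<omega> ~= 0" using that by (auto simp: Xi_def)
   then show ?thesis using 1(9)[of x \<omega> I y] that by (simp add: P_def Xi_def del: iter_partial.simps)
  qed
  show "0 < cg" "cg <= 1" "0 < r0" "r0 <= 1" "0 <= \<rho>" "\<rho> <= 1" by (rule cg r0 \<rho>)+
  show "1 <= CARD('n) - k" "CARD('n) - k <= CARD('n)" using k by auto
  show "2 * m < - real CARD('n) + 1/2 - real (CARD('n) - k) / 2 + real (CARD('n) - k) * \<rho>"
   using m unfolding kd by (simp add: field_simps)
 qed
 moreover have "AE x in lborel. \<forall>xi. xi ~= 0 --> a' x [] xi = a x xi \<and> P x [] xi = \<phi> x xi"
  using Zn by eventually_elim (simp add: a'_def P_def)
 ultimately show thesis by (rule that)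
qed

section \<open>Summation of the dyadic pieces\<close>

text \<open>A pointwise Cauchy-Schwarz with weights s^j, where s^2 = q, controls the sum of |T_j| by
  the single function \<open>W\<close>. This gives summability almost everywhere along with the norm
  bound; each of the two geometric series contributes a factor 1/(1 - s).\<close>

lemma dyadic_sum_bound:
 fixes T :: "nat => 'a::euclidean_space => complex"
 assumes T[measurable]: "\<And>j. T j \<in> bmeas" and B[measurable]: "B \<in> sets borel" and K: "0 <= K" and q: "0 < q" "q < 1"
  and bd: "\<And>j. (\<integral>\<^sup>+x\<in>B. sqn (T j x) \<partial>lborel) <= ennreal (K * q ^ j) * G" and G: "G < \<top>"
 shows "AE x in lborel. x \<in> B --> summable (\<lambda>j. norm (T j x))"
  and "(\<integral>\<^sup>+x\<in>B. sqn (\<Sum>j. T j x) \<partial>lborel) <= ennreal (K / (1 - sqrt q)^2) * G"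
proof -
 define s where "s = sqrt q"
 have s: "0 < s" "s < 1" and ss: "s * s = q" using q by (auto simp: s_def)
 \<comment> \<open>Half of the decay is used up here: the weight s^-j turns q^j into s^j, which is
   still summable.\<close>
 define W where "W = (\<lambda>x. \<Sum>j. ennreal ((1 / s) ^ j * (norm (T j x))^2))"
 have Wm[measurable]: "W \<in> bmeas" unfolding W_def by measurable
 have geo: "(\<Sum>j. ennreal (s ^ j)) = ennreal (1 / (1 - s))"
  using s by (subst suminf_ennreal2) (auto simp: suminf_geometric summable_geometric)
 have WB: "(\<integral>\<^sup>+x\<in>B. W x \<partial>lborel) <= ennreal (K / (1 - s)) * G"
 proof -
  have "(\<integral>\<^sup>+x\<in>B. W x \<partial>lborel) = (NN x. (\<Sum>j. ennreal ((1 / s) ^ j) * (sqn (T j x) * indicator B x)))"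
  proof (rule nn_integral_cong)
   fix x
   show "W x * indicator B x = (\<Sum>j. ennreal ((1 / s) ^ j) * (sqn (T j x) * indicator B x))"
    using s by (cases "x \<in> B") (simp_all add: W_def ennreal_mult'')
  qed
  also have "\<dots> = (\<Sum>j. \<integral>\<^sup>+x. ennreal ((1 / s) ^ j) * (sqn (T j x) * indicator B x) \<partial>lborel)"
   by (rule nn_integral_suminf) measurable
  also have "\<dots> = (\<Sum>j. ennreal ((1 / s) ^ j) * (\<integral>\<^sup>+x\<in>B. sqn (T j x) \<partial>lborel))"
   by (intro suminf_cong nn_integral_cmult) measurable
  also have "\<dots> <= (\<Sum>j. ennreal K * (ennreal (s ^ j) * G))"
  proof (rule suminf_le)
   fix j
   have "ennreal ((1 / s) ^ j) * (\<integral>\<^sup>+x\<in>B. sqn (T j x) \<partial>lborel) <= ennreal ((1 / s) ^ j) * (ennreal (K * q ^ j) * G)"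
    by (rule mult_left_mono[OF bd]) simp
   also have "\<dots> = ennreal ((1 / s) ^ j * (K * q ^ j)) * G"
   proof -
    have "ennreal ((1 / s) ^ j * (K * q ^ j)) = ennreal ((1 / s) ^ j) * ennreal (K * q ^ j)"
     by (rule ennreal_mult) (use s K q in auto)
    then show ?thesis by (simp only: mult.assoc)
   qed
   also have "(1 / s) ^ j * (K * q ^ j) = K * s ^ j"
    unfolding ss[symmetric] using s by (simp add: power_mult_distrib power_divide)
   also have "ennreal (K * s ^ j) * G = ennreal K * (ennreal (s ^ j) * G)"
    using s K by (simp add: ennreal_mult mult.assoc)
   finally show "ennreal ((1 / s) ^ j) * (\<integral>\<^sup>+x\<in>B. sqn (T j x) \<partial>lborel) <= ennreal K * (ennreal (s ^ j) * G)" .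
  qed auto
  also have "\<dots> = ennreal K * (ennreal (1 / (1 - s)) * G)"
   unfolding geo[symmetric] by simp
  also have "\<dots> = ennreal (K / (1 - s)) * G" using s K by (simp add: mult.assoc[symmetric] ennreal_mult[symmetric])
  finally show ?thesis .
 qed
 have cs: "(\<Sum>j. ennreal (norm (T j x)))^2 <= ennreal (1 / (1 - s)) * W x" for x
 proof -
  let ?f = "\<lambda>j. ennreal (sqrt (s ^ j))" and ?g = "\<lambda>j. ennreal (sqrt ((1 / s) ^ j) * norm (T j x))"
  have fg: "?f j * ?g j = ennreal (norm (T j x))" for j
  proof -
   have "?f j * ?g j = ennreal (sqrt (s ^ j) * (sqrt ((1 / s) ^ j) * norm (T j x)))"
    by (rule ennreal_mult[symmetric]) (use s in auto)
   also have "sqrt (s ^ j) * (sqrt ((1 / s) ^ j) * norm (T j x)) = norm (T j x)"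
    using s by (simp add: real_sqrt_mult[symmetric] mult.assoc[symmetric] power_mult_distrib[symmetric])
   finally show ?thesis .
  qed
  have f2: "(?f j)^2 = ennreal (s ^ j)" for j using s by (simp add: ennreal_power)
  have g2: "(?g j)^2 = ennreal ((1 / s) ^ j * (norm (T j x))^2)" for j using s by (simp add: ennreal_power power_mult_distrib)
  have "(\<integral>\<^sup>+j. ?f j * ?g j \<partial>count_space UNIV)^2 <= (\<integral>\<^sup>+j. (?f j)^2 \<partial>count_space UNIV) * (\<integral>\<^sup>+j. (?g j)^2 \<partial>count_space UNIV)"
   by (rule Cauchy_Schwarz_nn_integral) simp_all
  then show ?thesis unfolding fg f2 g2 nn_integral_count_space_nat geo W_def .
 qed
 have "(\<integral>\<^sup>+x\<in>B. W x \<partial>lborel) < \<top>" using WB by (rule le_less_trans) (use G in \<open>simp add: ennreal_mult_less_top\<close>)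
 then have "AE x in lborel. W x * indicator B x ~= \<infinity>" by (intro nn_integral_noteq_infinite) auto
 then have fin: "AE x in lborel. x \<in> B --> W x < \<top>" by (rule eventually_mono) (auto simp: less_top)
 have sm: "summable (\<lambda>j. norm (T j x))" if "W x < \<top>" for x
 proof (rule summable_suminf_not_top)
  have "ennreal (1 / (1 - s)) * W x < \<top>" using that by (simp add: ennreal_mult_less_top)
  then have "(\<Sum>j. ennreal (norm (T j x)))^2 < \<top>" using cs[of x] by (rule le_less_trans[rotated])
  then show "(\<Sum>j. ennreal (norm (T j x))) ~= \<top>" by (auto simp: power2_eq_square)
 qed simp
 show "AE x in lborel. x \<in> B --> summable (\<lambda>j. norm (T j x))" using fin by (rule eventually_mono) (use sm in blast)
 have "(\<integral>\<^sup>+x\<in>B. sqn (\<Sum>j. T j x) \<partial>lborel) <= (NN x. ennreal (1 / (1 - s)) * (W x * indicator B x))"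
 proof (rule nn_integral_mono_AE, use fin in \<open>rule eventually_mono\<close>)
  fix x assume x: "x \<in> B --> W x < \<top>"
  show "sqn (\<Sum>j. T j x) * indicator B x <= ennreal (1 / (1 - s)) * (W x * indicator B x)"
  proof (cases "x \<in> B")
   case True
   then have sx: "summable (\<lambda>j. norm (T j x))" using sm x by blast
   have "sqn (\<Sum>j. T j x) <= (ennreal (\<Sum>j. norm (T j x)))^2"
    by (subst ennreal_power) (auto intro!: ennreal_leI power_mono summable_norm[OF sx] suminf_nonneg[OF sx])
   also have "ennreal (\<Sum>j. norm (T j x)) = (\<Sum>j. ennreal (norm (T j x)))" by (rule suminf_ennreal2[symmetric]) (auto intro: sx)
   finally have "sqn (\<Sum>j. T j x) <= ennreal (1 / (1 - s)) * W x" using cs[of x] by (rule order_trans)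
   then show ?thesis using True by simp
  qed simp
 qed
 also have "\<dots> = ennreal (1 / (1 - s)) * (\<integral>\<^sup>+x\<in>B. W x \<partial>lborel)" by (rule nn_integral_cmult) measurable
 also have "\<dots> <= ennreal (1 / (1 - s)) * (ennreal (K / (1 - s)) * G)" by (rule mult_left_mono[OF WB]) simp
 also have "\<dots> = ennreal (K / (1 - s)^2) * G"
  using s K by (simp add: mult.assoc[symmetric] ennreal_mult[symmetric] power2_eq_square)
 finally show "(\<integral>\<^sup>+x\<in>B. sqn (\<Sum>j. T j x) \<partial>lborel) <= ennreal (K / (1 - sqrt q)^2) * G" by (simp only: s_def)
qed

section \<open>Fourier transforms of test functions\<close>

lemma test_function_partials:
 fixes u :: "real^'n => complex"
 assumes "u \<in> test_functions"
 obtains R where "0 < R" "\<And>al x. x \<notin> cball 0 R ==> iter_partial al u x = 0"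
proof -
 have "bounded (closure {x. u x ~= 0})" using assms compact_imp_bounded by (auto simp: test_functions_def)
 then obtain R where R0: "0 < R" "\<forall>x\<in>closure {x. u x ~= 0}. norm x <= R" unfolding bounded_pos by blast
 then have R: "0 < R" "closure {x. u x ~= 0} \<subseteq> cball 0 R" by auto
 have "\<forall>x. x \<notin> cball 0 R --> iter_partial al u x = 0" for al
 proof (induction al)
  case Nil
  show ?case using R(2) closure_subset[of "{x. u x ~= 0}"] by auto
 next
  case (Cons i al)
  show ?case
  proof (intro allI impI)
   fix x :: "real^'n" assume x: "x \<notin> cball 0 R"
   have "((\<lambda>_. 0) has_derivative (\<lambda>_. 0)) (at x)" by simp
   then have "(iter_partial al u has_derivative (\<lambda>_. 0)) (at x)"
    by (rule has_derivative_transform_within_open[of _ _ _ _ "- cball 0 R"]) (use Cons x in auto)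
   then have "frechet_derivative (iter_partial al u) (at x) = (\<lambda>_. 0)" by (rule frechet_derivative_at[symmetric])
   then show "iter_partial (i # al) u x = 0" by simp
  qed
 qed
 then show thesis using that R(1) by blast
qed

lemma integrable_continuous_compact_support:
 fixes G :: "real^'n => complex"
 assumes "continuous_on UNIV G" "\<And>x. x \<notin> cball 0 R ==> G x = 0"
 shows "integrable lborel G" and "\<exists>B\<ge>0. \<forall>x. norm (G x) <= B"
proof -
 have "compact (G ` cball 0 R)" by (intro compact_continuous_image continuous_on_subset[OF assms(1)]) auto
 then have "bounded (G ` cball 0 R)" by (rule compact_imp_bounded)
 then obtain B where B: "0 < B" "\<And>x. x \<in> cball 0 R ==> norm (G x) <= B" unfolding bounded_pos by blast
 have B': "norm (G x) <= B" for x using B assms(2)[of x] by (cases "x \<in> cball 0 R") auto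
 then show "\<exists>B\<ge>0. \<forall>x. norm (G x) <= B" using B(1) by (intro exI[of _ B]) auto
 have Gm: "G \<in> bmeas" by (rule borel_measurable_continuous_onI[OF assms(1)])
 show "integrable lborel G"
 proof (rule integrableI_bounded_set[of "cball 0 R" _ _ B])
  show "emeasure lborel (cball (0::real^'n) R) < \<infinity>" by (rule emeasure_bounded_finite) simp
 qed (use Gm B' assms(2) in auto)
qed

text \<open>By Fubini, the integral of G equals the integral of F(x + e) - F(x), which vanishes by
  translation invariance.\<close>

lemma integral_directional_derivative_zero:
 fixes F G :: "real^'n => complex"
 assumes F: "continuous_on UNIV F" "\<And>x. x \<notin> cball 0 R ==> F x = 0"
  and G: "continuous_on UNIV G" "\<And>x. x \<notin> cball 0 R ==> G x = 0"
  and d: "\<And>x t. ((\<lambda>t. F (x + t .* e)) has_vector_derivative G (x + t .* e)) (at t)" and e: "norm e = 1"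
 shows "(LL x. G x) = 0"
proof -
 have Fi: "integrable lborel F" by (rule integrable_continuous_compact_support(1)[OF F])
 obtain B where B: "\<And>x. norm (G x) <= B" using integrable_continuous_compact_support(2)[OF G] by blast
 have Fm[measurable]: "F \<in> bmeas" and Gm[measurable]: "G \<in> bmeas"
  using F(1) G(1) by (auto intro: borel_measurable_continuous_onI)
 let ?h = "\<lambda>(x, t). indicator {0..1::real} t .* G (x + t .* e)"
 have hm: "?h \<in> borel_measurable (lborel \<Otimes>\<^sub>M lborel)" by measurable
 have hi: "integrable (lborel \<Otimes>\<^sub>M lborel) ?h"
 proof (rule integrableI_bounded_set[of "cball (0::real^'n) (R + 1) \<times> {0..1::real}" _ _ B])
  show "cball (0::real^'n) (R + 1) \<times> {0..1::real} \<in> sets (lborel \<Otimes>\<^sub>M lborel)" by (intro pair_measureI) auto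
  show "emeasure (lborel \<Otimes>\<^sub>M lborel) (cball (0::real^'n) (R + 1) \<times> {0..1::real}) < \<infinity>"
   unfolding lborel_prod by (intro emeasure_compact_finite compact_Times) auto
  show "AE p in lborel \<Otimes>\<^sub>M lborel. p \<in> cball (0::real^'n) (R + 1) \<times> {0..1} --> norm (?h p) <= B"
   using B by (auto simp: indicator_def)
  have "?h p = 0" if "p \<notin> cball (0::real^'n) (R + 1) \<times> {0..1::real}" for p
  proof -
   obtain x t where p: "p = (x, t)" by (cases p) auto
   show ?thesis
   proof (cases "t \<in> {0..1}")
    case True
    then have "R + 1 < norm x" using that p by auto
    moreover have "norm x <= norm (x + t .* e) + norm (t .* e)" using norm_triangle_ineq4[of "x + t .* e" "t .* e"] by simp
    moreover have "norm (t .* e) <= 1" using True e by simp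
    ultimately show ?thesis using G(2)[of "x + t .* e"] by (simp add: p)
   qed (simp add: p)
  qed
  then show "AE p in lborel \<Otimes>\<^sub>M lborel. p \<notin> cball (0::real^'n) (R + 1) \<times> {0..1} --> ?h p = 0" by blast
 qed (rule hm)
 have sw: "(LL t. \<integral>x. ?h (x, t) \<partial>lborel) = (LL x. \<integral>t. ?h (x, t) \<partial>lborel)"
  using lborel_pair.Fubini_integral[of "\<lambda>x t. ?h (x, t)"] hi by (simp add: case_prod_beta')
 have c1: "(LL x. ?h (x, t)) = indicator {0..1} t .* (LL x. G x)" for t
  using integral_lborel_translate[OF Gm, of "t .* e"] by simp
 have c2: "(LL t. ?h (x, t)) = F (x + e) - F x" for x
 proof -
  have "(LL t. indicator {0..1} t .* G (x + t .* e)) = F (x + 1 .* e) - F (x + 0 .* e)"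
  proof (rule integral_FTC_atLeastAtMost)
   show "((\<lambda>t. F (x + t .* e)) has_vector_derivative G (x + t .* e)) (at t within {0..1})" for t
    using d by (rule has_vector_derivative_at_within)
   show "continuous_on {0..1} (\<lambda>t. G (x + t .* e))"
    by (intro continuous_on_compose2[OF G(1)] continuous_intros) auto
  qed simp
  then show ?thesis by simp
 qed
 have c3: "(LL x. F (x + e) - F x) = 0"
 proof -
  have "integrable lborel (\<lambda>x. F (x + e))"
   by (rule integrable_continuous_compact_support[of _ "R + 1"])
     (use F(2) e in \<open>auto intro!: continuous_on_compose2[OF F(1)] continuous_intros, smt (verit) norm_triangle_ineq4 add_diff_cancel_right'\<close>)
  then show ?thesis using Fi integral_lborel_translate[OF Fm, of e] by simp
 qed
 have "(LL t. indicator {0..1::real} t .* (LL x. G x)) = 0"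
  using sw unfolding c1 c2 c3 .
 then show ?thesis by simp
qed

definition ft :: "(real^'n => complex) => real^'n => complex" where
 "ft v xi = (LL x. wave x xi * v x)"

lemma exp_imag_integrable:
 assumes "integrable M v" "v \<in> borel_measurable M" "(\<lambda>x. x \<bullet> xi) \<in> borel_measurable M"
 shows "integrable M (\<lambda>x. wave x xi * v x)"
proof (rule Bochner_Integration.integrable_bound[OF assms(1)])
 have [measurable]: "v \<in> borel_measurable M" "(\<lambda>x. x \<bullet> xi) \<in> borel_measurable M" using assms by auto
 show "(\<lambda>x. wave x xi * v x) \<in> borel_measurable M" by measurable
 show "AE x in M. norm (wave x xi * v x) <= norm (v x)" by (simp add: norm_mult)
qed

text \<open>The integration by parts behind it is the vanishing integral of the i-th derivative of
  the wave times the function.\<close>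

lemma ft_partial:
 fixes u :: "real^'n => complex"
 assumes u: "u \<in> test_functions"
 shows "ft (iter_partial (i # al) u) xi = \<i> * of_real (xi $ i) * ft (iter_partial al u) xi"
proof -
 obtain R where R: "0 < R" "\<And>al x. x \<notin> cball 0 R ==> iter_partial al u x = 0" by (rule test_function_partials[OF u]) blast
 have j: "jet UNIV (\<lambda>al. iter_partial al u)" using u by (intro jet_smooth_on) (simp add: test_functions_def)
 have c: "continuous_on UNIV (iter_partial al u)" for al by (rule jet_continuous_on[OF j])
 let ?v = "iter_partial al u" and ?w = "iter_partial (i # al) u"
 let ?E = "\<lambda>x. wave x xi"
 let ?c = "\<i> * of_real (xi $ i)"
 have cE: "continuous_on UNIV ?E" by (intro continuous_intros)
 have cEv: "continuous_on UNIV (\<lambda>x. ?E x * ?v x)" and cEw: "continuous_on UNIV (\<lambda>x. ?E x * ?w x)"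
  by (intro continuous_on_mult cE c)+
 have "(LL x. ?E x * ?w x - ?c * (?E x * ?v x)) = 0"
 proof (rule integral_directional_derivative_zero[of "\<lambda>x. ?E x * ?v x" R _ "axis i 1"])
  show "continuous_on UNIV (\<lambda>x. ?E x * ?w x - ?c * (?E x * ?v x))"
   by (intro continuous_on_diff continuous_on_mult continuous_on_const cE c)
  show "?E x * ?v x = 0" if "x \<notin> cball 0 R" for x by (simp only: R(2)[OF that] mult_zero_right)
  show "?E x * ?w x - ?c * (?E x * ?v x) = 0" if "x \<notin> cball 0 R" for x by (simp only: R(2)[OF that] mult_zero_right diff_self)
  fix x t
  let ?e = "axis i (1::real) :: real^'n"
  have E: "?E (x + t .* ?e) = exp (- \<i> * of_real (x \<bullet> xi) + of_real t * (- ?c))" for t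
   by (simp add: inner_add_left inner_axis' algebra_simps)
  have "((\<lambda>z. exp (- \<i> * of_real (x \<bullet> xi) + z * (- ?c))) has_field_derivative (- ?c) * exp (- \<i> * of_real (x \<bullet> xi) + of_real t * (- ?c))) (at (of_real t))"
   by (auto intro!: derivative_eq_intros)
  from has_vector_derivative_real_field[OF this]
  have 1: "((\<lambda>t. ?E (x + t .* ?e)) has_vector_derivative (- ?c) * ?E (x + t .* ?e)) (at t)" unfolding E .
  have "((\<lambda>t. ?v (x + t .* ?e)) has_vector_derivative (\<Sum>l\<in>UNIV. (?e $ l) .* iter_partial (l # al) u (x + t .* ?e))) (at t)"
   by (rule jet_vector_derivative[OF j]) simp
  also have "(\<Sum>l\<in>UNIV. (?e $ l) .* iter_partial (l # al) u (x + t .* ?e)) = ?w (x + t .* ?e)"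
  proof -
   have "(\<Sum>l\<in>UNIV. (?e $ l) .* iter_partial (l # al) u (x + t .* ?e)) = (\<Sum>l\<in>UNIV. if l = i then ?w (x + t .* ?e) else 0)"
    by (intro sum.cong refl) (simp add: axis_def)
   then show ?thesis by simp
  qed
  finally have 2: "((\<lambda>t. ?v (x + t .* ?e)) has_vector_derivative ?w (x + t .* ?e)) (at t)" .
  from has_vector_derivative_mult[OF 1 2]
  show "((\<lambda>t. ?E (x + t .* ?e) * ?v (x + t .* ?e)) has_vector_derivative
    ?E (x + t .* ?e) * ?w (x + t .* ?e) - ?c * (?E (x + t .* ?e) * ?v (x + t .* ?e))) (at t)"
   by (rule has_vector_derivative_eq_rhs) (simp only: minus_mult_left[symmetric] mult.assoc add_uminus_conv_diff)
 qed (use cEv in \<open>simp_all\<close>)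
 moreover have "integrable lborel (\<lambda>x. ?E x * ?v x)" 
  by (rule integrable_continuous_compact_support[OF cEv, of R]) (simp add: R(2) del: iter_partial.simps)
 moreover have "integrable lborel (\<lambda>x. ?E x * ?w x)"
  by (rule integrable_continuous_compact_support[OF cEw, of R]) (simp add: R(2) del: iter_partial.simps)
 ultimately have "(LL x. ?E x * ?w x) - ?c * (LL x. ?E x * ?v x) = 0"
  by (simp only: Bochner_Integration.integral_diff integrable_mult_right integral_mult_right_zero)
 then show ?thesis by (simp only: ft_def right_minus_eq)
qed

lemma ft_monomial_bound:
 fixes u :: "real^'n => complex"
 assumes u: "u \<in> test_functions"
 shows "\<exists>B. \<forall>xi. prod_list (map (\<lambda>i. \<bar>xi $ i\<bar>) al) * norm (ft u xi) <= B"
proof -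
 obtain R where R: "0 < R" "\<And>al x. x \<notin> cball 0 R ==> iter_partial al u x = 0" by (rule test_function_partials[OF u]) blast
 have j: "jet UNIV (\<lambda>al. iter_partial al u)" using u by (intro jet_smooth_on) (simp add: test_functions_def)
 have i: "integrable lborel (iter_partial al u)" by (rule integrable_continuous_compact_support[OF jet_continuous_on[OF j] R(2)])
 have "prod_list (map (\<lambda>i. \<bar>xi $ i\<bar>) al) * norm (ft u xi) = norm (ft (iter_partial al u) xi)" for xi
 proof (induction al)
  case (Cons i al)
  have "norm (ft (iter_partial (i # al) u) xi) = \<bar>xi $ i\<bar> * norm (ft (iter_partial al u) xi)"
   unfolding ft_partial[OF u] norm_mult by simp
  then show ?case using Cons by (simp add: mult.assoc del: iter_partial.simps)
 qed simp
 moreover have "norm (ft (iter_partial al u) xi) <= (LL x. norm (iter_partial al u x))" for xi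
 proof -
  have "norm (ft (iter_partial al u) xi) <= (LL x. norm (wave x xi * iter_partial al u x))"
   unfolding ft_def by (rule integral_norm_bound)
  then show ?thesis by (simp add: norm_mult)
 qed
 ultimately show ?thesis by (intro exI[of _ "\<integral>x. norm (iter_partial al u x) \<partial>lborel"]) simp
qed

lemma integrable_prod_inverse_square:
 "integrable lborel (\<lambda>xi::real^'n. \<Prod>i\<in>UNIV. inverse (1 + (xi $ i)^2))"
proof -
 have "integrable lborel (\<lambda>t::real. inverse (1 + t^2))"
  using integrable_inverse_1_plus_square by (simp add: set_integrable_def einterval_def)
 then have "integrable lborel (\<lambda>t::real. complex_of_real (inverse (1 + t^2)))" by (rule integrable_of_real)
 then have "integrable lborel (\<lambda>xi::real^'n. \<Prod>b\<in>Basis. complex_of_real (inverse (1 + (xi \<bullet> b)^2)))"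
  by (rule integral_lborel_prod(2))
 moreover have "(\<Prod>b\<in>Basis. complex_of_real (inverse (1 + (xi \<bullet> b)^2))) = complex_of_real (\<Prod>i\<in>UNIV. inverse (1 + (xi $ i)^2))" for xi :: "real^'n"
 proof -
  have B: "(Basis :: (real^'n) set) = (\<lambda>i. axis i 1) ` UNIV" by (auto simp: Basis_vec_def)
  have "inj (\<lambda>i::'n. axis i (1::real))" by (auto simp: inj_on_def axis_eq_axis)
  then show ?thesis unfolding B by (subst prod.reindex) (auto simp: inner_axis)
 qed
 ultimately have "integrable lborel (\<lambda>xi::real^'n. complex_of_real (\<Prod>i\<in>UNIV. inverse (1 + (xi $ i)^2)))" by (simp only:)
 then show ?thesis by (simp only: complex_of_real_integrable_eq)
qed

text \<open>The product of the 1 + xi_i^2 expands into squared monomials over subsets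
  \<open>J\<close>; each of them times the transform is bounded by \<open>ft_monomial_bound\<close>,
  and the reciprocal of the product is integrable.\<close>

lemma ft_test_integrable:
 fixes u :: "real^'n => complex"
 assumes u: "u \<in> test_functions" and m: "ft u \<in> bmeas"
 shows "integrable lborel (ft u)"
proof -
 have mon: "\<exists>B. \<forall>xi. (\<Prod>i\<in>J. (xi $ i)^2) * norm (ft u xi) <= B" for J :: "'n set"
 proof -
  \<comment> \<open>Listing every index of \<open>J\<close> twice produces the squares.\<close>
  have "\<exists>al. \<forall>xi::real^'n. prod_list (map (\<lambda>i. \<bar>xi $ i\<bar>) al) = (\<Prod>i\<in>J. (xi $ i)^2)"
  proof (induction J rule: finite_induct[OF finite])
   case 1
   show ?case by (intro exI[of _ "[]"]) simp
  next
   case (2 i J)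
   then obtain al where "\<forall>xi::real^'n. prod_list (map (\<lambda>i. \<bar>xi $ i\<bar>) al) = (\<Prod>i\<in>J. (xi $ i)^2)" by blast
   then show ?case using 2 by (intro exI[of _ "i # i # al"]) (simp add: power2_eq_square mult.assoc[symmetric])
  qed
  then show ?thesis using ft_monomial_bound[OF u] by metis
 qed
 then obtain B where B: "\<And>J xi. (\<Prod>i\<in>J. (xi $ i)^2) * norm (ft u xi) <= B J" by metis
 let ?p = "\<lambda>xi::real^'n. \<Prod>i\<in>UNIV. inverse (1 + (xi $ i)^2)"
 have bd: "norm (ft u xi) <= (\<Sum>J\<in>Pow UNIV. B J) * ?p xi" for xi
 proof -
  have pos: "0 < (\<Prod>i\<in>UNIV. (xi $ i)^2 + 1)" by (intro prod_pos) (simp add: add_nonneg_pos)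
  have "(\<Prod>i\<in>UNIV. (xi $ i)^2 + 1) * norm (ft u xi) = (\<Sum>J\<in>Pow UNIV. (\<Prod>i\<in>J. (xi $ i)^2) * norm (ft u xi))"
   by (simp add: prod_add sum_distrib_right)
  also have "\<dots> <= (\<Sum>J\<in>Pow UNIV. B J)" by (intro sum_mono B)
  finally have "norm (ft u xi) <= (\<Sum>J\<in>Pow UNIV. B J) / (\<Prod>i\<in>UNIV. (xi $ i)^2 + 1)"
   using pos by (simp add: pos_le_divide_eq mult.commute)
  also have "\<dots> = (\<Sum>J\<in>Pow UNIV. B J) * ?p xi"
   by (simp add: divide_inverse prod_inversef[symmetric] add.commute)
  finally show ?thesis .
 qed
 have "integrable lborel (\<lambda>xi. (\<Sum>J\<in>Pow UNIV. B J) * ?p xi)" by (intro integrable_mult_right integrable_prod_inverse_square)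
 then show ?thesis
 proof (rule Bochner_Integration.integrable_bound)
  show "AE xi in lborel. norm (ft u xi) <= norm ((\<Sum>J\<in>Pow UNIV. B J) * ?p xi)"
   using bd by (intro always_eventually allI) (metis abs_ge_self order_trans real_norm_def)
 qed (use m in simp)
qed

section \<open>The extended operator\<close>

lemma L2_iff:
 fixes u :: "real^'n => complex"
 shows "u \<in> L2 \<longleftrightarrow> u \<in> borel_measurable lebesgue \<and> (\<integral>\<^sup>+x. sqn (u x) \<partial>lebesgue) < \<top>"
proof -
 have "integrable lebesgue (\<lambda>x. (norm (u x))^2) \<longleftrightarrow> (\<integral>\<^sup>+x. sqn (u x) \<partial>lebesgue) < \<top>" if "u \<in> borel_measurable lebesgue"
 proof -
  have "(\<lambda>x. (norm (u x))^2) \<in> borel_measurable lebesgue" using that by measurable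
  then show ?thesis by (simp add: integrable_iff_bounded)
 qed
 then show ?thesis unfolding L2_def by blast
qed

lemma L2_nn_integral:
 fixes u :: "real^'n => complex"
 assumes "u \<in> L2"
 shows "(\<integral>\<^sup>+x. sqn (u x) \<partial>lebesgue) = ennreal ((L2_norm u)^2)"
proof -
 have i: "integrable lebesgue (\<lambda>x. (norm (u x))^2)" using assms by (simp add: L2_def)
 have "0 <= (LINT x|lebesgue. (norm (u x))^2)" by (rule Bochner_Integration.integral_nonneg) simp
 then show ?thesis unfolding L2_norm_def by (simp add: nn_integral_eq_integral[OF i])
qed

lemma L2I:
 fixes u :: "real^'n => complex"
 assumes u: "u \<in> borel_measurable lebesgue" and c: "0 <= c" and le: "(\<integral>\<^sup>+x. sqn (u x) \<partial>lebesgue) <= ennreal (c^2)"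
 shows "u \<in> L2" "L2_norm u <= c"
proof -
 show u2: "u \<in> L2" unfolding L2_iff using u le by (auto intro: le_less_trans)
 have "(L2_norm u)^2 <= c^2" using le unfolding L2_nn_integral[OF u2] by simp
 then show "L2_norm u <= c" using c by (rule power2_le_imp_le)
qed

lemma test_function_bounds:
 fixes \<psi> :: "real^'n => complex"
 assumes "\<psi> \<in> test_functions"
 obtains B R where "0 <= B" "0 < R" "\<And>x. norm (\<psi> x) <= B * indicator (cube 0 R) x" "\<psi> \<in> bmeas"
  "\<And>x. x \<notin> cball 0 R ==> \<psi> x = 0"
proof -
 obtain R where R: "0 < R" "\<And>al x. x \<notin> cball 0 R ==> iter_partial al \<psi> x = 0" using test_function_partials[OF assms] by metis
 have j: "jet UNIV (\<lambda>al. iter_partial al \<psi>)" using assms by (intro jet_smooth_on) (simp add: test_functions_def)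
 have c: "continuous_on UNIV \<psi>" using jet_continuous_on[OF j, of "[]"] by simp
 have z: "\<And>x. x \<notin> cball 0 R ==> \<psi> x = 0" using R(2)[of _ "[]"] by simp
 obtain B where B: "0 <= B" "\<And>x. norm (\<psi> x) <= B" using integrable_continuous_compact_support(2)[OF c z] by blast
 have "x \<in> cube 0 R" if "x \<in> cball 0 R" for x :: "real^'n"
  using that component_le_norm_cart[of x] unfolding cube_def by (auto intro: order_trans)
 then have "norm (\<psi> x) <= B * indicator (cube 0 R) x" for x
  using B z[of x] by (cases "x \<in> cball 0 R") (auto simp: indicator_def)
 then show thesis using that[of B R] B(1) R(1) z borel_measurable_continuous_onI[OF c] by blast
qed

lemma cube_lebesgue: "cube zeta R \<in> sets lebesgue"
 by (rule sets_completionI_sets) simp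

lemma mult_test_L2:
 fixes \<psi> f :: "real^'n => complex"
 assumes \<psi>: "\<And>x. norm (\<psi> x) <= B * indicator E x" "\<psi> \<in> bmeas" "0 <= B" and f: "f \<in> borel_measurable lebesgue"
  and c: "0 <= c" and le: "(\<integral>\<^sup>+x\<in>E. sqn (f x) \<partial>lebesgue) <= ennreal (c^2)" and E: "E \<in> sets lebesgue"
 shows "(\<lambda>x. \<psi> x * f x) \<in> L2" "L2_norm (\<lambda>x. \<psi> x * f x) <= B * c"
proof -
 have \<psi>m: "\<psi> \<in> borel_measurable lebesgue" using \<psi>(2) by (intro measurable_completion) simp
 have m: "(\<lambda>x. \<psi> x * f x) \<in> borel_measurable lebesgue" using \<psi>m f by (rule borel_measurable_times)
 have "(\<integral>\<^sup>+x. sqn (\<psi> x * f x) \<partial>lebesgue) <= (\<integral>\<^sup>+x. ennreal (B^2) * (sqn (f x) * indicator E x) \<partial>lebesgue)"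
 proof (rule nn_integral_mono)
  fix x
  show "sqn (\<psi> x * f x) <= ennreal (B^2) * (sqn (f x) * indicator E x)"
  proof (cases "x \<in> E")
   case True
   have "(norm (\<psi> x))^2 <= B^2" using \<psi>(1)[of x] True by (intro power_mono) auto
   then have "(norm (\<psi> x * f x))^2 <= B^2 * (norm (f x))^2" by (simp add: norm_mult power_mult_distrib mult_right_mono)
   then have "sqn (\<psi> x * f x) <= ennreal (B^2 * (norm (f x))^2)" by (rule ennreal_leI)
   then show ?thesis using True by (simp add: ennreal_mult)
  next
   case False
   then have "\<psi> x = 0" using \<psi>(1)[of x] by simp
   then show ?thesis by simp
  qed
 qed
 also have "\<dots> = ennreal (B^2) * (\<integral>\<^sup>+x\<in>E. sqn (f x) \<partial>lebesgue)"
 proof (rule nn_integral_cmult)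
  have [measurable]: "f \<in> borel_measurable lebesgue" "E \<in> sets lebesgue" using f E by auto
  show "(\<lambda>x. sqn (f x) * indicator E x) \<in> borel_measurable lebesgue" by measurable
 qed
 also have "\<dots> <= ennreal (B^2) * ennreal (c^2)" by (rule mult_left_mono[OF le]) simp
 also have "\<dots> = ennreal ((B * c)^2)" by (simp add: ennreal_mult power_mult_distrib)
 finally have le2: "(\<integral>\<^sup>+x. sqn (\<psi> x * f x) \<partial>lebesgue) <= ennreal ((B * c)^2)" .
 show "(\<lambda>x. \<psi> x * f x) \<in> L2" "L2_norm (\<lambda>x. \<psi> x * f x) <= B * c"
  using L2I[OF m _ le2] \<psi>(3) c by simp_all
qed

text \<open>Elements of \<open>L2_comp\<close> are Lebesgue measurable and vanish off a compact set
  only almost everywhere, while \<open>plancherel_bound\<close> asks for a Borel function that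
  vanishes everywhere off a ball; hence the passage to a representative.\<close>

lemma L2_comp_fourier:
 fixes u :: "real^'n => complex"
 assumes u: "u \<in> L2_comp"
 shows "fourier u \<in> bmeas"
  and "(NN xi. sqn (fourier u xi)) <= ennreal ((2 * pi) ^ CARD('n) * (L2_norm u)^2)"
  and "integrable lebesgue u"
proof -
 have uL: "u \<in> L2" and um: "u \<in> borel_measurable lebesgue" using u by (auto simp: L2_comp_def L2_def)
 obtain K where K: "compact K" "AE x in lebesgue. x \<notin> K --> u x = 0" using u by (auto simp: L2_comp_def)
 obtain R where "\<forall>x\<in>K. norm x <= R" using compact_imp_bounded[OF K(1)] unfolding bounded_iff by blast
 then have R: "K \<subseteq> cball 0 R" by auto
 obtain g where g: "g \<in> bmeas" "AE x in lborel. u x = g x" using lebesgue_ex_borel_complex[OF um] by blast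
 \<comment> \<open>A Borel representative cut off to a ball, so that its support condition holds
   everywhere.\<close>
 define v where "v = (\<lambda>x. of_real (indicator (cball 0 R) x) * g x)"
 have vm[measurable]: "v \<in> bmeas"
 proof -
  have [measurable]: "cball (0::real^'n) R \<in> sets borel" by (rule borel_closed) simp
  show ?thesis unfolding v_def using g(1) by measurable
 qed
 have ae: "AE x in lebesgue. u x = v x"
  using AE_completion[OF g(2)] K(2) by eventually_elim (use R in \<open>auto simp: v_def indicator_def\<close>)
 have vL: "v \<in> borel_measurable lebesgue" using vm by (intro measurable_completion) simp
 have "(NN x. sqn (v x)) = (\<integral>\<^sup>+x. sqn (v x) \<partial>lebesgue)"
  by (simp only: nn_integral_completion)
 also have "\<dots> = (\<integral>\<^sup>+x. sqn (u x) \<partial>lebesgue)" using ae by (intro nn_integral_cong_AE) (auto elim!: eventually_mono)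
 also have "\<dots> = ennreal ((L2_norm u)^2)" by (rule L2_nn_integral[OF uL])
 finally have v2: "(NN x. sqn (v x)) = ennreal ((L2_norm u)^2)" .
 have v0: "\<And>x. x \<notin> cball 0 R ==> v x = 0" by (simp add: v_def)
 have vfin: "(NN x. sqn (v x)) < \<top>" by (simp add: v2)
 note pl = plancherel_bound[OF vm v0 vfin]
 have uf: "fourier u = (\<lambda>xi. \<integral>x. wave x xi * v x \<partial>lborel)"
 proof
  fix xi :: "real^'n"
  have m: "(\<lambda>x. wave x xi * v x) \<in> borel_measurable lborel" by measurable
  have em: "(\<lambda>x. wave x xi) \<in> borel_measurable lebesgue"
  proof (rule measurable_completion)
   show "(\<lambda>x. wave x xi) \<in> borel_measurable lborel" by measurable
  qed
  have "fourier u xi = (LINT x|lebesgue. wave x xi * v x)"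
   unfolding fourier_def
  proof (rule integral_cong_AE)
   show "(\<lambda>x. wave x xi * u x) \<in> borel_measurable lebesgue" using em um by (rule borel_measurable_times)
   show "(\<lambda>x. wave x xi * v x) \<in> borel_measurable lebesgue" using em vL by (rule borel_measurable_times)
   show "AE x in lebesgue. wave x xi * u x = wave x xi * v x"
    using ae by (rule eventually_mono) simp
  qed
  also have "\<dots> = (LL x. wave x xi * v x)" by (rule integral_completion[OF m])
  finally show "fourier u xi = (LL x. wave x xi * v x)" .
 qed
 show "fourier u \<in> bmeas" unfolding uf by (rule pl(3))
 show "(NN xi. sqn (fourier u xi)) <= ennreal ((2 * pi) ^ CARD('n) * (L2_norm u)^2)"
  using pl(1) unfolding uf v2 by (simp add: ennreal_mult)
 have "integrable lebesgue v" using pl(2) by (simp add: integrable_completion)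
 then show "integrable lebesgue u"
  by (rule integrable_cong_AE_imp[OF _ um]) (use ae in \<open>auto elim!: eventually_mono\<close>)
qed

lemma fourier_linear:
 fixes u v :: "real^'n => complex" and c d :: complex
 assumes "u \<in> L2_comp" "v \<in> L2_comp"
 shows "fourier (\<lambda>z. c * u z + d * v z) xi = c * fourier u xi + d * fourier v xi"
proof -
 have xm: "(\<lambda>x::real^'n. x \<bullet> xi) \<in> borel_measurable lebesgue"
 proof (rule measurable_completion)
  show "(\<lambda>x::real^'n. x \<bullet> xi) \<in> borel_measurable lborel" by measurable
 qed
 have i: "integrable lebesgue (\<lambda>x. wave x xi * w x)" if "w \<in> L2_comp" for w
  using L2_comp_fourier(3)[OF that] by (intro exp_imag_integrable xm) auto
 have "(LINT x|lebesgue. wave x xi * (c * u x + d * v x)) =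
   (LINT x|lebesgue. c * (wave x xi * u x) + d * (wave x xi * v x))"
  by (intro Bochner_Integration.integral_cong refl) (simp add: algebra_simps)
 also have "\<dots> = c * (LINT x|lebesgue. wave x xi * u x) + d * (LINT x|lebesgue. wave x xi * v x)"
  using i[OF assms(1)] i[OF assms(2)] by (simp only: Bochner_Integration.integral_add integrable_mult_right integral_mult_right_zero)
 finally show ?thesis unfolding fourier_def .
qed

section \<open>The extension as a series of dyadic pieces\<close>

context clean_fio
begin

definition pieceT :: "(real^'n => complex) => nat => real^'n => complex" where
 "pieceT g j = opT (\<lambda>xi. of_real (indicator (dyadic j) xi) * g xi)"

text \<open>For a general compactly supported \<open>u\<close> the transform need not be integrable,
  so the frequency integral is replaced by the series over shells, which converges for almost every
  \<open>x\<close>.\<close>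

definition extT :: "(real^'n => complex) => real^'n => complex" where
 "extT u x = of_real (1 / (2 * pi) ^ CARD('n)) * (\<Sum>j. pieceT (fourier u) j x)"

lemma pieceT_measurable: "g \<in> bmeas ==> pieceT g j \<in> bmeas"
 unfolding pieceT_def by (intro opT_measurable) measurable

lemma extT_measurable:
 assumes "u \<in> L2_comp"
 shows "extT u \<in> bmeas"
proof -
 have [measurable]: "\<And>j. pieceT (fourier u) j \<in> bmeas" by (rule pieceT_measurable[OF L2_comp_fourier(1)[OF assms]])
 show ?thesis unfolding extT_def by measurable
qed

lemma extT_bound:
 assumes R: "0 <= R"
 shows "\<exists>K\<ge>0. \<forall>u\<in>L2_comp. (AE x in lborel. x \<in> cube 0 R --> summable (\<lambda>j. norm (pieceT (fourier u) j x))) \<and>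
   (\<integral>\<^sup>+x\<in>cube 0 R. sqn (extT u x) \<partial>lborel) <= ennreal ((K * L2_norm u)^2)"
proof -
 obtain K q where K: "0 <= K" and q: "0 < q" "q < 1" and dec: "\<And>j f. f \<in> bmeas ==> (NN xi. sqn (f xi)) < \<top> ==>
   (\<integral>\<^sup>+x\<in>cube 0 R. sqn (opT (\<lambda>xi. of_real (indicator (dyadic j) xi) * f xi) x) \<partial>lborel)
    <= ennreal (K * q ^ j) * (NN xi. sqn (f xi))"
  using dyadic_decay[OF R] by blast
 let ?c = "1 / (2 * pi) ^ CARD('n)"
 let ?K2 = "?c^2 * (K / (1 - sqrt q)^2 * (2 * pi) ^ CARD('n))"
 have K2: "0 <= ?K2" using K by simp
 show ?thesis
 proof (intro exI[of _ "sqrt ?K2"] conjI ballI)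
  show "0 <= sqrt ?K2" using K2 by simp
  fix u :: "real^'n => complex" assume u: "u \<in> L2_comp"
  note F = L2_comp_fourier[OF u]
  have fin: "(NN xi. sqn (fourier u xi)) < \<top>" using F(2) by (rule le_less_trans) simp
  have pm: "\<And>j. pieceT (fourier u) j \<in> bmeas" by (rule pieceT_measurable[OF F(1)])
  have bd: "\<And>j. (\<integral>\<^sup>+x\<in>cube 0 R. sqn (pieceT (fourier u) j x) \<partial>lborel) <= ennreal (K * q ^ j) * (NN xi. sqn (fourier u xi))"
   unfolding pieceT_def by (rule dec[OF F(1) fin])
  note D = dyadic_sum_bound[OF pm cube_sets K q bd fin]
  show "AE x in lborel. x \<in> cube 0 R --> summable (\<lambda>j. norm (pieceT (fourier u) j x))" by (rule D(1))
  have "(\<integral>\<^sup>+x\<in>cube 0 R. sqn (extT u x) \<partial>lborel) =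
   (NN x. ennreal (?c^2) * (sqn (\<Sum>j. pieceT (fourier u) j x) * indicator (cube 0 R) x))"
  proof (rule nn_integral_cong)
   fix x
   have "(norm (extT u x))^2 = ?c^2 * (norm (\<Sum>j. pieceT (fourier u) j x))^2"
    unfolding extT_def norm_mult norm_of_real power_mult_distrib power2_abs ..
   then have "sqn (extT u x) = ennreal (?c^2) * sqn (\<Sum>j. pieceT (fourier u) j x)"
    by (simp only:) (rule ennreal_mult, simp_all only: zero_le_power2)
   then show "sqn (extT u x) * indicator (cube 0 R) x = ennreal (?c^2) * (sqn (\<Sum>j. pieceT (fourier u) j x) * indicator (cube 0 R) x)"
    by (simp only: mult.assoc)
  qed
  also have "\<dots> = ennreal (?c^2) * (\<integral>\<^sup>+x\<in>cube 0 R. sqn (\<Sum>j. pieceT (fourier u) j x) \<partial>lborel)"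
  proof (rule nn_integral_cmult)
   have [measurable]: "\<And>j. pieceT (fourier u) j \<in> bmeas" by (rule pm)
   show "(\<lambda>x. sqn (\<Sum>j. pieceT (fourier u) j x) * indicator (cube 0 R) x) \<in> borel_measurable lborel" by measurable
  qed
  also have "\<dots> <= ennreal (?c^2) * (ennreal (K / (1 - sqrt q)^2) * ennreal ((2 * pi) ^ CARD('n) * (L2_norm u)^2))"
   by (intro mult_left_mono order_trans[OF D(2)] F(2)) simp_all
  also have "\<dots> = ennreal (?c^2 * (K / (1 - sqrt q)^2 * ((2 * pi) ^ CARD('n) * (L2_norm u)^2)))"
  proof -
   have 1: "ennreal (K / (1 - sqrt q)^2) * ennreal ((2 * pi) ^ CARD('n) * (L2_norm u)^2) = ennreal (K / (1 - sqrt q)^2 * ((2 * pi) ^ CARD('n) * (L2_norm u)^2))"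
    by (rule ennreal_mult[symmetric]) (use K in auto)
   show ?thesis unfolding 1 by (rule ennreal_mult[symmetric]) (use K in auto)
  qed
  also have "?c^2 * (K / (1 - sqrt q)^2 * ((2 * pi) ^ CARD('n) * (L2_norm u)^2)) = (sqrt ?K2 * L2_norm u)^2"
  proof -
   have "(sqrt ?K2 * L2_norm u)^2 = ?K2 * (L2_norm u)^2"
    unfolding power_mult_distrib[of "sqrt ?K2" "L2_norm u"] real_sqrt_pow2[OF K2] ..
   then show ?thesis by (simp only: mult.assoc)
  qed
  finally show "(\<integral>\<^sup>+x\<in>cube 0 R. sqn (extT u x) \<partial>lborel) <= ennreal ((sqrt ?K2 * L2_norm u)^2)" .
 qed
qed

text \<open>Countably many cubes exhaust the space, so the local statement of
  \<open>extT_bound\<close> holds almost everywhere.\<close>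

lemma pieceT_summable:
 assumes u: "u \<in> L2_comp"
 shows "AE x in lborel. summable (\<lambda>j. norm (pieceT (fourier u) j x))"
proof -
 have "AE x in lborel. \<forall>R::nat. x \<in> cube 0 (real R) --> summable (\<lambda>j. norm (pieceT (fourier u) j x))"
 proof (subst AE_all_countable, rule allI)
  fix R :: nat
  show "AE x in lborel. x \<in> cube 0 (real R) --> summable (\<lambda>j. norm (pieceT (fourier u) j x))"
   using extT_bound[of "real R"] u by force
 qed
 then show ?thesis
 proof (rule eventually_mono)
  fix x :: "real^'n" assume a: "\<forall>R::nat. x \<in> cube 0 (real R) --> summable (\<lambda>j. norm (pieceT (fourier u) j x))"
  obtain R :: nat where R: "norm x <= real R" using real_arch_simple by blast
  have "x \<in> cube 0 (real R)" unfolding cube_def using component_le_norm_cart[of x] R by (auto intro: order_trans)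
  then show "summable (\<lambda>j. norm (pieceT (fourier u) j x))" using a by blast
 qed
qed

lemma pieceT_linear:
 fixes u v :: "real^'n => complex" and c c' :: complex
 assumes u: "u \<in> L2_comp" and v: "v \<in> L2_comp"
 shows "pieceT (fourier (\<lambda>z. c * u z + c' * v z)) j x = c * pieceT (fourier u) j x + c' * pieceT (fourier v) j x"
proof -
 let ?e = "\<lambda>xi. exp (\<i> * of_real (P x [] xi)) * a x [] xi"
 let ?g = "\<lambda>w xi. of_real (indicator (dyadic j) xi) * fourier w xi :: complex"
 have i: "integrable lborel (\<lambda>xi. ?e xi * ?g w xi)" if w: "w \<in> L2_comp" for w
 proof (rule opT_integrable, rule integrable_L2_bounded_support[where R="2 ^ Suc j"])
  have [measurable]: "fourier w \<in> bmeas" by (rule L2_comp_fourier(1)[OF w])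
  show "?g w \<in> bmeas" by measurable
  have "(NN xi. sqn (?g w xi)) <= (NN xi. sqn (fourier w xi))"
   by (intro nn_integral_mono) (auto simp: indicator_def)
  also have "\<dots> < \<top>" using L2_comp_fourier(2)[OF w] by (rule le_less_trans) simp
  finally show "(NN xi. sqn (?g w xi)) < \<top>" .
  show "norm xi <= 2 ^ Suc j" if "?g w xi ~= 0" for xi using that by (auto simp: indicator_def dyadic_def split: if_splits)
 qed
 have "pieceT (fourier (\<lambda>z. c * u z + c' * v z)) j x = (LL xi. c * (?e xi * ?g u xi) + c' * (?e xi * ?g v xi))"
  unfolding pieceT_def opT_def fourier_linear[OF u v] by (intro Bochner_Integration.integral_cong refl) (simp add: algebra_simps)
 also have "\<dots> = c * (LL xi. ?e xi * ?g u xi) + c' * (LL xi. ?e xi * ?g v xi)"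
  using i[OF u] i[OF v] by (simp only: Bochner_Integration.integral_add integrable_mult_right integral_mult_right_zero)
 finally show ?thesis by (simp only: pieceT_def opT_def)
qed

text \<open>Countable additivity of the integral over the disjoint shells; this is where the
  extension is seen to agree with the given operator when the transform is integrable.\<close>

lemma opT_sum_dyadic:
 assumes f: "integrable lborel f"
 shows "opT f x = (\<Sum>j. pieceT f j x)"
proof -
 let ?h = "\<lambda>xi. exp (\<i> * of_real (P x [] xi)) * a x [] xi * f xi"
 have h: "integrable lborel ?h" by (rule opT_integrable[OF f])
 have U: "(\<Union>j. dyadic j) = (UNIV :: (real^'n) set)"
 proof -
  have "\<exists>j. xi \<in> dyadic j" for xi :: "real^'n"
  proof -
   define j where "j = (LEAST j. norm xi < 2 ^ Suc j)"
   obtain k :: nat where "norm xi < 2 ^ k" using real_arch_pow[of 2 "norm xi"] by auto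
   also have "(2::real) ^ k <= 2 ^ Suc k" by (rule power_increasing) auto
   finally have j: "norm xi < 2 ^ Suc j" unfolding j_def by (rule LeastI[of "\<lambda>j. norm xi < 2 ^ Suc j"])
   have "j = 0 \<or> 2 ^ j <= norm xi"
   proof (cases j)
    case (Suc i)
    then have "\<not> norm xi < 2 ^ Suc i" using not_less_Least[of i "\<lambda>j. norm xi < 2 ^ Suc j"] by (simp add: j_def)
    then show ?thesis using Suc by simp
   qed simp
   then show ?thesis using j by (intro exI[of _ j]) (simp add: dyadic_def)
  qed
  then show ?thesis by blast
 qed
 have dj: "dyadic i \<inter> dyadic j = ({} :: (real^'n) set)" if "i < j" for i j
 proof -
  have "(2::real) ^ Suc i <= 2 ^ j" using that by (intro power_increasing) auto
  have "xi \<notin> dyadic j" if "xi \<in> dyadic i" for xi :: "real^'n"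
  proof
   assume "xi \<in> dyadic j"
   then have "2 ^ j <= norm xi" using \<open>i < j\<close> by (simp add: dyadic_def)
   moreover have "norm xi < 2 ^ Suc i" using that unfolding dyadic_def by (simp only: mem_Collect_eq)
   ultimately show False using \<open>(2::real) ^ Suc i <= 2 ^ j\<close> by linarith
  qed
  then show ?thesis by blast
 qed
 have "(LINT xi:(\<Union>j. dyadic j)|lborel. ?h xi) = (\<Sum>j. (LINT xi:dyadic j|lborel. ?h xi))"
 proof (rule lebesgue_integral_countable_add)
  show "dyadic i \<inter> dyadic j = ({} :: (real^'n) set)" if "i ~= j" for i j
   using dj[of i j] dj[of j i] that by (cases "i < j") auto
  show "set_integrable lborel (\<Union>j. dyadic j) ?h" unfolding U set_integrable_def using h by simp
 qed simp
 moreover have "(LINT xi:dyadic j|lborel. ?h xi) = pieceT f j x" for j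
  unfolding pieceT_def opT_def set_lebesgue_integral_def
  by (intro Bochner_Integration.integral_cong refl) (simp add: scaleR_conv_of_real mult_ac)
 ultimately show ?thesis unfolding U by (simp add: opT_def set_lebesgue_integral_def)
qed

lemma extT_bounded: "bounded_L2_comp_loc extT"
 unfolding bounded_L2_comp_loc_def
proof (intro conjI ballI allI)
 fix u :: "real^'n => complex" assume u: "u \<in> L2_comp"
 have Sm: "extT u \<in> borel_measurable lebesgue" using extT_measurable[OF u] by (intro measurable_completion) simp
 show "extT u \<in> L2_loc"
  unfolding L2_loc_def
 proof (intro CollectI conjI ballI Sm)
  fix \<psi> :: "real^'n => complex" assume "\<psi> \<in> test_functions"
  then obtain B R where B: "0 <= B" "0 < R" "\<And>x. norm (\<psi> x) <= B * indicator (cube 0 R) x" "\<psi> \<in> bmeas"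
   by (rule test_function_bounds) blast
  obtain K where K: "0 <= K" "(\<integral>\<^sup>+x\<in>cube 0 R. sqn (extT u x) \<partial>lborel) <= ennreal ((K * L2_norm u)^2)"
   using extT_bound[of R] B(2) u by force
  have n0: "0 <= L2_norm u" unfolding L2_norm_def by simp
  show "(\<lambda>x. \<psi> x * extT u x) \<in> L2"
   by (rule mult_test_L2(1)[OF B(3,4,1) Sm, of "K * L2_norm u"]) (use K n0 in \<open>auto simp: nn_integral_completion cube_lebesgue\<close>)
 qed
next
 fix u v :: "real^'n => complex" and c c' :: complex
 assume u: "u \<in> L2_comp" and v: "v \<in> L2_comp"
 have "AE x in lborel. extT (\<lambda>z. c * u z + c' * v z) x = c * extT u x + c' * extT v x"
  using pieceT_summable[OF u] pieceT_summable[OF v]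
 proof eventually_elim
  case (elim x)
  have s: "summable (\<lambda>j. pieceT (fourier u) j x)" "summable (\<lambda>j. pieceT (fourier v) j x)"
   using elim by (auto intro: summable_norm_cancel)
  have "(\<Sum>j. c * pieceT (fourier u) j x + c' * pieceT (fourier v) j x) = c * (\<Sum>j. pieceT (fourier u) j x) + c' * (\<Sum>j. pieceT (fourier v) j x)"
   using s by (simp add: suminf_add[symmetric] suminf_mult summable_mult)
  then show ?case unfolding extT_def pieceT_linear[OF u v] by (simp add: algebra_simps)
 qed
 then show "AE x in lebesgue. extT (\<lambda>z. c * u z + c' * v z) x = c * extT u x + c' * extT v x"
  by (rule AE_completion)
next
 fix \<psi>1 \<psi>2 :: "real^'n => complex" assume "\<psi>1 \<in> test_functions" and p2: "\<psi>2 \<in> test_functions"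
 then obtain B R where B: "0 <= B" "0 < R" "\<And>x. norm (\<psi>1 x) <= B * indicator (cube 0 R) x" "\<psi>1 \<in> bmeas"
  by (elim test_function_bounds) blast
 obtain B2 R2 where B2: "0 <= B2" "0 < R2" "\<And>x. norm (\<psi>2 x) <= B2 * indicator (cube 0 R2) x" "\<psi>2 \<in> bmeas"
   "\<And>x. x \<notin> cball 0 R2 ==> \<psi>2 x = 0"
  using p2 by (elim test_function_bounds) blast
 obtain K where K: "0 <= K" "\<And>u. u \<in> L2_comp ==> (\<integral>\<^sup>+x\<in>cube 0 R. sqn (extT u x) \<partial>lborel) <= ennreal ((K * L2_norm u)^2)"
  using extT_bound[of R] B(2) by (meson less_imp_le)
 show "\<exists>C. \<forall>u\<in>L2. (\<lambda>x. \<psi>1 x * extT (\<lambda>z. \<psi>2 z * u z) x) \<in> L2 \<and> L2_norm (\<lambda>x. \<psi>1 x * extT (\<lambda>z. \<psi>2 z * u z) x) <= C * L2_norm u"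
 proof (intro exI[of _ "B * (K * B2)"] ballI)
  fix u :: "real^'n => complex" assume u: "u \<in> L2"
  have um: "u \<in> borel_measurable lebesgue" using u by (simp add: L2_def)
  have n0: "0 <= L2_norm w" for w :: "real^'n => complex" unfolding L2_norm_def by simp
  let ?w = "\<lambda>z. \<psi>2 z * u z"
  have "(\<integral>\<^sup>+x\<in>cube 0 R2. sqn (u x) \<partial>lebesgue) <= (\<integral>\<^sup>+x. sqn (u x) \<partial>lebesgue)"
   by (intro nn_integral_mono) (auto simp: indicator_def)
  then have le: "(\<integral>\<^sup>+x\<in>cube 0 R2. sqn (u x) \<partial>lebesgue) <= ennreal ((L2_norm u)^2)" by (simp only: L2_nn_integral[OF u])
  note w = mult_test_L2[OF B2(3,4,1) um n0 le cube_lebesgue]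
  have wc: "?w \<in> L2_comp" unfolding L2_comp_def
   using w(1) B2(5) by (auto intro!: exI[of _ "cball 0 R2"])
  have Sm: "extT ?w \<in> borel_measurable lebesgue" using extT_measurable[OF wc] by (intro measurable_completion) simp
  have le2: "(\<integral>\<^sup>+x\<in>cube 0 R. sqn (extT ?w x) \<partial>lebesgue) <= ennreal ((K * L2_norm ?w)^2)"
   using K(2)[OF wc] by (simp only: nn_integral_completion)
  note r = mult_test_L2[OF B(3,4,1) Sm mult_nonneg_nonneg[OF K(1) n0] le2 cube_lebesgue]
  have "B * (K * L2_norm ?w) <= B * (K * (B2 * L2_norm u))"
   by (intro mult_left_mono w(2) B(1) K(1))
  then show "(\<lambda>x. \<psi>1 x * extT ?w x) \<in> L2 \<and> L2_norm (\<lambda>x. \<psi>1 x * extT ?w x) <= B * (K * B2) * L2_norm u"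
   using r by (simp add: mult.assoc)
 qed
qed

end

lemma test_function_L2_comp:
 fixes u :: "real^'n => complex"
 assumes "u \<in> test_functions"
 shows "u \<in> L2_comp"
proof -
 obtain B R where B: "0 <= B" "0 < R" "\<And>x. norm (u x) <= B * indicator (cube 0 R) x" "u \<in> bmeas"
   "\<And>x. x \<notin> cball 0 R ==> u x = 0"
  using assms by (elim test_function_bounds) blast
 have um: "u \<in> borel_measurable lebesgue" using B(4) by (intro measurable_completion) simp
 have "(\<integral>\<^sup>+x. sqn (u x) \<partial>lebesgue) <= (NN x. ennreal (B^2) * indicator (cube (0::real^'n) R) x)"
  unfolding nn_integral_completion
 proof (rule nn_integral_mono)
  fix x
  show "sqn (u x) <= ennreal (B^2) * indicator (cube 0 R) x"
   using B(3)[of x] by (cases "x \<in> cube 0 R") (auto intro!: ennreal_leI power_mono)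
 qed
 also have "\<dots> = ennreal (B^2) * emeasure lborel (cube (0::real^'n) R)" by (rule nn_integral_cmult_indicator) simp
 also have "\<dots> < \<top>" using B(2) by (simp add: emeasure_cube ennreal_mult_less_top)
 finally have "u \<in> L2" unfolding L2_iff using um by blast
 then show ?thesis unfolding L2_comp_def using B(5) by (auto intro!: exI[of _ "cball 0 R"])
qed

theorem mainTheorem3:
  fixes a :: "real^'n \<Rightarrow> real^'n \<Rightarrow> complex"
    and \<phi> :: "real^'n \<Rightarrow> real^'n \<Rightarrow> real"
    and m \<rho> :: real and k :: nat
  assumes "0 \<le> \<rho>" and "\<rho> \<le> 1"
    and "k < CARD('n)"
    and "a \<in> Linf_S m \<rho>"
    and "\<phi> \<in> Linf_Phi 2"
    and "rough_corank k a \<phi>"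
    and "m < - (real CARD('n) + real k - 1) / 4 + (real CARD('n) - real k) * (\<rho> - 1) / 2"
  shows "extends_to_bounded_L2_comp_loc (FIO a \<phi>)"
proof (rule clean_exists[OF assms], goal_cases)
 case (1 a' P Xi cg r0)
 interpret clean_fio a' P Xi m \<rho> cg r0 "CARD('n) - k" by (rule 1(1))
 show ?case
  unfolding extends_to_bounded_L2_comp_loc_def
 proof (intro exI[of _ extT] conjI ballI extT_bounded)
  fix u :: "real^'n => complex" assume u: "u \<in> test_functions"
  have uc: "u \<in> L2_comp" by (rule test_function_L2_comp[OF u])
  have fm: "fourier u \<in> bmeas" by (rule L2_comp_fourier(1)[OF uc])
  have uf: "fourier u = ft u"
  proof
   fix xi :: "real^'n"
   obtain B R where um: "u \<in> bmeas" using u by (elim test_function_bounds) blast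
   show "fourier u xi = ft u xi" unfolding fourier_def ft_def
    by (rule integral_completion) (use um in measurable)
  qed
  have fi: "integrable lborel (fourier u)" unfolding uf by (rule ft_test_integrable[OF u]) (use fm uf in simp)
  have "AE x in lborel. extT u x = FIO a \<phi> u x"
   using 1(2)
  proof eventually_elim
   case (elim x)
   let ?g = "\<lambda>xi. exp (\<i> * of_real (P x [] xi)) * a' x [] xi * fourier u xi"
   let ?f = "\<lambda>xi. exp (\<i> * of_real (\<phi> x xi)) * a x xi * fourier u xi"
   have gm: "?g \<in> borel_measurable lborel"
    using borel_measurable_integrable[OF opT_integrable[OF fi, of x]] .
   have gL: "?g \<in> borel_measurable lebesgue" by (rule measurable_completion[OF gm])
   \<comment> \<open>The given and the modified phase may differ at xi = 0, a single point, which
     matters neither for measurability nor for the integral.\<close>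
   have fe: "?f = (\<lambda>xi. if xi = 0 then ?f 0 else ?g xi)" using elim by auto
   have "(\<lambda>xi. if xi = 0 then ?f 0 else ?g xi) \<in> borel_measurable lborel"
    using gm by (intro measurable_If) auto
   then have fL: "?f \<in> borel_measurable lebesgue" by (subst fe) (rule measurable_completion)
   have "AE xi in lborel. xi ~= (0::real^'n)" by (rule AE_lborel_singleton)
   then have ae: "AE xi in lebesgue. ?f xi = ?g xi"
    by (intro AE_completion) (auto elim!: eventually_mono simp: elim)
   have "(LINT xi|lebesgue. ?f xi) = (LINT xi|lebesgue. ?g xi)" by (rule integral_cong_AE[OF fL gL ae])
   also have "\<dots> = opT (fourier u) x" unfolding opT_def by (rule integral_completion[OF gm])
   also have "\<dots> = (\<Sum>j. pieceT (fourier u) j x)" by (rule opT_sum_dyadic[OF fi])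
   finally show ?case unfolding FIO_def extT_def by simp
  qed
  then show "AE x in lebesgue. extT u x = FIO a \<phi> u x" by (rule AE_completion)
 qed
qed

end
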